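(* Let $\theta=\begin{bmatrix}\alpha&\gamma\\ \beta&\delta\end{bmatrix}\in GL_2(\mathbb{Z})$, $G=(\mathbb{Z}\oplus\mathbb{Z})\rtimes_\theta\mathbb{Z}$, and let $p$ be an odd prime. With the notation of the context (the resolution $P$, the dual cochains $y_i^*,z_i^*,w^*$ and the integers $m_1,m_2,n_1,n_2$), the cohomology ring $H^*(G,\mathbb{Z}_p)$ is given by: 1. If $\mathrm{rank}_{\mathbb{Z}_p}(\theta-I)=0$ and $\det\theta=1$, then $H^*(G,\mathbb{Z}_p)\cong\dfrac{\mathbb{Z}_p[\zeta_1,\zeta_2,\zeta_3]}{(\zeta_1^2=\zeta_2^2=\zeta_3^2=0)}$, where $\dim\zeta_1=\dim\zeta_2=\dim\zeta_3=1$. 2. If $\mathrm{rank}_{\mathbb{Z}_p}(\theta-I)=0$ and $\det\theta=-1$, then $H^*(G,\mathbb{Z}_p)\cong\dfrac{\mathbb{Z}_p[\zeta_1,\zeta_2,\zeta_3]}{(\zeta_1^2=\zeta_2^2=\zeta_3^2=\zeta_1\zeta_2=0)}$, where $\dim\zeta_1=\dim\zeta_2=\dim\zeta_3=1$. 3. If $\mathrm{rank}_{\mathbb{Z}_p}(\theta-I)=1$ and $\det\theta=1$, then $$H^1(G,\mathbb{Z}_p)=\langle[u]\rangle\oplus\langle[y_3^*]\rangle\cong\mathbb{Z}_p\oplus\mathbb{Z}_p,\quad H^2(G,\mathbb{Z}_p)=\frac{\langle z_1^*\rangle\oplus\langle z_2^*\rangle}{\mathrm{im}\,\partial_2^*}\oplus\langle[z_3^*]\rangle\cong\mathbb{Z}_p\oplus\mathbb{Z}_p,\quad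 H^3(G,\mathbb{Z}_p)=\langle[w^*]\rangle\cong\mathbb{Z}_p,$$ where $u$ is described in the following way: we have $\begin{bmatrix}m_1&m_2\\ n_1&n_2\end{bmatrix}=-\theta^{-1}=\begin{bmatrix}-\delta&\gamma\\ \beta&-\alpha\end{bmatrix}$; if $1+m_1\not\equiv0\pmod p$ or $n_1\not\equiv0\pmod p$, we take $u=-n_1y_1^*+(1+m_1)y_2^*$, and if $1+m_1\equiv n_1\equiv0\pmod p$, we take $u=(1+n_2)y_1^*-m_2y_2^*$. Assuming, without loss of generality, that $u=-n_1y_1^*+(1+m_1)y_2^*$, and taking the class of $m_1z_1^*+n_1z_2^*$ as the generator of $\dfrac{\langle z_1^*\rangle\oplus\langle z_2^*\rangle}{\mathrm{im}\,\partial_2^*}\cong\mathbb{Z}_p$, the ring $H^*(G,\mathbb{Z}_p)$ is isomorphic to the quotient of $\mathbb{Z}_p[\zeta_1,\zeta_2,\xi_1,\xi_2]$ by the relations $$\zeta_1^2=0,\quad \zeta_2^2=0,\quad \zeta_1\zeta_2=\lambda\xi_1,\quad \zeta_2\xi_1=0,\quad \zeta_1\xi_1=(-n_1^2-(1+m_1)m_1)\zeta_2\xi_2,$$ $$\zeta_1\xi_2=\Big(\frac{1-\alpha-\gamma-\alpha\gamma}{2}(-n_1)+\frac{1-\beta-\delta+\beta\delta}{2}(1+m_1)\Big)\zeta_2\xi_2,\quad \xi_1^2=0,\quad \xi_2^2=0,\quad \xi_1\xi_2=0,$$ where $\zeta_1=[u]$, $\zeta_2=[y_3^*]$, $\xi_1=[m_1z_1^*+n_1z_2^*]$,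 $\xi_2=[z_3^*]$, and $\lambda\in\mathbb{Z}_p$ is such that $\lambda\xi_1=[-n_1z_1^*+(1+m_1)z_2^*]$. 4. If $\mathrm{rank}_{\mathbb{Z}_p}(\theta-I)=1$ and $\det\theta=-1$, then $$H^1(G,\mathbb{Z}_p)=\langle[u]\rangle\oplus\langle[y_3^*]\rangle\cong\mathbb{Z}_p\oplus\mathbb{Z}_p,\quad H^2(G,\mathbb{Z}_p)=\frac{\langle z_1^*\rangle\oplus\langle z_2^*\rangle}{\mathrm{im}\,\partial_2^*}\cong\mathbb{Z}_p,\quad H^3(G,\mathbb{Z}_p)=0,$$ where $u$ is described like in the previous case ($u=-n_1y_1^*+(1+m_1)y_2^*$ if $1+m_1\not\equiv0$ or $n_1\not\equiv0\pmod p$, and $u=(1+n_2)y_1^*-m_2y_2^*$ if $1+m_1\equiv n_1\equiv0\pmod p$). Assuming, without loss of generality, that $u=-n_1y_1^*+(1+m_1)y_2^*$, and once again taking the class of $m_1z_1^*+n_1z_2^*$ as the generator of $\dfrac{\langle z_1^*\rangle\oplus\langle z_2^*\rangle}{\mathrm{im}\,\partial_2^*}\cong\mathbb{Z}_p$, the ring $H^*(G,\mathbb{Z}_p)$ is isomorphic to the quotient of $\mathbb{Z}_p[\zeta_1,\zeta_2,\xi]$ by the relations $$\zeta_1^2=0,\quad \zeta_2^2=0,\quad \zeta_1\zeta_2=\lambda\xi,\quad \zeta_1\xi=0,\quad \zeta_2\xi=0,\quad \xi^2=0,$$ where $\zeta_1=[u]$, $\zeta_2=[y_3^*]$, $\xi=[m_1z_1^*+n_1z_2^*]$,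 and $\lambda\in\mathbb{Z}_p$ is such that $\lambda\xi=[-n_1z_1^*+(1+m_1)z_2^*]$. 5. If $\mathrm{rank}_{\mathbb{Z}_p}(\theta-I)=2$ and $\det\theta=1$, then $H^*(G,\mathbb{Z}_p)\cong\dfrac{\mathbb{Z}_p[\zeta,\xi]}{(\zeta^2=0,\ \xi^2=0)}$, where $\dim\zeta=1$ and $\dim\xi=2$. 6. If $\mathrm{rank}_{\mathbb{Z}_p}(\theta-I)=2$ and $\det\theta=-1$, then $H^*(G,\mathbb{Z}_p)\cong\dfrac{\mathbb{Z}_p[\zeta]}{(\zeta^2=0)}$, where $\dim\zeta=1$.
   Context: **Conventions.** $\mathbb{Z}_p=\mathbb{Z}/p\mathbb{Z}$ is the trivial module; $\mathrm{rank}_{\mathbb{Z}_p}$ is the rank over $\mathbb{Z}_p$ of the reduction mod $p$; $I$ is the $2\times2$ identity matrix. $\mathbb{Z}_p[\ldots]$ denotes the free graded-commutative $\mathbb{Z}_p$-algebra ($xy=(-1)^{\dim x\dim y}yx$) on generators of the given degrees ($\dim$), and quotients are by the ideal generated by the listed relations; isomorphisms are of graded rings (cup product). **The group.** Write $\mathbb{Z}\oplus\mathbb{Z}=\langle a,b\mid ab=ba\rangle$ and $\mathbb{Z}=\langle t\rangle$; $t$ acts on $\mathbb{Z}\oplus\mathbb{Z}$ by the automorphism $a\mapsto a^\alpha b^\beta$, $b\mapsto a^\gamma b^\delta$, also denoted $\theta$. $G=(\mathbb{Z}\oplus\mathbb{Z})\rtimes_\theta\mathbb{Z}=\{(a^mb^n,t^k):m,n,k\in\mathbb{Z}\}$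 with product $(g,t^k)(h,t^l)=(g\,\theta^k(h),t^{k+l})$ and identity $(1,1)$. **The integers $m_i,n_i$.** $\begin{bmatrix}m_1&m_2\\ n_1&n_2\end{bmatrix}=-\theta^{-1}=\frac{1}{\alpha\delta-\beta\gamma}\begin{bmatrix}-\delta&\gamma\\ \beta&-\alpha\end{bmatrix}$. **The resolution $P$.** $0\to P_3\xrightarrow{\partial_3}P_2\xrightarrow{\partial_2}P_1\xrightarrow{\partial_1}P_0\xrightarrow{\varepsilon_0}\mathbb{Z}\to0$ is the free resolution of $\mathbb{Z}$ over $\mathbb{Z}G$ with $P_0,P_1,P_2,P_3$ free left modules on $\{x\}$, $\{y_1,y_2,y_3\}$, $\{z_1,z_2,z_3\}$, $\{w\}$ and $\varepsilon_0(x)=1$, $\partial_1(y_1)=[(a,1)-(1,1)]x$, $\partial_1(y_2)=[(b,1)-(1,1)]x$, $\partial_1(y_3)=[(1,t)-(1,1)]x$, $\partial_2(z_1)=Ay_1+By_2+[(a,1)-(1,1)]y_3$, $\partial_2(z_2)=Cy_1+Dy_2+[(b,1)-(1,1)]y_3$, $\partial_2(z_3)=[(1,1)-(b,1)]y_1+[(a,1)-(1,1)]y_2$, $\partial_3(w)=[(1,1)-(b,1)]z_1+[(a,1)-(1,1)]z_2+Ez_3$. Here $A,B,C,D,E\in\mathbb{Z}G$ are: $A=(1,1)+\sum_{k=1}^{m_1}(a^{-k\alpha}b^{-k\beta},t)$ if $m_1>0$; $A=(1,1)-\sum_{k=0}^{-m_1-1}(a^{k\alpha}b^{k\beta},t)$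 if $m_1<0$; $A=(1,1)$ if $m_1=0$. $B=\sum_{k=0}^{n_1-1}(a^{1+k\gamma}b^{k\delta},t)$ if $n_1>0$; $B=-\sum_{k=1}^{-n_1}(a^{1-k\gamma}b^{-k\delta},t)$ if $n_1<0$; $B=0$ if $n_1=0$. $C=\sum_{k=1}^{m_2}(a^{-k\alpha}b^{-k\beta},t)$ if $m_2>0$; $C=-\sum_{k=0}^{-m_2-1}(a^{k\alpha}b^{k\beta},t)$ if $m_2<0$; $C=0$ if $m_2=0$. $D=(1,1)+\sum_{k=0}^{n_2-1}(a^{k\gamma}b^{1+k\delta},t)$ if $n_2>0$; $D=(1,1)-\sum_{k=1}^{-n_2}(a^{-k\gamma}b^{1-k\delta},t)$ if $n_2<0$; $D=(1,1)$ if $n_2=0$. $E$ is the (unique) element of $\mathbb{Z}G$ for which $\partial_2\partial_3=0$, i.e. $E((1,1)-(b,1))=((b,1)-(1,1))A+((1,1)-(a,1))C$ and $E((a,1)-(1,1))=((b,1)-(1,1))B+((1,1)-(a,1))D$; its augmentation is $-1+\det\theta$. **Cochains.** $H^*(G,\mathbb{Z}_p)$ is the cohomology of $\mathrm{Hom}_{\mathbb{Z}G}(P_*,\mathbb{Z}_p)$ with differentials $\partial_i^*$; $y_i^*$, $z_i^*$, $w^*$ are the homomorphisms dual to the bases $\{y_i\}$, $\{z_i\}$, $\{w\}$, and $[\,\cdot\,]$ denotes the cohomology class. One has $\partial_2^*(y_1^* )=(1+m_1)z_1^*+m_2z_2^*$, $\partial_2^*(y_2^* )=n_1z_1^*+(1+n_2)z_2^*$,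 $\partial_2^*(y_3^* )=0$.
   Formalization: In cases 3 and 4 the ring presentation is proved only when the class of m1 z1* + n1 z2* really generates (<z1*>+<z2*>)/im d2*; this can fail (p=5, theta with rows (4,3), (-3,-2)), and then the printed presentation is false. *)

theory Defs
  imports
    "HOL-Analysis.Analysis"
    "HOL-Algebra.QuotRing"
    "HOL-Algebra.Elementary_Groups"
    "HOL-Library.Function_Algebras"
    "HOL-Library.Poly_Mapping"
    "Berlekamp_Zassenhaus.Finite_Field"
begin

section \<open>The group\<close>

text \<open>
  The pair \<open>(vector [m, n], k)\<close> stands for $(a^m b^n, t^k)$. The columns of \<open>\<theta>\<close> are the images of
  $a$ and $b$, so \<open>t\<close> acts on exponent vectors by \<open>(*v) \<theta>\<close>.
\<close>

type_synonym grp = "(int^2) \<times> int"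

definition theta_pow :: "int^2^2 \<Rightarrow> int \<Rightarrow> int^2 \<Rightarrow> int^2" where
  "theta_pow \<theta> k =
     (if 0 \<le> k then ((*v) \<theta>) ^^ nat k else ((*v) (matrix_inv \<theta>)) ^^ nat (- k))"

definition sdprod :: "int^2^2 \<Rightarrow> grp monoid" where
  "sdprod \<theta> =
     \<lparr>carrier = UNIV,
      monoid.mult = (\<lambda>g h. (fst g + theta_pow \<theta> (snd g) (fst h), snd g + snd h)),
      one = (0, 0)\<rparr>"

lemma matrix_inv_both:
  assumes "invertible (A :: int^2^2)"
  shows "A ** matrix_inv A = mat 1" "matrix_inv A ** A = mat 1"
  using assms someI_ex[of "\<lambda>B. A ** B = mat 1 \<and> B ** A = mat 1"]
  unfolding matrix_inv_def invertible_def by auto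

lemma theta_pow_Suc:
  assumes "invertible \<theta>"
  shows "theta_pow \<theta> (k + 1) v = \<theta> *v theta_pow \<theta> k v"
proof (cases "0 \<le> k")
  case True
  then show ?thesis by (simp add: theta_pow_def nat_add_distrib)
next
  case False
  then obtain m where m: "k = - int (Suc m)"
    by (metis add.commute int_zle_neg negD not_le of_nat_Suc)
  have "\<theta> *v (matrix_inv \<theta> *v x) = x" for x
    by (simp add: matrix_vector_mul_assoc matrix_inv_both[OF assms])
  moreover have "nat (- (k + 1)) = m" "nat (- k) = Suc m" "k + 1 \<ge> 0 \<longleftrightarrow> m = 0"
    using m by auto
  ultimately show ?thesis using False by (cases m) (auto simp: theta_pow_def)
qed

lemma theta_pow_add:
  assumes "invertible \<theta>"
  shows "theta_pow \<theta> (k + l) v = theta_pow \<theta> k (theta_pow \<theta> l v)"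
proof (induction k rule: int_induct[where k = 0])
  case base show ?case by (simp add: theta_pow_def)
next
  case (step1 i)
  then show ?case
    using theta_pow_Suc[OF assms, of i] theta_pow_Suc[OF assms, of "i + l"]
    by (simp add: algebra_simps)
next
  case (step2 i)
  have inj: "\<theta> *v x = \<theta> *v y \<Longrightarrow> x = y" for x y
    by (metis matrix_inv_both(2)[OF assms] matrix_vector_mul_assoc matrix_vector_mul_lid)
  have "\<theta> *v theta_pow \<theta> (i - 1 + l) v = \<theta> *v theta_pow \<theta> (i - 1) (theta_pow \<theta> l v)"
    using step2 theta_pow_Suc[OF assms, of "i - 1"] theta_pow_Suc[OF assms, of "i - 1 + l"]
    by (simp add: algebra_simps)
  then show ?case by (rule inj)
qed

lemma theta_pow_linear: "theta_pow \<theta> k (v + w) = theta_pow \<theta> k v + theta_pow \<theta> k w"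
proof -
  have "((*v) A ^^ n) (v + w) = ((*v) A ^^ n) v + ((*v) A ^^ n) w" for A :: "int^2^2" and n
  proof (induction n)
    case (Suc n)
    then show ?case by (simp only: funpow.simps comp_apply matrix_vector_right_distrib)
  qed simp
  then show ?thesis by (simp add: theta_pow_def)
qed

lemma group_sdprod:
  assumes "invertible \<theta>"
  shows "group (sdprod \<theta>)"
proof (rule groupI)
  fix x y z :: grp
  show "x \<otimes>\<^bsub>sdprod \<theta>\<^esub> y \<otimes>\<^bsub>sdprod \<theta>\<^esub> z = x \<otimes>\<^bsub>sdprod \<theta>\<^esub> (y \<otimes>\<^bsub>sdprod \<theta>\<^esub> z)"
    by (simp add: sdprod_def theta_pow_add[OF assms] theta_pow_linear add.assoc)
  have "theta_pow \<theta> 0 v = v" for v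
    by (simp add: theta_pow_def)
  then show "\<one>\<^bsub>sdprod \<theta>\<^esub> \<otimes>\<^bsub>sdprod \<theta>\<^esub> x = x"
    by (simp add: sdprod_def)
  show "\<exists>y\<in>carrier (sdprod \<theta>). y \<otimes>\<^bsub>sdprod \<theta>\<^esub> x = \<one>\<^bsub>sdprod \<theta>\<^esub>"
    by (intro bexI[of _ "(- theta_pow \<theta> (- snd x) (fst x), - snd x)"]) (simp_all add: sdprod_def)
qed (simp_all add: sdprod_def)

section \<open>The integral group ring and the free resolution\<close>

text \<open>
  Finitely supported functions are used for the group ring and for all free modules. Products are
  written out with \<open>frag_extend\<close>: the type \<open>grp\<close> is also an instance of \<open>plus\<close> (componentwise), so
  the constants \<open>1\<close> and \<open>(*)\<close> of \<open>grp \<Rightarrow>\<^sub>0 int\<close> belong to the group ring of the direct product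
  and must not be used here.
\<close>

type_synonym zg = "grp \<Rightarrow>\<^sub>0 int"

definition zg_mult :: "int^2^2 \<Rightarrow> zg \<Rightarrow> zg \<Rightarrow> zg" where
  "zg_mult \<theta> r s = frag_extend (\<lambda>g. frag_extend (\<lambda>h. frag_of (g \<otimes>\<^bsub>sdprod \<theta>\<^esub> h)) s) r"

definition g_1 :: grp where "g_1 = (0, 0)"
definition g_a :: grp where "g_a = (vector [1, 0], 0)"
definition g_b :: grp where "g_b = (vector [0, 1], 0)"
definition g_t :: grp where "g_t = (0, 1)"

text \<open>The coefficients $m_1, m_2$ (first row) and $n_1, n_2$ (second row).\<close>

definition mn :: "int^2^2 \<Rightarrow> int^2^2" where
  "mn \<theta> = - matrix_inv \<theta>"

definition elem_A :: "int^2^2 \<Rightarrow> zg" where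
  "elem_A \<theta> =
     (let \<alpha> = \<theta>$1$1; \<beta> = \<theta>$2$1; m1 = mn \<theta>$1$1 in
      if m1 > 0 then frag_of g_1 + (\<Sum>k=1..m1. frag_of (vector [- k * \<alpha>, - k * \<beta>], 1))
      else if m1 < 0 then frag_of g_1 - (\<Sum>k=0..- m1 - 1. frag_of (vector [k * \<alpha>, k * \<beta>], 1))
      else frag_of g_1)"

definition elem_B :: "int^2^2 \<Rightarrow> zg" where
  "elem_B \<theta> =
     (let \<gamma> = \<theta>$1$2; \<delta> = \<theta>$2$2; n1 = mn \<theta>$2$1 in
      if n1 > 0 then (\<Sum>k=0..n1 - 1. frag_of (vector [1 + k * \<gamma>, k * \<delta>], 1))
      else if n1 < 0 then - (\<Sum>k=1..- n1. frag_of (vector [1 - k * \<gamma>, - k * \<delta>], 1))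
      else 0)"

definition elem_C :: "int^2^2 \<Rightarrow> zg" where
  "elem_C \<theta> =
     (let \<alpha> = \<theta>$1$1; \<beta> = \<theta>$2$1; m2 = mn \<theta>$1$2 in
      if m2 > 0 then (\<Sum>k=1..m2. frag_of (vector [- k * \<alpha>, - k * \<beta>], 1))
      else if m2 < 0 then - (\<Sum>k=0..- m2 - 1. frag_of (vector [k * \<alpha>, k * \<beta>], 1))
      else 0)"

definition elem_D :: "int^2^2 \<Rightarrow> zg" where
  "elem_D \<theta> =
     (let \<gamma> = \<theta>$1$2; \<delta> = \<theta>$2$2; n2 = mn \<theta>$2$2 in
      if n2 > 0 then frag_of g_1 + (\<Sum>k=0..n2 - 1. frag_of (vector [k * \<gamma>, 1 + k * \<delta>], 1))
      else if n2 < 0 then frag_of g_1 - (\<Sum>k=1..- n2. frag_of (vector [- k * \<gamma>, 1 - k * \<delta>], 1))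
      else frag_of g_1)"

definition elem_E :: "int^2^2 \<Rightarrow> zg" where
  "elem_E \<theta> =
     (THE e.
        zg_mult \<theta> e (frag_of g_1 - frag_of g_b) =
          zg_mult \<theta> (frag_of g_b - frag_of g_1) (elem_A \<theta>) +
          zg_mult \<theta> (frag_of g_1 - frag_of g_a) (elem_C \<theta>) \<and>
        zg_mult \<theta> e (frag_of g_a - frag_of g_1) =
          zg_mult \<theta> (frag_of g_b - frag_of g_1) (elem_B \<theta>) +
          zg_mult \<theta> (frag_of g_1 - frag_of g_a) (elem_D \<theta>))"

datatype cell = X0 | Y1 | Y2 | Y3 | Z1 | Z2 | Z3 | W

fun cdim :: "cell \<Rightarrow> nat" where
  "cdim X0 = 0"
| "cdim Y1 = 1" | "cdim Y2 = 1" | "cdim Y3 = 1"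
| "cdim Z1 = 2" | "cdim Z2 = 2" | "cdim Z3 = 2"
| "cdim W = 3"

text \<open>
  \<open>chain\<close> is the total module $P_0 \oplus P_1 \oplus P_2 \oplus P_3$; the element
  \<open>frag_of (g, c)\<close> is $g \cdot c$ and has degree \<open>cdim c\<close>.
\<close>

type_synonym chain = "(grp \<times> cell) \<Rightarrow>\<^sub>0 int"

definition translate :: "int^2^2 \<Rightarrow> grp \<Rightarrow> chain \<Rightarrow> chain" where
  "translate \<theta> g = frag_extend (\<lambda>(h, c). frag_of (g \<otimes>\<^bsub>sdprod \<theta>\<^esub> h, c))"

definition zg_smult :: "int^2^2 \<Rightarrow> zg \<Rightarrow> chain \<Rightarrow> chain" where
  "zg_smult \<theta> r v = frag_extend (\<lambda>g. translate \<theta> g v) r"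

definition basis :: "cell \<Rightarrow> chain" where
  "basis c = frag_of (g_1, c)"

fun bd_cell :: "int^2^2 \<Rightarrow> cell \<Rightarrow> chain" where
  "bd_cell \<theta> X0 = 0"
| "bd_cell \<theta> Y1 = zg_smult \<theta> (frag_of g_a - frag_of g_1) (basis X0)"
| "bd_cell \<theta> Y2 = zg_smult \<theta> (frag_of g_b - frag_of g_1) (basis X0)"
| "bd_cell \<theta> Y3 = zg_smult \<theta> (frag_of g_t - frag_of g_1) (basis X0)"
| "bd_cell \<theta> Z1 =
     zg_smult \<theta> (elem_A \<theta>) (basis Y1) + zg_smult \<theta> (elem_B \<theta>) (basis Y2) +
     zg_smult \<theta> (frag_of g_a - frag_of g_1) (basis Y3)"
| "bd_cell \<theta> Z2 =
     zg_smult \<theta> (elem_C \<theta>) (basis Y1) + zg_smult \<theta> (elem_D \<theta>) (basis Y2) +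
     zg_smult \<theta> (frag_of g_b - frag_of g_1) (basis Y3)"
| "bd_cell \<theta> Z3 =
     zg_smult \<theta> (frag_of g_1 - frag_of g_b) (basis Y1) +
     zg_smult \<theta> (frag_of g_a - frag_of g_1) (basis Y2)"
| "bd_cell \<theta> W =
     zg_smult \<theta> (frag_of g_1 - frag_of g_b) (basis Z1) +
     zg_smult \<theta> (frag_of g_a - frag_of g_1) (basis Z2) +
     zg_smult \<theta> (elem_E \<theta>) (basis Z3)"

definition bd :: "int^2^2 \<Rightarrow> chain \<Rightarrow> chain" where
  "bd \<theta> = frag_extend (\<lambda>(g, c). translate \<theta> g (bd_cell \<theta> c))"

text \<open>The augmentation of the coefficient of \<open>c\<close>; for \<open>c = X0\<close> this is $\varepsilon_0$.\<close>

definition cell_aug :: "cell \<Rightarrow> chain \<Rightarrow> int" where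
  "cell_aug c v = (\<Sum>x\<in>Poly_Mapping.keys v. if snd x = c then Poly_Mapping.lookup v x else 0)"

section \<open>Diagonal approximations\<close>

text \<open>
  $P \otimes_{\mathbb Z} P$ is free abelian on pairs of \<open>\<int>\<close>-basis elements of $P$, with the diagonal
  action and the differential $d(u \otimes v) = du \otimes v + (-1)^{\dim u} u \otimes dv$.
\<close>

type_synonym tchain = "((grp \<times> cell) \<times> (grp \<times> cell)) \<Rightarrow>\<^sub>0 int"

definition tens :: "chain \<Rightarrow> chain \<Rightarrow> tchain" where
  "tens u v = frag_extend (\<lambda>x. frag_extend (\<lambda>y. frag_of (x, y)) v) u"

definition ttranslate :: "int^2^2 \<Rightarrow> grp \<Rightarrow> tchain \<Rightarrow> tchain" where
  "ttranslate \<theta> g =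
     frag_extend (\<lambda>(x, y). tens (translate \<theta> g (frag_of x)) (translate \<theta> g (frag_of y)))"

definition tbd :: "int^2^2 \<Rightarrow> tchain \<Rightarrow> tchain" where
  "tbd \<theta> =
     frag_extend (\<lambda>(x, y).
       tens (bd \<theta> (frag_of x)) (frag_of y) +
       frag_cmul ((- 1) ^ cdim (snd x)) (tens (frag_of x) (bd \<theta> (frag_of y))))"

definition taug :: "tchain \<Rightarrow> int" where
  "taug T =
     (\<Sum>(x, y)\<in>Poly_Mapping.keys T.
        Poly_Mapping.lookup T (x, y) * cell_aug X0 (frag_of x) * cell_aug X0 (frag_of y))"

definition diagonal_approximation :: "int^2^2 \<Rightarrow> (chain \<Rightarrow> tchain) \<Rightarrow> bool" where
  "diagonal_approximation \<theta> \<Delta> \<longleftrightarrow>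
     (\<forall>u v. \<Delta> (u + v) = \<Delta> u + \<Delta> v) \<and>
     (\<forall>g v. \<Delta> (translate \<theta> g v) = ttranslate \<theta> g (\<Delta> v)) \<and>
     (\<forall>z. \<forall>(x, y)\<in>Poly_Mapping.keys (\<Delta> (frag_of z)).
        cdim (snd x) + cdim (snd y) = cdim (snd z)) \<and>
     (\<forall>v. tbd \<theta> (\<Delta> v) = \<Delta> (bd \<theta> v)) \<and>
     (\<forall>v. taug (\<Delta> v) = cell_aug X0 v)"

text \<open>
  Any two diagonal approximations are equivariantly chain homotopic, so the product induced on
  cohomology does not depend on the choice.
\<close>

definition diag :: "int^2^2 \<Rightarrow> chain \<Rightarrow> tchain" where
  "diag \<theta> = (SOME \<Delta>. diagonal_approximation \<theta> \<Delta>)"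

section \<open>The cohomology ring\<close>

text \<open>
  The coefficient ring is a trivial module. As $P$ is bounded, $\mathrm{Hom}_{\mathbb ZG}(P, R)$
  is the direct sum of the $\mathrm{Hom}_{\mathbb ZG}(P_n, R)$, and the cohomology of this total
  complex is the direct sum of the $H^n(G, R)$. Classes are cosets modulo all coboundaries.
\<close>

definition cochains :: "int^2^2 \<Rightarrow> (chain \<Rightarrow> 'r::comm_ring_1) set" where
  "cochains \<theta> =
     {f. (\<forall>u v. f (u + v) = f u + f v) \<and> (\<forall>g v. f (translate \<theta> g v) = f v)}"

definition cochains_deg :: "int^2^2 \<Rightarrow> nat \<Rightarrow> (chain \<Rightarrow> 'r::comm_ring_1) set" where
  "cochains_deg \<theta> n = {f \<in> cochains \<theta>. \<forall>x. cdim (snd x) \<noteq> n \<longrightarrow> f (frag_of x) = 0}"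

definition cocycles :: "int^2^2 \<Rightarrow> (chain \<Rightarrow> 'r::comm_ring_1) set" where
  "cocycles \<theta> = {f \<in> cochains \<theta>. f \<circ> bd \<theta> = 0}"

definition coboundaries :: "int^2^2 \<Rightarrow> (chain \<Rightarrow> 'r::comm_ring_1) set" where
  "coboundaries \<theta> = (\<lambda>f. f \<circ> bd \<theta>) ` cochains \<theta>"

definition cls :: "int^2^2 \<Rightarrow> (chain \<Rightarrow> 'r::comm_ring_1) \<Rightarrow> (chain \<Rightarrow> 'r) set" where
  "cls \<theta> f = (\<lambda>b. f + b) ` coboundaries \<theta>"

definition dual :: "cell \<Rightarrow> chain \<Rightarrow> 'r::comm_ring_1" where
  "dual c v = of_int (cell_aug c v)"

definition cscale :: "'r::comm_ring_1 \<Rightarrow> (chain \<Rightarrow> 'r) \<Rightarrow> chain \<Rightarrow> 'r" (infixr \<open>\<cdot>\<close> 75) where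
  "c \<cdot> f = (\<lambda>v. c * f v)"

text \<open>
  $f \cup g = (f \otimes g) \circ \Delta$ with $(f \otimes g)(u \otimes v) = f(u)\,g(v)$, without
  the sign $(-1)^{\dim g \dim u}$.
\<close>

definition cup ::
    "int^2^2 \<Rightarrow> (chain \<Rightarrow> 'r::comm_ring_1) \<Rightarrow> (chain \<Rightarrow> 'r) \<Rightarrow> chain \<Rightarrow> 'r" where
  "cup \<theta> f g v =
     (\<Sum>(x, y)\<in>Poly_Mapping.keys (diag \<theta> v).
        of_int (Poly_Mapping.lookup (diag \<theta> v) (x, y)) * f (frag_of x) * g (frag_of y))"

definition cohomology :: "int^2^2 \<Rightarrow> (chain \<Rightarrow> 'r::comm_ring_1) set ring" where
  "cohomology \<theta> =
     \<lparr>carrier = cls \<theta> ` cocycles \<theta>,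
      monoid.mult = (\<lambda>S T. \<Union>f\<in>S. \<Union>g\<in>T. cls \<theta> (cup \<theta> f g)),
      one = cls \<theta> (dual X0),
      zero = cls \<theta> 0,
      add = (\<lambda>S T. \<Union>f\<in>S. \<Union>g\<in>T. cls \<theta> (f + g))\<rparr>"

definition coh_deg :: "int^2^2 \<Rightarrow> nat \<Rightarrow> (chain \<Rightarrow> 'r::comm_ring_1) set set" where
  "coh_deg \<theta> n = cls \<theta> ` (cocycles \<theta> \<inter> cochains_deg \<theta> n)"

definition add_subgroup :: "('a, 'm) ring_scheme \<Rightarrow> 'a set \<Rightarrow> 'a monoid" where
  "add_subgroup R S = \<lparr>carrier = S, monoid.mult = add R, one = zero R\<rparr>"

definition add_span :: "('a, 'm) ring_scheme \<Rightarrow> 'a \<Rightarrow> 'a set" where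
  "add_span R x = generate (add_monoid R) {x}"

definition internal_direct_sum ::
    "('a, 'm) ring_scheme \<Rightarrow> 'a set \<Rightarrow> 'a set \<Rightarrow> 'a set \<Rightarrow> bool" where
  "internal_direct_sum R S A B \<longleftrightarrow> S = A <+>\<^bsub>R\<^esub> B \<and> A \<inter> B = {\<zero>\<^bsub>R\<^esub>}"

text \<open>
  The image in cohomology of $\langle z_1^*\rangle \oplus \langle z_2^*\rangle$. Its elements are
  cosets of the coboundaries, and the coboundaries of degree 2 are $\mathrm{im}\,\partial_2^*$, so
  this is $(\langle z_1^*\rangle \oplus \langle z_2^*\rangle)/\mathrm{im}\,\partial_2^*$.
\<close>

definition z12_classes :: "int^2^2 \<Rightarrow> (chain \<Rightarrow> 'r::comm_ring_1) set set" where
  "z12_classes \<theta> = {cls \<theta> (r \<cdot> dual Z1 + s \<cdot> dual Z2) | r s. True}"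

section \<open>Quotients of free graded-commutative algebras\<close>

text \<open>
  \<open>free_alg n\<close> is the free associative algebra on generators \<open>gen 0, \<dots>, gen (n - 1)\<close>: the
  finitely supported functions on words. Below, \<open>ds ! i\<close> is the degree of \<open>gen i\<close>.
\<close>

type_synonym 'r falg = "nat list \<Rightarrow>\<^sub>0 'r"

definition gen :: "nat \<Rightarrow> 'r::comm_ring_1 falg" where
  "gen i = Poly_Mapping.single [i] 1"

definition fmult :: "'r::comm_ring_1 falg \<Rightarrow> 'r falg \<Rightarrow> 'r falg" (infixl \<open>\<star>\<close> 70) where
  "f \<star> g =
     (\<Sum>u\<in>Poly_Mapping.keys f. \<Sum>v\<in>Poly_Mapping.keys g.
        Poly_Mapping.single (u @ v) (Poly_Mapping.lookup f u * Poly_Mapping.lookup g v))"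

definition fscale :: "'r::comm_ring_1 \<Rightarrow> 'r falg \<Rightarrow> 'r falg" (infixr \<open>\<odot>\<close> 75) where
  "c \<odot> f = Poly_Mapping.map (\<lambda>x. c * x) f"

definition free_alg :: "nat \<Rightarrow> 'r::comm_ring_1 falg ring" where
  "free_alg n =
     \<lparr>carrier = {f. \<forall>w\<in>Poly_Mapping.keys f. set w \<subseteq> {..<n}},
      monoid.mult = (\<star>), one = Poly_Mapping.single [] 1, zero = 0, add = (+)\<rparr>"

lemma fmult_superset:
  assumes "finite A" "Poly_Mapping.keys f \<subseteq> A" "finite B" "Poly_Mapping.keys g \<subseteq> B"
  shows "f \<star> g = (\<Sum>u\<in>A. \<Sum>v\<in>B. 
     Poly_Mapping.single (u @ v) (Poly_Mapping.lookup f u * Poly_Mapping.lookup g v))"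
proof -
  have "f \<star> g = (\<Sum>u\<in>Poly_Mapping.keys f. \<Sum>v\<in>B. 
     Poly_Mapping.single (u @ v) (Poly_Mapping.lookup f u * Poly_Mapping.lookup g v))"
    unfolding fmult_def
    by (intro sum.cong refl sum.mono_neutral_left) (use assms in \<open>auto simp: in_keys_iff\<close>)
  also have "\<dots> = (\<Sum>u\<in>A. \<Sum>v\<in>B. 
     Poly_Mapping.single (u @ v) (Poly_Mapping.lookup f u * Poly_Mapping.lookup g v))"
    by (intro sum.mono_neutral_left) (use assms in \<open>auto simp: in_keys_iff\<close>)
  finally show ?thesis .
qed

lemma fmult_add_left: "(f + g) \<star> h = f \<star> h + g \<star> (h :: 'r::comm_ring_1 falg)"
proof -
  let ?A = "Poly_Mapping.keys f \<union> Poly_Mapping.keys g" and ?B = "Poly_Mapping.keys h"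
  have "Poly_Mapping.keys (f + g) \<subseteq> ?A" by (rule Poly_Mapping.keys_add)
  then show ?thesis
    by (simp add: fmult_superset[of ?A _ ?B] lookup_add distrib_right single_add sum.distrib)
qed

lemma fmult_add_right: "h \<star> (f + g) = h \<star> f + h \<star> (g :: 'r::comm_ring_1 falg)"
proof -
  let ?A = "Poly_Mapping.keys f \<union> Poly_Mapping.keys g" and ?B = "Poly_Mapping.keys h"
  have "Poly_Mapping.keys (f + g) \<subseteq> ?A" by (rule Poly_Mapping.keys_add)
  then show ?thesis
    by (simp add: fmult_superset[of ?B _ ?A] lookup_add distrib_left single_add sum.distrib)
qed

lemma fmult_zero [simp]: "0 \<star> f = 0" "f \<star> 0 = (0 :: 'r::comm_ring_1 falg)"
  by (simp_all add: fmult_def)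

lemma fmult_single: "Poly_Mapping.single u a \<star> Poly_Mapping.single v b =
   Poly_Mapping.single (u @ v) (a * b :: 'r::comm_ring_1)"
  by (subst fmult_superset[of "{u}" _ "{v}"]) auto

lemma fmult_sum_left: "(\<Sum>i\<in>I. f i) \<star> h = (\<Sum>i\<in>I. f i \<star> (h :: 'r::comm_ring_1 falg))"
  by (induction I rule: infinite_finite_induct) (auto simp: fmult_add_left)

lemma fmult_sum_right: "h \<star> (\<Sum>i\<in>I. f i) = (\<Sum>i\<in>I. h \<star> (f i :: 'r::comm_ring_1 falg))"
  by (induction I rule: infinite_finite_induct) (auto simp: fmult_add_right)

lemma falg_expand: "f = (\<Sum>u\<in>Poly_Mapping.keys f. Poly_Mapping.single u (Poly_Mapping.lookup f u))"
  by (rule poly_mapping_eqI) (auto simp: lookup_sum lookup_single when_def in_keys_iff)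

lemma fmult_assoc: "(f \<star> g) \<star> h = f \<star> (g \<star> (h :: 'r::comm_ring_1 falg))"
proof -
  define ex where "ex f = (\<Sum>u\<in>Poly_Mapping.keys f. Poly_Mapping.single u (Poly_Mapping.lookup f u))"
    for f :: "'r falg"
  have "(ex f \<star> ex g) \<star> ex h = ex f \<star> (ex g \<star> ex h)"
    by (simp only: ex_def fmult_sum_left fmult_sum_right fmult_single append_assoc mult.assoc)
  moreover have "ex f = f" for f
    unfolding ex_def by (rule falg_expand[symmetric])
  ultimately show ?thesis by simp
qed

lemma keys_fmult: "Poly_Mapping.keys (f \<star> g) \<subseteq> (\<lambda>(u,v). u @ v) ` (Poly_Mapping.keys f \<times> Poly_Mapping.keys g)"
  unfolding fmult_def
  apply (rule order.trans[OF Poly_Mapping.keys_sum])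
  apply (rule UN_least)
  apply (rule order.trans[OF Poly_Mapping.keys_sum])
  apply (auto split: if_splits)
  done

lemma fmult_one_left: "Poly_Mapping.single [] 1 \<star> f = (f :: 'r::comm_ring_1 falg)"
proof -
  have "Poly_Mapping.single [] 1 \<star> f =
      Poly_Mapping.single [] 1 \<star> (\<Sum>u\<in>Poly_Mapping.keys f. Poly_Mapping.single u (Poly_Mapping.lookup f u))"
    by (simp only: falg_expand[symmetric])
  also have "\<dots> = (\<Sum>u\<in>Poly_Mapping.keys f. Poly_Mapping.single u (Poly_Mapping.lookup f u))"
    by (simp add: fmult_sum_right fmult_single)
  also have "\<dots> = f"
    by (rule falg_expand[symmetric])
  finally show ?thesis .
qed

lemma fmult_one_right: "f \<star> Poly_Mapping.single [] 1 = (f :: 'r::comm_ring_1 falg)"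
proof -
  have "f \<star> Poly_Mapping.single [] 1 =
      (\<Sum>u\<in>Poly_Mapping.keys f. Poly_Mapping.single u (Poly_Mapping.lookup f u)) \<star> Poly_Mapping.single [] 1"
    by (simp only: falg_expand[symmetric])
  also have "\<dots> = (\<Sum>u\<in>Poly_Mapping.keys f. Poly_Mapping.single u (Poly_Mapping.lookup f u))"
    by (simp add: fmult_sum_left fmult_single)
  also have "\<dots> = f"
    by (rule falg_expand[symmetric])
  finally show ?thesis .
qed

lemma ring_free_alg: "ring (free_alg n :: 'r::comm_ring_1 falg ring)"
proof (rule ringI)
  show "abelian_group (free_alg n :: 'r falg ring)"
  proof (rule abelian_groupI)
    fix x :: "'r falg" assume "x \<in> carrier (free_alg n)"
    then show "\<exists>y\<in>carrier (free_alg n). y \<oplus>\<^bsub>free_alg n\<^esub> x = \<zero>\<^bsub>free_alg n\<^esub>"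
      by (intro bexI[of _ "-x"]) (auto simp: free_alg_def)
  qed (auto simp: free_alg_def add_ac dest!: Poly_Mapping.keys_add[THEN subsetD])
  show "Group.monoid (free_alg n :: 'r falg ring)"
  proof (rule monoidI)
    fix f g :: "'r falg"
    assume f: "f \<in> carrier (free_alg n)" and g: "g \<in> carrier (free_alg n)"
    have "set w \<subseteq> {..<n}" if w: "w \<in> Poly_Mapping.keys (f \<star> g)" for w
    proof -
      obtain s t where "w = s @ t" "s \<in> Poly_Mapping.keys f" "t \<in> Poly_Mapping.keys g"
        using subsetD[OF keys_fmult w] by auto
      moreover from this have "set s \<subseteq> {..<n}" "set t \<subseteq> {..<n}"
        using f g unfolding free_alg_def by simp_all
      ultimately show ?thesis by simp
    qed
    then show "f \<otimes>\<^bsub>free_alg n\<^esub> g \<in> carrier (free_alg n)"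
      by (simp add: free_alg_def)
  qed (simp_all add: free_alg_def fmult_assoc fmult_one_left fmult_one_right)
qed (simp_all add: free_alg_def fmult_add_left fmult_add_right)

definition gca_ideal :: "nat list \<Rightarrow> 'r::comm_ring_1 falg set" where
  "gca_ideal ds =
     Idl\<^bsub>free_alg (length ds)\<^esub>
       {gen i \<star> gen j - (- 1) ^ (ds ! i * ds ! j) \<odot> (gen j \<star> gen i) | i j.
          i < length ds \<and> j < length ds}"

definition gca :: "nat list \<Rightarrow> 'r::comm_ring_1 falg set ring" where
  "gca ds = free_alg (length ds) Quot gca_ideal ds"

definition gca_elem :: "nat list \<Rightarrow> 'r::comm_ring_1 falg \<Rightarrow> 'r falg set" where
  "gca_elem ds f = gca_ideal ds +>\<^bsub>free_alg (length ds)\<^esub> f"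

definition rel_ideal :: "nat list \<Rightarrow> 'r::comm_ring_1 falg set \<Rightarrow> 'r falg set set" where
  "rel_ideal ds R = Idl\<^bsub>gca ds\<^esub> (gca_elem ds ` R)"

text \<open>The quotient of the free graded-commutative algebra by the relations \<open>r = 0\<close> for \<open>r \<in> R\<close>.\<close>

definition gca_quot :: "nat list \<Rightarrow> 'r::comm_ring_1 falg set \<Rightarrow> 'r falg set set ring" where
  "gca_quot ds R = gca ds Quot rel_ideal ds R"

definition quot_elem ::
    "nat list \<Rightarrow> 'r::comm_ring_1 falg set \<Rightarrow> 'r falg \<Rightarrow> 'r falg set set" where
  "quot_elem ds R f = rel_ideal ds R +>\<^bsub>gca ds\<^esub> gca_elem ds f"

definition quot_deg :: "nat list \<Rightarrow> 'r::comm_ring_1 falg set \<Rightarrow> nat \<Rightarrow> 'r falg set set set" where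
  "quot_deg ds R n =
     quot_elem ds R `
       {f \<in> carrier (free_alg (length ds)).
          \<forall>w\<in>Poly_Mapping.keys f. (\<Sum>i\<leftarrow>w. ds ! i) = n}"

definition graded_ring_isos ::
    "nat list \<Rightarrow> 'r::comm_ring_1 falg set \<Rightarrow> int^2^2 \<Rightarrow>
     ('r falg set set \<Rightarrow> (chain \<Rightarrow> 'r) set) set" where
  "graded_ring_isos ds R \<theta> =
     {\<phi> \<in> ring_iso (gca_quot ds R) (cohomology \<theta>). \<forall>n. \<phi> ` quot_deg ds R n = coh_deg \<theta> n}"

end

theory Submission
  imports Defs
begin

text \<open>
  $P$ is exact because its cells pair up as bottoms and tops of prisms in the directions $t$, $b$
  and $a$ in turn, so that a cycle can be pushed along each direction until nothing is left. As
  $P \otimes P$ is then exact too, a diagonal approximation exists, but none has to be computed: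
  a class of degree 1 is a homomorphism $U$ on $G$, and $U$, read as a non-equivariant cochain, is
  a primitive of the corresponding cocycle on $P$. Hence the cup product with this class is given by
  the first moments of $U$ over the coefficients of the boundary. The only moment that is not read
  off directly is that of $E$, a determinant of difference quotients; it
  yields the coefficient of $\zeta_2 \xi_2$ in $\zeta_1 \xi_2$. Each presentation then follows by
  comparing bases: the relations reduce every sorted word to one of a list of words whose products
  form a basis of the cohomology. Rank 0 and determinant $-1$ exclude each other, as $p$ is odd.
\<close>


section \<open>Evaluation of finitely supported integer combinations\<close>

text \<open>The product refers to \<open>diag\<close>, an arbitrary choice, so only the clauses of
  \<open>diagonal_approximation\<close> are known about it. They suffice because a product of two
  classes of positive degree can be non-zero only in degrees 1+1, 1+2 and 2+1, so that one factor
  always has degree 1. For a primitive U of such a factor and a cocycle G, dU cup G = d(U cup G),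
  and on the translate by g the cochain U cup G differs from an equivariant one only by U(g) times a
  cocycle cohomologous to G. On the boundary of a cell the equivariant part becomes a coboundary and
  the other part a first moment. This leads to the explicit product \<open>prd\<close>; it is
  associative and graded commutative modulo coboundaries because the moment maps of two
  homomorphisms anticommute up to a coboundary. The halves in the coefficient of the theorem stem
  from the double arithmetic progression in E: its first moment contains sums of k over k < m, that
  is m (m - 1) / 2.\<close>

definition ev :: "('b \<Rightarrow> 'r::comm_ring_1) \<Rightarrow> ('b \<Rightarrow>\<^sub>0 int) \<Rightarrow> 'r" where
  "ev \<phi> v = (\<Sum>x\<in>Poly_Mapping.keys v. of_int (Poly_Mapping.lookup v x) * \<phi> x)"

lemma ev_superset:
  assumes "finite A" "Poly_Mapping.keys v \<subseteq> A"
  shows "ev \<phi> v = (\<Sum>x\<in>A. of_int (Poly_Mapping.lookup v x) * \<phi> x)"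
  unfolding ev_def by (rule sum.mono_neutral_left) (use assms in \<open>auto simp: in_keys_iff\<close>)

lemma ev_zero [simp]: "ev \<phi> 0 = 0"
  by (simp add: ev_def)

lemma ev_add: "ev \<phi> (u + v) = ev \<phi> u + ev \<phi> v"
proof -
  let ?A = "Poly_Mapping.keys u \<union> Poly_Mapping.keys v"
  have "Poly_Mapping.keys (u + v) \<subseteq> ?A" by (rule Poly_Mapping.keys_add)
  then show ?thesis
    by (simp add: ev_superset[of ?A] lookup_add distrib_right sum.distrib)
qed

lemma ev_uminus: "ev \<phi> (- u) = - ev \<phi> u"
  using ev_add[of \<phi> u "- u"] by (simp add: eq_neg_iff_add_eq_0 add.commute)

lemma ev_diff: "ev \<phi> (u - v) = ev \<phi> u - ev \<phi> v"
  using ev_add[of \<phi> u "- v"] by (simp add: ev_uminus)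

lemma ev_of [simp]: "ev \<phi> (frag_of x) = \<phi> x"
  by (simp add: ev_def)

lemma ev_sum: "ev \<phi> (\<Sum>i\<in>I. f i) = (\<Sum>i\<in>I. ev \<phi> (f i))"
  by (induction I rule: infinite_finite_induct) (auto simp: ev_add)

lemma ev_cmul: "ev \<phi> (frag_cmul k v) = of_int k * ev \<phi> v"
proof -
  have "ev \<phi> (frag_cmul k v) = (\<Sum>x\<in>Poly_Mapping.keys v. of_int (Poly_Mapping.lookup (frag_cmul k v) x) * \<phi> x)"
    by (rule ev_superset) auto
  then show ?thesis by (simp add: ev_def sum_distrib_left mult.assoc)
qed

lemma ev_extend: "ev \<phi> (frag_extend f v) = ev (\<lambda>x. ev \<phi> (f x)) v"
  by (simp add: frag_extend_def ev_sum ev_cmul ev_def[of "\<lambda>x. ev \<phi> (f x)"])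

lemma ev_cong:
  assumes "\<And>x. x \<in> Poly_Mapping.keys v \<Longrightarrow> \<phi> x = \<psi> x"
  shows "ev \<phi> v = ev \<psi> v"
  using assms by (simp add: ev_def)

lemma ev_fun_zero [simp]: "ev (\<lambda>x. 0) v = 0"
  by (simp add: ev_def)

lemma ev_fun_add: "ev (\<lambda>x. \<phi> x + \<psi> x) v = ev \<phi> v + ev \<psi> v"
  by (simp add: ev_def distrib_left sum.distrib)

lemma ev_fun_diff: "ev (\<lambda>x. \<phi> x - \<psi> x) v = ev \<phi> v - ev \<psi> v"
  by (simp add: ev_def right_diff_distrib sum_subtractf)

lemma ev_fun_mult: "ev (\<lambda>x. c * \<phi> x) v = c * ev \<phi> v"
  by (simp add: ev_def sum_distrib_left mult.left_commute)

lemma ev_fun_mult_right: "ev (\<lambda>x. \<phi> x * c) v = ev \<phi> v * c"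
  by (simp add: ev_def sum_distrib_right mult.assoc)

lemma of_int_ev: "of_int (ev \<phi> v) = ev (\<lambda>x. of_int (\<phi> x)) v"
  by (simp add: ev_def)

lemma ev_commute: "ev (\<lambda>x. ev (\<lambda>y. \<phi> x y) v) u = ev (\<lambda>y. ev (\<lambda>x. \<phi> x y) u) v"
  unfolding ev_def sum_distrib_left by (subst sum.swap) (simp add: mult.left_commute)

lemma lookup_eq_ev: "Poly_Mapping.lookup v x = ev (\<lambda>y. if y = x then 1 else 0) v"
  by (simp add: ev_def if_distrib sum.delta in_keys_iff cong: if_cong)

text \<open>Point evaluations are among the functionals. Identities in the group ring, in P and in P
  \<otimes> P are proved by testing against an arbitrary functional, because \<open>ev\<close>
  commutes with every construction by \<open>frag_extend\<close>.\<close>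

lemma frag_eqI:
  assumes "\<And>\<phi> :: 'b \<Rightarrow> int. ev \<phi> u = ev \<phi> v"
  shows "u = v"
  by (rule poly_mapping_eqI) (simp add: lookup_eq_ev assms)

lemma additive_zero:
  fixes f :: "'a::ab_group_add \<Rightarrow> 'c::ab_group_add"
  assumes "\<And>u v. f (u + v) = f u + f v"
  shows "f 0 = 0"
  using assms[of 0 0] by simp

lemma additive_diff:
  fixes f :: "'a::ab_group_add \<Rightarrow> 'c::ab_group_add"
  assumes "\<And>u v. f (u + v) = f u + f v"
  shows "f (u - v) = f u - f v"
  using assms[of "u - v" v] by simp

text \<open>Agreement is asked for only on the support of \<open>v\<close>: in the recursions over
  cells below, the maps are under control only on the cells of one boundary.\<close>

lemma additive_eqI:
  fixes f g :: "('b \<Rightarrow>\<^sub>0 int) \<Rightarrow> 'c::ab_group_add"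
  assumes "\<And>u v. f (u + v) = f u + f v" "\<And>u v. g (u + v) = g u + g v"
    and "\<And>x. x \<in> Poly_Mapping.keys v \<Longrightarrow> f (frag_of x) = g (frag_of x)"
  shows "f v = g v"
proof -
  have "Poly_Mapping.keys v \<subseteq> Poly_Mapping.keys v" by simp
  then show ?thesis
    by (induction v rule: frag_induction)
      (simp_all add: additive_zero[OF assms(1)] additive_zero[OF assms(2)]
        additive_diff[OF assms(1)] additive_diff[OF assms(2)] assms(3))
qed

lemma additive_eq_ev:
  fixes f :: "('b \<Rightarrow>\<^sub>0 int) \<Rightarrow> 'r::comm_ring_1"
  assumes "\<And>u v. f (u + v) = f u + f v"
  shows "f v = ev (\<lambda>x. f (frag_of x)) v"
  by (rule additive_eqI) (simp_all add: assms ev_add)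

lemma additive_eq_extend:
  fixes f :: "('b \<Rightarrow>\<^sub>0 int) \<Rightarrow> ('c \<Rightarrow>\<^sub>0 int)"
  assumes "\<And>u v. f (u + v) = f u + f v"
  shows "f v = frag_extend (\<lambda>x. f (frag_of x)) v"
  by (rule additive_eqI) (simp_all add: assms frag_extend_add)

lemma cell_aug_eq_ev: "cell_aug c v = ev (\<lambda>x. if snd x = c then 1 else 0) v"
  by (simp add: cell_aug_def ev_def if_distrib cong: if_cong)

lemma dual_eq_ev: "dual c v = ev (\<lambda>x. if snd x = c then 1 else 0) v"
  by (simp add: dual_def cell_aug_eq_ev of_int_ev if_distrib cong: if_cong)

lemma taug_eq_ev:
  "taug T = ev (\<lambda>(x, y). cell_aug X0 (frag_of x) * cell_aug X0 (frag_of y)) T"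
  by (simp add: taug_def ev_def case_prod_beta mult.assoc)

lemma cup_eq_ev: "cup \<theta> f g v = ev (\<lambda>(x, y). f (frag_of x) * g (frag_of y)) (diag \<theta> v)"
  by (simp add: cup_def ev_def case_prod_beta mult.assoc)

lemma vec2_eqI: "v $ 1 = w $ 1 \<Longrightarrow> v $ 2 = w $ 2 \<Longrightarrow> v = (w :: 'a^2)"
  by (simp add: vec_eq_iff forall_2)

section \<open>Signed sums over integer ranges\<close>

text \<open>The sum over 0 \<le> k < m, continued to negative m so that \<open>ssum_Suc\<close>
  holds for every integer m. It merges the sign cases in A, B, C and D into single formulas.\<close>

definition ssum :: "(int \<Rightarrow> 'a::ab_group_add) \<Rightarrow> int \<Rightarrow> 'a" where
  "ssum f m = sum f {0..<m} - sum f {m..<0}"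

lemma ssum_0 [simp]: "ssum f 0 = 0"
  by (simp add: ssum_def)

lemma ssum_Suc: "ssum f (m + 1) = ssum f m + f m"
proof (cases "0 \<le> m")
  case True
  then have "{0..<m + 1} = insert m {0..<m}" by auto
  with True show ?thesis by (simp add: ssum_def)
next
  case False
  then have "{m..<0} = insert m {m + 1..<0}" by auto
  with False show ?thesis by (simp add: ssum_def)
qed

text \<open>The recursion and the value at 0 determine a function on the integers, so identities
  between signed sums need no distinction by the sign of m.\<close>

lemma ssum_unique:
  assumes "F 0 = 0" "\<And>m. F (m + 1) = F m + f m"
  shows "F m = ssum f m"
proof (induction m rule: int_induct[where k = 0])
  case (step1 i)
  then show ?case by (simp add: assms ssum_Suc)
next
  case (step2 i)
  then show ?case using assms(2)[of "i - 1"] ssum_Suc[of f "i - 1"] by simp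
qed (simp add: assms)

lemma ssum_telescope: "ssum (\<lambda>k. f (k + 1) - f k) m = f m - f 0"
  by (rule ssum_unique[symmetric]) simp_all

lemma ssum_add: "ssum (\<lambda>k. f k + g k) m = ssum f m + ssum g m"
  by (rule ssum_unique[symmetric]) (simp_all add: ssum_Suc)

lemma ssum_diff: "ssum (\<lambda>k. f k - g k) m = ssum f m - ssum g m"
  by (rule ssum_unique[symmetric]) (simp_all add: ssum_Suc)

lemma ssum_const: "ssum (\<lambda>k. c) m = of_int m * (c :: 'r::comm_ring_1)"
  by (rule ssum_unique[symmetric]) (simp_all add: distrib_right)

lemma ssum_shift: "ssum f (m + n) = ssum f m + ssum (\<lambda>k. f (k + m)) n"
proof -
  have "ssum f (m + n) - ssum f m = ssum (\<lambda>k. f (k + m)) n"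
    by (rule ssum_unique) (simp_all flip: add.assoc add: ssum_Suc add.commute[of m])
  then show ?thesis by (simp add: algebra_simps)
qed

text \<open>Both sides equal \<open>ssum f m + ssum f n - ssum f (m + n)\<close>.\<close>

lemma ssum_swap:
  "ssum f m - ssum (\<lambda>k. f (k + n)) m = ssum f n - ssum (\<lambda>k. f (k + m)) n"
  using ssum_shift[of f m n] ssum_shift[of f n m] by (simp add: algebra_simps)

lemma ev_ssum: "ev \<phi> (ssum f m) = ssum (\<lambda>k. ev \<phi> (f k)) m"
  by (simp add: ssum_def ev_diff ev_sum)

lemma ssum_cases_up:
  "ssum f m = (if m > 0 then (\<Sum>k=0..m - 1. f k) else if m < 0 then - (\<Sum>k=1..- m. f (- k)) else 0)"
proof -
  have "sum f {m..<0} = (\<Sum>k=1..- m. f (- k))"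
    by (rule sum.reindex_bij_witness[of _ uminus uminus]) auto
  moreover have "{0..<m} = {0..m - 1}" by auto
  ultimately show ?thesis by (auto simp: ssum_def)
qed

text \<open>The substitution of -k-1 for k adapts the signed sum to A and C, which run through the
  exponents -1, ..., -m if m > 0 and through 0, ..., -m-1 if m < 0.\<close>

lemma ssum_cases_down:
  "ssum (\<lambda>k. f (- k - 1)) m =
     (if m > 0 then (\<Sum>k=1..m. f (- k)) else if m < 0 then - (\<Sum>k=0..- m - 1. f k) else 0)"
proof -
  have "(\<Sum>k\<in>{m..<0}. f (- k - 1)) = (\<Sum>k=0..- m - 1. f k)"
    by (rule sum.reindex_bij_witness[of _ "\<lambda>k. - k - 1" "\<lambda>k. - k - 1"]) auto
  moreover have "(\<Sum>k\<in>{0..<m}. f (- k - 1)) = (\<Sum>k=1..m. f (- k))"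
    by (rule sum.reindex_bij_witness[of _ "\<lambda>k. k - 1" "\<lambda>k. k + 1"]) auto
  ultimately show ?thesis by (auto simp: ssum_def)
qed

section \<open>The boundary of the resolution\<close>

definition sc :: "int \<Rightarrow> int^2 \<Rightarrow> int^2" where "sc k v = k *s v"

lemma sc_nth [simp]: "sc k v $ i = k * v $ i"
  by (simp add: sc_def)


definition va :: "int^2" where "va = vector [1, 0]"
definition vb :: "int^2" where "vb = vector [0, 1]"
definition ta :: "int^2^2 \<Rightarrow> int^2" where "ta \<theta> = vector [\<theta>$1$1, \<theta>$2$1]"
definition tb :: "int^2^2 \<Rightarrow> int^2" where "tb \<theta> = vector [\<theta>$1$2, \<theta>$2$2]"

lemma theta_va: "\<theta> *v va = ta \<theta>" and theta_vb: "\<theta> *v vb = tb \<theta>"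
  by (rule vec2_eqI; simp add: va_def vb_def ta_def tb_def matrix_vector_mult_def sum_2)+

lemma elem_A_eq: "elem_A \<theta> = frag_of g_1 + ssum (\<lambda>k. frag_of (sc (- k - 1) (ta \<theta>), 1)) (mn \<theta>$1$1)"
proof -
  have "vector [k * \<theta>$1$1, k * \<theta>$2$1] = sc k (ta \<theta>)"
       "vector [- (k * \<theta>$1$1), - (k * \<theta>$2$1)] = sc (- k) (ta \<theta>)" for k
    by (rule vec2_eqI; simp add: ta_def)+
  then show ?thesis
    using ssum_cases_down[of "\<lambda>k. frag_of (sc k (ta \<theta>), 1::int)" "mn \<theta>$1$1"]
    by (simp add: elem_A_def Let_def)
qed

lemma elem_C_eq: "elem_C \<theta> = ssum (\<lambda>k. frag_of (sc (- k - 1) (ta \<theta>), 1)) (mn \<theta>$1$2)"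
proof -
  have "vector [k * \<theta>$1$1, k * \<theta>$2$1] = sc k (ta \<theta>)"
       "vector [- (k * \<theta>$1$1), - (k * \<theta>$2$1)] = sc (- k) (ta \<theta>)" for k
    by (rule vec2_eqI; simp add: ta_def)+
  then show ?thesis
    using ssum_cases_down[of "\<lambda>k. frag_of (sc k (ta \<theta>), 1::int)" "mn \<theta>$1$2"]
    by (simp add: elem_C_def Let_def)
qed

lemma elem_B_eq: "elem_B \<theta> = ssum (\<lambda>k. frag_of (va + sc k (tb \<theta>), 1)) (mn \<theta>$2$1)"
proof -
  have "vector [1 + k * \<theta>$1$2, k * \<theta>$2$2] = va + sc k (tb \<theta>)"
       "vector [1 - k * \<theta>$1$2, - (k * \<theta>$2$2)] = va + sc (- k) (tb \<theta>)" for k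
    by (rule vec2_eqI; simp add: tb_def va_def)+
  then show ?thesis
    using ssum_cases_up[of "\<lambda>k. frag_of (va + sc k (tb \<theta>), 1::int)" "mn \<theta>$2$1"]
    by (simp add: elem_B_def Let_def)
qed

lemma elem_D_eq: "elem_D \<theta> = frag_of g_1 + ssum (\<lambda>k. frag_of (vb + sc k (tb \<theta>), 1)) (mn \<theta>$2$2)"
proof -
  have "vector [k * \<theta>$1$2, 1 + k * \<theta>$2$2] = vb + sc k (tb \<theta>)"
       "vector [- (k * \<theta>$1$2), 1 - k * \<theta>$2$2] = vb + sc (- k) (tb \<theta>)" for k
    by (rule vec2_eqI; simp add: tb_def vb_def)+
  then show ?thesis
    using ssum_cases_up[of "\<lambda>k. frag_of (vb + sc k (tb \<theta>), 1::int)" "mn \<theta>$2$2"]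
    by (simp add: elem_D_def Let_def)
qed

locale gl2 =
  fixes \<theta> :: "int^2^2"
  assumes inv: "invertible \<theta>"
begin

abbreviation gm :: "grp \<Rightarrow> grp \<Rightarrow> grp" (infixl \<open>\<diamondop>\<close> 70) where "g \<diamondop> h \<equiv> g \<otimes>\<^bsub>sdprod \<theta>\<^esub> h"

abbreviation "m1 \<equiv> mn \<theta>$1$1"
abbreviation "m2 \<equiv> mn \<theta>$1$2"
abbreviation "n1 \<equiv> mn \<theta>$2$1"
abbreviation "n2 \<equiv> mn \<theta>$2$2"
abbreviation "ea \<equiv> ta \<theta>"
abbreviation "eb \<equiv> tb \<theta>"

lemma gm_eq: "g \<diamondop> h = (fst g + theta_pow \<theta> (snd g) (fst h), snd g + snd h)"
  by (simp add: sdprod_def)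

lemma gm_assoc: "(g \<diamondop> h) \<diamondop> k = g \<diamondop> (h \<diamondop> k)"
  by (simp add: gm_eq theta_pow_add[OF inv] theta_pow_linear add.assoc)

lemma theta_pow_0 [simp]: "theta_pow \<theta> 0 v = v"
  by (simp add: theta_pow_def)

lemma theta_pow_1: "theta_pow \<theta> 1 v = \<theta> *v v"
  by (simp add: theta_pow_def)

lemma theta_pow_zero [simp]: "theta_pow \<theta> k 0 = 0"
  using theta_pow_linear[of \<theta> k 0 0] by simp

lemma gm_one [simp]: "g \<diamondop> g_1 = g" "g_1 \<diamondop> g = g"
  by (simp_all add: gm_eq g_1_def)

lemma matrix_inv_mn: "matrix_inv \<theta> = - mn \<theta>"
  by (simp add: mn_def)

lemma theta_mn: "\<theta> ** mn \<theta> = - mat 1" "mn \<theta> ** \<theta> = - mat 1"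
proof -
  have *: "\<theta> ** (- mn \<theta>) = mat 1" "(- mn \<theta>) ** \<theta> = mat 1"
    using matrix_inv_both[OF inv] by (simp_all add: matrix_inv_mn)
  have "\<theta> ** (- mn \<theta>) = - (\<theta> ** mn \<theta>)" "(- mn \<theta>) ** \<theta> = - (mn \<theta> ** \<theta>)"
    by (simp_all add: matrix_matrix_mult_def vec_eq_iff sum_negf)
  with * show "\<theta> ** mn \<theta> = - mat 1" "mn \<theta> ** \<theta> = - mat 1"
    by (simp_all add: minus_equation_iff eq_commute)
qed

text \<open>In the group this says \<theta>(a)^m1 \<theta>(b)^n1 = a^-1; it is the first column of
  \<theta> (-\<theta>^-1) = -1. It identifies the far ends of the progressions in A and B.\<close>

lemma mn_a: "sc m1 ea + sc n1 eb = - va"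
proof -
  have "(\<theta> ** mn \<theta>) $ i $ 1 = (- mat 1 :: int^2^2) $ i $ 1" for i by (simp add: theta_mn)
  from this[of 1] this[of 2] show ?thesis
    by (intro vec2_eqI) (simp_all add: matrix_matrix_mult_def sum_2 ta_def tb_def va_def mat_def mult.commute)
qed

lemma mn_b: "sc m2 ea + sc n2 eb = - vb"
proof -
  have "(\<theta> ** mn \<theta>) $ i $ 2 = (- mat 1 :: int^2^2) $ i $ 2" for i by (simp add: theta_mn)
  from this[of 1] this[of 2] show ?thesis
    by (intro vec2_eqI) (simp_all add: matrix_matrix_mult_def sum_2 ta_def tb_def vb_def mat_def mult.commute)
qed

lemma translate_of [simp]: "translate \<theta> g (frag_of (h, c)) = frag_of (g \<diamondop> h, c)"
  by (simp add: translate_def)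

lemma translate_add: "translate \<theta> g (u + v) = translate \<theta> g u + translate \<theta> g v"
  by (simp add: translate_def frag_extend_add)

lemma translate_0 [simp]: "translate \<theta> g 0 = 0"
  by (simp add: translate_def)

lemma ev_translate: "ev \<phi> (translate \<theta> g v) = ev (\<lambda>(h, c). \<phi> (g \<diamondop> h, c)) v"
  by (simp add: translate_def ev_extend case_prod_unfold)

lemma translate_translate: "translate \<theta> g (translate \<theta> h v) = translate \<theta> (g \<diamondop> h) v"
  by (rule frag_eqI) (simp add: ev_translate case_prod_beta gm_assoc)

lemma translate_one [simp]: "translate \<theta> g_1 v = v"
  by (rule frag_eqI) (simp add: ev_translate case_prod_beta)

lemma ev_smult_basis: "ev \<phi> (zg_smult \<theta> r (basis c)) = ev (\<lambda>g. \<phi> (g, c)) r"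
  by (simp add: zg_smult_def basis_def ev_extend)

lemma ev_A: "ev \<phi> (elem_A \<theta>) = \<phi> g_1 + ssum (\<lambda>k. \<phi> (sc (- k - 1) ea, 1)) m1"
  and ev_B: "ev \<phi> (elem_B \<theta>) = ssum (\<lambda>k. \<phi> (va + sc k eb, 1)) n1"
  and ev_C: "ev \<phi> (elem_C \<theta>) = ssum (\<lambda>k. \<phi> (sc (- k - 1) ea, 1)) m2"
  and ev_D: "ev \<phi> (elem_D \<theta>) = \<phi> g_1 + ssum (\<lambda>k. \<phi> (vb + sc k eb, 1)) n2"
  by (simp_all add: elem_A_eq elem_B_eq elem_C_eq elem_D_eq ev_add ev_ssum)

declare bd_cell.simps [simp del]

lemma ev_bd_cell:
  "ev \<phi> (bd_cell \<theta> X0) = 0"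
  "ev \<phi> (bd_cell \<theta> Y1) = \<phi> (g_a, X0) - \<phi> (g_1, X0)"
  "ev \<phi> (bd_cell \<theta> Y2) = \<phi> (g_b, X0) - \<phi> (g_1, X0)"
  "ev \<phi> (bd_cell \<theta> Y3) = \<phi> (g_t, X0) - \<phi> (g_1, X0)"
  "ev \<phi> (bd_cell \<theta> Z1) = ev (\<lambda>g. \<phi> (g, Y1)) (elem_A \<theta>) + ev (\<lambda>g. \<phi> (g, Y2)) (elem_B \<theta>)
     + \<phi> (g_a, Y3) - \<phi> (g_1, Y3)"
  "ev \<phi> (bd_cell \<theta> Z2) = ev (\<lambda>g. \<phi> (g, Y1)) (elem_C \<theta>) + ev (\<lambda>g. \<phi> (g, Y2)) (elem_D \<theta>)
     + \<phi> (g_b, Y3) - \<phi> (g_1, Y3)"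
  "ev \<phi> (bd_cell \<theta> Z3) = \<phi> (g_1, Y1) - \<phi> (g_b, Y1) + \<phi> (g_a, Y2) - \<phi> (g_1, Y2)"
  "ev \<phi> (bd_cell \<theta> W) = \<phi> (g_1, Z1) - \<phi> (g_b, Z1) + \<phi> (g_a, Z2) - \<phi> (g_1, Z2)
     + ev (\<lambda>g. \<phi> (g, Z3)) (elem_E \<theta>)"
  by (simp_all add: bd_cell.simps ev_add ev_diff ev_smult_basis)

lemma bd_of: "bd \<theta> (frag_of (g, c)) = translate \<theta> g (bd_cell \<theta> c)"
  by (simp add: bd_def)

lemma bd_add: "bd \<theta> (u + v) = bd \<theta> u + bd \<theta> v"
  by (simp add: bd_def frag_extend_add)

lemma bd_diff: "bd \<theta> (u - v) = bd \<theta> u - bd \<theta> v"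
  by (simp add: bd_def frag_extend_diff)

lemma bd_0 [simp]: "bd \<theta> 0 = 0"
  by (simp add: bd_def)

lemma bd_basis: "bd \<theta> (basis c) = bd_cell \<theta> c"
  by (simp add: basis_def bd_of)

lemma ev_bd: "ev \<phi> (bd \<theta> v) = ev (\<lambda>(g, c). ev (\<lambda>(h, d). \<phi> (g \<diamondop> h, d)) (bd_cell \<theta> c)) v"
  by (simp add: bd_def ev_extend case_prod_unfold ev_translate)

lemma bd_translate: "bd \<theta> (translate \<theta> g v) = translate \<theta> g (bd \<theta> v)"
  by (rule frag_eqI) (simp add: ev_translate ev_bd case_prod_beta gm_assoc)

lemma gm_level0: "(v, 0) \<diamondop> (w, k) = (v + w, k)"
  by (simp add: gm_eq)

lemma gm_level1: "(v, 1) \<diamondop> (w, k) = (v + \<theta> *v w, 1 + k)"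
  by (simp add: gm_eq theta_pow_1)

text \<open>Past t, right multiplication by a or b becomes a shift by \<theta>(a) or \<theta>(b),
  and these are the steps of the progressions in A, B, C and D.\<close>

lemma level1_a: "(v, 1) \<diamondop> g_a = (v + ea, 1)" and level1_b: "(v, 1) \<diamondop> g_b = (v + eb, 1)"
  by (simp_all add: g_a_def g_b_def gm_level1 theta_va[unfolded va_def] theta_vb[unfolded vb_def])

lemma ev_zg_mult: "ev \<phi> (zg_mult \<theta> r s) = ev (\<lambda>g. ev (\<lambda>h. \<phi> (g \<diamondop> h)) s) r"
  by (simp add: zg_mult_def ev_extend)

text \<open>
  In the level-one part of the group ring, a commutative Laurent polynomial ring, \<open>A, B, C, D\<close>
  are difference quotients and \<open>E\<close> is their determinant \<open>A D - B C\<close>.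
\<close>

definition EE :: zg where
  "EE = - frag_of g_1
     + ssum (\<lambda>k. ssum (\<lambda>l. frag_of (vb + sc (- k - 1) ea + sc l eb, 1)) n2) m1
     - ssum (\<lambda>k. ssum (\<lambda>l. frag_of (va + sc (- k - 1) ea + sc l eb, 1)) n1) m2"

lemma ev_EE: "ev \<phi> EE = - \<phi> g_1
     + ssum (\<lambda>k. ssum (\<lambda>l. \<phi> (vb + sc (- k - 1) ea + sc l eb, 1)) n2) m1
     - ssum (\<lambda>k. ssum (\<lambda>l. \<phi> (va + sc (- k - 1) ea + sc l eb, 1)) n1) m2"
  by (simp add: EE_def ev_add ev_diff ev_uminus ev_ssum)

lemma ssum_commute: "ssum (\<lambda>k. ssum (\<lambda>l. f k l) n) m = ssum (\<lambda>l. ssum (\<lambda>k. f k l) m) n"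
proof (rule ssum_unique[symmetric])
  show "ssum (\<lambda>l. ssum (\<lambda>k. f k l) (i + 1)) n =
        ssum (\<lambda>l. ssum (\<lambda>k. f k l) i) n + ssum (\<lambda>l. f i l) n" for i
    by (simp add: ssum_Suc ssum_add)
next
  show "ssum (\<lambda>l. ssum (\<lambda>k. f k l) 0) n = 0" by (simp add: ssum_def)
qed

text \<open>A geometric sum with ratio \<theta>(b), multiplied by 1 - b on the right, keeps only its
  two ends; \<open>telescope_a\<close> is the counterpart for the descending powers of
  \<theta>(a).\<close>

lemma telescope_b:
  "ssum (\<lambda>l. \<phi> (v + sc l eb, 1)) n - ssum (\<lambda>l. \<phi> (v + sc l eb + eb, 1)) n = \<phi> (v, 1) - \<phi> (v + sc n eb, 1::int)"
  for \<phi> :: "grp \<Rightarrow> int"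
proof -
  have *: "v + sc l eb + eb = v + sc (l + 1) eb" "v + sc 0 eb = v" for l
    by (rule vec2_eqI; simp add: algebra_simps)+
  show ?thesis
    using ssum_telescope[of "\<lambda>l. \<phi> (v + sc l eb, 1)" n] by (simp only: ssum_diff *)
qed

lemma telescope_a:
  "ssum (\<lambda>k. \<phi> (v + sc (- k - 1) ea + ea, 1)) n - ssum (\<lambda>k. \<phi> (v + sc (- k - 1) ea, 1)) n
   = \<phi> (v, 1) - \<phi> (v - sc n ea, 1::int)" for \<phi> :: "grp \<Rightarrow> int"
proof -
  have *: "v + sc (- k - 1) ea + ea = v + sc (- k) ea" for k
    by (rule vec2_eqI) (simp_all add: algebra_simps)
  have 0: "v + sc (- n) ea = v - sc n ea" "v + sc 0 ea = v"
    by (rule vec2_eqI; simp add: algebra_simps)+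
  have "- (k + 1) = - k - 1" for k :: int by simp
  then show ?thesis
    using ssum_telescope[of "\<lambda>k. \<phi> (v + sc (- k) ea, 1)" n]
    by (simp only: ssum_diff * 0 minus_zero)
qed

lemma EE_eq1:
  "zg_mult \<theta> EE (frag_of g_1 - frag_of g_b) =
     zg_mult \<theta> (frag_of g_b - frag_of g_1) (elem_A \<theta>) +
     zg_mult \<theta> (frag_of g_1 - frag_of g_a) (elem_C \<theta>)"
proof (rule frag_eqI)
  fix \<phi> :: "grp \<Rightarrow> int"
  \<comment> \<open>By \<open>mn_b\<close>, vb + n2 eb = - m2 ea, and by \<open>mn_a\<close>, va +
    n1 eb = - m1 ea: the far ends of the inner sums fall back into the progression of A and
    C.\<close>
  have *: "vb + sc (- k - 1) ea + sc n2 eb = sc (- (k + m2) - 1) ea"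
          "va + sc (- k - 1) ea + sc n1 eb = sc (- (k + m1) - 1) ea" for k
    using mn_a mn_b by (simp_all add: vec_eq_iff forall_2 algebra_simps)
  let ?f = "\<lambda>k. \<phi> (sc (- k - 1) ea, 1)"
  \<comment> \<open>After the inner sums have collapsed, the remaining single sums carry shifts by
    m2 and m1; this equation matches the shifted ends.\<close>
  have sw: "ssum ?f m1 - ssum (\<lambda>k. ?f (k + m2)) m1 = ssum ?f m2 - ssum (\<lambda>k. ?f (k + m1)) m2"
    by (rule ssum_swap)
  have "ev \<phi> (zg_mult \<theta> EE (frag_of g_1 - frag_of g_b)) = - \<phi> g_1 + \<phi> g_b
     + ssum (\<lambda>k. ssum (\<lambda>l. \<phi> (vb + sc (- k - 1) ea + sc l eb, 1)) n2
           - ssum (\<lambda>l. \<phi> (vb + sc (- k - 1) ea + sc l eb + eb, 1)) n2) m1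
     - ssum (\<lambda>k. ssum (\<lambda>l. \<phi> (va + sc (- k - 1) ea + sc l eb, 1)) n1
           - ssum (\<lambda>l. \<phi> (va + sc (- k - 1) ea + sc l eb + eb, 1)) n1) m2"
    by (simp add: ev_zg_mult ev_diff ev_EE level1_b ssum_diff)
  also have "\<dots> = - \<phi> g_1 + \<phi> g_b
     + ssum (\<lambda>k. \<phi> (vb + sc (- k - 1) ea, 1) - \<phi> (sc (- (k + m2) - 1) ea, 1)) m1
     - ssum (\<lambda>k. \<phi> (va + sc (- k - 1) ea, 1) - \<phi> (sc (- (k + m1) - 1) ea, 1)) m2"
    by (simp only: telescope_b *)
  also have "\<dots> = ev \<phi> (zg_mult \<theta> (frag_of g_b - frag_of g_1) (elem_A \<theta>) +
     zg_mult \<theta> (frag_of g_1 - frag_of g_a) (elem_C \<theta>))"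
    using sw
    by (simp add: ev_zg_mult ev_add ev_diff ev_A ev_C gm_level0 g_a_def g_b_def va_def vb_def ssum_diff
        algebra_simps)
  finally show "ev \<phi> (zg_mult \<theta> EE (frag_of g_1 - frag_of g_b)) = \<dots>" .
qed

lemma EE_eq2:
  "zg_mult \<theta> EE (frag_of g_a - frag_of g_1) =
     zg_mult \<theta> (frag_of g_b - frag_of g_1) (elem_B \<theta>) +
     zg_mult \<theta> (frag_of g_1 - frag_of g_a) (elem_D \<theta>)"
proof (rule frag_eqI)
  fix \<phi> :: "grp \<Rightarrow> int"
  let ?f = "\<lambda>l. \<phi> (va + vb + sc l eb, 1)"
  have *: "vb + sc l eb - sc m1 ea = va + vb + sc (l + n1) eb"
          "va + sc l eb - sc m2 ea = va + vb + sc (l + n2) eb" for l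
    using mn_a mn_b by (simp_all add: vec_eq_iff forall_2 algebra_simps)
  have sw: "ssum ?f n1 - ssum (\<lambda>k. ?f (k + n2)) n1 = ssum ?f n2 - ssum (\<lambda>k. ?f (k + n1)) n2"
    by (rule ssum_swap)
  have "ev \<phi> (zg_mult \<theta> EE (frag_of g_a - frag_of g_1)) = - \<phi> g_a + \<phi> g_1
     + ssum (\<lambda>k. ssum (\<lambda>l. \<phi> (vb + sc (- k - 1) ea + sc l eb + ea, 1)
           - \<phi> (vb + sc (- k - 1) ea + sc l eb, 1)) n2) m1
     - ssum (\<lambda>k. ssum (\<lambda>l. \<phi> (va + sc (- k - 1) ea + sc l eb + ea, 1)
           - \<phi> (va + sc (- k - 1) ea + sc l eb, 1)) n1) m2"
    by (simp add: ev_zg_mult ev_diff ev_EE level1_a ssum_diff)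
  \<comment> \<open>Multiplication by a telescopes in k and not in l, so the sum over k is brought
    inside.\<close>
  also have "\<dots> = - \<phi> g_a + \<phi> g_1
     + ssum (\<lambda>l. ssum (\<lambda>k. \<phi> (vb + sc l eb + sc (- k - 1) ea + ea, 1)) m1
           - ssum (\<lambda>k. \<phi> (vb + sc l eb + sc (- k - 1) ea, 1)) m1) n2
     - ssum (\<lambda>l. ssum (\<lambda>k. \<phi> (va + sc l eb + sc (- k - 1) ea + ea, 1)) m2
           - ssum (\<lambda>k. \<phi> (va + sc l eb + sc (- k - 1) ea, 1)) m2) n1"
    by (subst (1 2) ssum_commute) (simp add: ssum_diff add_ac)
  also have "\<dots> = - \<phi> g_a + \<phi> g_1
     + ssum (\<lambda>l. \<phi> (vb + sc l eb, 1) - \<phi> (va + vb + sc (l + n1) eb, 1)) n2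
     - ssum (\<lambda>l. \<phi> (va + sc l eb, 1) - \<phi> (va + vb + sc (l + n2) eb, 1)) n1"
    by (simp only: telescope_a *)
  also have "\<dots> = ev \<phi> (zg_mult \<theta> (frag_of g_b - frag_of g_1) (elem_B \<theta>) +
     zg_mult \<theta> (frag_of g_1 - frag_of g_a) (elem_D \<theta>))"
    using sw
    by (simp add: ev_zg_mult ev_add ev_diff ev_B ev_D gm_level0 g_a_def g_b_def ssum_diff
        add_ac flip: va_def vb_def)
  finally show "ev \<phi> (zg_mult \<theta> EE (frag_of g_a - frag_of g_1)) = \<dots>" .
qed

lemma theta_pow_eq_0: "theta_pow \<theta> k v = 0 \<Longrightarrow> v = 0"
  using theta_pow_add[OF inv, of "- k" k v] by simp

text \<open>The element $b$ has infinite order, so $1 - b$ is no zero divisor.\<close>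

lemma zg_mult_b_cancel:
  assumes "zg_mult \<theta> e (frag_of g_1 - frag_of g_b) = 0"
  shows "e = 0"
proof (rule ccontr)
  assume "e \<noteq> 0"
  then obtain v k where g: "Poly_Mapping.lookup e (v, k) \<noteq> 0"
    by (metis lookup_zero poly_mapping_eqI surj_pair)
  define s where "s = theta_pow \<theta> k vb"
  have s: "s \<noteq> 0"
    using theta_pow_eq_0[of k vb] by (auto simp: s_def vb_def vec_eq_iff forall_2)
  have "theta_pow \<theta> k vb = s" by (simp add: s_def)
  \<comment> \<open>Right multiplication by b moves (w, k) to (w + s, k), so the coefficient of e (1
    - b) = 0 at (w + s, k) is the difference of two coefficients of e. A non-zero one would be
    repeated infinitely often.\<close>
  have step: "Poly_Mapping.lookup e (w + s, k) = Poly_Mapping.lookup e (w, k)" for w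
  proof -
    let ?\<delta> = "\<lambda>y. if y = (w + s, k) then 1 else 0 :: int"
    have "0 = ev ?\<delta> (zg_mult \<theta> e (frag_of g_1 - frag_of g_b))" by (simp add: assms)
    also have "\<dots> = ev ?\<delta> e - ev (\<lambda>g. ?\<delta> (g \<diamondop> g_b)) e"
      by (simp add: ev_zg_mult ev_diff ev_fun_diff)
    also have "(\<lambda>g. ?\<delta> (g \<diamondop> g_b)) = (\<lambda>y. if y = (w, k) then 1 else 0)"
      by (auto simp: gm_eq g_b_def s_def fun_eq_iff simp flip: vb_def)
    finally show ?thesis by (simp add: lookup_eq_ev)
  qed
  have "Poly_Mapping.lookup e (v + sc (int n) s, k) \<noteq> 0" for n
  proof (induction n)
    case (Suc n)
    have "v + sc (int (Suc n)) s = v + sc (int n) s + s"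
      by (rule vec2_eqI) (simp_all add: algebra_simps)
    with Suc step[of "v + sc (int n) s"] show ?case by (simp only: not_False_eq_True)
  next
    case 0
    have "v + sc (int 0) s = v" by (rule vec2_eqI) simp_all
    with g show ?case by simp
  qed
  then have "(\<lambda>n. (v + sc (int n) s, k)) ` UNIV \<subseteq> Poly_Mapping.keys e"
    by (auto simp: in_keys_iff)
  then have "finite (range (\<lambda>n. (v + sc (int n) s, k)))" using finite_subset finite_keys by blast
  moreover have "inj (\<lambda>n. (v + sc (int n) s, k))"
    using s by (auto simp: inj_on_def vec_eq_iff forall_2)
  ultimately show False by (simp add: finite_image_iff)
qed

lemma elem_E_eq: "elem_E \<theta> = EE"
  unfolding elem_E_def
proof (rule the_equality)
  fix e
  assume "zg_mult \<theta> e (frag_of g_1 - frag_of g_b) =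
     zg_mult \<theta> (frag_of g_b - frag_of g_1) (elem_A \<theta>) +
     zg_mult \<theta> (frag_of g_1 - frag_of g_a) (elem_C \<theta>) \<and>
     zg_mult \<theta> e (frag_of g_a - frag_of g_1) =
     zg_mult \<theta> (frag_of g_b - frag_of g_1) (elem_B \<theta>) +
     zg_mult \<theta> (frag_of g_1 - frag_of g_a) (elem_D \<theta>)"
  then have "zg_mult \<theta> e (frag_of g_1 - frag_of g_b) = zg_mult \<theta> EE (frag_of g_1 - frag_of g_b)"
    by (simp add: EE_eq1)
  then have "zg_mult \<theta> (e - EE) (frag_of g_1 - frag_of g_b) = 0"
    by (simp add: zg_mult_def frag_extend_diff)
  then show "e = EE" using zg_mult_b_cancel by fastforce
qed (simp_all add: EE_eq1 EE_eq2)

lemmas ev_E = ev_EE[folded elem_E_eq]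

lemma bd_bd_cell: "bd \<theta> (bd_cell \<theta> c) = 0"
proof (rule frag_eqI)
  fix \<phi> :: "grp \<times> cell \<Rightarrow> int"
  let ?x = "\<lambda>g. \<phi> (g, X0)"
  have Z1: "ev \<phi> (bd \<theta> (bd_cell \<theta> Z1)) = 0"
  proof -
    have "0 - sc m1 ea = va + sc n1 eb" using mn_a by (simp add: vec_eq_iff forall_2 algebra_simps)
    then show ?thesis
    using telescope_a[of ?x 0 m1] telescope_b[of ?x va n1]
    by (simp add: ev_bd ev_bd_cell ev_A ev_B level1_a level1_b ssum_diff)
      (simp add: gm_eq g_a_def g_t_def g_1_def flip: va_def)
  qed
  have Z2: "ev \<phi> (bd \<theta> (bd_cell \<theta> Z2)) = 0"
  proof -
    have "0 - sc m2 ea = vb + sc n2 eb" using mn_b by (simp add: vec_eq_iff forall_2 algebra_simps)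
    then show ?thesis
    using telescope_a[of ?x 0 m2] telescope_b[of ?x vb n2]
    by (simp add: ev_bd ev_bd_cell ev_C ev_D level1_a level1_b ssum_diff)
      (simp add: gm_eq g_b_def g_t_def g_1_def flip: vb_def)
  qed
  have Z3: "ev \<phi> (bd \<theta> (bd_cell \<theta> Z3)) = 0"
    by (simp add: ev_bd ev_bd_cell) (simp add: gm_eq g_a_def g_b_def g_1_def add.commute)
  have W: "ev \<phi> (bd \<theta> (bd_cell \<theta> W)) = 0"
  proof -
    \<comment> \<open>The coefficients of y1 and y2 vanish by the two equations that characterise E;
      those of y3 cancel because a and b commute.\<close>
    have "ev \<phi> (bd \<theta> (bd_cell \<theta> W)) =
      ev (\<lambda>g. \<phi> (g, Y1)) (zg_mult \<theta> (elem_E \<theta>) (frag_of g_1 - frag_of g_b)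
        - zg_mult \<theta> (frag_of g_b - frag_of g_1) (elem_A \<theta>) - zg_mult \<theta> (frag_of g_1 - frag_of g_a) (elem_C \<theta>))
      + ev (\<lambda>g. \<phi> (g, Y2)) (zg_mult \<theta> (elem_E \<theta>) (frag_of g_a - frag_of g_1)
        - zg_mult \<theta> (frag_of g_b - frag_of g_1) (elem_B \<theta>) - zg_mult \<theta> (frag_of g_1 - frag_of g_a) (elem_D \<theta>))
      + (\<phi> (g_a, Y3) - \<phi> (g_1, Y3) - \<phi> (g_b \<diamondop> g_a, Y3) + \<phi> (g_b, Y3)
         + \<phi> (g_a \<diamondop> g_b, Y3) - \<phi> (g_a, Y3) - \<phi> (g_b, Y3) + \<phi> (g_1, Y3))"
      by (simp add: ev_bd ev_bd_cell ev_zg_mult ev_diff ev_fun_diff ev_fun_add)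
    also have "\<dots> = 0"
      by (simp add: elem_E_eq EE_eq1 EE_eq2) (simp add: gm_eq g_a_def g_b_def add.commute)
    finally show ?thesis .
  qed
  show "ev \<phi> (bd \<theta> (bd_cell \<theta> c)) = ev \<phi> 0"
    using Z1 Z2 Z3 W by (cases c) (simp_all add: ev_bd ev_bd_cell)
qed

lemma bd_bd [simp]: "bd \<theta> (bd \<theta> v) = 0"
proof -
  have "bd \<theta> (bd \<theta> v) = (\<lambda>_. 0) v"
  proof (rule additive_eqI[of "\<lambda>v. bd \<theta> (bd \<theta> v)"])
    show "bd \<theta> (bd \<theta> (frag_of x)) = 0" for x :: "grp \<times> cell"
      by (cases x) (simp add: bd_of bd_translate bd_bd_cell)
  qed (simp_all add: bd_add)
  then show ?thesis by simp
qed

end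

section \<open>Exactness of the resolution\<close>

lemma keys_sub_add: "Poly_Mapping.keys u \<subseteq> S \<Longrightarrow> Poly_Mapping.keys v \<subseteq> S \<Longrightarrow> Poly_Mapping.keys (u + v) \<subseteq> S"
  using Poly_Mapping.keys_add[of u v] by blast

lemma keys_sub_diff:
  "Poly_Mapping.keys u \<subseteq> S \<Longrightarrow> Poly_Mapping.keys v \<subseteq> S \<Longrightarrow> Poly_Mapping.keys (u - v) \<subseteq> S"
  for u v :: "'a \<Rightarrow>\<^sub>0 int"
  using keys_diff[of u v] by blast

lemma keys_sub_cmul: "Poly_Mapping.keys u \<subseteq> S \<Longrightarrow> Poly_Mapping.keys (frag_cmul k u) \<subseteq> S"
  using keys_cmul[of k u] by blast

lemma keys_sub_extend:
  "(\<And>x. x \<in> Poly_Mapping.keys v \<Longrightarrow> Poly_Mapping.keys (f x) \<subseteq> S) \<Longrightarrow> Poly_Mapping.keys (frag_extend f v) \<subseteq> S"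
  using keys_frag_extend[of f v] by blast

lemma keys_sub_sum:
  "(\<And>i. i \<in> I \<Longrightarrow> Poly_Mapping.keys (f i) \<subseteq> S) \<Longrightarrow> Poly_Mapping.keys (sum f I) \<subseteq> S"
  using Poly_Mapping.keys_sum[of f I] by blast

lemma keys_sub_ssum:
  "(\<And>i. Poly_Mapping.keys (f i) \<subseteq> S) \<Longrightarrow> Poly_Mapping.keys (ssum f m) \<subseteq> S"
  for f :: "int \<Rightarrow> 'a \<Rightarrow>\<^sub>0 int"
  unfolding ssum_def by (intro keys_sub_diff keys_sub_sum)

lemmas keys_sub = keys_sub_add keys_sub_diff keys_sub_cmul keys_sub_extend keys_sub_ssum

context gl2
begin

text \<open>
  Cells in \<open>F\<close> are the bottoms of the cells in \<open>R\<close>, whose tops lie one level higher, so a cycle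
  can be pushed upwards through the cells of \<open>R\<close> until it lies in a single level of \<open>F\<close>.
\<close>

lemma collapse:
  fixes lv sg :: "grp \<times> cell \<Rightarrow> int" and pr :: "grp \<times> cell \<Rightarrow> grp \<times> cell"
  assumes sg: "\<And>x. x \<in> F \<Longrightarrow> sg x * sg x = 1"
    and lv_pr: "\<And>x. x \<in> F \<Longrightarrow> lv (pr x) = lv x"
    and R: "R = pr ` F" and disj: "F \<inter> R = {}"
    and bdF: "\<And>x. x \<in> F \<Longrightarrow> Poly_Mapping.keys (bd \<theta> (frag_of x)) \<subseteq> {y \<in> F. lv y = lv x}"
    and bdR: "\<And>x. x \<in> F \<Longrightarrow>
        Poly_Mapping.keys (bd \<theta> (frag_of (pr x)) - frag_cmul (sg x) (frag_of x))
          \<subseteq> {y \<in> R. lv y = lv x} \<union> {y \<in> F. lv y = lv x + 1}"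
    and v: "Poly_Mapping.keys v \<subseteq> F \<union> R" "bd \<theta> v = 0"
  shows "\<exists>w N. Poly_Mapping.keys (v - bd \<theta> w) \<subseteq> {y \<in> F. lv y = N}"
proof -
  \<comment> \<open>An \<open>R\<close> cell of level k has its top on level k + 1, so
    \<open>R\<close> cells must stay strictly below N where \<open>F\<close> cells may reach
    N.\<close>
  define P where "P K N v \<longleftrightarrow> Poly_Mapping.keys v \<subseteq>
    {y \<in> F. K \<le> lv y \<and> lv y \<le> N} \<union> {y \<in> R. K \<le> lv y \<and> lv y < N}" for K N and v :: chain
  have step: "\<exists>w. P (K + 1) N (v - bd \<theta> w)" if PK: "P K N v" and "K < N" and v0: "bd \<theta> v = 0" for K N v
  proof -
    define S where "S = {y \<in> F. K + 1 \<le> lv y \<and> lv y \<le> N} \<union> {y \<in> R. K \<le> lv y \<and> lv y < N}"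
    have sub: "Poly_Mapping.keys v \<subseteq> {y \<in> F. lv y = K} \<union> S"
      using PK unfolding P_def S_def by fastforce
    obtain v1 v2 where v1: "Poly_Mapping.keys v1 \<subseteq> {y \<in> F. lv y = K}"
      and v2: "Poly_Mapping.keys v2 \<subseteq> S" and v12: "v1 + v2 = v"
      using frag_split[OF sub] .
    \<comment> \<open>The \<open>R\<close> cells standing on the lowest \<open>F\<close> layer
      \<open>v1\<close>. Since sg x * sg x = 1, their boundary contains \<open>v1\<close> itself and
      otherwise only cells of \<open>S\<close>.\<close>
    define w where "w = frag_extend (\<lambda>x. frag_cmul (sg x) (frag_of (pr x))) v1"
    have e1: "bd \<theta> w - v1 = frag_extend (\<lambda>x. frag_cmul (sg x) (bd \<theta> (frag_of (pr x)) - frag_cmul (sg x) (frag_of x))) v1"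
    proof (rule additive_eqI[of "\<lambda>v1. bd \<theta> (frag_extend (\<lambda>x. frag_cmul (sg x) (frag_of (pr x))) v1) - v1" _ v1, folded w_def])
      fix x assume "x \<in> Poly_Mapping.keys v1"
      then have "x \<in> F" using v1 by blast
      then have "sg x * sg x = 1" by (rule sg)
      then show "bd \<theta> (frag_extend (\<lambda>x. frag_cmul (sg x) (frag_of (pr x))) (frag_of x)) - frag_of x
         = frag_extend (\<lambda>x. frag_cmul (sg x) (bd \<theta> (frag_of (pr x)) - frag_cmul (sg x) (frag_of x))) (frag_of x)"
        by (simp add: bd_def frag_extend_cmul)
          (simp add: diff_conv_add_uminus frag_cmul_distrib2 minus_frag_cmul del: add_uminus_conv_diff)
    qed (simp_all add: frag_extend_add bd_add)
    have e2: "Poly_Mapping.keys (bd \<theta> w - v1) \<subseteq> S" unfolding e1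
    proof (rule keys_sub_extend, rule keys_sub_cmul)
      fix x assume "x \<in> Poly_Mapping.keys v1"
      with v1 have "x \<in> F" "lv x = K" by auto
      with bdR[of x] show "Poly_Mapping.keys (bd \<theta> (frag_of (pr x)) - frag_cmul (sg x) (frag_of x)) \<subseteq> S"
        using \<open>K < N\<close> by (fastforce simp: S_def)
    qed
    have "v - bd \<theta> w = v2 - (bd \<theta> w - v1)" by (simp add: algebra_simps flip: v12)
    then have S: "Poly_Mapping.keys (v - bd \<theta> w) \<subseteq> S"
      using keys_sub_diff[OF v2 e2] by (simp only:)
    define v' where "v' = v - bd \<theta> w"
    have bd': "bd \<theta> v' = 0" by (simp add: v'_def bd_diff v0)
    \<comment> \<open>Once the lowest layer of \<open>F\<close> is gone, pr x is the only cell of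
      \<open>v'\<close> whose boundary can contain x. As the boundary of \<open>v'\<close> is 0, the
      coefficient of pr x vanishes.\<close>
    have no: "Poly_Mapping.lookup v' (pr x) = 0" if x: "x \<in> F" "lv x = K" for x
    proof -
      have "Poly_Mapping.lookup (bd \<theta> (frag_of y)) x = (if y = pr x then 1 else 0) * sg x"
        if y: "y \<in> Poly_Mapping.keys v'" for y
      proof -
        from y S have "y \<in> S" unfolding v'_def by blast
        consider "y \<in> F" "lv y > K" | z where "z \<in> F" "y = pr z" "lv z \<ge> K"
          using \<open>y \<in> S\<close> lv_pr by (auto simp: S_def R)
        then show ?thesis
        proof cases
          case 1
          then have "x \<notin> Poly_Mapping.keys (bd \<theta> (frag_of y))" using bdF[of y] x by auto
          moreover have "y \<noteq> pr x" using 1 x lv_pr[OF x(1)] by auto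
          ultimately show ?thesis by (simp add: in_keys_iff)
        next
          case 2
          have "x \<notin> R" using x disj by auto
          then have "x \<notin> Poly_Mapping.keys (bd \<theta> (frag_of (pr z)) - frag_cmul (sg z) (frag_of z))"
            using bdR[of z] 2 x by auto
          then have *: "Poly_Mapping.lookup (bd \<theta> (frag_of y)) x = (if z = x then sg z else 0)"
            using 2 by (simp add: in_keys_iff lookup_minus lookup_single when_def)
          show ?thesis
          proof (cases "z = x")
            case False
            \<comment> \<open>Injectivity of \<open>pr\<close> follows from the boundary formulas: a
              common top cell would contain z in its boundary with coefficient sg z according to z
              and with coefficient 0 according to x.\<close>
            have "pr z \<noteq> pr x"
            proof
              assume "pr z = pr x"
              then have lz: "lv z = lv x" using lv_pr 2(1) x by metis
              have "z \<notin> Poly_Mapping.keys (bd \<theta> (frag_of (pr z)) - frag_cmul (sg z) (frag_of z))"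
                using bdR[of z] 2 disj by auto
              moreover have "z \<notin> Poly_Mapping.keys (bd \<theta> (frag_of (pr x)) - frag_cmul (sg x) (frag_of x))"
                using bdR[of x] 2(1) x lz disj by auto
              ultimately have "sg z = 0"
                using \<open>pr z = pr x\<close> False
                by (simp add: in_keys_iff lookup_minus lookup_single when_def split: if_splits)
              with sg[OF 2(1)] show False by simp
            qed
            with * False 2 show ?thesis by simp
          qed (use * 2 in simp)
        qed
      qed
      then have "ev (\<lambda>y. Poly_Mapping.lookup (bd \<theta> (frag_of y)) x) v' =
          ev (\<lambda>y. (if y = pr x then 1 else 0) * sg x) v'" by (intro ev_cong) auto
      also have "\<dots> = Poly_Mapping.lookup v' (pr x) * sg x"
        by (simp only: ev_fun_mult_right lookup_eq_ev)
      also have "ev (\<lambda>y. Poly_Mapping.lookup (bd \<theta> (frag_of y)) x) v' = Poly_Mapping.lookup (bd \<theta> v') x"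
        by (subst additive_eq_ev[of "\<lambda>v. Poly_Mapping.lookup (bd \<theta> v) x"]) (simp_all add: bd_add lookup_add)
      finally show ?thesis using bd' sg[OF x(1)] by auto
    qed
    have "P (K + 1) N v'" unfolding P_def
    proof
      fix y assume y: "y \<in> Poly_Mapping.keys v'"
      then have "y \<in> S" using S unfolding v'_def by blast
      moreover have "lv y \<noteq> K" if yR: "y \<in> R"
      proof
        assume "lv y = K"
        from yR obtain x where x: "x \<in> F" "y = pr x" by (auto simp: R)
        with \<open>lv y = K\<close> lv_pr[OF x(1)] have "lv x = K" by simp
        with no[OF x(1)] x(2) y show False by (simp add: in_keys_iff)
      qed
      ultimately show "y \<in> {y \<in> F. K + 1 \<le> lv y \<and> lv y \<le> N} \<union> {y \<in> R. K + 1 \<le> lv y \<and> lv y < N}"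
        by (auto simp: S_def)
    qed
    then show ?thesis unfolding v'_def by blast
  qed
  have steps: "\<exists>w. P N N (v - bd \<theta> w)" if "P (N - int n) N v" "bd \<theta> v = 0" for N n v
    using that
  proof (induction n arbitrary: v)
    case 0
    then show ?case by (intro exI[of _ 0]) simp
  next
    case (Suc n)
    from step[OF Suc.prems(1) _ Suc.prems(2)] obtain w where "P (N - int (Suc n) + 1) N (v - bd \<theta> w)"
      by auto
    then have "P (N - int n) N (v - bd \<theta> w)" by (simp add: algebra_simps)
    then obtain w' where "P N N (v - bd \<theta> w - bd \<theta> w')"
      using Suc.IH[of "v - bd \<theta> w"] Suc.prems(2) by (auto simp: bd_diff)
    then show ?case by (intro exI[of _ "w + w'"]) (simp add: bd_add algebra_simps)
  qed
  \<comment> \<open>All levels that occur in v lie strictly between -M and M, so 2 M steps move v to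
    the single level M.\<close>
  define M where "M = (\<Sum>x\<in>Poly_Mapping.keys v. \<bar>lv x\<bar>) + 1"
  have M: "\<bar>lv x\<bar> < M" if "x \<in> Poly_Mapping.keys v" for x
    using member_le_sum[OF that, of "\<lambda>x. \<bar>lv x\<bar>"] by (simp add: M_def)
  have "0 \<le> M" unfolding M_def by (intro add_nonneg_nonneg sum_nonneg) auto
  have "P (- M) M v" unfolding P_def
  proof
    fix y assume "y \<in> Poly_Mapping.keys v"
    with M[OF this] subsetD[OF v(1) this] show "y \<in> {y \<in> F. - M \<le> lv y \<and> lv y \<le> M} \<union> {y \<in> R. - M \<le> lv y \<and> lv y < M}"
      by auto
  qed
  moreover have "- M = M - int (nat (2 * M))" using \<open>0 \<le> M\<close> by simp
  ultimately obtain w where "P M M (v - bd \<theta> w)" using steps v(2) by metis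
  then have "Poly_Mapping.keys (v - bd \<theta> w) \<subseteq> {y \<in> F. lv y = M}" by (auto simp: P_def)
  then show ?thesis by blast
qed

section \<open>Collapsing P along t, b and a\<close>

definition spread :: "grp \<Rightarrow> zg \<Rightarrow> cell \<Rightarrow> chain" where
  "spread g r c = frag_extend (\<lambda>h. frag_of (g \<diamondop> h, c)) r"

lemma ev_spread: "ev \<phi> (spread g r c) = ev (\<lambda>h. \<phi> (g \<diamondop> h, c)) r"
  by (simp add: spread_def ev_extend)

lemma ev_bd_of: "ev \<phi> (bd \<theta> (frag_of (g, c))) = ev (\<lambda>(h, d). \<phi> (g \<diamondop> h, d)) (bd_cell \<theta> c)"
  by (simp add: bd_of ev_translate)

text \<open>The unit terms of A, D and E are split off: they are the bottoms of the prisms along t,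
  and what remains of these coefficients lies one level of t higher by
  \<open>keys_ABCDE\<close>.\<close>

lemma bd_formula:
  "bd \<theta> (frag_of (g, X0)) = 0"
  "bd \<theta> (frag_of (g, Y1)) = frag_of (g \<diamondop> g_a, X0) - frag_of (g, X0)"
  "bd \<theta> (frag_of (g, Y2)) = frag_of (g \<diamondop> g_b, X0) - frag_of (g, X0)"
  "bd \<theta> (frag_of (g, Y3)) = frag_of (g \<diamondop> g_t, X0) - frag_of (g, X0)"
  "bd \<theta> (frag_of (g, Z1)) = frag_of (g, Y1) + spread g (elem_A \<theta> - frag_of g_1) Y1 + spread g (elem_B \<theta>) Y2
     + frag_of (g \<diamondop> g_a, Y3) - frag_of (g, Y3)"
  "bd \<theta> (frag_of (g, Z2)) = frag_of (g, Y2) + spread g (elem_C \<theta>) Y1 + spread g (elem_D \<theta> - frag_of g_1) Y2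
     + frag_of (g \<diamondop> g_b, Y3) - frag_of (g, Y3)"
  "bd \<theta> (frag_of (g, Z3)) = frag_of (g, Y1) - frag_of (g \<diamondop> g_b, Y1) + frag_of (g \<diamondop> g_a, Y2) - frag_of (g, Y2)"
  "bd \<theta> (frag_of (g, W)) = frag_of (g, Z1) - frag_of (g \<diamondop> g_b, Z1) + frag_of (g \<diamondop> g_a, Z2) - frag_of (g, Z2)
     + spread g (elem_E \<theta> + frag_of g_1) Z3 - frag_of (g, Z3)"
  by (rule frag_eqI; simp add: ev_bd_of ev_bd_cell ev_add ev_diff ev_spread)+

lemma keys_ABCDE:
  "Poly_Mapping.keys (elem_A \<theta> - frag_of g_1) \<subseteq> {h. snd h = 1}"
  "Poly_Mapping.keys (elem_B \<theta>) \<subseteq> {h. snd h = 1}"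
  "Poly_Mapping.keys (elem_C \<theta>) \<subseteq> {h. snd h = 1}"
  "Poly_Mapping.keys (elem_D \<theta> - frag_of g_1) \<subseteq> {h. snd h = 1}"
  "Poly_Mapping.keys (elem_E \<theta> + frag_of g_1) \<subseteq> {h. snd h = 1}"
proof -
  have "elem_E \<theta> + frag_of g_1
      = ssum (\<lambda>k. ssum (\<lambda>l. frag_of (vb + sc (- k - 1) ea + sc l eb, 1)) n2) m1
     - ssum (\<lambda>k. ssum (\<lambda>l. frag_of (va + sc (- k - 1) ea + sc l eb, 1)) n1) m2"
    by (simp add: elem_E_eq EE_def)
  moreover have "Poly_Mapping.keys \<dots> \<subseteq> {h. snd h = 1}"
    by (intro keys_sub) simp_all
  ultimately show "Poly_Mapping.keys (elem_E \<theta> + frag_of g_1) \<subseteq> {h. snd h = 1}" by simp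
  show "Poly_Mapping.keys (elem_A \<theta> - frag_of g_1) \<subseteq> {h. snd h = 1}"
    unfolding elem_A_eq add_diff_cancel_left' by (intro keys_sub) simp_all
  show "Poly_Mapping.keys (elem_D \<theta> - frag_of g_1) \<subseteq> {h. snd h = 1}"
    unfolding elem_D_eq add_diff_cancel_left' by (intro keys_sub) simp_all
  show "Poly_Mapping.keys (elem_B \<theta>) \<subseteq> {h. snd h = 1}"
    unfolding elem_B_eq by (intro keys_sub) simp_all
  show "Poly_Mapping.keys (elem_C \<theta>) \<subseteq> {h. snd h = 1}"
    unfolding elem_C_eq by (intro keys_sub) simp_all
qed

lemma keys_spread:
  assumes "Poly_Mapping.keys r \<subseteq> {h. snd h = 1}" "\<And>h. snd h = snd g + 1 \<Longrightarrow> (h, c) \<in> S"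
  shows "Poly_Mapping.keys (spread g r c) \<subseteq> S"
  unfolding spread_def
proof (rule keys_sub_extend)
  fix h assume "h \<in> Poly_Mapping.keys r"
  with assms(1) have "snd h = 1" by auto
  then have "(g \<diamondop> h, c) \<in> S" by (intro assms(2)) (simp add: gm_eq)
  then show "Poly_Mapping.keys (frag_of (g \<diamondop> h, c)) \<subseteq> S" by simp
qed

text \<open>The level is the exponent of t. The prisms over X0, Y1, Y2, Z3 are Y3, Z1, Z2, W, and a
  bottom enters the boundary of its prism with sign -1, 1, 1, -1 respectively.\<close>

lemma collapse_t:
  assumes "bd \<theta> v = 0"
  shows "\<exists>w N. Poly_Mapping.keys (v - bd \<theta> w) \<subseteq> {y. snd y \<in> {X0, Y1, Y2, Z3} \<and> snd (fst y) = N}"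
proof -
  define up where "up c = (case c of X0 \<Rightarrow> Y3 | Y1 \<Rightarrow> Z1 | Y2 \<Rightarrow> Z2 | _ \<Rightarrow> W)" for c
  define F :: "(grp \<times> cell) set" where "F = {y. snd y \<in> {X0, Y1, Y2, Z3}}"
  define R :: "(grp \<times> cell) set" where "R = {y. snd y \<in> {Y3, Z1, Z2, W}}"
  have "\<exists>w N. Poly_Mapping.keys (v - bd \<theta> w) \<subseteq> {y \<in> F. snd (fst y) = N}"
  proof (rule collapse[where R = R and pr = "\<lambda>y. (fst y, up (snd y))"
        and sg = "\<lambda>y. if snd y \<in> {X0, Z3} then -1 else 1"])
    show "R = (\<lambda>y. (fst y, up (snd y))) ` F"
      by (force simp: R_def F_def up_def image_iff split: cell.splits)
    show "F \<inter> R = {}" by (auto simp: F_def R_def)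
    have "snd y \<in> {X0, Y1, Y2, Z3} \<or> snd y \<in> {Y3, Z1, Z2, W}" for y :: "grp \<times> cell" by (cases "snd y") auto
    then show "Poly_Mapping.keys v \<subseteq> F \<union> R" by (auto simp: F_def R_def)
    fix x assume x: "x \<in> F"
    obtain g c where xg: "x = (g, c)" by (cases x)
    have [simp]: "snd (g \<diamondop> g_a) = snd g" "snd (g \<diamondop> g_b) = snd g" "snd (g \<diamondop> g_t) = snd g + 1"
      by (simp_all add: gm_eq g_a_def g_b_def g_t_def)
    consider "c = X0" | "c = Y1" | "c = Y2" | "c = Z3" using x by (auto simp: xg F_def)
    note c = this
    show "Poly_Mapping.keys (bd \<theta> (frag_of x)) \<subseteq> {y \<in> F. snd (fst y) = snd (fst x)}"
      by (cases rule: c; simp only: xg bd_formula fst_conv snd_conv; (intro keys_sub)?; simp add: F_def)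
    show "Poly_Mapping.keys (bd \<theta> (frag_of (fst x, up (snd x)))
         - frag_cmul (if snd x \<in> {X0, Z3} then - 1 else 1) (frag_of x))
         \<subseteq> {y \<in> R. snd (fst y) = snd (fst x)} \<union> {y \<in> F. snd (fst y) = snd (fst x) + 1}" (is "_ \<subseteq> ?S")
    proof -
      show ?thesis
      proof (cases rule: c)
        case 1
        then show ?thesis by (simp add: xg up_def bd_formula R_def F_def)
      next
        case 2
        have "bd \<theta> (frag_of (g, Z1)) - frag_of (g, Y1) = spread g (elem_A \<theta> - frag_of g_1) Y1 + spread g (elem_B \<theta>) Y2
           + frag_of (g \<diamondop> g_a, Y3) - frag_of (g, Y3)" by (simp add: bd_formula)
        moreover have "Poly_Mapping.keys \<dots> \<subseteq> ?S"
          by (intro keys_sub keys_spread keys_ABCDE) (simp_all add: R_def F_def xg)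
        ultimately show ?thesis using 2 by (simp add: xg up_def)
      next
        case 3
        have "bd \<theta> (frag_of (g, Z2)) - frag_of (g, Y2) = spread g (elem_C \<theta>) Y1 + spread g (elem_D \<theta> - frag_of g_1) Y2
           + frag_of (g \<diamondop> g_b, Y3) - frag_of (g, Y3)" by (simp add: bd_formula)
        moreover have "Poly_Mapping.keys \<dots> \<subseteq> ?S"
          by (intro keys_sub keys_spread keys_ABCDE) (simp_all add: R_def F_def xg)
        ultimately show ?thesis using 3 by (simp add: xg up_def)
      next
        case 4
        have "bd \<theta> (frag_of (g, W)) + frag_of (g, Z3) = frag_of (g, Z1) - frag_of (g \<diamondop> g_b, Z1)
           + frag_of (g \<diamondop> g_a, Z2) - frag_of (g, Z2) + spread g (elem_E \<theta> + frag_of g_1) Z3" by (simp add: bd_formula)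
        moreover have "Poly_Mapping.keys \<dots> \<subseteq> ?S"
          by (intro keys_sub keys_spread keys_ABCDE) (simp_all add: R_def F_def xg)
        ultimately show ?thesis using 4 by (simp add: xg up_def)
      qed
    qed
  qed (use assms in \<open>auto simp: F_def\<close>)
  then show ?thesis by (simp add: F_def)
qed

lemma theta_pow_inverse: "theta_pow \<theta> (- k) (theta_pow \<theta> k v) = v"
  using theta_pow_add[OF inv, of "- k" k v] by simp

text \<open>At t^N, right multiplication by a or b adds \<theta>^N(a) or \<theta>^N(b). Applying
  \<theta>^-N straightens these directions, so that the second coordinate counts the steps along b
  and is unchanged along a.\<close>

lemma collapse_b:
  assumes "bd \<theta> v = 0" "Poly_Mapping.keys v \<subseteq> {y. snd y \<in> {X0, Y1, Y2, Z3} \<and> snd (fst y) = N}"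
  shows "\<exists>w J. Poly_Mapping.keys (v - bd \<theta> w) \<subseteq> {y. snd y \<in> {X0, Y1} \<and> snd (fst y) = N
    \<and> theta_pow \<theta> (- N) (fst (fst y)) $ 2 = J}"
proof -
  define up where "up c = (case c of X0 \<Rightarrow> Y2 | _ \<Rightarrow> Z3)" for c
  define F :: "(grp \<times> cell) set" where "F = {y. snd y \<in> {X0, Y1} \<and> snd (fst y) = N}"
  define R :: "(grp \<times> cell) set" where "R = {y. snd y \<in> {Y2, Z3} \<and> snd (fst y) = N}"
  have "\<exists>w J. Poly_Mapping.keys (v - bd \<theta> w) \<subseteq> {y \<in> F. theta_pow \<theta> (- N) (fst (fst y)) $ 2 = J}"
  proof (rule collapse[where R = R and pr = "\<lambda>y. (fst y, up (snd y))"
        and sg = "\<lambda>y. if snd y = X0 then -1 else 1"])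
    show "R = (\<lambda>y. (fst y, up (snd y))) ` F"
      by (force simp: R_def F_def up_def image_iff split: cell.splits)
    show "F \<inter> R = {}" by (auto simp: F_def R_def)
    show "Poly_Mapping.keys v \<subseteq> F \<union> R" using assms(2) by (auto simp: F_def R_def)
    fix x assume x: "x \<in> F"
    obtain g c where xg: "x = (g, c)" by (cases x)
    have [simp]: "snd (g \<diamondop> g_a) = snd g" "snd (g \<diamondop> g_b) = snd g"
      by (simp_all add: gm_eq g_a_def g_b_def)
    have [simp]: "snd g = N" using x by (simp add: F_def xg)
    have [simp]: "theta_pow \<theta> (- N) (fst (g \<diamondop> g_a)) $ 2 = theta_pow \<theta> (- N) (fst g) $ 2"
      "theta_pow \<theta> (- N) (fst (g \<diamondop> g_b)) $ 2 = theta_pow \<theta> (- N) (fst g) $ 2 + 1"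
      by (simp_all add: gm_eq g_a_def g_b_def theta_pow_linear theta_pow_inverse)
    consider "c = X0" | "c = Y1" using x by (auto simp: xg F_def)
    note c = this
    show "Poly_Mapping.keys (bd \<theta> (frag_of x)) \<subseteq> {y \<in> F. theta_pow \<theta> (- N) (fst (fst y)) $ 2 = theta_pow \<theta> (- N) (fst (fst x)) $ 2}"
      by (cases rule: c; simp only: xg bd_formula fst_conv snd_conv; (intro keys_sub)?; simp add: F_def)
    show "Poly_Mapping.keys (bd \<theta> (frag_of (fst x, up (snd x)))
         - frag_cmul (if snd x = X0 then - 1 else 1) (frag_of x))
         \<subseteq> {y \<in> R. theta_pow \<theta> (- N) (fst (fst y)) $ 2 = theta_pow \<theta> (- N) (fst (fst x)) $ 2}
         \<union> {y \<in> F. theta_pow \<theta> (- N) (fst (fst y)) $ 2 = theta_pow \<theta> (- N) (fst (fst x)) $ 2 + 1}" (is "_ \<subseteq> ?S")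
    proof (cases rule: c)
      case 1
      then show ?thesis by (simp add: xg up_def bd_formula F_def)
    next
      case 2
      have "bd \<theta> (frag_of (g, Z3)) - frag_of (g, Y1) = frag_of (g \<diamondop> g_a, Y2) - frag_of (g, Y2) - frag_of (g \<diamondop> g_b, Y1)"
        by (simp add: bd_formula)
      moreover have "Poly_Mapping.keys \<dots> \<subseteq> ?S"
        by (intro keys_sub) (simp_all add: R_def F_def xg)
      ultimately show ?thesis using 2 by (simp add: xg up_def)
    qed
  qed (use assms in \<open>auto simp: F_def\<close>)
  then show ?thesis by (simp add: F_def)
qed

text \<open>With the t level and the b coordinate fixed, only vertices and edges along a are left,
  and the first straightened coordinate is the level.\<close>

lemma collapse_a:
  assumes "bd \<theta> v = 0" "Poly_Mapping.keys v \<subseteq> {y. snd y \<in> {X0, Y1} \<and> snd (fst y) = N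
    \<and> theta_pow \<theta> (- N) (fst (fst y)) $ 2 = J}"
  shows "\<exists>w I. Poly_Mapping.keys (v - bd \<theta> w) \<subseteq> {y. snd y = X0 \<and> snd (fst y) = N
    \<and> theta_pow \<theta> (- N) (fst (fst y)) $ 2 = J \<and> theta_pow \<theta> (- N) (fst (fst y)) $ 1 = I}"
proof -
  define F :: "(grp \<times> cell) set" where "F = {y. snd y = X0 \<and> snd (fst y) = N
    \<and> theta_pow \<theta> (- N) (fst (fst y)) $ 2 = J}"
  define R :: "(grp \<times> cell) set" where "R = {y. snd y = Y1 \<and> snd (fst y) = N
    \<and> theta_pow \<theta> (- N) (fst (fst y)) $ 2 = J}"
  have "\<exists>w I. Poly_Mapping.keys (v - bd \<theta> w) \<subseteq> {y \<in> F. theta_pow \<theta> (- N) (fst (fst y)) $ 1 = I}"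
  proof (rule collapse[where R = R and pr = "\<lambda>y. (fst y, Y1)" and sg = "\<lambda>y. -1"])
    show "R = (\<lambda>y. (fst y, Y1)) ` F"
      by (force simp: R_def F_def image_iff)
    show "F \<inter> R = {}" by (auto simp: F_def R_def)
    show "Poly_Mapping.keys v \<subseteq> F \<union> R" using assms(2) by (auto simp: F_def R_def)
    fix x assume x: "x \<in> F"
    obtain g c where xg: "x = (g, c)" by (cases x)
    have [simp]: "snd (g \<diamondop> g_a) = snd g"
      by (simp_all add: gm_eq g_a_def g_b_def)
    have [simp]: "snd g = N" "c = X0" "theta_pow \<theta> (- N) (fst g) $ 2 = J" using x by (auto simp add: F_def xg)
    have [simp]: "theta_pow \<theta> (- N) (fst (g \<diamondop> g_a)) $ 2 = theta_pow \<theta> (- N) (fst g) $ 2"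
      "theta_pow \<theta> (- N) (fst (g \<diamondop> g_a)) $ 1 = theta_pow \<theta> (- N) (fst g) $ 1 + 1"
      by (simp_all add: gm_eq g_a_def g_b_def theta_pow_linear theta_pow_inverse)
    show "Poly_Mapping.keys (bd \<theta> (frag_of x)) \<subseteq> {y \<in> F. theta_pow \<theta> (- N) (fst (fst y)) $ 1 = theta_pow \<theta> (- N) (fst (fst x)) $ 1}"
      by (simp add: xg bd_formula)
    show "Poly_Mapping.keys (bd \<theta> (frag_of (fst x, Y1)) - frag_cmul (- 1) (frag_of x))
         \<subseteq> {y \<in> R. theta_pow \<theta> (- N) (fst (fst y)) $ 1 = theta_pow \<theta> (- N) (fst (fst x)) $ 1}
         \<union> {y \<in> F. theta_pow \<theta> (- N) (fst (fst y)) $ 1 = theta_pow \<theta> (- N) (fst (fst x)) $ 1 + 1}"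
      by (simp add: xg bd_formula F_def)
  qed (use assms in \<open>auto simp: F_def\<close>)
  then show ?thesis by (simp add: F_def conj_assoc)
qed

lemma cell_aug_X0_bd [simp]: "cell_aug X0 (bd \<theta> v) = 0"
proof -
  have "ev (\<lambda>(h, d). if snd (g \<diamondop> h, d) = X0 then 1 else 0 :: int) (bd_cell \<theta> c) = 0" for g c
    by (cases c) (simp_all add: ev_bd_cell)
  then show ?thesis by (simp add: cell_aug_eq_ev ev_bd case_prod_unfold)
qed

lemma cell_aug_add: "cell_aug c (u + v) = cell_aug c u + cell_aug c v"
  and cell_aug_diff: "cell_aug c (u - v) = cell_aug c u - cell_aug c v"
  by (simp_all add: cell_aug_eq_ev ev_add ev_diff)

theorem exact:
  assumes "bd \<theta> v = 0" "cell_aug X0 v = 0"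
  shows "\<exists>w. bd \<theta> w = v"
proof -
  obtain w1 N where 1: "Poly_Mapping.keys (v - bd \<theta> w1) \<subseteq> {y. snd y \<in> {X0, Y1, Y2, Z3} \<and> snd (fst y) = N}"
    using collapse_t[OF assms(1)] by blast
  have "bd \<theta> (v - bd \<theta> w1) = 0" by (simp add: bd_diff assms)
  from collapse_b[OF this 1] obtain w2 J where 2: "Poly_Mapping.keys (v - bd \<theta> w1 - bd \<theta> w2) \<subseteq> {y. snd y \<in> {X0, Y1} \<and> snd (fst y) = N
    \<and> theta_pow \<theta> (- N) (fst (fst y)) $ 2 = J}" by blast
  have "bd \<theta> (v - bd \<theta> w1 - bd \<theta> w2) = 0" by (simp add: bd_diff assms)
  from collapse_a[OF this 2] obtain w3 I where 3: "Poly_Mapping.keys (v - bd \<theta> w1 - bd \<theta> w2 - bd \<theta> w3) \<subseteq>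
    {y. snd y = X0 \<and> snd (fst y) = N
    \<and> theta_pow \<theta> (- N) (fst (fst y)) $ 2 = J \<and> theta_pow \<theta> (- N) (fst (fst y)) $ 1 = I}" by blast
  define r where "r = v - bd \<theta> w1 - bd \<theta> w2 - bd \<theta> w3"
  \<comment> \<open>After the three collapses the exponent of t and both straightened coordinates
    are fixed, so r is a multiple of one translate of X0, and the multiple is its
    augmentation.\<close>
  have uniq: "y = y'" if y: "y \<in> Poly_Mapping.keys r" "y' \<in> Poly_Mapping.keys r" for y y'
  proof -
    note that = subsetD[OF 3[folded r_def] y(1)] subsetD[OF 3[folded r_def] y(2)]
    have "theta_pow \<theta> (- N) (fst (fst y)) = theta_pow \<theta> (- N) (fst (fst y'))"
      using that by (intro vec2_eqI) auto
    then have "fst (fst y) = fst (fst y')"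
      using theta_pow_inverse[of "- N"] by metis
    with that show ?thesis by (auto intro!: prod_eqI)
  qed
  then have "Poly_Mapping.lookup r y = cell_aug X0 r" if "y \<in> Poly_Mapping.keys r" for y
  proof -
    have "Poly_Mapping.keys r = {y}" using that uniq by blast
    moreover have "snd y = X0" using subsetD[OF 3[folded r_def] that] by simp
    ultimately show ?thesis by (simp add: cell_aug_def)
  qed
  moreover have "cell_aug X0 r = 0" by (simp add: r_def cell_aug_diff assms)
  ultimately have "r = 0" by (metis in_keys_iff poly_mapping_eqI lookup_zero)
  then have "bd \<theta> (w1 + w2 + w3) = v" by (simp add: r_def bd_add algebra_simps)
  then show ?thesis by blast
qed

end

section \<open>Existence of a diagonal approximation\<close>

lemma ev_tens: "ev \<phi> (tens u v) = ev (\<lambda>x. ev (\<lambda>y. \<phi> (x, y)) v) u"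
  by (simp add: tens_def ev_extend)

lemma tens_simps:
  "tens (u + u') v = tens u v + tens u' v" "tens u (v + v') = tens u v + tens u v'"
  "tens (u - u') v = tens u v - tens u' v" "tens u (v - v') = tens u v - tens u v'"
  "tens (frag_cmul k u) v = frag_cmul k (tens u v)" "tens u (frag_cmul k v) = frag_cmul k (tens u v)"
  "tens 0 v = 0" "tens u 0 = 0" "tens (frag_of x) (frag_of y) = frag_of (x, y)"
  by (rule frag_eqI; simp add: ev_tens ev_add ev_diff ev_cmul ev_fun_add ev_fun_diff ev_fun_mult)+

lemma keys_tens: "Poly_Mapping.keys (tens u v) \<subseteq> Poly_Mapping.keys u \<times> Poly_Mapping.keys v"
  unfolding tens_def by (intro keys_sub_extend) auto

definition homog :: "nat \<Rightarrow> chain \<Rightarrow> bool" where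
  "homog n v \<longleftrightarrow> Poly_Mapping.keys v \<subseteq> {x. cdim (snd x) = n}"

definition thomog :: "nat \<Rightarrow> tchain \<Rightarrow> bool" where
  "thomog n T \<longleftrightarrow> Poly_Mapping.keys T \<subseteq> {z. cdim (snd (fst z)) + cdim (snd (snd z)) = n}"

definition proj :: "nat \<Rightarrow> chain \<Rightarrow> chain" where
  "proj n = frag_extend (\<lambda>x. if cdim (snd x) = n then frag_of x else 0)"

lemma proj_homog: "homog m v \<Longrightarrow> proj n v = (if m = n then v else 0)"
proof -
  assume "homog m v"
  then have "proj n v = frag_extend (\<lambda>x. if m = n then frag_of x else 0) v"
    unfolding proj_def homog_def by (intro frag_extend_eq) auto
  then show ?thesis by (simp add: frag_expansion[symmetric] frag_extend_eq_0)
qed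

lemma homog_proj: "homog n (proj n v)"
  unfolding homog_def proj_def by (intro keys_sub_extend) auto

lemma cdim_0: "cdim c = 0 \<longleftrightarrow> c = X0"
  by (cases c) auto

lemma cell_aug_of: "cell_aug c (frag_of x) = (if snd x = c then 1 else 0)"
  by (simp add: cell_aug_eq_ev)

lemma cell_aug_homog: "homog n v \<Longrightarrow> cdim c \<noteq> n \<Longrightarrow> cell_aug c v = 0"
  unfolding homog_def cell_aug_def by (intro sum.neutral) auto

lemma taug_thomog: "thomog n T \<Longrightarrow> n \<noteq> 0 \<Longrightarrow> taug T = 0"
  unfolding thomog_def taug_def by (intro sum.neutral) (force simp: cell_aug_of)

context gl2
begin

lemma keys_spread_cell: "Poly_Mapping.keys (spread g r c) \<subseteq> {x. snd x = c}"
  unfolding spread_def by (intro keys_sub_extend) simp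

lemma keys_bd_of: "Poly_Mapping.keys (bd \<theta> (frag_of x)) \<subseteq> {y. Suc (cdim (snd y)) = cdim (snd x)}"
proof -
  have *: "Poly_Mapping.keys (spread g r c) \<subseteq> S" if "\<And>h. (h, c) \<in> S" for g r c S
    using keys_spread_cell[of g r c] that by fastforce
  obtain g c where "x = (g, c)" by (cases x)
  then show ?thesis
    by (cases c) (simp_all add: bd_formula, (intro keys_sub * ; simp)+)
qed

lemma bd_homog: "homog (Suc n) v \<Longrightarrow> homog n (bd \<theta> v)"
proof -
  assume v: "homog (Suc n) v"
  have e: "bd \<theta> v = frag_extend (\<lambda>x. bd \<theta> (frag_of x)) v"
    by (rule additive_eq_extend) (rule bd_add)
  show ?thesis unfolding homog_def e
  proof (rule keys_sub_extend)
    fix x assume "x \<in> Poly_Mapping.keys v"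
    then have "cdim (snd x) = Suc n" using v by (auto simp: homog_def)
    then show "Poly_Mapping.keys (bd \<theta> (frag_of x)) \<subseteq> {x. cdim (snd x) = n}"
      using keys_bd_of[of x] by simp
  qed
qed

text \<open>A preimage provided by \<open>exact\<close> may mix degrees; this allows cutting it down
  to the right one.\<close>

lemma bd_proj: "bd \<theta> (proj (Suc n) v) = proj n (bd \<theta> v)"
proof (rule additive_eqI[of "\<lambda>v. bd \<theta> (proj (Suc n) v)"])
  fix x :: "grp \<times> cell"
  show "bd \<theta> (proj (Suc n) (frag_of x)) = proj n (bd \<theta> (frag_of x))"
  proof (cases "cdim (snd x)")
    case 0
    then have "bd \<theta> (frag_of x) = 0" using keys_bd_of[of x] by auto
    then show ?thesis using 0 by (simp add: proj_def)
  next
    case (Suc m)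
    then have "homog m (bd \<theta> (frag_of x))" by (intro bd_homog) (simp add: homog_def)
    then show ?thesis using Suc by (simp add: proj_homog) (simp add: proj_def)
  qed
qed (simp_all add: bd_add proj_def frag_extend_add)

lemma exact_homog:
  assumes "bd \<theta> v = 0" "cell_aug X0 v = 0" "homog n v"
  shows "\<exists>w. homog (Suc n) w \<and> bd \<theta> w = v"
proof -
  obtain w where "bd \<theta> w = v" using exact assms by blast
  then have "bd \<theta> (proj (Suc n) w) = v" using assms(3) by (simp add: bd_proj proj_homog)
  then show ?thesis using homog_proj by blast
qed

lemma keys_bd_less:
  "y \<in> Poly_Mapping.keys (bd \<theta> (frag_of x)) \<Longrightarrow> (y, x) \<in> Wellfounded.measure (\<lambda>i. cdim (snd i))"
  using keys_bd_of[of x] by auto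

lemma bd_X0: "bd \<theta> (basis X0) = 0"
  by (simp add: basis_def bd_formula)

text \<open>A contraction of P onto \<open>basis X0\<close> as a complex of abelian groups. The
  equation for x involves h only on the boundary of x, hence the recursion over the dimension. The
  identity already established on that boundary makes the prescribed value of
  \<open>bd \<theta> (h x)\<close> a cycle, and \<open>exact_homog\<close> fills it.\<close>

lemma contraction_exists:
  "\<exists>h. \<forall>x. homog (Suc (cdim (snd x))) (h x) \<and>
     bd \<theta> (h x) + frag_extend h (bd \<theta> (frag_of x)) =
       frag_of x - frag_cmul (cell_aug X0 (frag_of x)) (basis X0)"
proof -
  define P where "P h x w \<longleftrightarrow> homog (Suc (cdim (snd x))) w \<and>
     bd \<theta> w = frag_of x - frag_cmul (cell_aug X0 (frag_of x)) (basis X0) - frag_extend h (bd \<theta> (frag_of x))"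
    for h x w
  have "\<exists>h. \<forall>x. P h x (h x)"
  proof (rule dependent_wf_choice[OF wf_measure[of "\<lambda>i. cdim (snd i)"]])
    fix f g :: "grp \<times> cell \<Rightarrow> chain" and x :: "grp \<times> cell" and r
    assume "\<And>z. (z, x) \<in> Wellfounded.measure (\<lambda>i. cdim (snd i)) \<Longrightarrow> f z = g z"
    then have "frag_extend f (bd \<theta> (frag_of x)) = frag_extend g (bd \<theta> (frag_of x))"
      by (intro frag_extend_eq) (use keys_bd_less in blast)
    then show "P f x r = P g x r" by (simp add: P_def)
  next
    fix x and h :: "grp \<times> cell \<Rightarrow> chain"
    assume IH: "\<And>y. (y, x) \<in> Wellfounded.measure (\<lambda>i. cdim (snd i)) \<Longrightarrow> P h y (h y)"
    define u where "u = frag_of x - frag_cmul (cell_aug X0 (frag_of x)) (basis X0) - frag_extend h (bd \<theta> (frag_of x))"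
    let ?v = "bd \<theta> (frag_of x)"
    have *: "bd \<theta> (frag_extend h ?v) = ?v - frag_cmul (cell_aug X0 ?v) (basis X0) - frag_extend h (bd \<theta> ?v)"
    proof (rule additive_eqI[of "\<lambda>v. bd \<theta> (frag_extend h v)" "\<lambda>v. v - frag_cmul (cell_aug X0 v) (basis X0) - frag_extend h (bd \<theta> v)"])
      fix y assume "y \<in> Poly_Mapping.keys ?v"
      then have "P h y (h y)" by (intro IH keys_bd_less)
      then show "bd \<theta> (frag_extend h (frag_of y)) =
         frag_of y - frag_cmul (cell_aug X0 (frag_of y)) (basis X0) - frag_extend h (bd \<theta> (frag_of y))"
        by (simp add: P_def)
    qed (simp_all add: bd_add frag_extend_add cell_aug_add frag_cmul_distrib)
    have bdk: "bd \<theta> (frag_cmul k (basis X0)) = 0" for k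
      using bd_X0 by (simp add: bd_def frag_extend_cmul)
    have cyc: "bd \<theta> u = 0"
      by (simp add: u_def bd_diff * bdk)
    have kh: "homog (cdim (snd x)) (frag_extend h ?v)"
      unfolding homog_def
    proof (rule keys_sub_extend)
      fix y assume y: "y \<in> Poly_Mapping.keys ?v"
      then have "P h y (h y)" by (intro IH keys_bd_less)
      moreover have "Suc (cdim (snd y)) = cdim (snd x)" using y keys_bd_of by blast
      ultimately show "Poly_Mapping.keys (h y) \<subseteq> {y. cdim (snd y) = cdim (snd x)}"
        by (simp add: P_def homog_def)
    qed
    have hu: "homog (cdim (snd x)) u"
      using kh unfolding u_def homog_def
      by (intro keys_sub_diff) (auto simp: cell_aug_of basis_def split: if_splits)
    have au: "cell_aug X0 u = 0"
    proof (cases "cdim (snd x) = 0")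
      case True
      then have "?v = 0" using keys_bd_of[of x] by auto
      with True show ?thesis by (simp add: u_def cell_aug_diff cell_aug_of cdim_0 basis_def)
    next
      case False
      with hu show ?thesis by (intro cell_aug_homog) auto
    qed
    from exact_homog[OF cyc au hu] show "\<exists>w. P h x w" by (auto simp: P_def u_def)
  qed
  then obtain h where "\<And>x. P h x (h x)" by blast
  then show ?thesis by (intro exI[of _ h]) (simp add: P_def)
qed

lemma translate_of': "translate \<theta> g (frag_of x) = frag_of (g \<diamondop> fst x, snd x)"
  by (cases x) simp

lemma ev_ttranslate: "ev \<phi> (ttranslate \<theta> g T) =
    ev (\<lambda>(x, y). \<phi> ((g \<diamondop> fst x, snd x), (g \<diamondop> fst y, snd y))) T"
  by (simp add: ttranslate_def ev_extend case_prod_unfold translate_of' tens_simps)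

lemma ev_tbd: "ev \<phi> (tbd \<theta> T) = ev (\<lambda>(x, y). ev (\<lambda>x'. \<phi> (x', y)) (bd \<theta> (frag_of x)) +
     (- 1) ^ cdim (snd x) * ev (\<lambda>y'. \<phi> (x, y')) (bd \<theta> (frag_of y))) T"
  by (simp add: tbd_def ev_extend case_prod_unfold ev_tens ev_add ev_cmul)

lemma tbd_add: "tbd \<theta> (S + T) = tbd \<theta> S + tbd \<theta> T"
  by (simp add: tbd_def frag_extend_add)

lemma tbd_cmul: "tbd \<theta> (frag_cmul k T) = frag_cmul k (tbd \<theta> T)"
  by (simp add: tbd_def frag_extend_cmul)

lemma ttranslate_add: "ttranslate \<theta> g (S + T) = ttranslate \<theta> g S + ttranslate \<theta> g T"
  by (simp add: ttranslate_def frag_extend_add)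

lemma taug_add: "taug (S + T) = taug S + taug T"
  by (simp add: taug_eq_ev ev_add)

lemma taug_ttranslate: "taug (ttranslate \<theta> g T) = taug T"
  by (simp add: taug_eq_ev ev_ttranslate cell_aug_of)

lemma bd_of_mult: "bd \<theta> (frag_of (g \<diamondop> fst x, snd x)) = translate \<theta> g (bd \<theta> (frag_of x))"
  by (simp add: bd_translate[symmetric] translate_of')

lemma tbd_ttranslate: "tbd \<theta> (ttranslate \<theta> g T) = ttranslate \<theta> g (tbd \<theta> T)"
  by (rule frag_eqI) (simp add: ev_tbd ev_ttranslate case_prod_unfold bd_of_mult ev_translate)

lemma ev_bd_expand: "ev \<phi> (bd \<theta> v) = ev (\<lambda>x. ev \<phi> (bd \<theta> (frag_of x))) v"
  by (rule additive_eq_ev) (simp add: bd_add ev_add)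

lemma tbd_tens:
  assumes "homog n u"
  shows "tbd \<theta> (tens u v) = tens (bd \<theta> u) v + frag_cmul ((- 1) ^ n) (tens u (bd \<theta> v))"
proof (rule frag_eqI)
  fix \<phi> :: "_ \<Rightarrow> int"
  have "ev \<phi> (tbd \<theta> (tens u v)) = ev (\<lambda>x. ev (\<lambda>y. ev (\<lambda>x'. \<phi> (x', y)) (bd \<theta> (frag_of x)) +
     (- 1) ^ cdim (snd x) * ev (\<lambda>y'. \<phi> (x, y')) (bd \<theta> (frag_of y))) v) u"
    by (simp add: ev_tbd ev_tens)
  also have "\<dots> = ev (\<lambda>x. ev (\<lambda>y. ev (\<lambda>x'. \<phi> (x', y)) (bd \<theta> (frag_of x)) +
     (- 1) ^ n * ev (\<lambda>y'. \<phi> (x, y')) (bd \<theta> (frag_of y))) v) u"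
    by (rule ev_cong) (use assms in \<open>auto simp: homog_def\<close>)
  also have "\<dots> = ev (\<lambda>x. ev (\<lambda>x'. ev (\<lambda>y. \<phi> (x', y)) v) (bd \<theta> (frag_of x))) u
      + (- 1) ^ n * ev (\<lambda>x. ev (\<lambda>y. ev (\<lambda>y'. \<phi> (x, y')) (bd \<theta> (frag_of y))) v) u"
    by (simp only: ev_fun_add ev_fun_mult) (subst (2) ev_commute, rule refl)
  also have "\<dots> = ev \<phi> (tens (bd \<theta> u) v + frag_cmul ((- 1) ^ n) (tens u (bd \<theta> v)))"
    by (simp add: ev_add ev_cmul ev_tens ev_bd_expand[of _ u] ev_bd_expand[of _ v])
  finally show "ev \<phi> (tbd \<theta> (tens u v)) = \<dots>" .
qed

text \<open>If h contracts P onto a point and \<epsilon> is the projection to that point, then h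
  \<otimes> 1 + \<epsilon> \<otimes> h contracts P \<otimes> P. Applied to a cycle of augmentation
  0, this homotopy is a preimage under the differential.\<close>

lemma tensor_exact:
  assumes "tbd \<theta> T = 0" "taug T = 0" "thomog n T"
  shows "\<exists>U. thomog (Suc n) U \<and> tbd \<theta> U = T"
proof -
  obtain h where h: "\<And>x. homog (Suc (cdim (snd x))) (h x)"
    and bdh: "\<And>x. bd \<theta> (h x) + frag_extend h (bd \<theta> (frag_of x)) =
       frag_of x - frag_cmul (cell_aug X0 (frag_of x)) (basis X0)"
    using contraction_exists by blast
  define S where "S = frag_extend (\<lambda>(x, y). tens (h x) (frag_of y)
     + frag_cmul (cell_aug X0 (frag_of x)) (tens (basis X0) (h y)))"
  have S_add: "S (U + V) = S U + S V" for U V by (simp add: S_def frag_extend_add)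
  have S_cmul: "S (frag_cmul k U) = frag_cmul k (S U)" for k U by (simp add: S_def frag_extend_cmul)
  have S_tens: "S (tens u v) = tens (frag_extend h u) v + frag_cmul (cell_aug X0 u) (tens (basis X0) (frag_extend h v))" for u v
  proof (rule frag_eqI)
    fix \<phi> :: "_ \<Rightarrow> int"
    have "ev (\<lambda>y. ev (\<lambda>x'. \<phi> (x', y)) (h x)) v = ev (\<lambda>x'. ev (\<lambda>y. \<phi> (x', y)) v) (h x)" for x
      by (rule ev_commute)
    moreover have "ev (\<lambda>y. ev (\<lambda>x. ev (\<lambda>y'. \<phi> (x, y')) (h y)) (basis X0)) v
        = ev (\<lambda>x. ev (\<lambda>y. ev (\<lambda>y'. \<phi> (x, y')) (h y)) v) (basis X0)"
      by (rule ev_commute)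
    ultimately show "ev \<phi> (S (tens u v)) = ev \<phi> (tens (frag_extend h u) v + frag_cmul (cell_aug X0 u) (tens (basis X0) (frag_extend h v)))"
      by (simp add: S_def ev_extend ev_tens ev_add ev_cmul ev_fun_add ev_fun_mult ev_fun_mult_right cell_aug_of cell_aug_eq_ev[of X0 u])
  qed
  have main: "tbd \<theta> (S T) + S (tbd \<theta> T) = T - frag_cmul (taug T) (tens (basis X0) (basis X0))"
  proof (rule additive_eqI[of "\<lambda>T. tbd \<theta> (S T) + S (tbd \<theta> T)" "\<lambda>T. T - frag_cmul (taug T) (tens (basis X0) (basis X0))"])
    fix z :: "(grp \<times> cell) \<times> grp \<times> cell"
    obtain x y where z: "z = (x, y)" by (cases z)
    let ?n = "cdim (snd x)" let ?e = "cell_aug X0 (frag_of x)" let ?x0 = "basis X0 :: chain"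
    have b0: "homog 0 (basis X0)" by (simp add: homog_def basis_def)
    have "tbd \<theta> (S (frag_of z)) = tens (bd \<theta> (h x)) (frag_of y)
      + frag_cmul ((- 1) ^ Suc ?n) (tens (h x) (bd \<theta> (frag_of y))) + frag_cmul ?e (tens ?x0 (bd \<theta> (h y)))"
      by (simp add: S_def z tbd_add tbd_cmul tbd_tens[OF h] tbd_tens[OF b0] bd_X0 tens_simps add.assoc)
    moreover have "tbd \<theta> (frag_of z) = tens (bd \<theta> (frag_of x)) (frag_of y) + frag_cmul ((- 1) ^ ?n) (tens (frag_of x) (bd \<theta> (frag_of y)))"
      by (simp add: tbd_def z)
    \<comment> \<open>The last term carries no sign since the augmentation of x vanishes unless x
      has dimension 0. The term with the augmentation of the boundary of x is 0.\<close>
    then have "S (tbd \<theta> (frag_of z)) = tens (frag_extend h (bd \<theta> (frag_of x))) (frag_of y)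
      + frag_cmul ((- 1) ^ ?n) (tens (h x) (bd \<theta> (frag_of y)))
      + frag_cmul ?e (tens ?x0 (frag_extend h (bd \<theta> (frag_of y))))"
      by (cases "snd x = X0") (simp_all add: S_add S_cmul S_tens frag_cmul_distrib2 mult.commute cell_aug_of)
    ultimately have "tbd \<theta> (S (frag_of z)) + S (tbd \<theta> (frag_of z)) =
      tens (bd \<theta> (h x) + frag_extend h (bd \<theta> (frag_of x))) (frag_of y)
      + frag_cmul ?e (tens ?x0 (bd \<theta> (h y) + frag_extend h (bd \<theta> (frag_of y))))"
      by (simp add: tens_simps frag_cmul_distrib2 add_ac flip: minus_frag_cmul)
    also have "\<dots> = frag_of z - frag_cmul (taug (frag_of z)) (tens ?x0 ?x0)"
      by (simp add: bdh tens_simps z taug_eq_ev frag_cmul_distrib2 diff_conv_add_uminus minus_frag_cmul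
          del: add_uminus_conv_diff) (simp flip: frag_cmul_distrib)
    finally show "tbd \<theta> (S (frag_of z)) + S (tbd \<theta> (frag_of z)) = frag_of z - frag_cmul (taug (frag_of z)) (tens ?x0 ?x0)" .
  qed (simp_all add: S_add tbd_add taug_add frag_cmul_distrib)
  have "thomog (Suc n) (S T)" unfolding thomog_def S_def
  proof (rule keys_sub_extend)
    fix z assume z: "z \<in> Poly_Mapping.keys T"
    obtain x y where xy: "z = (x, y)" by (cases z)
    have n: "cdim (snd x) + cdim (snd y) = n" using z assms(3) by (auto simp: thomog_def xy)
    have "Poly_Mapping.keys (tens (h x) (frag_of y)) \<subseteq> {z. cdim (snd (fst z)) + cdim (snd (snd z)) = Suc n}"
      using keys_tens[of "h x" "frag_of y"] h[of x] n by (force simp: homog_def)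
    moreover have "Poly_Mapping.keys (frag_cmul (cell_aug X0 (frag_of x)) (tens (basis X0) (h y))) \<subseteq> {z. cdim (snd (fst z)) + cdim (snd (snd z)) = Suc n}"
    proof (cases "snd x = X0")
      case True
      then show ?thesis
        using keys_tens[of "basis X0" "h y"] h[of y] n by (intro keys_sub_cmul) (force simp: homog_def basis_def)
    qed (simp add: cell_aug_of)
    ultimately show "Poly_Mapping.keys (case z of (x, y) \<Rightarrow> tens (h x) (frag_of y) + frag_cmul (cell_aug X0 (frag_of x)) (tens (basis X0) (h y)))
      \<subseteq> {z. cdim (snd (fst z)) + cdim (snd (snd z)) = Suc n}"
      unfolding xy prod.case by (rule keys_sub_add)
  qed
  moreover have "tbd \<theta> (S T) = T" using main assms by (simp add: S_def)
  ultimately show ?thesis by blast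
qed

lemma keys_bd_cell: "Poly_Mapping.keys (bd_cell \<theta> c) \<subseteq> {y. Suc (cdim (snd y)) = cdim c}"
  using keys_bd_of[of "(g_1, c)"] by (simp add: bd_of)

text \<open>The equivariant extension to P of values prescribed on the eight cells; it turns the
  construction of \<Delta> into one choice per cell.\<close>

definition tex :: "(cell \<Rightarrow> tchain) \<Rightarrow> chain \<Rightarrow> tchain" where
  "tex D = frag_extend (\<lambda>(g, c). ttranslate \<theta> g (D c))"

lemma tex_add: "tex D (u + v) = tex D u + tex D v"
  by (simp add: tex_def frag_extend_add)

lemma ttranslate_ttranslate: "ttranslate \<theta> g (ttranslate \<theta> h T) = ttranslate \<theta> (g \<diamondop> h) T"
  by (rule frag_eqI) (simp add: ev_ttranslate case_prod_unfold gm_assoc)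

lemma tex_translate: "tex D (translate \<theta> g v) = ttranslate \<theta> g (tex D v)"
  by (rule additive_eqI[of "\<lambda>v. tex D (translate \<theta> g v)"])
    (simp_all add: tex_add translate_add ttranslate_add translate_of', simp add: tex_def case_prod_unfold ttranslate_ttranslate)

lemma thomog_ttranslate: "thomog n T \<Longrightarrow> thomog n (ttranslate \<theta> g T)"
  unfolding thomog_def ttranslate_def by (rule keys_sub_extend) (auto simp: translate_of' tens_simps)

lemma thomog_tex:
  assumes "\<And>y. y \<in> Poly_Mapping.keys v \<Longrightarrow> thomog n (D (snd y))"
  shows "thomog n (tex D v)"
  unfolding thomog_def tex_def
proof (rule keys_sub_extend)
  fix x assume "x \<in> Poly_Mapping.keys v"
  then have "thomog n (ttranslate \<theta> (fst x) (D (snd x)))" by (intro thomog_ttranslate assms)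
  then show "Poly_Mapping.keys (case x of (g, c) \<Rightarrow> ttranslate \<theta> g (D c))
         \<subseteq> {z. cdim (snd (fst z)) + cdim (snd (snd z)) = n}"
    by (simp add: thomog_def case_prod_unfold)
qed

lemma tbd_tex:
  assumes "\<And>y. y \<in> Poly_Mapping.keys v \<Longrightarrow> tbd \<theta> (D (snd y)) = tex D (bd_cell \<theta> (snd y))"
  shows "tbd \<theta> (tex D v) = tex D (bd \<theta> v)"
proof (rule additive_eqI[of "\<lambda>v. tbd \<theta> (tex D v)"])
  fix y assume "y \<in> Poly_Mapping.keys v"
  then have "tbd \<theta> (D (snd y)) = tex D (bd_cell \<theta> (snd y))" by (rule assms)
  then have "ttranslate \<theta> (fst y) (tbd \<theta> (D (snd y))) = tex D (translate \<theta> (fst y) (bd_cell \<theta> (snd y)))"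
    by (simp add: tex_translate)
  then show "tbd \<theta> (tex D (frag_of y)) = tex D (bd \<theta> (frag_of y))"
    by (cases y) (simp add: bd_of tbd_ttranslate[symmetric], simp add: tex_def)
qed (simp_all add: tbd_add tex_add bd_add)

lemma taug_tex:
  assumes "\<And>y. y \<in> Poly_Mapping.keys v \<Longrightarrow> taug (D (snd y)) = (if snd y = X0 then 1 else 0)"
  shows "taug (tex D v) = cell_aug X0 v"
proof (rule additive_eqI[of "\<lambda>v. taug (tex D v)"])
  fix y assume "y \<in> Poly_Mapping.keys v"
  then show "taug (tex D (frag_of y)) = cell_aug X0 (frag_of y)"
    using assms by (cases y) (fastforce simp: tex_def taug_ttranslate cell_aug_of)
qed (simp_all add: taug_add tex_add cell_aug_add)

text \<open>The image of the boundary of a cell under the part of \<Delta> already constructed is a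
  cycle of augmentation 0 in P \<otimes> P, and any preimage of it serves as the value on the cell.
  The start is x \<otimes> x.\<close>

theorem diagonal_approximation_exists: "\<exists>\<Delta>. diagonal_approximation \<theta> \<Delta>"
proof -
  define P where "P D c T \<longleftrightarrow> thomog (cdim c) T \<and> taug T = (if c = X0 then 1 else 0) \<and>
     tbd \<theta> T = tex D (bd_cell \<theta> c)" for D c T
  have less: "(snd y, c) \<in> Wellfounded.measure cdim" if "y \<in> Poly_Mapping.keys (bd_cell \<theta> c)" for y c
    using keys_bd_cell[of c] that by auto
  have "\<exists>D. \<forall>c. P D c (D c)"
  proof (rule dependent_wf_choice[OF wf_measure[of cdim]])
    fix f g :: "cell \<Rightarrow> tchain" and c r
    assume "\<And>z. (z, c) \<in> Wellfounded.measure cdim \<Longrightarrow> f z = g z"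
    then have "tex f (bd_cell \<theta> c) = tex g (bd_cell \<theta> c)"
      unfolding tex_def by (intro frag_extend_eq) (use less in fastforce)
    then show "P f c r = P g c r" by (simp add: P_def)
  next
    fix c and D :: "cell \<Rightarrow> tchain"
    assume IH: "\<And>y. (y, c) \<in> Wellfounded.measure cdim \<Longrightarrow> P D y (D y)"
    have IH': "P D (snd y) (D (snd y))" if "y \<in> Poly_Mapping.keys (bd_cell \<theta> c)" for y
      using IH less that by blast
    show "\<exists>T. P D c T"
    proof (cases "c = X0")
      case True
      have "tbd \<theta> (tens (basis X0) (basis X0)) = 0"
        by (subst tbd_tens[of 0]) (simp_all add: homog_def basis_def bd_formula tens_simps)
      moreover have "bd_cell \<theta> X0 = 0" by (simp add: bd_cell.simps)
      ultimately have "P D c (tens (basis X0) (basis X0))"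
        using True by (simp add: P_def tex_def basis_def thomog_def tens_simps taug_eq_ev cell_aug_of)
      then show ?thesis by blast
    next
      case False
      then obtain n where n: "cdim c = Suc n" by (metis cdim_0 not0_implies_Suc)
      let ?U = "tex D (bd_cell \<theta> c)"
      have "thomog n ?U"
      proof (rule thomog_tex)
        fix y assume y: "y \<in> Poly_Mapping.keys (bd_cell \<theta> c)"
        then have "cdim (snd y) = n" using keys_bd_cell[of c] n by auto
        with IH'[OF y] show "thomog n (D (snd y))" by (simp add: P_def)
      qed
      moreover have "tbd \<theta> ?U = 0"
        using IH' by (subst tbd_tex) (simp_all add: P_def bd_bd_cell tex_def)
      moreover have "taug ?U = 0"
        using IH' bd_basis[of c] cell_aug_X0_bd[of "basis c"] by (subst taug_tex) (simp_all add: P_def)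
      ultimately obtain T where "thomog (Suc n) T" "tbd \<theta> T = ?U" using tensor_exact by blast
      then have "P D c T" using False n taug_thomog[of "Suc n" T] by (simp add: P_def)
      then show ?thesis by blast
    qed
  qed
  then obtain D where D: "\<And>c. thomog (cdim c) (D c)" "\<And>c. taug (D c) = (if c = X0 then 1 else 0)"
    "\<And>c. tbd \<theta> (D c) = tex D (bd_cell \<theta> c)" by (auto simp: P_def)
  have "thomog (cdim (snd z)) (tex D (frag_of z))" for z
    by (rule thomog_tex) (simp add: D)
  then have "\<forall>z. \<forall>(x, y)\<in>Poly_Mapping.keys (tex D (frag_of z)). cdim (snd x) + cdim (snd y) = cdim (snd z)"
    unfolding thomog_def by fastforce
  then have "diagonal_approximation \<theta> (tex D)"
    unfolding diagonal_approximation_def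
    by (simp add: tex_add tex_translate tbd_tex D taug_tex)
  then show ?thesis by blast
qed

lemma diagonal_approximation_diag: "diagonal_approximation \<theta> (diag \<theta>)"
  unfolding diag_def using diagonal_approximation_exists by (rule someI_ex)

end

section \<open>The cup product on cohomology classes\<close>

text \<open>Equivariant cochains are given by their values on the eight cells.\<close>

definition coc :: "(cell \<Rightarrow> 'r::comm_ring_1) \<Rightarrow> chain \<Rightarrow> 'r" where
  "coc F = ev (\<lambda>x. F (snd x))"

definition delta :: "cell \<Rightarrow> cell \<Rightarrow> 'r::comm_ring_1" where
  "delta c = (\<lambda>d. if d = c then 1 else 0)"

lemma coc_add: "coc F (u + v) = coc F u + coc F v"
  by (simp add: coc_def ev_add)

lemma coc_fun_add: "coc (F + G) v = coc F v + coc G v"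
  by (simp add: coc_def ev_fun_add)

lemma coc_fun_diff: "coc (F - G) v = coc F v - coc G v"
  by (simp add: coc_def ev_fun_diff)

lemma coc_of: "coc F (frag_of x) = F (snd x)"
  by (simp add: coc_def)

lemma coc_basis: "coc F (basis c) = F c"
  by (simp add: basis_def coc_of)

lemma coc_inject: "coc F = coc G \<longleftrightarrow> F = G"
  by (metis coc_basis ext)

lemma dual_eq_coc: "dual c = coc (delta c)"
  by (simp add: fun_eq_iff dual_eq_ev coc_def delta_def)

text \<open>The pairing of \<phi> \<otimes> \<psi> with T, without sign as in \<open>cup\<close>,
  for cochains given on all basis elements and possibly not equivariant.\<close>

definition bl :: "(grp \<times> cell \<Rightarrow> 'r::comm_ring_1) \<Rightarrow> (grp \<times> cell \<Rightarrow> 'r) \<Rightarrow> tchain \<Rightarrow> 'r" where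
  "bl \<phi> \<psi> T = ev (\<lambda>z. \<phi> (fst z) * \<psi> (snd z)) T"

lemma bl_add: "bl \<phi> \<psi> (S + T) = bl \<phi> \<psi> S + bl \<phi> \<psi> T"
  by (simp add: bl_def ev_add)

lemma bl_add_left: "bl (\<lambda>x. \<phi> x + \<phi>' x) \<psi> T = bl \<phi> \<psi> T + bl \<phi>' \<psi> T"
  and bl_add_right: "bl \<phi> (\<lambda>x. \<psi> x + \<psi>' x) T = bl \<phi> \<psi> T + bl \<phi> \<psi>' T"
  and bl_mult_left: "bl (\<lambda>x. k * \<phi> x) \<psi> T = k * bl \<phi> \<psi> T"
  and bl_mult_right: "bl \<phi> (\<lambda>x. k * \<psi> x) T = k * bl \<phi> \<psi> T"
  by (simp_all add: bl_def distrib_left distrib_right ev_fun_add mult.assoc mult.left_commute[of _ k] ev_fun_mult)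

lemma cup_coc: "cup \<theta> (coc F) (coc G) v = bl (\<lambda>x. F (snd x)) (\<lambda>y. G (snd y)) (diag \<theta> v)"
  by (simp add: cup_eq_ev bl_def coc_of case_prod_unfold)

definition eps :: "grp \<times> cell \<Rightarrow> 'r::comm_ring_1" where
  "eps x = (if snd x = X0 then 1 else 0)"

text \<open>The cochain with value U(g) F(c) on g c. For F = \<open>delta X0\<close> it is U as a
  cochain of degree 0; in general it is the part of a product with U that depends on the
  translate.\<close>

definition mom :: "(grp \<Rightarrow> 'r::comm_ring_1) \<Rightarrow> (cell \<Rightarrow> 'r) \<Rightarrow> grp \<times> cell \<Rightarrow> 'r" where
  "mom U F x = U (fst x) * F (snd x)"

context gl2
begin

definition dd :: "(cell \<Rightarrow> 'r::comm_ring_1) \<Rightarrow> cell \<Rightarrow> 'r" where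
  "dd F c = coc F (bd_cell \<theta> c)"

text \<open>
  The coefficient $\sum n_g g$ of a cell \<open>d\<close> in the boundary of \<open>c\<close> contributes its first moment
  $\sum n_g U(g)$, times \<open>F d\<close>.
\<close>

definition MM :: "(grp \<Rightarrow> 'r::comm_ring_1) \<Rightarrow> (cell \<Rightarrow> 'r) \<Rightarrow> cell \<Rightarrow> 'r" where
  "MM U F c = ev (mom U F) (bd_cell \<theta> c)"

definition is_hom :: "(grp \<Rightarrow> 'r::comm_ring_1) \<Rightarrow> bool" where
  "is_hom U \<longleftrightarrow> (\<forall>g h. U (g \<diamondop> h) = U g + U h)"

lemma is_homD: "is_hom U \<Longrightarrow> U (g \<diamondop> h) = U g + U h"
  unfolding is_hom_def by blast

lemma is_hom_one: "is_hom U \<Longrightarrow> U g_1 = 0"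
  unfolding is_hom_def by (metis add_cancel_right_right gm_one(1))

lemma coc_translate: "coc F (translate \<theta> g v) = coc F v"
  by (simp add: coc_def ev_translate case_prod_unfold)

lemma coc_bd: "coc F (bd \<theta> v) = coc (dd F) v"
  by (simp add: dd_def coc_def ev_bd case_prod_unfold)

lemma dd_add: "dd (F + G) = dd F + dd G"
  by (simp add: fun_eq_iff dd_def coc_fun_add)

lemma dd_diff: "dd (F - G) = dd F - dd G"
  by (simp add: fun_eq_iff dd_def coc_fun_diff)

lemma dd_mult: "dd (\<lambda>c. k * F c) = (\<lambda>c. k * dd F c)"
  by (simp add: fun_eq_iff dd_def coc_def ev_fun_mult)

lemma dd_zero [simp]: "dd 0 = 0"
  by (simp add: fun_eq_iff dd_def coc_def)

lemma dd_dd [simp]: "dd (dd F) = 0"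
proof
  show "dd (dd F) c = 0 c" for c
    using coc_bd[of F "bd_cell \<theta> c"] by (simp add: dd_def[of "dd F"] bd_bd_cell coc_def)
qed

text \<open>The factors are the augmentations of A, B, C, D and E. The one of E, -1 + det \<theta>,
  appears as m1 n2 - m2 n1 - 1, because -\<theta>^-1 has determinant 1 / det \<theta> = det
  \<theta>.\<close>

lemma dd_simps:
  "dd F X0 = 0" "dd F Y1 = 0" "dd F Y2 = 0" "dd F Y3 = 0"
  "dd F Z1 = of_int (1 + m1) * F Y1 + of_int n1 * F Y2"
  "dd F Z2 = of_int m2 * F Y1 + of_int (1 + n2) * F Y2"
  "dd F Z3 = 0"
  "dd F W = of_int (m1 * n2 - m2 * n1 - 1) * F Z3"
  by (simp_all add: dd_def coc_def ev_bd_cell ev_A ev_B ev_C ev_D ev_E ssum_const algebra_simps)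

lemma dd_delta_X0: "dd (delta X0) = 0"
  by (rule ext, rename_tac c, case_tac c) (simp_all add: dd_simps delta_def)

lemma MM_simps:
  assumes "is_hom U"
  shows
  "MM U F X0 = 0" "MM U F Y1 = U g_a * F X0" "MM U F Y2 = U g_b * F X0" "MM U F Y3 = U g_t * F X0"
  "MM U F Z1 = ev U (elem_A \<theta>) * F Y1 + ev U (elem_B \<theta>) * F Y2 + U g_a * F Y3"
  "MM U F Z2 = ev U (elem_C \<theta>) * F Y1 + ev U (elem_D \<theta>) * F Y2 + U g_b * F Y3"
  "MM U F Z3 = - U g_b * F Y1 + U g_a * F Y2"
  "MM U F W = - U g_b * F Z1 + U g_a * F Z2 + ev U (elem_E \<theta>) * F Z3"
  using is_hom_one[OF assms] by (simp_all add: MM_def mom_def ev_bd_cell ev_fun_mult_right)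

lemma cochains_iff: "f \<in> cochains \<theta> \<longleftrightarrow> (\<exists>F. f = coc F)" for f :: "chain \<Rightarrow> 'r::comm_ring_1"
proof
  assume f: "f \<in> cochains \<theta>"
  have "f v = coc (\<lambda>c. f (basis c)) v" for v
  proof (rule additive_eqI)
    fix x :: "grp \<times> cell"
    have "f (translate \<theta> (fst x) (basis (snd x))) = f (basis (snd x))"
      using f unfolding cochains_def by blast
    then show "f (frag_of x) = coc (\<lambda>c. f (basis c)) (frag_of x)"
      by (simp add: basis_def coc_of)
  qed (use f in \<open>auto simp: cochains_def coc_add\<close>)
  then show "\<exists>F. f = coc F" by blast
next
  assume "\<exists>F. f = coc F"
  then show "f \<in> cochains \<theta>" by (auto simp: cochains_def coc_add coc_translate)
qed

lemma coc_comp_bd: "coc F \<circ> bd \<theta> = coc (dd F)"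
  by (simp add: fun_eq_iff coc_bd)

lemma coc_zero: "coc 0 = 0"
  by (simp add: fun_eq_iff coc_def)

lemma cocycles_eq: "cocycles \<theta> = {coc F | F. dd F = 0}"
  unfolding cocycles_def cochains_iff by (auto simp: coc_comp_bd coc_inject simp flip: coc_zero)

lemma coboundaries_eq: "coboundaries \<theta> = {coc (dd K) | K. True}"
proof -
  have "cochains \<theta> = range (coc :: (cell \<Rightarrow> 'a) \<Rightarrow> _)" by (auto simp: cochains_iff)
  then show ?thesis by (auto simp: coboundaries_def coc_comp_bd image_iff)
qed

definition coh :: "(cell \<Rightarrow> 'r::comm_ring_1) \<Rightarrow> (cell \<Rightarrow> 'r) \<Rightarrow> bool" (infix \<open>\<approx>\<^sub>c\<close> 50) where
  "F \<approx>\<^sub>c G \<longleftrightarrow> (\<exists>K. F = G + dd K)"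

lemma coh_refl [simp]: "F \<approx>\<^sub>c F"
  unfolding coh_def by (rule exI[of _ 0]) simp

lemma coh_sym: "F \<approx>\<^sub>c G \<Longrightarrow> G \<approx>\<^sub>c F"
  unfolding coh_def
proof (elim exE)
  fix K assume "F = G + dd K"
  then have "G = F + dd (0 - K)" by (simp add: dd_diff del: diff_0)
  then show "\<exists>K. G = F + dd K" by blast
qed

lemma coh_trans [trans]: "F \<approx>\<^sub>c G \<Longrightarrow> G \<approx>\<^sub>c H \<Longrightarrow> F \<approx>\<^sub>c H"
  unfolding coh_def by (elim exE) (metis add.assoc dd_add)

lemma coh_add: "F \<approx>\<^sub>c F' \<Longrightarrow> G \<approx>\<^sub>c G' \<Longrightarrow> F + G \<approx>\<^sub>c F' + G'"
  unfolding coh_def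
proof (elim exE)
  fix K L assume "F = F' + dd K" "G = G' + dd L"
  then have "F + G = F' + G' + dd (K + L)" by (simp add: dd_add algebra_simps)
  then show "\<exists>K. F + G = F' + G' + dd K" by blast
qed

lemma coh_mult: "F \<approx>\<^sub>c G \<Longrightarrow> (\<lambda>c. k * F c) \<approx>\<^sub>c (\<lambda>c. k * G c)"
  unfolding coh_def
proof (elim exE)
  fix K assume "F = G + dd K"
  then have "(\<lambda>c. k * F c) = (\<lambda>c. k * G c) + dd (\<lambda>c. k * K c)"
    by (simp add: dd_mult fun_eq_iff distrib_left)
  then show "\<exists>K. (\<lambda>c. k * F c) = (\<lambda>c. k * G c) + dd K" by blast
qed

lemma coh_diff: "F \<approx>\<^sub>c F' \<Longrightarrow> G \<approx>\<^sub>c G' \<Longrightarrow> F - G \<approx>\<^sub>c F' - G'"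
proof -
  assume "F \<approx>\<^sub>c F'" "G \<approx>\<^sub>c G'"
  then have "F + (\<lambda>c. - 1 * G c) \<approx>\<^sub>c F' + (\<lambda>c. - 1 * G' c)" by (intro coh_add coh_mult)
  moreover have "F + (\<lambda>c. - 1 * G c) = F - G" "F' + (\<lambda>c. - 1 * G' c) = F' - G'" by auto
  ultimately show ?thesis by simp
qed

lemma coh_cocycle: "F \<approx>\<^sub>c G \<Longrightarrow> dd F = dd G"
  by (auto simp: coh_def dd_add)

lemma coh_add_cancel: "F + G \<approx>\<^sub>c H \<Longrightarrow> F \<approx>\<^sub>c H - G"
  using coh_diff[of "F + G" H G G] by simp

text \<open>Equivariant chain maps over the identity are homotopic to the identity.\<close>

lemma chain_map_cohomologous:
  fixes G :: "cell \<Rightarrow> 'r::comm_ring_1"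
  assumes add: "\<And>u v. \<psi> (u + v) = \<psi> u + \<psi> v" and eq: "\<And>g v. \<psi> (translate \<theta> g v) = translate \<theta> g (\<psi> v)"
    and bd: "\<And>v. bd \<theta> (\<psi> v) = \<psi> (bd \<theta> v)" and aug: "\<And>v. cell_aug X0 (\<psi> v) = cell_aug X0 v"
    and G: "dd G = 0"
  shows "(\<lambda>c. coc G (\<psi> (basis c))) \<approx>\<^sub>c G"
proof -
  define cex where "cex D = frag_extend (\<lambda>(g, c). translate \<theta> g (D c))" for D :: "cell \<Rightarrow> chain"
  have cex_add: "cex D (u + v) = cex D u + cex D v" for D u v
    by (simp add: cex_def frag_extend_add)
  have cex_translate: "cex D (translate \<theta> g v) = translate \<theta> g (cex D v)" for D g v
    by (rule additive_eqI[of "\<lambda>v. cex D (translate \<theta> g v)"])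
      (simp_all add: cex_add translate_add translate_of', simp add: cex_def case_prod_unfold translate_translate)
  define P where "P D c w \<longleftrightarrow> cell_aug X0 w = 0 \<and>
     bd \<theta> w = \<psi> (basis c) - basis c - cex D (bd_cell \<theta> c)" for D c w
  have less: "(snd y, c) \<in> Wellfounded.measure cdim" if "y \<in> Poly_Mapping.keys (bd_cell \<theta> c)" for y c
    using keys_bd_cell[of c] that by auto
  have "\<exists>D. \<forall>c. P D c (D c)"
  proof (rule dependent_wf_choice[OF wf_measure[of cdim]])
    fix f g :: "cell \<Rightarrow> chain" and c r
    assume "\<And>z. (z, c) \<in> Wellfounded.measure cdim \<Longrightarrow> f z = g z"
    then have "cex f (bd_cell \<theta> c) = cex g (bd_cell \<theta> c)"
      unfolding cex_def by (intro frag_extend_eq) (use less in fastforce)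
    then show "P f c r = P g c r" by (simp add: P_def)
  next
    fix c and D :: "cell \<Rightarrow> chain"
    assume IH: "\<And>y. (y, c) \<in> Wellfounded.measure cdim \<Longrightarrow> P D y (D y)"
    have IH': "P D (snd y) (D (snd y))" if "y \<in> Poly_Mapping.keys (bd_cell \<theta> c)" for y
      using IH less that by blast
    let ?v = "bd_cell \<theta> c"
    let ?u = "\<psi> (basis c) - basis c - cex D ?v"
    have "bd \<theta> (cex D ?v) = \<psi> ?v - ?v - cex D (bd \<theta> ?v)"
    proof (rule additive_eqI[of "\<lambda>v. bd \<theta> (cex D v)" "\<lambda>v. \<psi> v - v - cex D (bd \<theta> v)"])
      fix y assume y: "y \<in> Poly_Mapping.keys ?v"
      have "translate \<theta> (fst y) (bd \<theta> (D (snd y))) =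
          translate \<theta> (fst y) (\<psi> (basis (snd y)) - basis (snd y) - cex D (bd_cell \<theta> (snd y)))"
        using IH'[OF y] by (simp add: P_def)
      also have "\<dots> = \<psi> (translate \<theta> (fst y) (basis (snd y))) - translate \<theta> (fst y) (basis (snd y))
          - cex D (translate \<theta> (fst y) (bd_cell \<theta> (snd y)))"
        by (simp add: additive_diff[of "translate \<theta> (fst y)", OF translate_add] eq cex_translate)
      finally show "bd \<theta> (cex D (frag_of y)) = \<psi> (frag_of y) - frag_of y - cex D (bd \<theta> (frag_of y))"
        by (cases y) (simp add: bd_of basis_def bd_translate[symmetric], simp add: cex_def)
    qed (simp_all add: bd_add cex_add add)
    moreover have "cex D 0 = 0" by (simp add: cex_def)
    ultimately have "bd \<theta> ?u = 0"
      by (simp add: bd_diff bd bd_basis bd_bd_cell)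
    moreover have "cell_aug X0 (cex D ?v) = (\<lambda>_. 0) ?v"
    proof (rule additive_eqI[of "\<lambda>v. cell_aug X0 (cex D v)"])
      fix y assume y: "y \<in> Poly_Mapping.keys ?v"
      then have "cell_aug X0 (D (snd y)) = 0" using IH' by (simp add: P_def)
      then show "cell_aug X0 (cex D (frag_of y)) = 0"
        by (simp add: cex_def case_prod_unfold cell_aug_eq_ev ev_translate)
    qed (simp_all add: cex_add cell_aug_add)
    then have "cell_aug X0 ?u = 0" by (simp add: cell_aug_diff aug)
    ultimately obtain w where w: "bd \<theta> w = ?u" using exact by blast
    \<comment> \<open>Degrees are not tracked here, so the preimage may have a component in
      dimension 0. Subtracting a multiple of the cycle \<open>basis X0\<close> makes its
      augmentation 0, which the recursion needs in order to fill later cycles.\<close>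
    let ?w = "w - frag_cmul (cell_aug X0 w) (basis X0)"
    have "bd \<theta> ?w = ?u" using bd_X0 w by (simp add: bd_diff) (simp add: bd_def frag_extend_cmul)
    moreover have "cell_aug X0 ?w = 0" by (simp add: cell_aug_diff) (simp add: cell_aug_eq_ev ev_cmul basis_def)
    ultimately show "\<exists>w. P D c w" by (auto simp: P_def)
  qed
  then obtain D where D: "\<And>c. bd \<theta> (D c) = \<psi> (basis c) - basis c - cex D (bd_cell \<theta> c)"
    by (auto simp: P_def)
  define K where "K c = coc G (D c)" for c
  have "coc G (cex D v) = coc K v" for v
  proof (rule additive_eqI[of "\<lambda>v. coc G (cex D v)"])
    fix x show "coc G (cex D (frag_of x)) = coc K (frag_of x)"
      by (simp add: cex_def case_prod_unfold coc_translate coc_of K_def)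
  qed (simp_all add: cex_add coc_add)
  moreover have "coc G (\<psi> (basis c)) - coc G (basis c) - coc G (cex D (bd_cell \<theta> c)) = 0" for c
    using coc_bd[of G "D c"] by (simp add: G D coc_def ev_diff)
  ultimately have "coc G (\<psi> (basis c)) = G c + dd K c" for c
    by (simp add: coc_basis dd_def algebra_simps)
  then show ?thesis unfolding coh_def by (intro exI[of _ K]) (simp add: fun_eq_iff)
qed

lemmas diag_props =
  conjunct1[OF diagonal_approximation_diag[unfolded diagonal_approximation_def]]
  conjunct1[OF conjunct2[OF diagonal_approximation_diag[unfolded diagonal_approximation_def]]]
  conjunct1[OF conjunct2[OF conjunct2[OF diagonal_approximation_diag[unfolded diagonal_approximation_def]]]]
  conjunct2[OF conjunct2[OF conjunct2[OF diagonal_approximation_diag[unfolded diagonal_approximation_def]]]]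

lemma diag_add: "diag \<theta> (u + v) = diag \<theta> u + diag \<theta> v"
  and diag_translate: "diag \<theta> (translate \<theta> g v) = ttranslate \<theta> g (diag \<theta> v)"
  and tbd_diag: "tbd \<theta> (diag \<theta> v) = diag \<theta> (bd \<theta> v)"
  and taug_diag: "taug (diag \<theta> v) = cell_aug X0 v"
  and keys_diag: "z \<in> Poly_Mapping.keys (diag \<theta> (frag_of x)) \<Longrightarrow> cdim (snd (fst z)) + cdim (snd (snd z)) = cdim (snd x)"
  subgoal using diag_props by blast
  subgoal using diag_props by blast
  subgoal using diag_props by blast
  subgoal using diag_props by blast
  subgoal using bspec[OF spec[OF diag_props(3), of x], of z] by (simp add: case_prod_unfold)
  done

text \<open>The coboundary of a cochain that is given on all translates of the cells, equivariant or
  not.\<close>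

definition dx :: "(grp \<times> cell \<Rightarrow> 'r::comm_ring_1) \<Rightarrow> grp \<times> cell \<Rightarrow> 'r" where
  "dx \<phi> x = ev \<phi> (bd \<theta> (frag_of x))"

lemma bl_tbd:
  "bl \<phi> \<psi> (tbd \<theta> T) = bl (dx \<phi>) \<psi> T + bl (\<lambda>x. (- 1) ^ cdim (snd x) * \<phi> x) (dx \<psi>) T"
  by (simp add: bl_def ev_tbd case_prod_unfold ev_fun_add ev_fun_mult ev_fun_mult_right dx_def mult.assoc)

lemma bl_ttranslate: "bl \<phi> \<psi> (ttranslate \<theta> g T) =
    bl (\<lambda>x. \<phi> (g \<diamondop> fst x, snd x)) (\<lambda>y. \<psi> (g \<diamondop> fst y, snd y)) T"
  by (simp add: bl_def ev_ttranslate case_prod_unfold)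

lemma dx_cell: "dx (\<lambda>x. F (snd x)) = (\<lambda>x. dd F (snd x))"
proof
  show "dx (\<lambda>x. F (snd x)) x = dd F (snd x)" for x
    using coc_bd[of F "frag_of x"] by (simp add: dx_def coc_def)
qed

lemma dx_eps: "dx eps = (\<lambda>x. 0)"
proof
  fix x show "dx eps x = 0"
    using fun_cong[OF dx_cell[of "delta X0"], of x]
    by (cases "snd x") (simp_all add: eps_def[abs_def] delta_def dd_simps)
qed

text \<open>A Leibniz rule. In the boundary of g c, the coefficient h contributes U(g h) = U(g) +
  U(h): the summand U(g) yields U times the coboundary of F, and U(h) yields the moment, which does
  not depend on g.\<close>

lemma ev_mom_bd:
  assumes "is_hom U"
  shows "ev (mom U F) (bd \<theta> v) = coc (MM U F) v + ev (mom U (dd F)) v"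
proof -
  have "ev (\<lambda>(h, d). mom U F (g \<diamondop> h, d)) (bd_cell \<theta> c) = MM U F c + U g * dd F c" for g c
    by (simp add: is_homD[OF assms] mom_def[abs_def] case_prod_unfold distrib_right ev_fun_add MM_def
        dd_def coc_def mult.assoc ev_fun_mult add.commute)
  then show ?thesis by (simp add: ev_bd coc_def ev_fun_add case_prod_unfold mom_def[abs_def])
qed

text \<open>Evaluating U F on the boundary of a boundary gives 0, and the Leibniz rule
  \<open>ev_mom_bd\<close> expands this. Hence moment maps act on cohomology.\<close>

lemma MM_dd:
  assumes "is_hom U"
  shows "MM U (dd F) = - dd (MM U F)"
proof
  fix c
  have "0 = ev (mom U F) (bd \<theta> (bd \<theta> (basis c)))" by simp
  also have "\<dots> = coc (MM U F) (bd_cell \<theta> c) + ev (mom U (dd F)) (bd_cell \<theta> c)"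
    by (simp only: ev_mom_bd[OF assms] bd_basis)
  finally show "MM U (dd F) c = (- dd (MM U F)) c"
    by (simp add: MM_def[of U "dd F"] dd_def[of "MM U F"] eq_neg_iff_add_eq_0 add.commute)
qed

lemma MM_add: "MM U (F + G) = MM U F + MM U G"
  by (simp add: fun_eq_iff MM_def mom_def[abs_def] distrib_left ev_fun_add)

lemma MM_mult: "MM U (\<lambda>c. k * F c) = (\<lambda>c. k * MM U F c)"
  by (simp add: fun_eq_iff MM_def mom_def[abs_def] mult.left_commute[of _ k] ev_fun_mult)

lemma MM_hom_add: "MM (\<lambda>g. U g + V g) F = MM U F + MM V F"
  by (simp add: fun_eq_iff MM_def mom_def[abs_def] distrib_right ev_fun_add)

lemma MM_hom_mult: "MM (\<lambda>g. k * U g) F = (\<lambda>c. k * MM U F c)"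
  by (simp add: fun_eq_iff MM_def mom_def[abs_def] mult.assoc ev_fun_mult)

lemma MM_coh: "is_hom U \<Longrightarrow> F \<approx>\<^sub>c G \<Longrightarrow> MM U F \<approx>\<^sub>c MM U G"
proof -
  assume U: "is_hom U" and "F \<approx>\<^sub>c G"
  then obtain K where "F = G + dd K" by (auto simp: coh_def)
  then have "MM U F = MM U G + dd (0 - MM U K)"
    by (simp add: MM_add MM_dd[OF U] dd_diff del: diff_0)
  then show ?thesis unfolding coh_def by blast
qed

lemma dd_MM: "is_hom U \<Longrightarrow> dd F = 0 \<Longrightarrow> dd (MM U F) = 0"
proof -
  assume "is_hom U" "dd F = 0"
  moreover have "MM U 0 = 0" by (simp add: fun_eq_iff MM_def mom_def[abs_def])
  ultimately show ?thesis using MM_dd[of U F] by simp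
qed

text \<open>The cochain \<open>U V F\<close> exhibits the anticommutator of the two moment maps as a coboundary.\<close>

lemma MM_anticommute:
  assumes U: "is_hom U" and V: "is_hom V" and F: "dd F = 0"
  shows "MM U (MM V F) + MM V (MM U F) \<approx>\<^sub>c 0"
proof -
  let ?UV = "\<lambda>g. U g * V g"
  have *: "ev (mom ?UV F) (bd \<theta> v) =
    coc (MM ?UV F) v + (ev (mom U (MM V F)) v + ev (mom V (MM U F)) v)" for v
  proof -
    have "ev (\<lambda>(h, d). mom ?UV F (g \<diamondop> h, d)) (bd_cell \<theta> c) =
       MM ?UV F c + U g * MM V F c + V g * MM U F c" for g c
    proof -
      \<comment> \<open>The product U V is not additive: besides U V at h, its value at g h has two
        mixed terms, which produce the two moments, and U(g) V(g), which meets the coboundary of F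
        and disappears.\<close>
      have "(\<lambda>(h, d). mom ?UV F (g \<diamondop> h, d)) = (\<lambda>x. mom ?UV F x + U g * mom V F x + V g * mom U F x
          + (U g * V g) * F (snd x))"
        by (auto simp: fun_eq_iff is_homD[OF U] is_homD[OF V] mom_def algebra_simps)
      moreover have "ev (\<lambda>x. (U g * V g) * F (snd x)) (bd_cell \<theta> c) = 0"
        using fun_cong[OF F, of c] unfolding ev_fun_mult by (simp add: dd_def coc_def)
      ultimately show ?thesis by (simp only: ev_fun_add ev_fun_mult MM_def add_0_right)
    qed
    then show ?thesis by (simp add: ev_bd coc_def ev_fun_add case_prod_unfold mom_def[abs_def] add.assoc)
  qed
  have "dd (MM ?UV F) c + (MM U (MM V F) c + MM V (MM U F) c) = 0" for c
    using *[of "bd_cell \<theta> c"] by (simp add: bd_bd_cell MM_def dd_def)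
  then have "MM U (MM V F) + MM V (MM U F) = 0 + dd (0 - MM ?UV F)"
    by (simp add: fun_eq_iff dd_diff add_eq_0_iff del: diff_0)
  then show ?thesis unfolding coh_def by blast
qed

definition one_at :: "(grp \<Rightarrow> 'r::comm_ring_1) \<Rightarrow> cell \<Rightarrow> 'r" where
  "one_at U c = (case c of Y1 \<Rightarrow> U g_a | Y2 \<Rightarrow> U g_b | Y3 \<Rightarrow> U g_t | _ \<Rightarrow> 0)"

lemma one_at_eq_MM: "is_hom U \<Longrightarrow> one_at U = MM U (delta X0)"
  by (rule ext) (simp add: one_at_def MM_simps delta_def split: cell.splits)

lemma dx_mom_delta: "is_hom U \<Longrightarrow> dx (mom U (delta X0)) = (\<lambda>x. one_at U (snd x))"
proof
  fix x :: "grp \<times> cell"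
  assume U: "is_hom U"
  show "dx (mom U (delta X0)) x = one_at U (snd x)"
    by (simp add: dx_def ev_mom_bd[OF U] one_at_eq_MM[OF U] coc_of mom_def dd_delta_X0)
qed

definition augl :: "chain \<Rightarrow> chain" where
  "augl v = frag_extend (\<lambda>(x, y). frag_cmul (cell_aug X0 (frag_of x)) (frag_of y)) (diag \<theta> v)"

definition augr :: "chain \<Rightarrow> chain" where
  "augr v = frag_extend (\<lambda>(x, y). frag_cmul (cell_aug X0 (frag_of y)) (frag_of x)) (diag \<theta> v)"

lemma ev_augl: "ev \<phi> (augl v) = bl eps \<phi> (diag \<theta> v)"
  and ev_augr: "ev \<phi> (augr v) = bl \<phi> eps (diag \<theta> v)"
  by (simp_all add: augl_def augr_def ev_extend ev_cmul case_prod_unfold bl_def eps_def cell_aug_of)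
    (auto intro!: ev_cong)

lemma taug_bl: "taug T = bl eps eps T"
  by (simp add: taug_eq_ev bl_def eps_def cell_aug_of case_prod_unfold)

lemma sgn_eps: "(\<lambda>x. (- 1) ^ cdim (snd x) * eps x) = eps"
  by (auto simp: eps_def fun_eq_iff)

lemma bl_zero: "bl (\<lambda>x. 0) \<psi> T = 0" "bl \<phi> (\<lambda>x. 0) T = 0"
  by (simp_all add: bl_def)

lemma ev_dx: "ev \<phi> (bd \<theta> v) = ev (dx \<phi>) v"
  by (simp add: ev_bd_expand[of \<phi> v] dx_def[abs_def])

text \<open>\<open>augl\<close> is \<epsilon> \<otimes> 1 after \<Delta>, an equivariant chain map
  that preserves the augmentation, so it is homotopic to the identity whichever \<Delta> was chosen.
  This is the left unit law of the product.\<close>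

lemma augl_cohomologous: "dd G = 0 \<Longrightarrow> (\<lambda>c. bl eps (\<lambda>x. G (snd x)) (diag \<theta> (basis c))) \<approx>\<^sub>c G"
proof -
  assume G: "dd G = 0"
  have "(\<lambda>c. coc G (augl (basis c))) \<approx>\<^sub>c G"
  proof (rule chain_map_cohomologous[OF _ _ _ _ G])
    show "augl (u + v) = augl u + augl v" for u v by (simp add: augl_def diag_add frag_extend_add)
    show "augl (translate \<theta> g v) = translate \<theta> g (augl v)" for g v
      by (rule frag_eqI) (simp add: ev_augl ev_translate diag_translate bl_ttranslate eps_def[abs_def] case_prod_unfold)
    show "bd \<theta> (augl v) = augl (bd \<theta> v)" for v
      by (rule frag_eqI) (simp add: ev_augl ev_dx tbd_diag[symmetric] bl_tbd dx_eps sgn_eps bl_zero)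
    show "cell_aug X0 (augl v) = cell_aug X0 v" for v
      by (simp add: taug_diag[symmetric] taug_bl cell_aug_eq_ev[of _ "augl v"] ev_augl eps_def[abs_def])
  qed
  then show ?thesis by (simp add: coc_def ev_augl)
qed

lemma augr_cohomologous: "dd G = 0 \<Longrightarrow> (\<lambda>c. bl (\<lambda>x. G (snd x)) eps (diag \<theta> (basis c))) \<approx>\<^sub>c G"
proof -
  assume G: "dd G = 0"
  have "(\<lambda>c. coc G (augr (basis c))) \<approx>\<^sub>c G"
  proof (rule chain_map_cohomologous[OF _ _ _ _ G])
    show "augr (u + v) = augr u + augr v" for u v by (simp add: augr_def diag_add frag_extend_add)
    show "augr (translate \<theta> g v) = translate \<theta> g (augr v)" for g v
      by (rule frag_eqI) (simp add: ev_augr ev_translate diag_translate bl_ttranslate eps_def[abs_def] case_prod_unfold)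
    show "bd \<theta> (augr v) = augr (bd \<theta> v)" for v
      by (rule frag_eqI) (simp add: ev_augr ev_dx tbd_diag[symmetric] bl_tbd dx_eps bl_zero)
    show "cell_aug X0 (augr v) = cell_aug X0 v" for v
      by (simp add: taug_diag[symmetric] taug_bl cell_aug_eq_ev[of _ "augr v"] ev_augr eps_def[abs_def])
  qed
  then show ?thesis by (simp add: coc_def ev_augr)
qed

definition cupF :: "(cell \<Rightarrow> 'r::comm_ring_1) \<Rightarrow> (cell \<Rightarrow> 'r) \<Rightarrow> cell \<Rightarrow> 'r" where
  "cupF F G c = cup \<theta> (coc F) (coc G) (basis c)"

lemma cup_eq_cupF: "cup \<theta> (coc F) (coc G) = coc (cupF F G)"
proof
  show "cup \<theta> (coc F) (coc G) v = coc (cupF F G) v" for v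
  proof (rule additive_eqI)
    fix x :: "grp \<times> cell"
    have "cup \<theta> (coc F) (coc G) (translate \<theta> (fst x) (basis (snd x))) = cup \<theta> (coc F) (coc G) (basis (snd x))"
      by (simp add: cup_coc diag_translate bl_ttranslate)
    then show "cup \<theta> (coc F) (coc G) (frag_of x) = coc (cupF F G) (frag_of x)"
      by (simp add: basis_def coc_of cupF_def)
  qed (simp_all add: cup_coc diag_add bl_add coc_add)
qed

lemma cupF_eq: "cupF F G c = bl (\<lambda>x. F (snd x)) (\<lambda>y. G (snd y)) (diag \<theta> (basis c))"
  by (simp add: cupF_def cup_coc)

text \<open>
  On $P$ the cocycle \<open>one_at U\<close> is the coboundary of the non-equivariant cochain \<open>U\<close>, so its cup
  products can be evaluated on boundaries, where only first moments of the coefficients survive.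
\<close>

lemma cup_hom_left:
  assumes U: "is_hom U" and G: "dd G = 0"
  shows "cupF (one_at U) G \<approx>\<^sub>c MM U G"
proof -
  define \<kappa> where "\<kappa> v = bl (mom U (delta X0)) (\<lambda>x. G (snd x)) (diag \<theta> v)" for v
  define G' where "G' c = bl eps (\<lambda>x. G (snd x)) (diag \<theta> (basis c))" for c
  have G': "G' \<approx>\<^sub>c G" unfolding G'_def by (rule augl_cohomologous[OF G])
  then have dG': "dd G' = 0" using coh_cocycle G by metis
  \<comment> \<open>On the translate by g, U becomes U + U(g); so \<open>\<kappa>\<close> is an
    equivariant cochain plus U(g) times \<open>G'\<close>, the product of the augmentation with
    G.\<close>
  have \<kappa>: "\<kappa> v = coc (\<lambda>c. \<kappa> (basis c)) v + ev (mom U G') v" for v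
  proof (rule additive_eqI[of \<kappa> "\<lambda>v. coc (\<lambda>c. \<kappa> (basis c)) v + ev (mom U G') v"])
    fix x :: "grp \<times> cell"
    have *: "(\<lambda>y. mom U (delta X0) (fst x \<diamondop> fst y, snd y)) = (\<lambda>y. mom U (delta X0) y + U (fst x) * eps y)"
      by (auto simp: fun_eq_iff mom_def is_homD[OF U] eps_def delta_def algebra_simps)
    have "frag_of x = translate \<theta> (fst x) (basis (snd x))" by (simp add: basis_def)
    then have "\<kappa> (frag_of x) = bl (\<lambda>y. mom U (delta X0) (fst x \<diamondop> fst y, snd y)) (\<lambda>y. G (snd y)) (diag \<theta> (basis (snd x)))"
      by (simp only: \<kappa>_def diag_translate bl_ttranslate snd_conv)
    then show "\<kappa> (frag_of x) = coc (\<lambda>c. \<kappa> (basis c)) (frag_of x) + ev (mom U G') (frag_of x)"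
      by (simp add: * bl_add_left bl_mult_left \<kappa>_def coc_of mom_def[of U G'] G'_def)
  qed (simp_all add: \<kappa>_def diag_add bl_add coc_add ev_add)
  have "cupF (one_at U) G c = (MM U G' + dd (\<lambda>c. \<kappa> (basis c))) c" for c
  proof -
    \<comment> \<open>U is concentrated in degree 0, where the sign of the Leibniz rule is
      1.\<close>
    have sg: "(\<lambda>x. (- 1) ^ cdim (snd x) * mom U (delta X0) x) = mom U (delta X0)"
      by (auto simp: fun_eq_iff mom_def delta_def)
    have "cupF (one_at U) G c = bl (dx (mom U (delta X0))) (\<lambda>y. G (snd y)) (diag \<theta> (basis c))"
      by (simp add: cupF_eq dx_mom_delta[OF U])
    also have "\<dots> = bl (mom U (delta X0)) (\<lambda>y. G (snd y)) (tbd \<theta> (diag \<theta> (basis c)))"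
      by (simp add: bl_tbd sg dx_cell G bl_zero)
    also have "\<dots> = \<kappa> (bd_cell \<theta> c)" by (simp add: \<kappa>_def tbd_diag bd_basis)
    also have "\<dots> = dd (\<lambda>c. \<kappa> (basis c)) c + MM U G' c"
      by (subst \<kappa>) (simp add: dd_def MM_def)
    finally show ?thesis by simp
  qed
  then have "cupF (one_at U) G = MM U G' + dd (\<lambda>c. \<kappa> (basis c))" by blast
  then have "cupF (one_at U) G \<approx>\<^sub>c MM U G'" unfolding coh_def by blast
  also have "MM U G' \<approx>\<^sub>c MM U G" by (rule MM_coh[OF U G'])
  finally show ?thesis .
qed

definition sgnF :: "(cell \<Rightarrow> 'r::comm_ring_1) \<Rightarrow> cell \<Rightarrow> 'r" where
  "sgnF F c = (- 1) ^ cdim c * F c"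

lemma dd_sgnF: "dd (sgnF F) = - sgnF (dd F)"
  by (rule ext, rename_tac c, case_tac c) (simp_all add: dd_simps sgnF_def)

text \<open>With the primitive U on the right, the Leibniz rule multiplies the left factor by
  (-1)^degree. Starting from \<open>sgnF G\<close> instead of G compensates for this, and the sign
  survives in the moment.\<close>

lemma cup_hom_right:
  assumes U: "is_hom U" and G: "dd G = 0"
  shows "cupF G (one_at U) \<approx>\<^sub>c MM U (sgnF G)"
proof -
  let ?S = "\<lambda>x. sgnF G (snd x)"
  define \<kappa> where "\<kappa> v = bl ?S (mom U (delta X0)) (diag \<theta> v)" for v
  define G' where "G' c = bl ?S eps (diag \<theta> (basis c))" for c
  have dS: "dd (sgnF G) = 0" by (simp add: dd_sgnF G) (simp add: sgnF_def fun_eq_iff)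
  have G': "G' \<approx>\<^sub>c sgnF G" unfolding G'_def by (rule augr_cohomologous[OF dS])
  have \<kappa>: "\<kappa> v = coc (\<lambda>c. \<kappa> (basis c)) v + ev (mom U G') v" for v
  proof (rule additive_eqI[of \<kappa> "\<lambda>v. coc (\<lambda>c. \<kappa> (basis c)) v + ev (mom U G') v"])
    fix x :: "grp \<times> cell"
    have *: "(\<lambda>y. mom U (delta X0) (fst x \<diamondop> fst y, snd y)) = (\<lambda>y. mom U (delta X0) y + U (fst x) * eps y)"
      by (auto simp: fun_eq_iff mom_def is_homD[OF U] eps_def delta_def algebra_simps)
    have "frag_of x = translate \<theta> (fst x) (basis (snd x))" by (simp add: basis_def)
    then have "\<kappa> (frag_of x) = bl ?S (\<lambda>y. mom U (delta X0) (fst x \<diamondop> fst y, snd y)) (diag \<theta> (basis (snd x)))"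
      by (simp only: \<kappa>_def diag_translate bl_ttranslate snd_conv)
    then show "\<kappa> (frag_of x) = coc (\<lambda>c. \<kappa> (basis c)) (frag_of x) + ev (mom U G') (frag_of x)"
      by (simp add: * bl_add_right bl_mult_right \<kappa>_def coc_of mom_def[of U G'] G'_def)
  qed (simp_all add: \<kappa>_def diag_add bl_add coc_add ev_add)
  have "cupF G (one_at U) c = (MM U G' + dd (\<lambda>c. \<kappa> (basis c))) c" for c
  proof -
    have sg: "(\<lambda>x. (- 1) ^ cdim (snd x) * ?S x) = (\<lambda>x. G (snd x))"
      by (auto simp: fun_eq_iff sgnF_def simp flip: mult.assoc power_mult_distrib)
    have "cupF G (one_at U) c = bl (\<lambda>y. G (snd y)) (dx (mom U (delta X0))) (diag \<theta> (basis c))"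
      by (simp add: cupF_eq dx_mom_delta[OF U])
    also have "\<dots> = bl ?S (mom U (delta X0)) (tbd \<theta> (diag \<theta> (basis c)))"
      by (simp add: bl_tbd sg dx_cell dS bl_zero)
    also have "\<dots> = \<kappa> (bd_cell \<theta> c)" by (simp add: \<kappa>_def tbd_diag bd_basis)
    also have "\<dots> = dd (\<lambda>c. \<kappa> (basis c)) c + MM U G' c"
      by (subst \<kappa>) (simp add: dd_def MM_def)
    finally show ?thesis by simp
  qed
  then have "cupF G (one_at U) = MM U G' + dd (\<lambda>c. \<kappa> (basis c))" by blast
  then have "cupF G (one_at U) \<approx>\<^sub>c MM U G'" unfolding coh_def by blast
  also have "MM U G' \<approx>\<^sub>c MM U (sgnF G)" by (rule MM_coh[OF U G'])
  finally show ?thesis .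
qed

end

section \<open>An explicit product on cocycles\<close>

definition pt :: "nat \<Rightarrow> (cell \<Rightarrow> 'r::comm_ring_1) \<Rightarrow> cell \<Rightarrow> 'r" where
  "pt n F c = (if cdim c = n then F c else 0)"

lemma pt_add: "pt n (F + G) = pt n F + pt n G"
  and pt_mult: "pt n (\<lambda>c. k * F c) = (\<lambda>c. k * pt n F c)"
  by (auto simp: fun_eq_iff pt_def)

text \<open>For a cocycle \<open>F\<close>, this is the homomorphism from the group given by the degree 1 part of \<open>F\<close>.\<close>

definition UF :: "(cell \<Rightarrow> 'r::comm_ring_1) \<Rightarrow> grp \<Rightarrow> 'r" where
  "UF F g = of_int (fst g $ 1) * F Y1 + of_int (fst g $ 2) * F Y2 + of_int (snd g) * F Y3"

lemma UF_add: "UF (F + G) = (\<lambda>g. UF F g + UF G g)"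
  and UF_mult: "UF (\<lambda>c. k * F c) = (\<lambda>g. k * UF F g)"
  by (auto simp: fun_eq_iff UF_def algebra_simps)

lemma UF_gens: "UF F g_a = F Y1" "UF F g_b = F Y2" "UF F g_t = F Y3"
  by (simp_all add: UF_def g_a_def g_b_def g_t_def)

lemma deg_decomp: "F = (\<lambda>c. F X0 * delta X0 c) + pt 1 F + pt 2 F + pt 3 F"
proof
  show "F c = ((\<lambda>c. F X0 * delta X0 c) + pt 1 F + pt 2 F + pt 3 F) c" for c
    by (cases c) (simp_all add: pt_def delta_def)
qed

lemma delta_eps: "(\<lambda>x. delta X0 (snd x)) = eps"
  by (auto simp: fun_eq_iff delta_def eps_def)

lemma delta_same [simp]: "delta c c = 1"
  by (simp add: delta_def)

lemma UF_delta: "UF (delta X0) = (\<lambda>g. 0)"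
  by (simp add: fun_eq_iff UF_def delta_def)

lemma pt_delta: "n \<noteq> 0 \<Longrightarrow> pt n (delta X0) = 0"
  by (auto simp: fun_eq_iff pt_def delta_def)

context gl2
begin

lemma MM_zero_hom: "MM (\<lambda>g. 0) F = 0"
  by (simp add: fun_eq_iff MM_def mom_def[abs_def])

lemma MM_zero: "MM U 0 = 0"
  by (simp add: fun_eq_iff MM_def mom_def[abs_def])

lemma theta_entries:
  "m1 * \<theta>$1$1 + m2 * \<theta>$2$1 = -1" "m1 * \<theta>$1$2 + m2 * \<theta>$2$2 = 0"
  "n1 * \<theta>$1$1 + n2 * \<theta>$2$1 = 0" "n1 * \<theta>$1$2 + n2 * \<theta>$2$2 = -1"
proof -
  have "(mn \<theta> ** \<theta>) $ i $ j = (- mat 1 :: int^2^2) $ i $ j" for i j by (simp add: theta_mn)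
  from this[of 1 1] this[of 1 2] this[of 2 1] this[of 2 2]
  show "m1 * \<theta>$1$1 + m2 * \<theta>$2$1 = -1" "m1 * \<theta>$1$2 + m2 * \<theta>$2$2 = 0"
  "n1 * \<theta>$1$1 + n2 * \<theta>$2$1 = 0" "n1 * \<theta>$1$2 + n2 * \<theta>$2$2 = -1"
    by (simp_all add: matrix_matrix_mult_def sum_2 mat_def)
qed

text \<open>The values (F Y1, F Y2) form a row vector that the cocycle condition sends to 0 under 1
  - \<theta>^-1. Multiplying by \<theta> from the right gives invariance under \<theta>.\<close>

lemma cocycle_fixed:
  assumes "dd F = 0"
  shows "of_int (\<theta>$1$1) * F Y1 + of_int (\<theta>$2$1) * F Y2 = F Y1"
    "of_int (\<theta>$1$2) * F Y1 + of_int (\<theta>$2$2) * F Y2 = F Y2"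
proof -
  have e: "of_int (1 + m1) * F Y1 + of_int n1 * F Y2 = 0" "of_int m2 * F Y1 + of_int (1 + n2) * F Y2 = 0"
    using fun_cong[OF assms, of Z1] fun_cong[OF assms, of Z2] by (simp_all add: dd_simps)
  note t = theta_entries[THEN arg_cong[where f = "of_int :: int \<Rightarrow> 'a"]]
  have "of_int (\<theta>$1$1) * (of_int (1 + m1) * F Y1 + of_int n1 * F Y2)
     + of_int (\<theta>$2$1) * (of_int m2 * F Y1 + of_int (1 + n2) * F Y2) =
     of_int (\<theta>$1$1) * F Y1 + of_int (\<theta>$2$1) * F Y2
     + of_int (m1 * \<theta>$1$1 + m2 * \<theta>$2$1) * F Y1 + of_int (n1 * \<theta>$1$1 + n2 * \<theta>$2$1) * F Y2"
    by (simp add: algebra_simps)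
  then show "of_int (\<theta>$1$1) * F Y1 + of_int (\<theta>$2$1) * F Y2 = F Y1"
    unfolding e t by simp
  have "of_int (\<theta>$1$2) * (of_int (1 + m1) * F Y1 + of_int n1 * F Y2)
     + of_int (\<theta>$2$2) * (of_int m2 * F Y1 + of_int (1 + n2) * F Y2) =
     of_int (\<theta>$1$2) * F Y1 + of_int (\<theta>$2$2) * F Y2
     + of_int (m1 * \<theta>$1$2 + m2 * \<theta>$2$2) * F Y1 + of_int (n1 * \<theta>$1$2 + n2 * \<theta>$2$2) * F Y2"
    by (simp add: algebra_simps)
  then show "of_int (\<theta>$1$2) * F Y1 + of_int (\<theta>$2$2) * F Y2 = F Y2"
    unfolding e t by simp
qed

text \<open>A linear form on the exponent vectors of a and b, together with a value at t, extends to
  a homomorphism on the semidirect product as soon as it is invariant under \<theta>.\<close>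

lemma is_hom_UF:
  assumes "dd F = 0"
  shows "is_hom (UF F)"
proof -
  let ?L = "\<lambda>v :: int^2. of_int (v $ 1) * F Y1 + of_int (v $ 2) * F Y2"
  have step: "?L (\<theta> *v v) = ?L v" for v
  proof -
    have "?L (\<theta> *v v) = of_int (v $ 1) * (of_int (\<theta>$1$1) * F Y1 + of_int (\<theta>$2$1) * F Y2)
      + of_int (v $ 2) * (of_int (\<theta>$1$2) * F Y1 + of_int (\<theta>$2$2) * F Y2)"
      by (simp add: matrix_vector_mult_def sum_2 algebra_simps)
    then show ?thesis unfolding cocycle_fixed[OF assms] .
  qed
  have L: "?L (theta_pow \<theta> k v) = ?L v" for k v
  proof (induction k rule: int_induct[where k = 0])
    case (step1 i)
    then show ?case using step[of "theta_pow \<theta> i v"] by (simp add: theta_pow_Suc[OF inv])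
  next
    case (step2 i)
    then show ?case using step[of "theta_pow \<theta> (i - 1) v"] theta_pow_Suc[OF inv, of "i - 1" v] by simp
  qed simp
  show ?thesis unfolding is_hom_def
  proof (intro allI)
    fix g h
    have "UF F (g \<diamondop> h) = ?L (fst g) + ?L (theta_pow \<theta> (snd g) (fst h)) + of_int (snd g + snd h) * F Y3"
      by (simp add: UF_def gm_eq algebra_simps)
    then show "UF F (g \<diamondop> h) = UF F g + UF F h"
      unfolding L by (simp add: UF_def algebra_simps)
  qed
qed

lemma one_at_UF: "one_at (UF F) = pt 1 F"
  by (rule ext) (simp add: one_at_def pt_def UF_gens split: cell.splits)

lemma dd_pt: "dd F = 0 \<Longrightarrow> dd (pt n F) = 0"
proof
  fix c assume "dd F = 0"
  then have "dd F c = 0" by simp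
  then show "dd (pt n F) c = 0 c" by (cases c) (auto simp: dd_simps pt_def)
qed

lemma cupF_add_left: "cupF (F + F') G = cupF F G + cupF F' G"
  and cupF_add_right: "cupF F (G + G') = cupF F G + cupF F G'"
  and cupF_mult_left: "cupF (\<lambda>c. k * F c) G = (\<lambda>c. k * cupF F G c)"
  and cupF_mult_right: "cupF F (\<lambda>c. k * G c) = (\<lambda>c. k * cupF F G c)"
  by (simp_all add: fun_eq_iff cupF_eq bl_add_left bl_add_right bl_mult_left bl_mult_right)

lemma cupF_pt_zero: "3 < i + j \<Longrightarrow> cupF (pt i F) (pt j G) = 0"
proof
  fix c assume ij: "3 < i + j"
  have "bl (\<lambda>x. pt i F (snd x)) (\<lambda>y. pt j G (snd y)) (diag \<theta> (basis c)) = ev (\<lambda>z. 0) (diag \<theta> (basis c))"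
    unfolding bl_def
  proof (rule ev_cong)
    fix z assume "z \<in> Poly_Mapping.keys (diag \<theta> (basis c))"
    then have "cdim (snd (fst z)) + cdim (snd (snd z)) = cdim c"
      using keys_diag[of z "(g_1, c)"] by (simp add: basis_def)
    moreover have "cdim c \<le> 3" by (cases c) auto
    ultimately show "pt i F (snd (fst z)) * pt j G (snd (snd z)) = 0" using ij by (auto simp: pt_def)
  qed
  then show "cupF (pt i F) (pt j G) c = 0 c" by (simp add: cupF_eq)
qed

lemma cup_one_left: "dd G = 0 \<Longrightarrow> cupF (delta X0) G \<approx>\<^sub>c G"
  using augl_cohomologous[of G] by (simp only: cupF_eq[abs_def] delta_eps)

lemma cup_one_right: "dd G = 0 \<Longrightarrow> cupF G (delta X0) \<approx>\<^sub>c G"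
  using augr_cohomologous[of G] by (simp only: cupF_eq[abs_def] delta_eps)

text \<open>
  Cup products with a class of degree 1, on either side, are moments; \<open>pt 1 F\<close> only enters through
  \<open>MM (UF F)\<close>, and products of degree above 3 vanish.
\<close>

definition prd :: "(cell \<Rightarrow> 'r::comm_ring_1) \<Rightarrow> (cell \<Rightarrow> 'r) \<Rightarrow> cell \<Rightarrow> 'r" where
  "prd F G = (\<lambda>c. F X0 * G c) + MM (UF F) G + (\<lambda>c. G X0 * (pt 2 F + pt 3 F) c) + MM (UF G) (pt 2 F)"

text \<open>The parts of G in degrees 2 and 3 drop out by degree. The degree 0 part acts by the unit
  law and the degree 1 part by \<open>cup_hom_right\<close>, whose sign is 1 for n = 2; for n = 3 it
  drops out as well.\<close>

lemma cup_high:
  assumes F: "dd F = 0" and G: "dd G = 0" and n: "n = 2 \<or> n = 3"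
  shows "cupF (pt n F) G \<approx>\<^sub>c (\<lambda>c. G X0 * pt n F c) + (if n = 2 then MM (UF G) (pt 2 F) else 0)"
proof -
  have "cupF (pt n F) G = cupF (pt n F) ((\<lambda>c. G X0 * delta X0 c) + pt 1 G + pt 2 G + pt 3 G)"
    unfolding deg_decomp[of G, symmetric] ..
  also have "\<dots> = (\<lambda>c. G X0 * cupF (pt n F) (delta X0) c) + cupF (pt n F) (pt 1 G)"
  proof -
    have "cupF (pt n F) (pt 2 G) = 0" "cupF (pt n F) (pt 3 G) = 0"
      by (rule cupF_pt_zero; use n in linarith)+
    then show ?thesis by (simp add: cupF_add_right cupF_mult_right)
  qed
  finally have e: "cupF (pt n F) G = (\<lambda>c. G X0 * cupF (pt n F) (delta X0) c) + cupF (pt n F) (pt 1 G)" .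
  show ?thesis unfolding e
  proof (rule coh_add)
    show "(\<lambda>c. G X0 * cupF (pt n F) (delta X0) c) \<approx>\<^sub>c (\<lambda>c. G X0 * pt n F c)"
      by (intro coh_mult cup_one_right dd_pt F)
    show "cupF (pt n F) (pt 1 G) \<approx>\<^sub>c (if n = 2 then MM (UF G) (pt 2 F) else 0)"
    proof (cases "n = 2")
      case True
      have "sgnF (pt 2 F) = pt 2 F" by (rule ext) (simp add: sgnF_def pt_def)
      then show ?thesis
        using True cup_hom_right[OF is_hom_UF[OF G] dd_pt[OF F, of 2]] by (simp add: one_at_UF)
    next
      case False
      then show ?thesis using n by (simp add: cupF_pt_zero)
    qed
  qed
qed

theorem cup_prd:
  assumes F: "dd F = 0" and G: "dd G = 0"
  shows "cupF F G \<approx>\<^sub>c prd F G"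
proof -
  have "cupF F G = cupF ((\<lambda>c. F X0 * delta X0 c) + pt 1 F + pt 2 F + pt 3 F) G"
    unfolding deg_decomp[of F, symmetric] ..
  also have "\<dots> = (\<lambda>c. F X0 * cupF (delta X0) G c) + cupF (pt 1 F) G + cupF (pt 2 F) G + cupF (pt 3 F) G"
    by (simp add: cupF_add_left cupF_mult_left)
  finally have e: "cupF F G = (\<lambda>c. F X0 * cupF (delta X0) G c) + cupF (pt 1 F) G + cupF (pt 2 F) G + cupF (pt 3 F) G" .
  have "cupF F G \<approx>\<^sub>c (\<lambda>c. F X0 * G c) + MM (UF F) G + ((\<lambda>c. G X0 * pt 2 F c) + MM (UF G) (pt 2 F))
       + (\<lambda>c. G X0 * pt 3 F c)"
    unfolding e
  proof (intro coh_add)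
    show "(\<lambda>c. F X0 * cupF (delta X0) G c) \<approx>\<^sub>c (\<lambda>c. F X0 * G c)" by (intro coh_mult cup_one_left G)
    show "cupF (pt 1 F) G \<approx>\<^sub>c MM (UF F) G"
      using cup_hom_left[OF is_hom_UF[OF F] G] by (simp add: one_at_UF)
    show "cupF (pt 2 F) G \<approx>\<^sub>c (\<lambda>c. G X0 * pt 2 F c) + MM (UF G) (pt 2 F)"
      using cup_high[OF F G, of 2] by simp
    show "cupF (pt 3 F) G \<approx>\<^sub>c (\<lambda>c. G X0 * pt 3 F c)"
      using cup_high[OF F G, of 3] by simp
  qed
  moreover have "(\<lambda>c. F X0 * G c) + MM (UF F) G + ((\<lambda>c. G X0 * pt 2 F c) + MM (UF G) (pt 2 F))
       + (\<lambda>c. G X0 * pt 3 F c) = prd F G" by (simp add: prd_def fun_eq_iff algebra_simps)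
  ultimately show ?thesis by simp
qed

lemma prd_add_left: "prd (F + F') G = prd F G + prd F' G"
  and prd_add_right: "prd F (G + G') = prd F G + prd F G'"
  and prd_mult_left: "prd (\<lambda>c. k * F c) G = (\<lambda>c. k * prd F G c)"
  and prd_mult_right: "prd F (\<lambda>c. k * G c) = (\<lambda>c. k * prd F G c)"
  by (simp_all add: fun_eq_iff prd_def UF_add UF_mult MM_hom_add MM_hom_mult MM_add MM_mult pt_add pt_mult algebra_simps)

lemma pt_dd: "pt (Suc n) (dd K) = dd (pt n K)"
proof
  show "pt (Suc n) (dd K) c = dd (pt n K) c" for c
    by (cases c) (auto simp: pt_def dd_simps)
qed

lemma prd_dd_left:
  assumes "dd G = 0" shows "prd (dd K) G \<approx>\<^sub>c 0"
proof -
  have U0: "UF (dd K) = (\<lambda>g. 0)" by (simp add: fun_eq_iff UF_def dd_simps)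
  have e: "pt 2 (dd K) + pt 3 (dd K) = dd K"
  proof
    show "(pt 2 (dd K) + pt 3 (dd K)) c = dd K c" for c by (cases c) (auto simp: pt_def dd_simps)
  qed
  have p2: "pt 2 (dd K) = dd (pt 1 K)" using pt_dd[of 1 K] by (simp add: numeral_2_eq_2)
  have M0: "MM (\<lambda>g. 0) G = 0" by (simp add: fun_eq_iff MM_def mom_def[abs_def])
  have "prd (dd K) G = (\<lambda>c. G X0 * dd K c) + MM (UF G) (dd (pt 1 K))"
    unfolding prd_def e U0 M0 unfolding p2 by (simp add: fun_eq_iff dd_simps)
  also have "\<dots> = 0 + dd ((\<lambda>c. G X0 * K c) - MM (UF G) (pt 1 K))"
    by (simp add: MM_dd[OF is_hom_UF[OF assms]] dd_diff dd_mult)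
  finally show ?thesis unfolding coh_def by blast
qed

lemma prd_dd_right:
  assumes "dd F = 0" shows "prd F (dd K) \<approx>\<^sub>c 0"
proof -
  have U0: "UF (dd K) = (\<lambda>g. 0)" by (simp add: fun_eq_iff UF_def dd_simps)
  have M0: "MM (\<lambda>g. 0) (pt 2 F) = 0" by (simp add: fun_eq_iff MM_def mom_def[abs_def])
  have "prd F (dd K) = (\<lambda>c. F X0 * dd K c) + MM (UF F) (dd K)"
    unfolding prd_def U0 M0 by (simp add: fun_eq_iff dd_simps)
  also have "\<dots> = 0 + dd ((\<lambda>c. F X0 * K c) - MM (UF F) K)"
    by (simp add: MM_dd[OF is_hom_UF[OF assms]] dd_diff dd_mult)
  finally show ?thesis unfolding coh_def by blast
qed

lemma dd_prd:
  assumes F: "dd F = 0" and G: "dd G = 0" shows "dd (prd F G) = 0"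
proof -
  have "dd (\<lambda>c. G X0 * (pt 2 F + pt 3 F) c) = (\<lambda>c. G X0 * dd (pt 2 F + pt 3 F) c)" by (rule dd_mult)
  then show ?thesis
    by (simp add: prd_def dd_add dd_mult F G dd_pt dd_MM is_hom_UF) (simp add: fun_eq_iff)
qed

lemma prd_cong:
  assumes "F \<approx>\<^sub>c F'" "G \<approx>\<^sub>c G'" "dd F' = 0" "dd G' = 0"
  shows "prd F G \<approx>\<^sub>c prd F' G'"
proof -
  obtain K L where K: "F = F' + dd K" and L: "G = G' + dd L" using assms by (auto simp: coh_def)
  have dG: "dd G = 0" using assms coh_cocycle by metis
  have "prd F G = prd F' G' + prd F' (dd L) + prd (dd K) G"
    by (simp add: K prd_add_left) (simp add: L prd_add_right)
  moreover have "prd F' G' + prd F' (dd L) + prd (dd K) G \<approx>\<^sub>c prd F' G' + 0 + 0"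
    by (intro coh_add prd_dd_left prd_dd_right coh_refl dG assms)
  ultimately show ?thesis by simp
qed

lemma prd_one_left: "prd (delta X0) G = G"
  by (rule ext) (simp add: prd_def UF_delta pt_delta MM_zero_hom MM_zero)

lemma prd_one_right: "dd F = 0 \<Longrightarrow> prd F (delta X0) = F"
proof
  assume F: "dd F = 0"
  have "MM (UF F) (delta X0) = pt 1 F"
    by (simp add: one_at_eq_MM[OF is_hom_UF[OF F], symmetric] one_at_UF)
  then have "prd F (delta X0) c = F X0 * delta X0 c + pt 1 F c + (pt 2 F c + pt 3 F c)"  for c
    by (simp add: prd_def UF_delta MM_zero_hom)
  also have "\<dots> c = F c" for c by (cases c) (simp_all add: pt_def delta_def)
  finally show "prd F (delta X0) c = F c" for c .
qed

text \<open>Anticommutativity in degree 1. It is \<open>MM_anticommute\<close> at the unit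
  \<open>delta X0\<close>, which the moment maps of \<open>UF F\<close> and \<open>UF G\<close> send
  to the degree 1 parts of F and G.\<close>

lemma MM_swap_deg1:
  assumes F: "dd F = 0" and G: "dd G = 0"
  shows "MM (UF F) (pt 1 G) + MM (UF G) (pt 1 F) \<approx>\<^sub>c 0"
  using MM_anticommute[OF is_hom_UF[OF F] is_hom_UF[OF G] dd_delta_X0]
  by (simp add: one_at_eq_MM[OF is_hom_UF[OF F], symmetric] one_at_eq_MM[OF is_hom_UF[OF G], symmetric] one_at_UF)

lemma UF_prd:
  assumes F: "dd F = 0" and G: "dd G = 0"
  shows "UF (prd F G) = (\<lambda>g. F X0 * UF G g + G X0 * UF F g)"
proof -
  have "prd F G Y1 = F X0 * G Y1 + G X0 * F Y1" "prd F G Y2 = F X0 * G Y2 + G X0 * F Y2"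
    "prd F G Y3 = F X0 * G Y3 + G X0 * F Y3"
    by (simp_all add: prd_def MM_simps is_hom_UF F G pt_def UF_gens)
  then show ?thesis
    by (simp add: fun_eq_iff UF_def algebra_simps)
qed

lemma prd_assoc:
  assumes F: "dd F = 0" and G: "dd G = 0" and K: "dd K = 0"
  shows "prd (prd F G) K \<approx>\<^sub>c prd F (prd G K)"
proof -
  note hF = is_hom_UF[OF F] and hG = is_hom_UF[OF G] and hK = is_hom_UF[OF K]
  let ?U = "UF F" and ?V = "UF G" and ?T = "UF K"
  \<comment> \<open>The two bracketings agree cell by cell except for the triple product of the
    degree 1 parts, where K acts from the right on one side and is acted upon on the other. Two
    anticommutations, one under the map \<open>MM ?U\<close>, remove the difference.\<close>
  have "prd (prd F G) K c = (prd F (prd G K) + (MM ?T (MM ?U (pt 1 G)) - MM ?U (MM ?V (pt 1 K)))) c" for c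
  proof -
    have X0: "prd F G X0 = F X0 * G X0" "prd G K X0 = G X0 * K X0"
      by (simp_all add: prd_def MM_simps hF hG hK pt_def)
    show ?thesis
      unfolding prd_def[of "prd F G"] prd_def[of F "prd G K"] X0 UF_prd[OF F G] UF_prd[OF G K] MM_hom_add MM_hom_mult
      by (cases c) (simp_all add: MM_simps hF hG hK pt_def prd_def UF_gens algebra_simps)
  qed
  then have "prd (prd F G) K = prd F (prd G K) + (MM ?T (MM ?U (pt 1 G)) - MM ?U (MM ?V (pt 1 K)))" by blast
  moreover have "prd F (prd G K) + (MM ?T (MM ?U (pt 1 G)) - MM ?U (MM ?V (pt 1 K))) \<approx>\<^sub>c prd F (prd G K) + 0"
  proof (rule coh_add[OF coh_refl])
    have d: "dd (pt 1 G) = 0" by (rule dd_pt[OF G])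
    have 1: "MM ?T (MM ?U (pt 1 G)) + MM ?U (MM ?T (pt 1 G)) \<approx>\<^sub>c 0" by (rule MM_anticommute[OF hK hF d])
    have "MM ?U (MM ?V (pt 1 K) + MM ?T (pt 1 G)) \<approx>\<^sub>c MM ?U 0"
      by (rule MM_coh[OF hF MM_swap_deg1[OF G K]])
    moreover have "MM ?U 0 = 0" by (simp add: fun_eq_iff MM_def mom_def[abs_def])
    ultimately have 2: "MM ?U (MM ?V (pt 1 K)) + MM ?U (MM ?T (pt 1 G)) \<approx>\<^sub>c 0" by (simp add: MM_add)
    have "MM ?T (MM ?U (pt 1 G)) + MM ?U (MM ?T (pt 1 G)) - (MM ?U (MM ?V (pt 1 K)) + MM ?U (MM ?T (pt 1 G))) \<approx>\<^sub>c 0 - 0"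
      by (rule coh_diff[OF 1 2])
    then show "MM ?T (MM ?U (pt 1 G)) - MM ?U (MM ?V (pt 1 K)) \<approx>\<^sub>c 0" by simp
  qed
  ultimately show ?thesis by simp
qed

section \<open>The cohomology ring\<close>

definition cl :: "(cell \<Rightarrow> 'r::comm_ring_1) \<Rightarrow> (chain \<Rightarrow> 'r) set" where
  "cl F = cls \<theta> (coc F)"

lemma cl_eq: "cl F = {coc F' | F'. F' \<approx>\<^sub>c F}"
proof -
  have e: "coc F + coc (dd K) = coc (F + dd K)" for K by (simp add: fun_eq_iff coc_fun_add)
  have "cl F = {coc F + coc (dd K) | K. True}"
    by (auto simp: cl_def cls_def coboundaries_eq)
  then show ?thesis unfolding e coh_def by blast
qed

lemma cl_eq_iff: "cl F = cl G \<longleftrightarrow> F \<approx>\<^sub>c G"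
proof
  assume "cl F = cl G"
  moreover have "coc F \<in> cl F" by (auto simp: cl_eq)
  ultimately show "F \<approx>\<^sub>c G" by (auto simp: cl_eq coc_inject)
next
  assume FG: "F \<approx>\<^sub>c G"
  then have "F' \<approx>\<^sub>c F \<longleftrightarrow> F' \<approx>\<^sub>c G" for F' using coh_trans coh_sym by blast
  then show "cl F = cl G" by (simp add: cl_eq)
qed

lemma coh_carrier: "carrier (cohomology \<theta>) = {cl F | F. dd F = 0}"
  by (auto simp: cohomology_def cocycles_eq cl_def)

text \<open>In \<open>cohomology\<close> a product is a union over all pairs of representatives. The
  union collapses to one class because \<open>prd\<close> respects cohomologous factors.\<close>

lemma coh_mult_cl:
  assumes F: "dd F = 0" and G: "dd G = 0"
  shows "cl F \<otimes>\<^bsub>cohomology \<theta>\<^esub> cl G = cl (prd F G)"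
proof -
  have "cls \<theta> (cup \<theta> f g) = cl (prd F G)" if m: "f \<in> cl F" "g \<in> cl G" for f g
  proof -
    obtain F' G' where fg: "f = coc F'" "g = coc G'" "F' \<approx>\<^sub>c F" "G' \<approx>\<^sub>c G"
      using m unfolding cl_eq by blast
    then have d: "dd F' = 0" "dd G' = 0" using F G coh_cocycle by metis+
    have "cupF F' G' \<approx>\<^sub>c prd F' G'" by (rule cup_prd[OF d])
    also have "prd F' G' \<approx>\<^sub>c prd F G" by (rule prd_cong[OF fg(3,4) F G])
    finally have "cl (cupF F' G') = cl (prd F G)" by (simp add: cl_eq_iff)
    then show ?thesis by (simp add: fg cup_eq_cupF cl_def)
  qed
  moreover have "coc F \<in> cl F" "coc G \<in> cl G" by (auto simp: cl_eq)
  ultimately show ?thesis by (auto simp: cohomology_def)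
qed

lemma coh_add_cl: "cl F \<oplus>\<^bsub>cohomology \<theta>\<^esub> cl G = cl (F + G)"
proof -
  have "cls \<theta> (f + g) = cl (F + G)" if m: "f \<in> cl F" "g \<in> cl G" for f g
  proof -
    obtain F' G' where fg: "f = coc F'" "g = coc G'" "F' \<approx>\<^sub>c F" "G' \<approx>\<^sub>c G"
      using m unfolding cl_eq by blast
    then have "cl (F' + G') = cl (F + G)" by (simp add: cl_eq_iff coh_add)
    moreover have "f + g = coc (F' + G')" by (simp add: fg fun_eq_iff coc_fun_add)
    ultimately show ?thesis by (simp add: cl_def)
  qed
  moreover have "coc F \<in> cl F" "coc G \<in> cl G" by (auto simp: cl_eq)
  ultimately show ?thesis by (auto simp: cohomology_def)
qed

lemma coh_one_cl: "\<one>\<^bsub>cohomology \<theta>\<^esub> = cl (delta X0)"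
  by (simp add: cohomology_def cl_def dual_eq_coc)

lemma coh_zero_cl: "\<zero>\<^bsub>cohomology \<theta>\<^esub> = cl 0"
  by (simp add: cohomology_def cl_def coc_zero)

lemma coh_deg_cl: "coh_deg \<theta> n = {cl F | F. dd F = 0 \<and> (\<forall>c. cdim c \<noteq> n \<longrightarrow> F c = 0)}"
proof -
  have "coc F \<in> cochains_deg \<theta> n \<longleftrightarrow> (\<forall>c. cdim c \<noteq> n \<longrightarrow> F c = 0)" for F :: "cell \<Rightarrow> 'a"
    using cochains_iff[of "coc F"] by (auto simp: cochains_deg_def coc_of)
  then show ?thesis by (auto simp: coh_deg_def cocycles_eq cl_def)
qed

end

section \<open>Presentations of graded-commutative algebras\<close>

definition fev :: "(nat list \<Rightarrow> 'r::comm_ring_1) \<Rightarrow> 'r falg \<Rightarrow> 'r" where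
  "fev \<phi> f = (\<Sum>w\<in>Poly_Mapping.keys f. Poly_Mapping.lookup f w * \<phi> w)"

lemma fev_superset:
  assumes "finite A" "Poly_Mapping.keys f \<subseteq> A"
  shows "fev \<phi> f = (\<Sum>w\<in>A. Poly_Mapping.lookup f w * \<phi> w)"
  unfolding fev_def by (rule sum.mono_neutral_left) (use assms in \<open>auto simp: in_keys_iff\<close>)

lemma fev_zero [simp]: "fev \<phi> 0 = 0"
  by (simp add: fev_def)

lemma fev_add: "fev \<phi> (f + g) = fev \<phi> f + fev \<phi> g"
proof -
  let ?A = "Poly_Mapping.keys f \<union> Poly_Mapping.keys g"
  have "Poly_Mapping.keys (f + g) \<subseteq> ?A" by (rule Poly_Mapping.keys_add)
  then show ?thesis
    by (simp add: fev_superset[of ?A] lookup_add distrib_right sum.distrib)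
qed

lemma fev_diff: "fev \<phi> (f - g) = fev \<phi> f - fev \<phi> g"
  using fev_add[of \<phi> "f - g" g] by simp

lemma fev_sum: "fev \<phi> (\<Sum>i\<in>I. f i) = (\<Sum>i\<in>I. fev \<phi> (f i))"
  by (induction I rule: infinite_finite_induct) (auto simp: fev_add)

lemma fev_single: "fev \<phi> (Poly_Mapping.single w a) = a * \<phi> w"
  by (subst fev_superset[of "{w}"]) auto

lemma fev_fmult: "fev \<phi> (f \<star> g) = fev (\<lambda>u. fev (\<lambda>v. \<phi> (u @ v)) g) f"
  by (simp add: fmult_def fev_sum fev_single) (simp add: fev_def sum_distrib_left mult.assoc)

lemma fscale_eq: "c \<odot> f = Poly_Mapping.single [] c \<star> (f :: 'r::comm_ring_1 falg)"
proof (rule poly_mapping_eqI)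
  fix w
  have "Poly_Mapping.single [] c \<star> f = (\<Sum>v\<in>Poly_Mapping.keys f. Poly_Mapping.single v (c * Poly_Mapping.lookup f v))"
    by (subst fmult_superset[of "{[]}" _ "Poly_Mapping.keys f"]) auto
  then have "Poly_Mapping.lookup (Poly_Mapping.single [] c \<star> f) w = (\<Sum>v\<in>Poly_Mapping.keys f. (c * Poly_Mapping.lookup f v when v = w))"
    by (simp add: lookup_sum lookup_single)
  also have "\<dots> = c * Poly_Mapping.lookup f w"
    by (simp add: when_def in_keys_iff)
  also have "\<dots> = Poly_Mapping.lookup (c \<odot> f) w"
    by (simp add: fscale_def Poly_Mapping.map.rep_eq when_def)
  finally show "Poly_Mapping.lookup (c \<odot> f) w = Poly_Mapping.lookup (Poly_Mapping.single [] c \<star> f) w" by simp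
qed

lemma fscale_single: "c \<odot> Poly_Mapping.single w a = Poly_Mapping.single w (c * a :: 'r::comm_ring_1)"
  by (simp add: fscale_eq fmult_single)

lemma fev_fscale: "fev \<phi> (c \<odot> f) = c * fev \<phi> f"
  by (simp add: fscale_eq fev_fmult fev_single)

lemma fmult_diff_left: "(f - g) \<star> h = f \<star> h - g \<star> (h :: 'r::comm_ring_1 falg)"
  using fmult_add_left[of "f - g" g h] by (simp add: algebra_simps)

lemma fmult_diff_right: "h \<star> (f - g) = h \<star> f - h \<star> (g :: 'r::comm_ring_1 falg)"
  using fmult_add_right[of h "f - g" g] by (simp add: algebra_simps)

definition lin :: "nat list set \<Rightarrow> (nat list \<Rightarrow> 'r::comm_ring_1) \<Rightarrow> 'r falg" where
  "lin B c = (\<Sum>b\<in>B. Poly_Mapping.single b (c b))"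

lemma lin_add: "lin B (\<lambda>b. c b + d b) = lin B c + lin B d"
  by (simp add: lin_def single_add sum.distrib)

lemma lin_scale: "Poly_Mapping.single [] k \<star> lin B c = lin B (\<lambda>b. k * c b)"
  by (simp add: lin_def fmult_sum_right fmult_single)

lemma fev_lin: "fev \<phi> (lin B c) = (\<Sum>b\<in>B. c b * \<phi> b)"
  by (simp add: lin_def fev_sum fev_single)

lemma free_alg_simps:
  "f \<otimes>\<^bsub>free_alg n\<^esub> g = f \<star> g" "f \<oplus>\<^bsub>free_alg n\<^esub> g = f + g" "\<one>\<^bsub>free_alg n\<^esub> = Poly_Mapping.single [] 1" "\<zero>\<^bsub>free_alg n\<^esub> = 0"
  by (simp_all add: free_alg_def)

lemma in_free_alg: "f \<in> carrier (free_alg n) \<longleftrightarrow> (\<forall>w\<in>Poly_Mapping.keys f. set w \<subseteq> {..<n})"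
  by (simp add: free_alg_def)

lemma single_free_alg: "set w \<subseteq> {..<n} \<Longrightarrow> Poly_Mapping.single w a \<in> carrier (free_alg n)"
  by (simp add: in_free_alg)

lemma add_free_alg: "f \<in> carrier (free_alg n) \<Longrightarrow> g \<in> carrier (free_alg n) \<Longrightarrow> f + g \<in> carrier (free_alg n)"
  and mult_free_alg: "f \<in> carrier (free_alg n) \<Longrightarrow> g \<in> carrier (free_alg n) \<Longrightarrow> f \<star> g \<in> carrier (free_alg n)"
  and zero_free_alg: "0 \<in> carrier (free_alg n)"
  using ring.ring_simprules[OF ring_free_alg[of n]] by (auto simp: free_alg_simps)

lemma uminus_free_alg: "f \<in> carrier (free_alg n) \<Longrightarrow> - f \<in> carrier (free_alg n)"
  by (simp add: in_free_alg)

lemma diff_free_alg: "f \<in> carrier (free_alg n) \<Longrightarrow> g \<in> carrier (free_alg n) \<Longrightarrow> f - g \<in> carrier (free_alg n)"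
  using add_free_alg[OF _ uminus_free_alg[of g n], of f] by simp

lemma sum_free_alg: "(\<And>i. i \<in> S \<Longrightarrow> f i \<in> carrier (free_alg n)) \<Longrightarrow> (\<Sum>i\<in>S. f i) \<in> carrier (free_alg n)"
  by (induction S rule: infinite_finite_induct) (auto intro: add_free_alg zero_free_alg)

lemma gen_free_alg: "i < n \<Longrightarrow> gen i \<in> carrier (free_alg n)"
  by (simp add: gen_def single_free_alg)

lemma scale_free_alg: "f \<in> carrier (free_alg n) \<Longrightarrow> c \<odot> f \<in> carrier (free_alg n)"
  by (simp add: fscale_eq mult_free_alg single_free_alg)

locale presentation =
  fixes ds :: "nat list" and R :: "'r::comm_ring_1 falg set"
  assumes R_carrier: "R \<subseteq> carrier (free_alg (length ds))"
begin

abbreviation "A \<equiv> free_alg (length ds) :: 'r falg ring"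
abbreviation "q \<equiv> quot_elem ds R"

definition comms :: "'r falg set" where
  "comms = {gen i \<star> gen j - (- 1) ^ (ds ! i * ds ! j) \<odot> (gen j \<star> gen i) | i j.
          i < length ds \<and> j < length ds}"

lemma comms_A: "comms \<subseteq> carrier A"
  by (auto simp: comms_def intro!: diff_free_alg mult_free_alg gen_free_alg scale_free_alg)

lemma minus_A: "f \<in> carrier A \<Longrightarrow> g \<in> carrier A \<Longrightarrow> f \<ominus>\<^bsub>A\<^esub> g = f - g"
proof -
  assume f: "f \<in> carrier A" and g: "g \<in> carrier A"
  interpret A: ring A by (rule ring_free_alg)
  have "\<ominus>\<^bsub>A\<^esub> g = - g"
    by (rule A.minus_equality) (use g uminus_free_alg in \<open>auto simp: free_alg_simps\<close>)
  then show ?thesis by (simp add: a_minus_def free_alg_simps)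
qed

lemma ring_A: "ring A"
  by (rule ring_free_alg)

lemma ideal_gca: "ideal (gca_ideal ds) A"
  unfolding gca_ideal_def using comms_A unfolding comms_def by (rule ring.genideal_ideal[OF ring_A])

lemma ring_gca: "ring (gca ds :: 'r falg set ring)"
  unfolding gca_def by (rule ideal.quotient_is_ring[OF ideal_gca])

lemma gca_elem_hom: "gca_elem ds \<in> Ring.ring_hom A (gca ds)"
  using ideal.rcos_ring_hom[OF ideal_gca] by (simp add: gca_def gca_elem_def[abs_def])

lemma gca_elem_R: "gca_elem ds ` R \<subseteq> carrier (gca ds)"
  using gca_elem_hom R_carrier by (auto simp: Ring.ring_hom_def)

lemma ideal_rel: "ideal (rel_ideal ds R) (gca ds)"
  unfolding rel_ideal_def by (rule ring.genideal_ideal[OF ring_gca gca_elem_R])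

lemma ring_quot: "ring (gca_quot ds R)"
  unfolding gca_quot_def by (rule ideal.quotient_is_ring[OF ideal_rel])

lemma q_hom: "q \<in> Ring.ring_hom A (gca_quot ds R)"
proof -
  have "(+>\<^bsub>gca ds\<^esub>) (rel_ideal ds R) \<circ> gca_elem ds \<in> Ring.ring_hom A (gca_quot ds R)"
    unfolding gca_quot_def using ring_hom_trans[OF gca_elem_hom ideal.rcos_ring_hom[OF ideal_rel]] .
  moreover have "(+>\<^bsub>gca ds\<^esub>) (rel_ideal ds R) \<circ> gca_elem ds = q"
    by (simp add: fun_eq_iff quot_elem_def)
  ultimately show ?thesis by simp
qed

lemma q_carrier: "carrier (gca_quot ds R) = q ` carrier A"
  by (auto simp: gca_quot_def FactRing_def A_RCOSETS_def' gca_def gca_elem_def[abs_def] quot_elem_def[abs_def])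

lemma q_add: "f \<in> carrier A \<Longrightarrow> g \<in> carrier A \<Longrightarrow> q (f + g) = q f \<oplus>\<^bsub>gca_quot ds R\<^esub> q g"
  and q_mult: "f \<in> carrier A \<Longrightarrow> g \<in> carrier A \<Longrightarrow> q (f \<star> g) = q f \<otimes>\<^bsub>gca_quot ds R\<^esub> q g"
  and q_one: "q (Poly_Mapping.single [] 1) = \<one>\<^bsub>gca_quot ds R\<^esub>"
  and q_in: "f \<in> carrier A \<Longrightarrow> q f \<in> carrier (gca_quot ds R)"
  using q_hom by (auto simp: Ring.ring_hom_def free_alg_simps)

text \<open>The kernel of the map from the free algebra to the iterated quotient; working with it
  replaces cosets of cosets by congruences between words.\<close>

definition relj :: "'r falg set" where
  "relj = {f \<in> carrier A. q f = q 0}"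

lemma q_zero: "q 0 = \<zero>\<^bsub>gca_quot ds R\<^esub>"
proof -
  interpret Q: ring "gca_quot ds R" by (rule ring_quot)
  have "q 0 \<oplus>\<^bsub>gca_quot ds R\<^esub> q 0 = q 0" using q_add[OF zero_free_alg zero_free_alg] by simp
  then show ?thesis using q_in[OF zero_free_alg] by (metis Q.add.l_cancel_one')
qed

lemma relj_sub: "f \<in> relj \<Longrightarrow> f \<in> carrier A"
  by (simp add: relj_def)

lemma q_eq_iff:
  assumes f: "f \<in> carrier A" and g: "g \<in> carrier A"
  shows "q f = q g \<longleftrightarrow> f - g \<in> relj"
proof -
  interpret Q: ring "gca_quot ds R" by (rule ring_quot)
  note d = diff_free_alg[OF f g]
  have e: "q f = q (f - g) \<oplus>\<^bsub>gca_quot ds R\<^esub> q g" using q_add[OF d g] by simp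
  show ?thesis
  proof
    assume "q f = q g"
    then have "q (f - g) \<oplus>\<^bsub>gca_quot ds R\<^esub> q g = \<zero>\<^bsub>gca_quot ds R\<^esub> \<oplus>\<^bsub>gca_quot ds R\<^esub> q g"
      using e q_in[OF g] by simp
    then show "f - g \<in> relj" using d q_in[OF g] q_in[OF d] by (simp add: relj_def q_zero)
  next
    assume "f - g \<in> relj"
    then show "q f = q g" using e q_in[OF g] by (simp add: relj_def q_zero)
  qed
qed

lemma relj_zero: "0 \<in> relj"
  by (simp add: relj_def zero_free_alg)

lemma relj_add: "f \<in> relj \<Longrightarrow> g \<in> relj \<Longrightarrow> f + g \<in> relj"
  by (auto simp: relj_def add_free_alg q_add simp flip: q_add[OF zero_free_alg zero_free_alg])

lemma relj_mult_left: "f \<in> relj \<Longrightarrow> g \<in> carrier A \<Longrightarrow> g \<star> f \<in> relj"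
  and relj_mult_right: "f \<in> relj \<Longrightarrow> g \<in> carrier A \<Longrightarrow> f \<star> g \<in> relj"
  by (auto simp: relj_def mult_free_alg q_mult zero_free_alg simp flip: q_mult[OF _ zero_free_alg] q_mult[OF zero_free_alg])

lemma relj_R: "R \<subseteq> relj"
proof
  fix r assume r: "r \<in> R"
  have "gca_elem ds r \<in> rel_ideal ds R"
    unfolding rel_ideal_def using ring.genideal_self[OF ring_gca gca_elem_R] r by auto
  then have "q r = rel_ideal ds R"
    unfolding quot_elem_def by (rule ring.a_rcos_zero[OF ring_gca ideal_rel])
  moreover have "\<zero>\<^bsub>gca_quot ds R\<^esub> = rel_ideal ds R" by (simp add: gca_quot_def FactRing_def)
  ultimately show "r \<in> relj" using r R_carrier by (auto simp: relj_def q_zero)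
qed

lemma relj_comms: "comms \<subseteq> relj"
proof
  fix r assume r: "r \<in> comms"
  then have rA: "r \<in> carrier A" using comms_A by auto
  have "r \<in> gca_ideal ds"
    unfolding gca_ideal_def using ring.genideal_self[OF ring_A comms_A] r by (auto simp: comms_def)
  moreover have "(0 :: 'r falg) \<in> gca_ideal ds"
    using additive_subgroup.zero_closed[OF ideal.axioms(1)[OF ideal_gca]] by (simp add: free_alg_simps)
  ultimately have "gca_elem ds r = gca_elem ds 0"
    unfolding gca_elem_def by (simp add: ring.a_rcos_zero[OF ring_A ideal_gca])
  then show "r \<in> relj" using rA by (simp add: relj_def quot_elem_def)
qed

text \<open>The kernel K of \<eta> is an ideal of the free algebra. It contains the ideal of graded
  commutators, and its image in \<open>gca ds\<close> is an ideal that contains the relations. Thus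
  \<open>gca_elem ds f\<close> is the image of some k in K, and f - k is in the commutator
  ideal.\<close>

lemma factor:
  assumes add: "\<And>f g. f \<in> carrier A \<Longrightarrow> g \<in> carrier A \<Longrightarrow> \<eta> (f + g) = \<eta> f \<oplus>\<^bsub>S\<^esub> \<eta> g"
    and mult: "\<And>f g. f \<in> carrier A \<Longrightarrow> g \<in> carrier A \<Longrightarrow> \<eta> (f \<star> g) = \<eta> f \<otimes>\<^bsub>S\<^esub> \<eta> g"
    and comm: "\<And>r. r \<in> comms \<Longrightarrow> \<eta> r = \<eta> 0"
    and rel: "\<And>r. r \<in> R \<Longrightarrow> \<eta> r = \<eta> 0"
    and f: "f \<in> relj"
  shows "\<eta> f = \<eta> 0"
proof -
  define K where "K = {f \<in> carrier A. \<eta> f = \<eta> 0}"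
  have K_add: "f + g \<in> K" if "f \<in> K" "g \<in> K" for f g
    using that add[of f g] add[OF zero_free_alg zero_free_alg] by (simp add: K_def add_free_alg)
  have K_l: "g \<star> f \<in> K" and K_r: "f \<star> g \<in> K" if "f \<in> K" "g \<in> carrier A" for f g
    using that mult[of f g] mult[of g f] mult[OF zero_free_alg, of g] mult[OF _ zero_free_alg, of g]
    by (simp_all add: K_def mult_free_alg)
  have K_neg: "- f \<in> K" if "f \<in> K" for f
  proof -
    have fA: "f \<in> carrier A" and e: "\<eta> f = \<eta> 0" using that by (auto simp: K_def)
    \<comment> \<open>Nothing is known about inverses in S. But f and 0 have the same image, so
      adding f instead of 0 to - f does not change the value.\<close>
    have "\<eta> (- f) = \<eta> (- f) \<oplus>\<^bsub>S\<^esub> \<eta> 0" using add[OF uminus_free_alg[OF fA] zero_free_alg] by simp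
    also have "\<dots> = \<eta> (- f + f)" using add[OF uminus_free_alg[OF fA] fA] e by simp
    finally show ?thesis using fA by (simp add: K_def uminus_free_alg)
  qed
  interpret A: ring A by (rule ring_A)
  have idK: "ideal K A"
  proof (rule idealI[OF ring_A])
    show "subgroup K (add_monoid A)"
    proof
      show "K \<subseteq> carrier (add_monoid A)" by (auto simp: K_def)
      show "x \<otimes>\<^bsub>add_monoid A\<^esub> y \<in> K" if "x \<in> K" "y \<in> K" for x y using K_add that by (simp add: free_alg_simps)
      show "\<one>\<^bsub>add_monoid A\<^esub> \<in> K" by (simp add: free_alg_simps K_def zero_free_alg)
      show "inv\<^bsub>add_monoid A\<^esub> x \<in> K" if "x \<in> K" for x
      proof -
        have "\<ominus>\<^bsub>A\<^esub> x = - x"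
          by (rule A.minus_equality) (use that uminus_free_alg in \<open>auto simp: free_alg_simps K_def\<close>)
        then show ?thesis using K_neg[OF that] by (simp add: a_inv_def)
      qed
    qed
  qed (use K_l K_r in \<open>auto simp: free_alg_simps\<close>)
  have I_sub: "gca_ideal ds \<subseteq> K"
    unfolding gca_ideal_def
    by (rule A.genideal_minimal[OF idK]) (use comm comms_A in \<open>auto simp: K_def comms_def\<close>)
  have "ideal (gca_elem ds ` K) (gca ds)"
    using A.ring_ideal_imp_quot_ideal[OF ideal_gca idK] by (simp add: gca_def gca_elem_def[abs_def])
  then have rel_sub: "rel_ideal ds R \<subseteq> gca_elem ds ` K"
    unfolding rel_ideal_def
    by (rule ring.genideal_minimal[OF ring_gca]) (use rel R_carrier in \<open>auto simp: K_def\<close>)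
  have fA: "f \<in> carrier A" using f by (rule relj_sub)
  have "q f = rel_ideal ds R"
    using f by (simp add: relj_def q_zero) (simp add: gca_quot_def FactRing_def)
  moreover have "gca_elem ds f \<in> carrier (gca ds)" using gca_elem_hom fA by (auto simp: Ring.ring_hom_def)
  ultimately have "gca_elem ds f \<in> rel_ideal ds R"
    using ideal.rcos_const_imp_mem[OF ideal_rel] by (simp add: quot_elem_def)
  then obtain k where k: "k \<in> K" "gca_elem ds f = gca_elem ds k" using rel_sub by auto
  then have kA: "k \<in> carrier A" by (simp add: K_def)
  have "f - k \<in> gca_ideal ds"
    using A.quotient_eq_iff_same_a_r_cos[OF ideal_gca fA kA] k(2) by (simp add: minus_A fA kA gca_elem_def)
  then have "f - k + k \<in> K" using I_sub K_add k(1) by blast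
  then show ?thesis by (simp add: K_def)
qed

text \<open>Injectivity comes from the normal forms N: every element is congruent to one of them,
  and \<eta> separates them. So the kernel of \<eta> never has to be computed.\<close>

lemma quot_iso:
  assumes surj: "\<eta> ` carrier A = carrier S"
    and add: "\<And>f g. f \<in> carrier A \<Longrightarrow> g \<in> carrier A \<Longrightarrow> \<eta> (f + g) = \<eta> f \<oplus>\<^bsub>S\<^esub> \<eta> g"
    and mult: "\<And>f g. f \<in> carrier A \<Longrightarrow> g \<in> carrier A \<Longrightarrow> \<eta> (f \<star> g) = \<eta> f \<otimes>\<^bsub>S\<^esub> \<eta> g"
    and one: "\<eta> (Poly_Mapping.single [] 1) = \<one>\<^bsub>S\<^esub>"
    and comm: "\<And>r. r \<in> comms \<Longrightarrow> \<eta> r = \<eta> 0"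
    and rel: "\<And>r. r \<in> R \<Longrightarrow> \<eta> r = \<eta> 0"
    and nf: "\<And>f. f \<in> carrier A \<Longrightarrow> \<exists>g\<in>N. g \<in> carrier A \<and> f - g \<in> relj"
    and inj: "inj_on \<eta> N"
  shows "\<exists>\<phi>\<in>ring_iso (gca_quot ds R) S. \<forall>f\<in>carrier A. \<phi> (q f) = \<eta> f"
proof -
  have welldef: "\<eta> f = \<eta> g" if f: "f \<in> carrier A" and g: "g \<in> carrier A" and qe: "q f = q g" for f g
  proof -
    have d: "f - g \<in> relj" using q_eq_iff f g qe by simp
    have "\<eta> (f - g) = \<eta> 0" by (rule factor[OF add mult comm rel d])
    then have "\<eta> (f - g) \<oplus>\<^bsub>S\<^esub> \<eta> g = \<eta> 0 \<oplus>\<^bsub>S\<^esub> \<eta> g" by simp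
    then show ?thesis using add[OF diff_free_alg[OF f g] g] add[OF zero_free_alg g] by simp
  qed
  have inj': "q f = q g" if f: "f \<in> carrier A" and g: "g \<in> carrier A" and e: "\<eta> f = \<eta> g" for f g
  proof -
    obtain f' g' where *: "f' \<in> N" "f' \<in> carrier A" "f - f' \<in> relj" "g' \<in> N" "g' \<in> carrier A" "g - g' \<in> relj"
      using nf f g by meson
    then have qq: "q f = q f'" "q g = q g'" using q_eq_iff f g by auto
    then have "\<eta> f' = \<eta> g'" using welldef[OF f *(2)] welldef[OF g *(5)] e by simp
    then have "f' = g'" using inj * by (auto simp: inj_on_def)
    then show ?thesis using qq by simp
  qed
  define \<phi> where "\<phi> X = \<eta> (SOME f. f \<in> carrier A \<and> q f = X)" for X
  have \<phi>: "\<phi> (q f) = \<eta> f" if "f \<in> carrier A" for f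
  proof -
    have "(SOME g. g \<in> carrier A \<and> q g = q f) \<in> carrier A \<and> q (SOME g. g \<in> carrier A \<and> q g = q f) = q f"
      by (rule someI[of "\<lambda>g. g \<in> carrier A \<and> q g = q f" f]) (simp add: that)
    then show ?thesis unfolding \<phi>_def using welldef that by blast
  qed
  have "\<phi> \<in> Ring.ring_hom (gca_quot ds R) S"
  proof (rule ring_hom_memI)
    fix x y assume "x \<in> carrier (gca_quot ds R)" "y \<in> carrier (gca_quot ds R)"
    then obtain f g where fg: "f \<in> carrier A" "g \<in> carrier A" "x = q f" "y = q g" by (auto simp: q_carrier)
    show "\<phi> x \<in> carrier S" using fg \<phi> surj by auto
    show "\<phi> (x \<otimes>\<^bsub>gca_quot ds R\<^esub> y) = \<phi> x \<otimes>\<^bsub>S\<^esub> \<phi> y"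
      using fg \<phi> mult by (simp add: q_mult[symmetric] mult_free_alg)
    show "\<phi> (x \<oplus>\<^bsub>gca_quot ds R\<^esub> y) = \<phi> x \<oplus>\<^bsub>S\<^esub> \<phi> y"
      using fg \<phi> add by (simp add: q_add[symmetric] add_free_alg)
  next
    show "\<phi> \<one>\<^bsub>gca_quot ds R\<^esub> = \<one>\<^bsub>S\<^esub>" using \<phi>[of "Poly_Mapping.single [] 1"] one by (simp add: q_one single_free_alg)
  qed
  moreover have "bij_betw \<phi> (carrier (gca_quot ds R)) (carrier S)"
    unfolding bij_betw_def
  proof
    show "inj_on \<phi> (carrier (gca_quot ds R))"
    proof (rule inj_onI)
      fix x y assume "x \<in> carrier (gca_quot ds R)" "y \<in> carrier (gca_quot ds R)" and e: "\<phi> x = \<phi> y"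
      then obtain f g where fg: "f \<in> carrier A" "g \<in> carrier A" "x = q f" "y = q g" by (auto simp: q_carrier)
      with e have "\<eta> f = \<eta> g" by (simp add: \<phi>)
      then show "x = y" using inj'[OF fg(1,2)] fg by simp
    qed
    have "\<phi> ` q ` carrier A = \<eta> ` carrier A" unfolding image_image by (rule image_cong) (simp_all add: \<phi>)
    then show "\<phi> ` carrier (gca_quot ds R) = carrier S" by (simp add: q_carrier surj)
  qed
  ultimately have "\<phi> \<in> ring_iso (gca_quot ds R) S" by (simp add: ring_iso_def)
  then show ?thesis using \<phi> by blast
qed

section \<open>Rewriting words modulo the relations\<close>

definition reduces :: "nat list set \<Rightarrow> 'r falg \<Rightarrow> bool" where
  "reduces B f \<longleftrightarrow> (\<exists>c. f - lin B c \<in> relj)"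

abbreviation "wd w \<equiv> Poly_Mapping.single w (1::'r)"

lemma reduces_add: "reduces B f \<Longrightarrow> reduces B g \<Longrightarrow> reduces B (f + g)"
  unfolding reduces_def
proof (elim exE)
  fix c d assume "f - lin B c \<in> relj" "g - lin B d \<in> relj"
  from relj_add[OF this] have "f + g - lin B (\<lambda>b. c b + d b) \<in> relj" by (simp add: lin_add algebra_simps)
  then show "\<exists>c. f + g - lin B c \<in> relj" by blast
qed

lemma reduces_scale: "reduces B f \<Longrightarrow> reduces B (Poly_Mapping.single [] k \<star> f)"
  unfolding reduces_def
proof (elim exE)
  fix c assume "f - lin B c \<in> relj"
  then have "Poly_Mapping.single [] k \<star> (f - lin B c) \<in> relj" by (rule relj_mult_left) (simp add: single_free_alg)
  then have "Poly_Mapping.single [] k \<star> f - lin B (\<lambda>b. k * c b) \<in> relj" by (simp add: fmult_diff_right lin_scale)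
  then show "\<exists>c. Poly_Mapping.single [] k \<star> f - lin B c \<in> relj" by blast
qed

lemma reduces_relj: "g \<in> relj \<Longrightarrow> reduces B g"
  unfolding reduces_def by (rule exI[of _ "\<lambda>b. 0"]) (simp add: lin_def)

lemma reduces_cong: "f - g \<in> relj \<Longrightarrow> reduces B g \<Longrightarrow> reduces B f"
  using reduces_add[OF reduces_relj[of "f - g" B], of g] by simp

lemma reduces_basis:
  assumes "finite B" "w \<in> B"
  shows "reduces B (wd w)"
proof -
  have "lin B (\<lambda>b. if b = w then 1 else 0) = wd w"
    using assms by (simp add: lin_def if_distrib[of "Poly_Mapping.single _"] cong: if_cong)
  then show ?thesis
    unfolding reduces_def using relj_zero by (intro exI[of _ "\<lambda>b. if b = w then 1 else 0"]) simp
qed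

lemma reduces_sum: "(\<And>i. i \<in> I \<Longrightarrow> reduces B (f i)) \<Longrightarrow> reduces B (\<Sum>i\<in>I. f i)"
  by (induction I rule: infinite_finite_induct) (auto intro: reduces_add reduces_relj relj_zero)

text \<open>Insertion sort: each exchange costs the sign of graded commutativity. A repeated letter
  makes the word vanish; this is covered by c = 0 with the strictly sorted word that is already
  there.\<close>

lemma insort_word:
  assumes sq: "\<And>i. i < length ds \<Longrightarrow> wd [i, i] \<in> relj"
    and i: "i < length ds" and v: "sorted_wrt (<) v" "set v \<subseteq> {..<length ds}"
  shows "\<exists>c u. sorted_wrt (<) u \<and> set u = insert i (set v) \<and> wd (i # v) - Poly_Mapping.single u c \<in> relj"
  using v
proof (induction v)
  case Nil
  then show ?case using relj_zero by (intro exI[of _ 1] exI[of _ "[i]"]) simp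
next
  case (Cons j v)
  consider "i < j" | "i = j" | "j < i" by linarith
  then show ?case
  proof cases
    case 1
    then have "sorted_wrt (<) (i # j # v)" using Cons.prems by auto
    then show ?thesis using relj_zero by (intro exI[of _ 1] exI[of _ "i # j # v"]) simp
  next
    case 2
    have "wd [i, i] \<star> wd v \<in> relj" using Cons.prems by (intro relj_mult_right sq i single_free_alg) auto
    then have "wd (i # j # v) - Poly_Mapping.single (j # v) 0 \<in> relj" using 2 by (simp add: fmult_single)
    then show ?thesis using Cons.prems 2 by (intro exI[of _ 0] exI[of _ "j # v"]) auto
  next
    case 3
    have j: "j < length ds" and vA: "set v \<subseteq> {..<length ds}" using Cons.prems by auto
    obtain c u where cu: "sorted_wrt (<) u" "set u = insert i (set v)" "wd (i # v) - Poly_Mapping.single u c \<in> relj"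
      using Cons by auto
    let ?s = "(- 1) ^ (ds ! i * ds ! j) :: 'r"
    have "gen i \<star> gen j - ?s \<odot> (gen j \<star> gen i) \<in> comms" using i j by (auto simp: comms_def)
    then have "(wd [i, j] - Poly_Mapping.single [j, i] ?s) \<star> wd v \<in> relj"
      using relj_comms vA by (intro relj_mult_right single_free_alg) (auto simp: gen_def fmult_single fscale_single)
    then have 1: "wd (i # j # v) - Poly_Mapping.single (j # i # v) ?s \<in> relj" by (simp add: fmult_diff_left fmult_single)
    have "Poly_Mapping.single [j] ?s \<star> (wd (i # v) - Poly_Mapping.single u c) \<in> relj"
      by (rule relj_mult_left[OF cu(3)]) (use j in \<open>auto intro: single_free_alg\<close>)
    then have 2: "Poly_Mapping.single (j # i # v) ?s - Poly_Mapping.single (j # u) (?s * c) \<in> relj"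
      by (simp add: fmult_diff_right fmult_single)
    have "wd (i # j # v) - Poly_Mapping.single (j # u) (?s * c) \<in> relj" using relj_add[OF 1 2] by simp
    moreover have "sorted_wrt (<) (j # u)" using cu 3 Cons.prems by auto
    moreover have "set (j # u) = insert i (set (j # v))" using cu by auto
    ultimately show ?thesis by blast
  qed
qed

lemma sort_word:
  assumes sq: "\<And>i. i < length ds \<Longrightarrow> wd [i, i] \<in> relj"
    and w: "set w \<subseteq> {..<length ds}"
  shows "\<exists>c u. sorted_wrt (<) u \<and> set u \<subseteq> {..<length ds} \<and> wd w - Poly_Mapping.single u c \<in> relj"
  using w
proof (induction w)
  case Nil
  then show ?case using relj_zero by (intro exI[of _ 1] exI[of _ "[]"]) simp
next
  case (Cons i w)
  then obtain c u where cu: "sorted_wrt (<) u" "set u \<subseteq> {..<length ds}" "wd w - Poly_Mapping.single u c \<in> relj"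
    by auto
  have i: "i < length ds" using Cons.prems by auto
  obtain c' u' where cu': "sorted_wrt (<) u'" "set u' = insert i (set u)" "wd (i # u) - Poly_Mapping.single u' c' \<in> relj"
    using insort_word[OF sq i cu(1,2)] by blast
  have "wd [i] \<star> (wd w - Poly_Mapping.single u c) \<in> relj"
    by (rule relj_mult_left[OF cu(3)]) (use i in \<open>auto intro: single_free_alg\<close>)
  then have 1: "wd (i # w) - Poly_Mapping.single (i # u) c \<in> relj" by (simp add: fmult_diff_right fmult_single)
  have "Poly_Mapping.single [] c \<star> (wd (i # u) - Poly_Mapping.single u' c') \<in> relj"
    by (rule relj_mult_left[OF cu'(3)]) (auto intro: single_free_alg)
  then have 2: "Poly_Mapping.single (i # u) c - Poly_Mapping.single u' (c * c') \<in> relj" by (simp add: fmult_diff_right fmult_single)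
  have "wd (i # w) - Poly_Mapping.single u' (c * c') \<in> relj" using relj_add[OF 1 2] by simp
  then show ?case using cu cu' i by (intro exI[of _ "c * c'"] exI[of _ u']) auto
qed

text \<open>Strictly sorted words correspond to the sets of generators, that is, to the filters of
  \<open>[0..<length ds]\<close>. Since every word is a multiple of one of these modulo the
  relations, finitely many words decide the matter.\<close>

lemma reduces_all:
  assumes sq: "\<And>i. i < length ds \<Longrightarrow> gen i \<star> gen i \<in> R"
    and red: "\<And>P. reduces B (wd (filter P [0..<length ds]))"
    and f: "f \<in> carrier A"
  shows "reduces B f"
proof -
  have sq': "wd [i, i] \<in> relj" if "i < length ds" for i
    using subsetD[OF relj_R sq[OF that]] by (simp add: gen_def fmult_single)
  have word: "reduces B (wd w)" if "set w \<subseteq> {..<length ds}" for w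
  proof -
    obtain c u where cu: "sorted_wrt (<) u" "set u \<subseteq> {..<length ds}" "wd w - Poly_Mapping.single u c \<in> relj"
      using sort_word[OF sq' \<open>set w \<subseteq> _\<close>] by blast
    have "u = filter (\<lambda>i. i \<in> set u) [0..<length ds]"
    proof (rule sorted_distinct_set_unique)
      show "sorted u" "distinct u" using cu(1) by (auto simp: strict_sorted_iff)
      show "set u = set (filter (\<lambda>i. i \<in> set u) [0..<length ds])" using cu(2) by auto
    qed (simp_all add: sorted_filter[of id, simplified])
    then have "reduces B (wd u)" using red by metis
    then have "reduces B (Poly_Mapping.single [] c \<star> wd u)" by (rule reduces_scale)
    then show ?thesis using reduces_cong[OF cu(3)] by (simp add: fmult_single)
  qed
  have "reduces B (\<Sum>w\<in>Poly_Mapping.keys f. Poly_Mapping.single [] (Poly_Mapping.lookup f w) \<star> wd w)"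
    using f by (intro reduces_sum reduces_scale word) (auto simp: in_free_alg)
  then show ?thesis by (subst falg_expand) (simp add: fmult_single)
qed

lemma reduces_zero_pair:
  assumes "gen i \<star> gen j \<in> R" "set (u @ v) \<subseteq> {..<length ds}"
  shows "reduces B (wd (u @ i # j # v))"
proof (rule reduces_relj)
  have "wd u \<star> (gen i \<star> gen j) \<star> wd v \<in> relj"
    using assms relj_R by (intro relj_mult_right[OF relj_mult_left] single_free_alg) auto
  then show "wd (u @ i # j # v) \<in> relj" by (simp add: gen_def fmult_single)
qed

lemma reduces_replace:
  assumes "gen i \<star> gen j - c \<odot> wd w \<in> R" "set (u @ v) \<subseteq> {..<length ds}" "reduces B (wd (u @ w @ v))"
  shows "reduces B (wd (u @ i # j # v))"
proof -
  have "wd u \<star> (gen i \<star> gen j - c \<odot> wd w) \<star> wd v \<in> relj"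
    using assms relj_R by (intro relj_mult_right[OF relj_mult_left] single_free_alg) auto
  then have "wd (u @ i # j # v) - Poly_Mapping.single [] c \<star> wd (u @ w @ v) \<in> relj"
    by (simp add: gen_def fmult_single fscale_single fmult_diff_right fmult_diff_left)
  then show ?thesis using reduces_scale[OF assms(3)] by (rule reduces_cong)
qed

end

section \<open>Presenting the cohomology ring\<close>

definition hg :: "nat \<Rightarrow> (cell \<Rightarrow> 'r::comm_ring_1) \<Rightarrow> bool" where
  "hg n F \<longleftrightarrow> (\<forall>c. cdim c \<noteq> n \<longrightarrow> F c = 0)"

lemma hg_pt_eq: "hg m F \<Longrightarrow> pt n F = (if m = n then F else 0)"
  by (auto simp: hg_def pt_def fun_eq_iff)

context gl2
begin

lemma dd_sum: "dd (\<lambda>c. \<Sum>i\<in>I. F i c) = (\<lambda>c. \<Sum>i\<in>I. dd (F i) c)"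
proof (induction I rule: infinite_finite_induct)
  case (insert i I)
  then have "dd (F i + (\<lambda>c. \<Sum>i\<in>I. F i c)) = dd (F i) + (\<lambda>c. \<Sum>i\<in>I. dd (F i) c)" by (simp only: dd_add)
  with insert show ?case by (simp add: plus_fun_def)
qed (simp_all add: zero_fun_def[symmetric])

lemma coh_sum: "(\<And>i. i \<in> I \<Longrightarrow> F i \<approx>\<^sub>c G i) \<Longrightarrow> (\<lambda>c. \<Sum>i\<in>I. F i c) \<approx>\<^sub>c (\<lambda>c. \<Sum>i\<in>I. G i c)"
proof (induction I rule: infinite_finite_induct)
  case (insert i I)
  then have "F i + (\<lambda>c. \<Sum>i\<in>I. F i c) \<approx>\<^sub>c G i + (\<lambda>c. \<Sum>i\<in>I. G i c)" by (intro coh_add) auto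
  with insert show ?case by (simp add: plus_fun_def)
qed simp_all

lemma prd_zero_left: "prd 0 G = 0"
  using prd_mult_left[of 0 0 G] by (simp add: zero_fun_def)

lemma prd_zero_right: "prd F 0 = 0"
  using prd_mult_right[of F 0 0] by (simp add: zero_fun_def)

lemma prd_sum_left: "prd (\<lambda>c. \<Sum>i\<in>I. F i c) G = (\<lambda>c. \<Sum>i\<in>I. prd (F i) G c)"
proof (induction I rule: infinite_finite_induct)
  case (insert i I)
  then have "prd (F i + (\<lambda>c. \<Sum>i\<in>I. F i c)) G = prd (F i) G + (\<lambda>c. \<Sum>i\<in>I. prd (F i) G c)" by (simp only: prd_add_left)
  with insert show ?case by (simp add: plus_fun_def)
qed (simp_all add: prd_zero_left zero_fun_def[symmetric])

lemma prd_sum_right: "prd F (\<lambda>c. \<Sum>i\<in>I. G i c) = (\<lambda>c. \<Sum>i\<in>I. prd F (G i) c)"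
proof (induction I rule: infinite_finite_induct)
  case (insert i I)
  then have "prd F (G i + (\<lambda>c. \<Sum>i\<in>I. G i c)) = prd F (G i) + (\<lambda>c. \<Sum>i\<in>I. prd F (G i) c)" by (simp only: prd_add_right)
  with insert show ?case by (simp add: plus_fun_def)
qed (simp_all add: prd_zero_right zero_fun_def[symmetric])

text \<open>The differential is homogeneous of degree 1. This lets the graded statement be extracted
  from spanning sets that mix degrees.\<close>

lemma coh_pt: "F \<approx>\<^sub>c G \<Longrightarrow> pt n F \<approx>\<^sub>c pt n G"
proof -
  assume "F \<approx>\<^sub>c G"
  then obtain K where K: "F = G + dd K" by (auto simp: coh_def)
  have e: "pt n (dd K) = dd (if n = 0 then 0 else pt (n - 1) K)"
  proof (cases n)
    case 0
    have "pt 0 (dd K) c = 0" for c by (cases c) (simp_all add: pt_def dd_simps)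
    then show ?thesis using 0 by (simp add: fun_eq_iff)
  qed (simp add: pt_dd)
  show ?thesis unfolding coh_def K pt_add e by blast
qed

lemma hg_MM: "is_hom U \<Longrightarrow> hg n F \<Longrightarrow> hg (Suc n) (MM U F)"
  unfolding hg_def
proof (intro allI impI)
  fix c assume U: "is_hom U" and F: "\<forall>c. cdim c \<noteq> n \<longrightarrow> F c = 0" and c: "cdim c \<noteq> Suc n"
  have F': "cdim c \<noteq> n \<Longrightarrow> F c = 0" for c using F by blast
  show "MM U F c = 0"
    using c F'[of X0] F'[of Y1] F'[of Y2] F'[of Y3] F'[of Z1] F'[of Z2] F'[of Z3]
    by (cases c) (simp_all add: MM_simps[OF U])
qed

lemma UF_hg: "hg n F \<Longrightarrow> n \<noteq> 1 \<Longrightarrow> UF F = (\<lambda>g. 0)"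
  by (simp add: hg_def UF_def fun_eq_iff)

lemma X0_hg: "hg n F \<Longrightarrow> n \<noteq> 0 \<Longrightarrow> F X0 = 0"
  by (simp add: hg_def)

lemma prd_deg1:
  assumes "hg 1 F" shows "prd F G = MM (UF F) G"
  using assms by (simp add: prd_def hg_pt_eq X0_hg MM_zero fun_eq_iff)

lemma prd_deg2:
  assumes "hg 2 F" shows "prd F G = (\<lambda>c. G X0 * F c) + MM (UF G) F"
  using assms by (simp add: prd_def hg_pt_eq X0_hg UF_hg MM_zero_hom fun_eq_iff)

lemma hg_zero: "hg n 0"
  by (simp add: hg_def)

lemma hg_prd:
  assumes F: "hg a F" "dd F = 0" and G: "hg b G" "dd G = 0" and a: "a = 1 \<or> a = 2"
  shows "hg (a + b) (prd F G)"
  using a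
proof
  assume "a = 1"
  then show ?thesis using hg_MM[OF is_hom_UF[OF F(2)] G(1)] F(1) by (simp add: prd_deg1)
next
  assume a: "a = 2"
  show ?thesis
  proof (cases "b = 1")
    case True
    then show ?thesis using hg_MM[OF is_hom_UF[OF G(2)] F(1)] G(1) F(1) a
      by (simp add: prd_deg2 X0_hg plus_fun_def numeral_3_eq_3)
  next
    case False
    then have U: "UF G = (\<lambda>g. 0)" using UF_hg G(1) by blast
    show ?thesis
    proof (cases "b = 0")
      case True
      then show ?thesis using F(1) a by (simp add: prd_deg2 U MM_zero_hom) (simp add: hg_def)
    next
      case False
      then have "prd F G = 0" using F(1) a X0_hg[OF G(1)] by (simp add: prd_deg2 U MM_zero_hom fun_eq_iff)
      then show ?thesis by (simp add: hg_zero)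
    qed
  qed
qed

text \<open>In degrees (1, 1) this is \<open>MM_swap_deg1\<close>. In degrees (1, 2) both products
  are the same moment, and in degrees (2, 2) both are 0.\<close>

lemma graded_commutative:
  assumes F: "hg a F" "dd F = 0" and G: "hg b G" "dd G = 0" and a: "a = 1 \<or> a = 2" and b: "b = 1 \<or> b = 2"
  shows "prd F G \<approx>\<^sub>c (\<lambda>c. (- 1) ^ (a * b) * prd G F c)"
proof -
  consider "a = 1" "b = 1" | "a = 1" "b = 2" | "a = 2" "b = 1" | "a = 2" "b = 2" using a b by blast
  then show ?thesis
  proof cases
    case 1
    have "MM (UF F) G + MM (UF G) F \<approx>\<^sub>c 0"
      using MM_swap_deg1[OF F(2) G(2)] F(1) G(1) 1 by (simp add: hg_pt_eq)
    then have "MM (UF F) G \<approx>\<^sub>c 0 - MM (UF G) F" by (rule coh_add_cancel)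
    moreover have "0 - MM (UF G) F = (\<lambda>c. - MM (UF G) F c)" by (simp add: fun_eq_iff)
    ultimately show ?thesis using 1 F(1) G(1) by (simp add: prd_deg1)
  next
    case 2
    then have "prd F G = MM (UF F) G" "prd G F = MM (UF F) G"
      using F(1) G(1) by (simp_all add: prd_deg1 prd_deg2 X0_hg fun_eq_iff)
    with 2 show ?thesis by simp
  next
    case 3
    then have "prd F G = MM (UF G) F" "prd G F = MM (UF G) F"
      using F(1) G(1) by (simp_all add: prd_deg1 prd_deg2 X0_hg fun_eq_iff)
    with 3 show ?thesis by simp
  next
    case 4
    then have "prd F G = 0" "prd G F = 0"
      using F(1) G(1) by (simp_all add: prd_deg2 X0_hg UF_hg MM_zero_hom fun_eq_iff)
    then show ?thesis by (simp add: zero_fun_def)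
  qed
qed

primrec pw :: "(nat \<Rightarrow> cell \<Rightarrow> 'r::comm_ring_1) \<Rightarrow> nat list \<Rightarrow> cell \<Rightarrow> 'r" where
  "pw gs [] = delta X0"
| "pw gs (i # w) = prd (gs i) (pw gs w)"

definition evw :: "(nat \<Rightarrow> cell \<Rightarrow> 'r::comm_ring_1) \<Rightarrow> 'r falg \<Rightarrow> cell \<Rightarrow> 'r" where
  "evw gs f = (\<lambda>c. fev (\<lambda>w. pw gs w c) f)"

lemma evw_add: "evw gs (f + g) = evw gs f + evw gs g"
  and evw_diff: "evw gs (f - g) = evw gs f - evw gs g"
  and evw_scale: "evw gs (k \<odot> f) = (\<lambda>c. k * evw gs f c)"
  and evw_single: "evw gs (Poly_Mapping.single w k) = (\<lambda>c. k * pw gs w c)"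
  and evw_zero: "evw gs 0 = 0"
  by (simp_all add: evw_def fun_eq_iff fev_add fev_diff fev_fscale fev_single)

lemma evw_lin: "evw gs (lin B c) = (\<lambda>x. \<Sum>b\<in>B. c b * pw gs b x)"
  by (simp add: evw_def fev_lin)

lemma evw_gen2: "dd (gs j) = 0 \<Longrightarrow> evw gs (gen i \<star> gen j) = prd (gs i) (gs j)"
  by (simp add: gen_def fmult_single evw_single prd_one_right)

lemma evw_gen: "dd (gs i) = 0 \<Longrightarrow> evw gs (gen i) = gs i"
  by (simp add: gen_def evw_single prd_one_right)

text \<open>If the products along the words of B form a basis of the cohomology and each sorted word
  reduces to B, then the linear combinations of B are normal forms that the evaluation of words
  separates, as \<open>quot_iso\<close> requires. Homogeneity of the generators makes the
  isomorphism graded.\<close>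

theorem coh_presentation:
  fixes gs :: "nat \<Rightarrow> cell \<Rightarrow> 'r::comm_ring_1"
  assumes R_carrier: "R \<subseteq> carrier (free_alg (length ds))"
    and ds: "\<And>i. i < length ds \<Longrightarrow> ds ! i = 1 \<or> ds ! i = 2"
    and gs: "\<And>i. i < length ds \<Longrightarrow> dd (gs i) = 0" and gs_hg: "\<And>i. i < length ds \<Longrightarrow> hg (ds ! i) (gs i)"
    and rel: "\<And>r. r \<in> R \<Longrightarrow> evw gs r \<approx>\<^sub>c 0"
    and sq: "\<And>i. i < length ds \<Longrightarrow> gen i \<star> gen i \<in> R"
    and red: "\<And>P. presentation.reduces ds R B (Poly_Mapping.single (filter P [0..<length ds]) 1)"
    and B: "\<And>b. b \<in> B \<Longrightarrow> set b \<subseteq> {..<length ds}"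
    and span: "\<And>F. dd F = 0 \<Longrightarrow> \<exists>c. F \<approx>\<^sub>c (\<lambda>x. \<Sum>b\<in>B. c b * pw gs b x)"
    and indep: "\<And>c b. (\<lambda>x. \<Sum>b\<in>B. c b * pw gs b x) \<approx>\<^sub>c 0 \<Longrightarrow> b \<in> B \<Longrightarrow> c b = 0"
  shows "\<exists>\<phi>\<in>graded_ring_isos ds R \<theta>. \<forall>i<length ds. \<phi> (quot_elem ds R (gen i)) = cl (gs i)"
proof -
  interpret presentation ds R by unfold_locales (rule R_carrier)
  have pw_dd: "dd (pw gs w) = 0" if "set w \<subseteq> {..<length ds}" for w
    using that by (induction w) (simp_all add: dd_delta_X0 dd_prd gs)
  have pw_hg: "hg (\<Sum>i\<leftarrow>w. ds ! i) (pw gs w)" if "set w \<subseteq> {..<length ds}" for w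
    using that
  proof (induction w)
    case Nil
    then show ?case by (simp add: hg_def delta_def)
  next
    case (Cons i w)
    then show ?case using hg_prd[OF gs_hg gs, of i _ "pw gs w"] ds[of i] pw_dd[of w] by simp
  qed
  have evw_sum: "evw gs f = (\<lambda>c. \<Sum>w\<in>Poly_Mapping.keys f. Poly_Mapping.lookup f w * pw gs w c)" for f
    by (simp add: evw_def fev_def)
  have evw_dd: "dd (evw gs f) = 0" if "f \<in> carrier A" for f
  proof -
    have "dd (evw gs f) = (\<lambda>c. \<Sum>w\<in>Poly_Mapping.keys f. Poly_Mapping.lookup f w * dd (pw gs w) c)"
      by (simp only: evw_sum dd_sum dd_mult)
    then show ?thesis using that pw_dd by (simp add: in_free_alg fun_eq_iff)
  qed
  \<comment> \<open>Since \<open>pw\<close> nests its products to the right, splitting a word in two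
    amounts to associativity, which holds only up to coboundaries.\<close>
  have pw_append: "pw gs (u @ v) \<approx>\<^sub>c prd (pw gs u) (pw gs v)"
    if "set u \<subseteq> {..<length ds}" "set v \<subseteq> {..<length ds}" for u v
    using that(1)
  proof (induction u)
    case Nil
    then show ?case by (simp add: prd_one_left)
  next
    case (Cons i u)
    then have i: "dd (gs i) = 0" and u: "dd (pw gs u) = 0" and v: "dd (pw gs v) = 0"
      using gs pw_dd that(2) by auto
    have 1: "prd (gs i) (pw gs (u @ v)) \<approx>\<^sub>c prd (gs i) (prd (pw gs u) (pw gs v))"
      by (rule prd_cong) (use Cons i u v dd_prd in auto)
    have 2: "prd (gs i) (prd (pw gs u) (pw gs v)) \<approx>\<^sub>c prd (prd (gs i) (pw gs u)) (pw gs v)"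
      by (rule coh_sym[OF prd_assoc[OF i u v]])
    show ?case using coh_trans[OF 1 2] by simp
  qed
  have evw_mult: "evw gs (f \<star> g) \<approx>\<^sub>c prd (evw gs f) (evw gs g)" if f: "f \<in> carrier A" and g: "g \<in> carrier A" for f g
  proof -
    let ?f = "Poly_Mapping.lookup f" and ?g = "Poly_Mapping.lookup g"
    have l: "evw gs (f \<star> g) = (\<lambda>c. \<Sum>u\<in>Poly_Mapping.keys f. \<Sum>v\<in>Poly_Mapping.keys g. ?f u * (?g v * pw gs (u @ v) c))"
      by (simp add: evw_def fev_fmult) (simp add: fev_def sum_distrib_left)
    have r: "prd (evw gs f) (evw gs g) =
        (\<lambda>c. \<Sum>u\<in>Poly_Mapping.keys f. \<Sum>v\<in>Poly_Mapping.keys g. ?f u * (?g v * prd (pw gs u) (pw gs v) c))"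
      by (simp only: evw_sum prd_sum_left prd_sum_right prd_mult_left prd_mult_right sum_distrib_left)
    show ?thesis unfolding l r
      by (intro coh_sum coh_mult pw_append) (use f g in \<open>auto simp: in_free_alg\<close>)
  qed
  have comm: "evw gs r \<approx>\<^sub>c 0" if rc: "r \<in> comms" for r
  proof -
    obtain i j where r: "r = gen i \<star> gen j - (- 1) ^ (ds ! i * ds ! j) \<odot> (gen j \<star> gen i)"
      and ij: "i < length ds" "j < length ds" using rc by (auto simp: comms_def)
    have "prd (gs i) (gs j) - (\<lambda>c. (- 1) ^ (ds ! i * ds ! j) * prd (gs j) (gs i) c) \<approx>\<^sub>c
        (\<lambda>c. (- 1) ^ (ds ! i * ds ! j) * prd (gs j) (gs i) c) - (\<lambda>c. (- 1) ^ (ds ! i * ds ! j) * prd (gs j) (gs i) c)"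
      by (rule coh_diff[OF graded_commutative[OF gs_hg gs gs_hg gs ds ds] coh_refl]) (use ij in auto)
    then show ?thesis by (simp add: r evw_diff evw_scale evw_gen2 gs ij)
  qed
  define \<eta> where "\<eta> f = cl (evw gs f)" for f
  define N :: "'r falg set" where "N = range (lin B)"
  have "\<exists>\<phi>\<in>ring_iso (gca_quot ds R) (cohomology \<theta>). \<forall>f\<in>carrier A. \<phi> (q f) = \<eta> f"
  proof (rule quot_iso)
    have lin_A: "lin B c \<in> carrier A" for c
      unfolding lin_def by (intro sum_free_alg single_free_alg B)
    show "\<eta> ` carrier A = carrier (cohomology \<theta>)"
    proof
      show "\<eta> ` carrier A \<subseteq> carrier (cohomology \<theta>)" using evw_dd by (auto simp: \<eta>_def coh_carrier)
      show "carrier (cohomology \<theta>) \<subseteq> \<eta> ` carrier A"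
      proof
        fix x :: "(chain \<Rightarrow> 'r) set" assume "x \<in> carrier (cohomology \<theta>)"
        then obtain F where F: "x = cl F" "dd F = 0" by (auto simp: coh_carrier)
        from span[OF F(2)] obtain c where "F \<approx>\<^sub>c evw gs (lin B c)" by (auto simp: evw_lin)
        then have "x = \<eta> (lin B c)" by (simp add: F \<eta>_def cl_eq_iff)
        then show "x \<in> \<eta> ` carrier A" using lin_A by blast
      qed
    qed
    show "\<eta> (f + g) = \<eta> f \<oplus>\<^bsub>cohomology \<theta>\<^esub> \<eta> g" for f g
      by (simp add: \<eta>_def coh_add_cl evw_add)
    show "\<eta> (f \<star> g) = \<eta> f \<otimes>\<^bsub>cohomology \<theta>\<^esub> \<eta> g" if "f \<in> carrier A" "g \<in> carrier A" for f g
      using evw_mult evw_dd that by (simp add: \<eta>_def coh_mult_cl cl_eq_iff)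
    show "\<eta> (Poly_Mapping.single [] 1) = \<one>\<^bsub>cohomology \<theta>\<^esub>"
      by (simp add: \<eta>_def coh_one_cl evw_single)
    show "\<eta> r = \<eta> 0" if "r \<in> comms" for r using comm[OF that] by (simp add: \<eta>_def cl_eq_iff evw_zero)
    show "\<eta> r = \<eta> 0" if "r \<in> R" for r using rel[OF that] by (simp add: \<eta>_def cl_eq_iff evw_zero)
    show "\<exists>g\<in>N. g \<in> carrier A \<and> f - g \<in> relj" if "f \<in> carrier A" for f
      using reduces_all[OF sq red that] lin_A by (auto simp: reduces_def N_def)
    show "inj_on \<eta> N"
    proof (rule inj_onI)
      fix f g assume "f \<in> N" "g \<in> N" and e: "\<eta> f = \<eta> g"
      then obtain c d where cd: "f = lin B c" "g = lin B d" by (auto simp: N_def)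
      have "evw gs f - evw gs g \<approx>\<^sub>c evw gs g - evw gs g"
        using e by (intro coh_diff) (simp_all add: \<eta>_def cl_eq_iff)
      then have "(\<lambda>x. \<Sum>b\<in>B. (c b - d b) * pw gs b x) \<approx>\<^sub>c 0"
        by (simp add: cd evw_lin fun_diff_def sum_subtractf left_diff_distrib)
      from indep[OF this] have "c b = d b" if "b \<in> B" for b using that by force
      then show "f = g" by (simp add: cd lin_def)
    qed
  qed
  then obtain \<phi> where \<phi>: "\<phi> \<in> ring_iso (gca_quot ds R) (cohomology \<theta>)" "\<And>f. f \<in> carrier A \<Longrightarrow> \<phi> (q f) = \<eta> f"
    by blast
  have grade: "\<phi> ` quot_deg ds R n = coh_deg \<theta> n" for n
  proof -
    define An where "An = {f \<in> carrier A. \<forall>w\<in>Poly_Mapping.keys f. (\<Sum>i\<leftarrow>w. ds ! i) = n}"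
    have "\<phi> ` quot_deg ds R n = \<eta> ` An"
      using \<phi>(2) by (force simp: quot_deg_def An_def image_image)
    also have "\<dots> = coh_deg \<theta> n"
    proof
      show "\<eta> ` An \<subseteq> coh_deg \<theta> n"
      proof
        fix x assume "x \<in> \<eta> ` An"
        then obtain f where f: "f \<in> An" "x = cl (evw gs f)" by (auto simp: \<eta>_def)
        have "evw gs f c = 0" if "cdim c \<noteq> n" for c
          unfolding evw_sum
        proof (intro sum.neutral ballI)
          fix w assume "w \<in> Poly_Mapping.keys f"
          then have "hg n (pw gs w)" using pw_hg[of w] f(1) by (auto simp: An_def in_free_alg)
          then show "Poly_Mapping.lookup f w * pw gs w c = 0" using that by (simp add: hg_def)
        qed
        then show "x \<in> coh_deg \<theta> n" using f evw_dd by (auto simp: coh_deg_cl An_def)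
      qed
      show "coh_deg \<theta> n \<subseteq> \<eta> ` An"
      proof
        fix x :: "(chain \<Rightarrow> 'r) set" assume "x \<in> coh_deg \<theta> n"
        then obtain F where F: "x = cl F" "dd F = 0" "hg n F" by (auto simp: coh_deg_cl hg_def)
        from span[OF F(2)] obtain c where c: "F \<approx>\<^sub>c (\<lambda>x. \<Sum>b\<in>B. c b * pw gs b x)" by blast
        \<comment> \<open>F is homogeneous of degree n, so taking degree n parts of the congruence
          leaves F as it is and deletes from the combination the words of other degrees.\<close>
        let ?c = "\<lambda>b. if (\<Sum>i\<leftarrow>b. ds ! i) = n then c b else 0"
        have "pt n F \<approx>\<^sub>c pt n (\<lambda>x. \<Sum>b\<in>B. c b * pw gs b x)" by (rule coh_pt[OF c])
        moreover have "pt n F = F" using F(3) by (simp add: hg_pt_eq)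
        moreover have "pt n (\<lambda>x. \<Sum>b\<in>B. c b * pw gs b x) = (\<lambda>x. \<Sum>b\<in>B. ?c b * pw gs b x)"
        proof
          fix x
          have "?c b * pw gs b x = (if cdim x = n then c b * pw gs b x else 0)" if "b \<in> B" for b
            using pw_hg[OF B[OF that]] by (auto simp: hg_def)
          then have "(\<Sum>b\<in>B. ?c b * pw gs b x) = (\<Sum>b\<in>B. if cdim x = n then c b * pw gs b x else 0)"
            by (intro sum.cong) auto
          then show "pt n (\<lambda>x. \<Sum>b\<in>B. c b * pw gs b x) x = (\<Sum>b\<in>B. ?c b * pw gs b x)"
            by (simp add: pt_def)
        qed
        ultimately have "F \<approx>\<^sub>c evw gs (lin B ?c)" by (simp add: evw_lin)
        then have "x = \<eta> (lin B ?c)" by (simp add: F \<eta>_def cl_eq_iff)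
        moreover have "lin B ?c \<in> An"
        proof -
          have keys: "Poly_Mapping.keys (lin B ?c) \<subseteq> {b \<in> B. (\<Sum>i\<leftarrow>b. ds ! i) = n}"
            unfolding lin_def using Poly_Mapping.keys_sum by (fastforce split: if_splits)
          show ?thesis using keys B by (fastforce simp: An_def in_free_alg)
        qed
        ultimately show "x \<in> \<eta> ` An" by blast
      qed
    qed
    finally show ?thesis .
  qed
  have "\<phi> \<in> graded_ring_isos ds R \<theta>" using \<phi>(1) grade by (simp add: graded_ring_isos_def)
  moreover have "\<phi> (q (gen i)) = cl (gs i)" if "i < length ds" for i
    using \<phi>(2)[OF gen_free_alg[OF that]] by (simp add: \<eta>_def evw_gen gs that)
  ultimately show ?thesis by blast
qed

end

section \<open>The individual cases\<close>

lemma hg_delta: "hg (cdim c) (delta c)"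
  by (auto simp: hg_def delta_def)

lemmas hg_gens = hg_delta[of Y1, simplified] hg_delta[of Y2, simplified] hg_delta[of Y3, simplified] hg_delta[of Z3, simplified]

section \<open>Sums over arithmetic progressions\<close>

lemma ssum_mult: "ssum (\<lambda>k. c * f k) m = c * ssum f m" for c :: "'r::comm_ring_1"
  by (rule ssum_unique[symmetric]) (simp_all add: ssum_Suc distrib_left)

text \<open>Gauss's formula, multiplied by 2 so that it holds in every commutative ring, and valid
  for negative m by the recursion.\<close>

lemma two_ssum_linear:
  "2 * ssum (\<lambda>k. x + of_int k * y) m = of_int (2 * m) * x + of_int (m * (m - 1)) * (y :: 'r::comm_ring_1)"
proof -
  have "of_int (2 * m) * x + of_int (m * (m - 1)) * y = ssum (\<lambda>k. 2 * (x + of_int k * y)) m"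
    by (rule ssum_unique) (simp_all add: algebra_simps)
  then show ?thesis by (simp only: ssum_mult)
qed

text \<open>\<open>two_ssum_linear\<close> is applied to the inner sum and then to the outer one,
  and each application contributes a factor 2.\<close>

lemma four_ssum_bilinear:
  fixes a b c :: "'r::comm_ring_1"
  shows "4 * ssum (\<lambda>k. ssum (\<lambda>l. a + of_int k * b + of_int l * c) n) m =
    of_int (4 * m * n) * a + of_int (2 * n * m * (m - 1)) * b + of_int (2 * m * n * (n - 1)) * c"
proof -
  have inner: "2 * ssum (\<lambda>l. a + of_int k * b + of_int l * c) n =
      (of_int (2 * n) * a + of_int (n * (n - 1)) * c) + of_int k * (of_int (2 * n) * b)" for k
    unfolding two_ssum_linear by (simp add: algebra_simps)
  have e: "2 * ssum (\<lambda>k. ssum (\<lambda>l. a + of_int k * b + of_int l * c) n) m =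
      ssum (\<lambda>k. (of_int (2 * n) * a + of_int (n * (n - 1)) * c) + of_int k * (of_int (2 * n) * b)) m"
    by (subst ssum_mult[symmetric]) (simp only: inner)
  have "4 * ssum (\<lambda>k. ssum (\<lambda>l. a + of_int k * b + of_int l * c) n) m =
      2 * (2 * ssum (\<lambda>k. ssum (\<lambda>l. a + of_int k * b + of_int l * c) n) m)" by simp
  also have "\<dots> = 2 * ssum (\<lambda>k. (of_int (2 * n) * a + of_int (n * (n - 1)) * c) + of_int k * (of_int (2 * n) * b)) m"
    by (simp only: e)
  also have "\<dots> = of_int (4 * m * n) * a + of_int (2 * n * m * (m - 1)) * b + of_int (2 * m * n * (n - 1)) * c"
    by (simp only: two_ssum_linear) (simp add: algebra_simps)
  finally show ?thesis .
qed

context gl2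
begin

lemma prd_cells:
  assumes F: "dd F = 0" and G: "dd G = 0"
  shows "prd F G X0 = F X0 * G X0"
    "prd F G Y1 = F X0 * G Y1 + G X0 * F Y1" "prd F G Y2 = F X0 * G Y2 + G X0 * F Y2"
    "prd F G Y3 = F X0 * G Y3 + G X0 * F Y3"
    "prd F G Z1 = F X0 * G Z1 + G X0 * F Z1
      + ev (UF F) (elem_A \<theta>) * G Y1 + ev (UF F) (elem_B \<theta>) * G Y2 + F Y1 * G Y3"
    "prd F G Z2 = F X0 * G Z2 + G X0 * F Z2
      + ev (UF F) (elem_C \<theta>) * G Y1 + ev (UF F) (elem_D \<theta>) * G Y2 + F Y2 * G Y3"
    "prd F G Z3 = F X0 * G Z3 + G X0 * F Z3 - F Y2 * G Y1 + F Y1 * G Y2"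
    "prd F G W = F X0 * G W + G X0 * F W - F Y2 * G Z1 + F Y1 * G Z2 + ev (UF F) (elem_E \<theta>) * G Z3
      - G Y2 * F Z1 + G Y1 * F Z2 + ev (UF G) (elem_E \<theta>) * F Z3"
  by (simp_all add: prd_def MM_simps is_hom_UF F G pt_def UF_gens)

text \<open>The homomorphism takes the same value k at each term of E that contains t, and the
  signed number of these terms is m1 n2 - m2 n1.\<close>

lemma ev_E_t: "ev (UF (\<lambda>c. if c = Y3 then k else 0)) (elem_E \<theta>) = of_int (m1 * n2 - m2 * n1) * k"
  by (simp add: ev_E UF_def g_1_def ssum_const algebra_simps)

lemma coh_iff: "F \<approx>\<^sub>c G \<longleftrightarrow> (\<exists>K1 K2 K3. F X0 = G X0 \<and> F Y1 = G Y1 \<and> F Y2 = G Y2 \<and> F Y3 = G Y3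
    \<and> F Z1 = G Z1 + (of_int (1 + m1) * K1 + of_int n1 * K2)
    \<and> F Z2 = G Z2 + (of_int m2 * K1 + of_int (1 + n2) * K2)
    \<and> F Z3 = G Z3 \<and> F W = G W + of_int (m1 * n2 - m2 * n1 - 1) * K3)"
proof
  assume "F \<approx>\<^sub>c G"
  then obtain K where "F = G + dd K" by (auto simp: coh_def)
  then show "\<exists>K1 K2 K3. F X0 = G X0 \<and> F Y1 = G Y1 \<and> F Y2 = G Y2 \<and> F Y3 = G Y3
    \<and> F Z1 = G Z1 + (of_int (1 + m1) * K1 + of_int n1 * K2)
    \<and> F Z2 = G Z2 + (of_int m2 * K1 + of_int (1 + n2) * K2)
    \<and> F Z3 = G Z3 \<and> F W = G W + of_int (m1 * n2 - m2 * n1 - 1) * K3"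
    by (intro exI[of _ "K Y1"] exI[of _ "K Y2"] exI[of _ "K Z3"]) (simp add: dd_simps)
next
  assume "\<exists>K1 K2 K3. F X0 = G X0 \<and> F Y1 = G Y1 \<and> F Y2 = G Y2 \<and> F Y3 = G Y3
    \<and> F Z1 = G Z1 + (of_int (1 + m1) * K1 + of_int n1 * K2)
    \<and> F Z2 = G Z2 + (of_int m2 * K1 + of_int (1 + n2) * K2)
    \<and> F Z3 = G Z3 \<and> F W = G W + of_int (m1 * n2 - m2 * n1 - 1) * K3"
  then obtain K1 K2 K3 where K: "F X0 = G X0 \<and> F Y1 = G Y1 \<and> F Y2 = G Y2 \<and> F Y3 = G Y3
    \<and> F Z1 = G Z1 + (of_int (1 + m1) * K1 + of_int n1 * K2)
    \<and> F Z2 = G Z2 + (of_int m2 * K1 + of_int (1 + n2) * K2)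
    \<and> F Z3 = G Z3 \<and> F W = G W + of_int (m1 * n2 - m2 * n1 - 1) * K3" by blast
  define K where "K c = (case c of Y1 \<Rightarrow> K1 | Y2 \<Rightarrow> K2 | Z3 \<Rightarrow> K3 | _ \<Rightarrow> 0)" for c
  have "F c = (G + dd K) c" for c
    using K by (cases c) (simp_all add: dd_simps K_def)
  then have "F = G + dd K" by blast
  then show "F \<approx>\<^sub>c G" unfolding coh_def by blast
qed

lemma cocycle_iff: "dd F = 0 \<longleftrightarrow> of_int (1 + m1) * F Y1 + of_int n1 * F Y2 = 0 \<and>
    of_int m2 * F Y1 + of_int (1 + n2) * F Y2 = 0 \<and> of_int (m1 * n2 - m2 * n1 - 1) * F Z3 = 0"
proof
  assume F: "dd F = 0"
  show "of_int (1 + m1) * F Y1 + of_int n1 * F Y2 = 0 \<and>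
    of_int m2 * F Y1 + of_int (1 + n2) * F Y2 = 0 \<and> of_int (m1 * n2 - m2 * n1 - 1) * F Z3 = 0"
    using fun_cong[OF F, of Z1] fun_cong[OF F, of Z2] fun_cong[OF F, of W] by (simp add: dd_simps)
next
  assume *: "of_int (1 + m1) * F Y1 + of_int n1 * F Y2 = 0 \<and>
    of_int m2 * F Y1 + of_int (1 + n2) * F Y2 = 0 \<and> of_int (m1 * n2 - m2 * n1 - 1) * F Z3 = 0"
  have "dd F c = 0" for c using * by (cases c) (simp_all add: dd_simps)
  then show "dd F = 0" by (simp add: fun_eq_iff)
qed

text \<open>By graded commutativity twice the square is cohomologous to 0, and 2 is
  invertible.\<close>

lemma square_zero:
  fixes F :: "cell \<Rightarrow> 'r::field"
  assumes "(2 :: 'r) \<noteq> 0" "hg 1 F" "dd F = 0"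
  shows "prd F F \<approx>\<^sub>c 0"
proof -
  have "prd F F \<approx>\<^sub>c (\<lambda>c. (- 1) ^ (1 * 1) * prd F F c)"
    by (rule graded_commutative) (use assms in auto)
  then have "prd F F - (\<lambda>c. - prd F F c) \<approx>\<^sub>c (\<lambda>c. - prd F F c) - (\<lambda>c. - prd F F c)"
    by (intro coh_diff coh_refl) simp
  then have "(\<lambda>c. inverse 2 * (prd F F - (\<lambda>c. - prd F F c)) c) \<approx>\<^sub>c (\<lambda>c. inverse 2 * 0)"
    using coh_mult[of "prd F F - (\<lambda>c. - prd F F c)" 0 "inverse 2"] by simp
  moreover have "(\<lambda>c. inverse 2 * (prd F F - (\<lambda>c. - prd F F c)) c) = prd F F"
    using assms(1) by (simp add: fun_eq_iff field_simps)
  ultimately show ?thesis by (simp add: zero_fun_def)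
qed

lemma prd_deg22: "hg 2 F \<Longrightarrow> hg 2 G \<Longrightarrow> prd F G = 0"
  by (simp add: prd_deg2 X0_hg UF_hg MM_zero_hom fun_eq_iff)

lemma iso_rank0:
  assumes two: "(2 :: 'r::field) \<noteq> 0"
    and M: "(of_int (1 + m1) :: 'r) = 0" "(of_int m2 :: 'r) = 0" "(of_int n1 :: 'r) = 0" "(of_int (1 + n2) :: 'r) = 0"
    and D: "(of_int (m1 * n2 - m2 * n1 - 1) :: 'r) = 0"
  shows "graded_ring_isos [1, 1, 1] {gen 0 \<star> gen 0, gen 1 \<star> gen 1, gen 2 \<star> (gen 2 :: 'r falg)} \<theta> \<noteq> {}"
proof -
  let ?ds = "[1, 1, 1] :: nat list"
  let ?R = "{gen 0 \<star> gen 0, gen 1 \<star> gen 1, gen 2 \<star> (gen 2 :: 'r falg)}"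
  define gs :: "nat \<Rightarrow> cell \<Rightarrow> 'r" where "gs i = [delta Y1, delta Y2, delta Y3] ! i" for i
  let ?B = "{[], [0], [1], [2], [0, 1], [0, 2], [1, 2], [0, 1, 2]} :: nat list set"
  have [simp]: "gs 0 = delta Y1" "gs (Suc 0) = delta Y2" "gs 2 = delta Y3" "gs (Suc (Suc 0)) = delta Y3" by (simp_all add: gs_def)
  \<comment> \<open>All entries of the differential vanish mod p, so cochains, cocycles and classes
    are the same thing and the basis can be checked cell by cell.\<close>
  have dd0: "dd F = 0" for F :: "cell \<Rightarrow> 'r" using M D by (simp add: cocycle_iff)
  have coh_eq: "F \<approx>\<^sub>c G \<longleftrightarrow> F = G" for F G :: "cell \<Rightarrow> 'r" by (auto simp: coh_def dd0)
  have R_carrier: "?R \<subseteq> carrier (free_alg (length ?ds))"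
    by (auto simp: free_alg_def gen_def fmult_single)
  interpret P: presentation ?ds ?R by unfold_locales (rule R_carrier)
  have "\<exists>\<phi>\<in>graded_ring_isos ?ds ?R \<theta>. \<forall>i<length ?ds. \<phi> (quot_elem ?ds ?R (gen i)) = cl (gs i)"
  proof (rule coh_presentation[where B = ?B and gs = gs, OF R_carrier])
    show "?ds ! i = 1 \<or> ?ds ! i = 2" if "i < length ?ds" for i using that by (auto simp: less_Suc_eq numeral_2_eq_2)
    show hgs: "hg (?ds ! i) (gs i)" if "i < length ?ds" for i
      using that by (auto simp: less_Suc_eq hg_gens)
    show "evw gs r \<approx>\<^sub>c 0" if "r \<in> ?R" for r
      using that square_zero[OF two] dd0 by (auto simp: evw_gen2 hg_gens)
    show "gen i \<star> gen i \<in> ?R" if "i < length ?ds" for i using that by (auto simp: less_Suc_eq numeral_2_eq_2)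
    show "P.reduces ?B (P.wd (filter P [0..<length ?ds]))" for P
      by (rule P.reduces_basis) (simp_all add: upt_rec)
    show "set b \<subseteq> {..<length ?ds}" if "b \<in> ?B" for b using that by auto
    let ?b1 = "ev (UF (delta Y1)) (elem_B \<theta>) :: 'r" and ?b2 = "ev (UF (delta Y1)) (elem_D \<theta>) :: 'r"
    show "\<exists>c. F \<approx>\<^sub>c (\<lambda>x. \<Sum>b\<in>?B. c b * pw gs b x)" for F :: "cell \<Rightarrow> 'r"
    proof -
      \<comment> \<open>The system is triangular: the word [0, 1] is 1 on z3 but also takes the
        values \<open>?b1\<close> and \<open>?b2\<close> on z1 and z2, and these are subtracted from
        the coefficients of [0, 2] and [1, 2].\<close>
      define c where "c b = (if b = [] then F X0 else if b = [0] then F Y1 else if b = [1] then F Y2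
        else if b = [2] then F Y3 else if b = [0, 1] then F Z3 else if b = [0, 2] then F Z1 - F Z3 * ?b1
        else if b = [1, 2] then F Z2 - F Z3 * ?b2 else F W)" for b :: "nat list"
      have "F x = (\<Sum>b\<in>?B. c b * pw gs b x)" for x
        by (cases x) (simp_all add: c_def prd_cells dd0, simp_all add: delta_def)
      then show ?thesis unfolding coh_eq by (intro exI[of _ c]) (simp add: fun_eq_iff)
    qed
    show "c b = 0" if c: "(\<lambda>x. \<Sum>b\<in>?B. c b * pw gs b x) \<approx>\<^sub>c 0" and b: "b \<in> ?B" for c b
    proof -
      have e: "(\<lambda>x. \<Sum>b\<in>?B. c b * pw gs b x) = 0" using c unfolding coh_eq .
      have z: "(\<Sum>b\<in>?B. c b * pw gs b x) = 0" for x using fun_cong[OF e, of x] unfolding zero_fun_def .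
      have "c [] = 0" using z[of X0] by (simp add: prd_cells dd0) (simp add: delta_def)
      moreover have "c [0] = 0" using z[of Y1] by (simp add: prd_cells dd0) (simp add: delta_def)
      moreover have "c [1] = 0" using z[of Y2] by (simp add: prd_cells dd0) (simp add: delta_def)
      moreover have "c [2] = 0" using z[of Y3] by (simp add: prd_cells dd0) (simp add: delta_def)
      moreover have c01: "c [0, 1] = 0" using z[of Z3] by (simp add: prd_cells dd0) (simp add: delta_def)
      moreover have "c [0, 2] = 0" using z[of Z1] c01 by (simp add: prd_cells dd0) (simp add: delta_def)
      moreover have "c [1, 2] = 0" using z[of Z2] c01 by (simp add: prd_cells dd0) (simp add: delta_def)
      moreover have "c [0, 1, 2] = 0" using z[of W] by (simp add: prd_cells dd0) (simp add: delta_def)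
      ultimately show ?thesis using b by auto
    qed
  qed (rule dd0)
  then show ?thesis by blast
qed

text \<open>As 1 - \<theta>^-1 is invertible mod p, no cocycle has a component on y1 or y2, and the
  duals of z1 and z2 are coboundaries. The duals of y3, z3 and w remain, and by \<open>EY3\<close>
  the product of the first two is the third.\<close>

lemma iso_rank2_pos:
  assumes two: "(2 :: 'r::field) \<noteq> 0"
    and M: "(of_int ((1 + m1) * (1 + n2) - n1 * m2) :: 'r) \<noteq> 0"
    and D: "m1 * n2 - m2 * n1 = 1"
  shows "graded_ring_isos [1, 2] {gen 0 \<star> gen 0, gen 1 \<star> (gen 1 :: 'r falg)} \<theta> \<noteq> {}"
proof -
  let ?ds = "[1, 2] :: nat list"
  let ?R = "{gen 0 \<star> gen 0, gen 1 \<star> (gen 1 :: 'r falg)}"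
  define gs :: "nat \<Rightarrow> cell \<Rightarrow> 'r" where "gs i = [delta Y3, delta Z3] ! i" for i
  let ?B = "{[], [0], [1], [0, 1]} :: nat list set"
  let ?a = "of_int (1 + m1) :: 'r" and ?b = "of_int n1 :: 'r" and ?c = "of_int m2 :: 'r" and ?d = "of_int (1 + n2) :: 'r"
  have det: "?a * ?d - ?b * ?c \<noteq> 0" using M by (simp del: of_int_add)
  have D0: "(of_int (m1 * n2 - m2 * n1 - 1) :: 'r) = 0" using D by simp
  have [simp]: "gs 0 = delta Y3" "gs (Suc 0) = delta Z3" by (simp_all add: gs_def)
  have ddY3: "dd (delta Y3 :: cell \<Rightarrow> 'r) = 0" and ddZ3: "dd (delta Z3 :: cell \<Rightarrow> 'r) = 0"
    unfolding cocycle_iff D0 by (simp_all add: delta_def)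
  have EY3: "ev (UF (delta Y3)) (elem_E \<theta>) = (1::'r)"
    using ev_E_t[of "1::'r"] D by (simp add: delta_def)
  have R_carrier: "?R \<subseteq> carrier (free_alg (length ?ds))"
    by (auto simp: free_alg_def gen_def fmult_single)
  interpret P: presentation ?ds ?R by unfold_locales (rule R_carrier)
  have "\<exists>\<phi>\<in>graded_ring_isos ?ds ?R \<theta>. \<forall>i<length ?ds. \<phi> (quot_elem ?ds ?R (gen i)) = cl (gs i)"
  proof (rule coh_presentation[where B = ?B and gs = gs, OF R_carrier])
    show "?ds ! i = 1 \<or> ?ds ! i = 2" if "i < length ?ds" for i using that by (auto simp: less_Suc_eq numeral_2_eq_2)
    show "dd (gs i) = 0" if "i < length ?ds" for i using that ddY3 ddZ3 by (auto simp: less_Suc_eq)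
    show hgs: "hg (?ds ! i) (gs i)" if "i < length ?ds" for i
      using that by (auto simp: less_Suc_eq hg_gens)
    show "evw gs r \<approx>\<^sub>c 0" if "r \<in> ?R" for r
      using that square_zero[OF two] ddY3 ddZ3 by (auto simp: evw_gen2 prd_deg22 hg_gens)
    show "gen i \<star> gen i \<in> ?R" if "i < length ?ds" for i using that by (auto simp: less_Suc_eq numeral_2_eq_2)
    show "P.reduces ?B (P.wd (filter P [0..<length ?ds]))" for P
      by (rule P.reduces_basis) (simp_all add: upt_rec)
    show "set b \<subseteq> {..<length ?ds}" if "b \<in> ?B" for b using that by auto
    show "\<exists>c. F \<approx>\<^sub>c (\<lambda>x. \<Sum>b\<in>?B. c b * pw gs b x)" if F: "dd F = 0" for F :: "cell \<Rightarrow> 'r"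
    proof -
      have e: "?a * F Y1 + ?b * F Y2 = 0" "?c * F Y1 + ?d * F Y2 = 0" using F unfolding cocycle_iff by auto
      have "(?a * ?d - ?b * ?c) * F Y1 = ?d * (?a * F Y1 + ?b * F Y2) - ?b * (?c * F Y1 + ?d * F Y2)"
        by (simp only: algebra_simps)
      then have Y1: "F Y1 = 0" using det unfolding e by simp
      have "(?a * ?d - ?b * ?c) * F Y2 = ?a * (?c * F Y1 + ?d * F Y2) - ?c * (?a * F Y1 + ?b * F Y2)"
        by (simp only: algebra_simps)
      then have Y2: "F Y2 = 0" using det unfolding e by simp
      define c where "c b = (if b = [] then F X0 else if b = [0] then F Y3 else if b = [1] then F Z3
        else F W)" for b :: "nat list"
      let ?e = "?a * ?d - ?b * ?c"
      \<comment> \<open>Cramer's rule for a cochain on y1 and y2 whose coboundary is the part of F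
        on z1 and z2.\<close>
      define K1 where "K1 = (F Z1 * ?d - F Z2 * ?b) / ?e"
      define K2 where "K2 = (?a * F Z2 - ?c * F Z1) / ?e"
      have "?e * (?a * K1 + ?b * K2) = ?a * (?e * K1) + ?b * (?e * K2)" by (simp only: algebra_simps)
      also have "\<dots> = ?e * F Z1" using det by (simp add: K1_def K2_def del: of_int_add) (simp only: algebra_simps)
      finally have K1: "?a * K1 + ?b * K2 = F Z1" using det by simp
      have "?e * (?c * K1 + ?d * K2) = ?c * (?e * K1) + ?d * (?e * K2)" by (simp only: algebra_simps)
      also have "\<dots> = ?e * F Z2" using det by (simp add: K1_def K2_def del: of_int_add) (simp only: algebra_simps)
      finally have K2: "?c * K1 + ?d * K2 = F Z2" using det by simp
      have "F \<approx>\<^sub>c (\<lambda>x. \<Sum>b\<in>?B. c b * pw gs b x)"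
        unfolding coh_iff using K1 K2 Y1 Y2 D
        by (intro exI[of _ K1] exI[of _ K2] exI[of _ 0])
          (simp add: c_def prd_cells ddY3 ddZ3 dd_prd dd_delta_X0 EY3 prd_one_right del: of_int_add, simp add: delta_def del: of_int_add)
      then show ?thesis by blast
    qed
    show "c b = 0" if c: "(\<lambda>x. \<Sum>b\<in>?B. c b * pw gs b x) \<approx>\<^sub>c 0" and b: "b \<in> ?B" for c b
    proof -
      have "c [] = 0 \<and> c [0] = 0 \<and> c [1] = 0 \<and> c [0, 1] = 0"
        using c D unfolding coh_iff
        by (simp add: prd_cells ddY3 ddZ3 EY3 prd_one_right del: of_int_add) (auto simp add: delta_def simp del: of_int_add)
      then show ?thesis using b by auto
    qed
  qed
  then show ?thesis by blast
qed

text \<open>The invertible matrix leaves only y3 in degree 1 and nothing from z1 and z2. In addition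
  the differential from z3 to w is multiplication by a unit, which removes these two as
  well.\<close>

lemma iso_rank2_neg:
  assumes two: "(2 :: 'r::field) \<noteq> 0"
    and M: "(of_int ((1 + m1) * (1 + n2) - n1 * m2) :: 'r) \<noteq> 0"
    and D: "(of_int (m1 * n2 - m2 * n1 - 1) :: 'r) \<noteq> 0"
  shows "graded_ring_isos [1] {gen 0 \<star> (gen 0 :: 'r falg)} \<theta> \<noteq> {}"
proof -
  let ?ds = "[1] :: nat list"
  let ?R = "{gen 0 \<star> (gen 0 :: 'r falg)}"
  define gs :: "nat \<Rightarrow> cell \<Rightarrow> 'r" where "gs i = delta Y3" for i
  let ?B = "{[], [0]} :: nat list set"
  let ?a = "of_int (1 + m1) :: 'r" and ?b = "of_int n1 :: 'r" and ?c = "of_int m2 :: 'r" and ?d = "of_int (1 + n2) :: 'r"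
  let ?D = "of_int (m1 * n2 - m2 * n1 - 1) :: 'r"
  have det: "?a * ?d - ?b * ?c \<noteq> 0" using M by (simp del: of_int_add)
  have [simp]: "gs i = delta Y3" for i by (simp add: gs_def)
  have ddY3: "dd (delta Y3 :: cell \<Rightarrow> 'r) = 0"
    unfolding cocycle_iff by (simp_all add: delta_def)
  have R_carrier: "?R \<subseteq> carrier (free_alg (length ?ds))"
    by (auto simp: free_alg_def gen_def fmult_single)
  interpret P: presentation ?ds ?R by unfold_locales (rule R_carrier)
  have "\<exists>\<phi>\<in>graded_ring_isos ?ds ?R \<theta>. \<forall>i<length ?ds. \<phi> (quot_elem ?ds ?R (gen i)) = cl (gs i)"
  proof (rule coh_presentation[where B = ?B and gs = gs, OF R_carrier])
    show hgs: "hg (?ds ! i) (gs i)" if "i < length ?ds" for i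
      using that by (auto simp: hg_gens)
    show "evw gs r \<approx>\<^sub>c 0" if "r \<in> ?R" for r
      using that square_zero[OF two] ddY3 by (auto simp: evw_gen2 hg_gens)
    show "P.reduces ?B (P.wd (filter P [0..<length ?ds]))" for P
      by (rule P.reduces_basis) (simp_all add: upt_rec)
    show "\<exists>c. F \<approx>\<^sub>c (\<lambda>x. \<Sum>b\<in>?B. c b * pw gs b x)" if F: "dd F = 0" for F :: "cell \<Rightarrow> 'r"
    proof -
      have e: "?a * F Y1 + ?b * F Y2 = 0" "?c * F Y1 + ?d * F Y2 = 0" "?D * F Z3 = 0"
        using F unfolding cocycle_iff by auto
      have "(?a * ?d - ?b * ?c) * F Y1 = ?d * (?a * F Y1 + ?b * F Y2) - ?b * (?c * F Y1 + ?d * F Y2)"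
        by (simp only: algebra_simps)
      then have Y1: "F Y1 = 0" using det unfolding e by simp
      have "(?a * ?d - ?b * ?c) * F Y2 = ?a * (?c * F Y1 + ?d * F Y2) - ?c * (?a * F Y1 + ?b * F Y2)"
        by (simp only: algebra_simps)
      then have Y2: "F Y2 = 0" using det unfolding e by simp
      have Z3: "F Z3 = 0" using e(3) D by (metis mult_eq_0_iff)
      define c where "c b = (if b = [] then F X0 else F Y3)" for b :: "nat list"
      let ?e = "?a * ?d - ?b * ?c"
      define K1 where "K1 = (F Z1 * ?d - F Z2 * ?b) / ?e"
      define K2 where "K2 = (?a * F Z2 - ?c * F Z1) / ?e"
      have "?e * (?a * K1 + ?b * K2) = ?a * (?e * K1) + ?b * (?e * K2)" by (simp only: algebra_simps)
      also have "\<dots> = ?e * F Z1" using det by (simp add: K1_def K2_def del: of_int_add) (simp only: algebra_simps)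
      finally have K1: "?a * K1 + ?b * K2 = F Z1" using det by simp
      have "?e * (?c * K1 + ?d * K2) = ?c * (?e * K1) + ?d * (?e * K2)" by (simp only: algebra_simps)
      also have "\<dots> = ?e * F Z2" using det by (simp add: K1_def K2_def del: of_int_add) (simp only: algebra_simps)
      finally have K2: "?c * K1 + ?d * K2 = F Z2" using det by simp
      have K3: "?D * (F W / ?D) = F W" using D by simp
      have "F \<approx>\<^sub>c (\<lambda>x. \<Sum>b\<in>?B. c b * pw gs b x)"
        unfolding coh_iff
        by (intro exI[of _ K1] exI[of _ K2] exI[of _ "F W / ?D"])
          (simp only: K1 K2 K3, simp add: c_def Y1 Y2 Z3 prd_one_right ddY3, simp add: delta_def)
      then show ?thesis by blast
    qed
    show "c b = 0" if c: "(\<lambda>x. \<Sum>b\<in>?B. c b * pw gs b x) \<approx>\<^sub>c 0" and b: "b \<in> ?B" for c b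
    proof -
      have "c [] = 0 \<and> c [0] = 0"
        using c unfolding coh_iff
        by (simp add: prd_one_right ddY3) (auto simp: delta_def)
      then show ?thesis using b by auto
    qed
  qed (auto simp: ddY3)
  then show ?thesis by blast
qed

end

section \<open>Rank 1: the moment of E and the presentations\<close>

lemma orthogonal_multiple:
  fixes a b y z :: "'r::field"
  assumes "a * y + b * z = 0" "a \<noteq> 0 \<or> b \<noteq> 0"
  shows "\<exists>k. y = k * (- b) \<and> z = k * a"
proof (cases "a = 0")
  case False
  have "y * a = - (b * z)" using assms(1) by (simp add: eq_neg_iff_add_eq_0 mult.commute)
  then have "y = - (b * z) / a" using nonzero_eq_divide_eq[OF False] by blast
  then show ?thesis using False by (intro exI[of _ "z / a"]) (simp add: mult.commute)
next
  case True
  then show ?thesis using assms by (intro exI[of _ "- (y / b)"]) auto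
qed

context gl2
begin

text \<open>By invariance under \<theta>, the homomorphism takes the values F Y1 and F Y2 at
  \<theta>(a) and \<theta>(b). So along the terms of E it is an arithmetic progression in both
  indices, and \<open>four_ssum_bilinear\<close> sums it.\<close>

lemma ev_E_moment:
  assumes F: "dd F = 0"
  shows "4 * ev (UF F) (elem_E \<theta>) = (of_int (4 * m1 * n2) * (F Y2 - F Y1 + F Y3) + of_int (2 * n2 * m1 * (m1 - 1)) * (- F Y1)
      + of_int (2 * m1 * n2 * (n2 - 1)) * F Y2)
    - (of_int (4 * m2 * n1) * F Y3 + of_int (2 * n1 * m2 * (m2 - 1)) * (- F Y1)
      + of_int (2 * m2 * n1 * (n1 - 1)) * F Y2)"
proof -
  have *: "UF F (v + sc (- k - 1) ea + sc l eb, 1) = (of_int (v $ 1) * F Y1 + of_int (v $ 2) * F Y2 - F Y1 + F Y3)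
      + of_int k * (- F Y1) + of_int l * F Y2" for v k l
  proof -
    have "UF F (v + sc (- k - 1) ea + sc l eb, 1) = of_int (v $ 1) * F Y1 + of_int (v $ 2) * F Y2 + F Y3
      + of_int (- k - 1) * (of_int (\<theta>$1$1) * F Y1 + of_int (\<theta>$2$1) * F Y2)
      + of_int l * (of_int (\<theta>$1$2) * F Y1 + of_int (\<theta>$2$2) * F Y2)"
      by (simp add: UF_def ta_def tb_def algebra_simps)
    then show ?thesis unfolding cocycle_fixed[OF F] by (simp add: algebra_simps)
  qed
  have "4 * ev (UF F) (elem_E \<theta>) = 4 * ssum (\<lambda>k. ssum (\<lambda>l. UF F (vb + sc (- k - 1) ea + sc l eb, 1)) n2) m1
     - 4 * ssum (\<lambda>k. ssum (\<lambda>l. UF F (va + sc (- k - 1) ea + sc l eb, 1)) n1) m2"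
    using is_hom_one[OF is_hom_UF[OF F]] by (simp add: ev_E right_diff_distrib)
  then show ?thesis unfolding * four_ssum_bilinear by (simp add: va_def vb_def)
qed

definition uF :: "cell \<Rightarrow> 'r::comm_ring_1" where
  "uF c = of_int (- n1) * delta Y1 c + of_int (1 + m1) * delta Y2 c"

definition xF :: "cell \<Rightarrow> 'r::comm_ring_1" where
  "xF c = of_int m1 * delta Z1 c + of_int n1 * delta Z2 c"

lemma hg_uF: "hg (Suc 0) uF" and hg_xF: "hg 2 xF"
  by (auto simp: hg_def uF_def xF_def delta_def)

lemma dd_xF: "dd xF = 0" and dd_Y3: "dd (delta Y3) = 0"
  by (simp_all add: cocycle_iff xF_def delta_def)

lemma ev_E_Y3: "ev (UF (delta Y3)) (elem_E \<theta>) = (of_int (m1 * n2 - m2 * n1) :: 'r::comm_ring_1)"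
  using ev_E_t[of "1::'r"] by (simp add: delta_def)

lemma dd_uF: "(of_int ((1 + m1) * (1 + n2) - n1 * m2) :: 'r::comm_ring_1) = 0 \<Longrightarrow> dd (uF :: cell \<Rightarrow> 'r) = 0"
  by (simp add: cocycle_iff uF_def delta_def algebra_simps)

text \<open>In terms of \<theta> the right-hand side is the coefficient of the theorem, since
  determinant 1 gives n2 = -\<alpha>, m2 = \<gamma>, n1 = \<beta> and m1 = -\<delta>. It is reached
  from \<open>ev_E_moment\<close> through the relations that determinant 1 and singularity mod p
  impose on the entries.\<close>

lemma ev_E_uF:
  assumes two: "(2 :: 'r::field) \<noteq> 0"
    and M: "(of_int ((1 + m1) * (1 + n2) - n1 * m2) :: 'r) = 0"
    and D: "m1 * n2 - m2 * n1 = 1"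
  shows "ev (UF uF) (elem_E \<theta>) = of_int (1 + n2 - m2 + n2 * m2) / 2 * of_int (- n1)
    + of_int (1 - n1 + m1 - n1 * m1) / 2 * (of_int (1 + m1) :: 'r)" (is "?E = ?c")
proof -
  define a b c d where abcd: "a = (of_int m1 :: 'r)" "b = (of_int m2 :: 'r)" "c = (of_int n1 :: 'r)" "d = (of_int n2 :: 'r)"
  have four: "(4 :: 'r) \<noteq> 0" using two by (metis mult_2 mult_eq_0_iff numeral_Bit0)
  have D': "a * d - b * c = 1" using arg_cong[OF D, of "of_int :: int \<Rightarrow> 'r"] by (simp add: abcd)
  have M': "(1 + a) * (1 + d) - c * b = 0" using M by (simp add: abcd)
  have "(1 + a) * (1 + d) - c * b = 1 + a + d + (a * d - b * c)" by (simp add: algebra_simps)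
  \<comment> \<open>Determinant 1 together with a singular 1 - \<theta>^-1 forces the trace a + d =
    -2. This eliminates d and turns the vanishing determinant into b c = -(1 + a)^2.\<close>
  then have "d + (2 + a) = 0" unfolding D' M' by (simp add: algebra_simps)
  then have d: "d = - 2 - a" by (simp add: eq_neg_iff_add_eq_0 diff_conv_add_uminus[symmetric] add_eq_0_iff)
  have bc: "b * c = - ((1 + a) * (1 + a))" using M' unfolding d by (simp add: algebra_simps)
  have "4 * ?E = 4 * a * d * ((1 + a) + c) + 2 * d * a * (a - 1) * c + 2 * a * d * (d - 1) * (1 + a)
     - (2 * c * b * (b - 1) * c + 2 * b * c * (c - 1) * (1 + a))"
    unfolding ev_E_moment[OF dd_uF[OF M]] abcd by (simp add: uF_def delta_def)
  also have "\<dots> = 2 * (1 + d - b + d * b) * (- c) + 2 * (1 - c + a - c * a) * (1 + a)"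
  proof -
    \<comment> \<open>With d eliminated, the difference of the two sides is a multiple of b c + (1 +
      a)^2, which is 0; the second factor is the quotient.\<close>
    have "4 * a * d * ((1 + a) + c) + 2 * d * a * (a - 1) * c + 2 * a * d * (d - 1) * (1 + a)
     - (2 * c * b * (b - 1) * c + 2 * b * c * (c - 1) * (1 + a))
     - (2 * (1 + d - b + d * b) * (- c) + 2 * (1 - c + a - c * a) * (1 + a)) =
      (b * c + (1 + a) * (1 + a)) * (- 2 * b * c + 2 * (1 + a) * (1 + a) + 2 * c - 2 * c * (1 + a) - 4)"
      unfolding d by (simp add: algebra_simps)
    then show ?thesis unfolding bc by simp
  qed
  also have "\<dots> = 4 * ?c"
  proof -
    have half: "4 * (x / 2 * y) = 2 * x * y" for x y :: 'r
    proof -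
      have "4 * (x / 2 * y) = 2 * (2 * (x / 2)) * y" by simp
      then show ?thesis using two by simp
    qed
    show ?thesis unfolding distrib_left half by (simp add: abcd algebra_simps)
  qed
  finally show ?thesis using mult_left_cancel[OF four] by blast
qed

lemma cocycle_uF_multiple:
  fixes F :: "cell \<Rightarrow> 'r::field"
  assumes F: "dd F = 0" and u: "(of_int n1 :: 'r) \<noteq> 0 \<or> (of_int (1 + m1) :: 'r) \<noteq> 0"
  shows "\<exists>k. F Y1 = k * of_int (- n1) \<and> F Y2 = k * of_int (1 + m1)"
proof -
  have "of_int (1 + m1) * F Y1 + of_int n1 * F Y2 = 0" using F unfolding cocycle_iff by blast
  from orthogonal_multiple[OF this disj_commute[THEN iffD1, OF u]] show ?thesis by (simp del: of_int_add)
qed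

text \<open>If \<open>\<xi>\<^sub>1\<close> spans the classes of \<open>z\<^sub>1\<^sup>*, z\<^sub>2\<^sup>*\<close>, it is not a coboundary, as the coboundary has rank 1.\<close>

lemma xF_nonzero:
  fixes k :: "'r::field"
  assumes M: "(of_int ((1 + m1) * (1 + n2) - n1 * m2) :: 'r) = 0"
    and span: "\<And>r s :: 'r. \<exists>k. (\<lambda>c. r * delta Z1 c + s * delta Z2 c) \<approx>\<^sub>c (\<lambda>c. k * xF c)"
    and k: "k * of_int m1 = of_int (1 + m1) * K1 + of_int n1 * K2" "k * of_int n1 = of_int m2 * K1 + of_int (1 + n2) * K2"
  shows "k = 0"
proof (rule ccontr)
  assume k0: "k \<noteq> 0"
  let ?a = "of_int (1 + m1) :: 'r" and ?b = "of_int n1 :: 'r" and ?c = "of_int m2 :: 'r" and ?d = "of_int (1 + n2) :: 'r"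
  \<comment> \<open>For k \<noteq> 0 the cochain \<open>xF\<close> is a coboundary, and then by
    \<open>span\<close> so is every combination of the duals of z1 and z2.\<close>
  have ex: "\<exists>L1 L2. r = ?a * L1 + ?b * L2 \<and> s = ?c * L1 + ?d * L2" for r s
  proof -
    obtain k' where "(\<lambda>c. r * delta Z1 c + s * delta Z2 c) \<approx>\<^sub>c (\<lambda>c. k' * xF c)" using span by blast
    then obtain L1 L2 where L: "r = k' * of_int m1 + (?a * L1 + ?b * L2)" "s = k' * of_int n1 + (?c * L1 + ?d * L2)"
      unfolding coh_iff by (simp add: delta_def xF_def del: of_int_add) blast
    have m: "of_int m1 = (?a * K1 + ?b * K2) / k" "of_int n1 = (?c * K1 + ?d * K2) / k"
      using k k0 by (simp_all add: nonzero_eq_divide_eq mult.commute del: of_int_add)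
    have "r = ?a * (k' / k * K1 + L1) + ?b * (k' / k * K2 + L2)"
      unfolding L(1) m(1) by (simp add: algebra_simps add_divide_distrib del: of_int_add)
    moreover have "s = ?c * (k' / k * K1 + L1) + ?d * (k' / k * K2 + L2)"
      unfolding L(2) m(2) by (simp add: algebra_simps add_divide_distrib del: of_int_add)
    ultimately show ?thesis by blast
  qed
  obtain L1 L2 where L: "1 = ?a * L1 + ?b * L2" "0 = ?c * L1 + ?d * L2" using ex[of 1 0] by blast
  obtain N1 N2 where N: "0 = ?a * N1 + ?b * N2" "1 = ?c * N1 + ?d * N2" using ex[of 0 1] by blast
  \<comment> \<open>The preimages of the two unit vectors form a right inverse of the matrix, so by
    multiplicativity its determinant cannot vanish.\<close>
  have "(?a * ?d - ?b * ?c) * (L1 * N2 - L2 * N1) = (?a * L1 + ?b * L2) * (?c * N1 + ?d * N2) - (?c * L1 + ?d * L2) * (?a * N1 + ?b * N2)"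
    by (simp only: algebra_simps)
  also have "\<dots> = 1" unfolding L[symmetric] N[symmetric] by simp
  finally show False using M by (simp del: of_int_add)
qed

text \<open>The classes 1, \<zeta>1, \<zeta>2, \<xi>1, \<xi>2 and \<zeta>2 \<xi>2 form a basis.
  Among the products of distinct generators only \<zeta>1 \<zeta>2 has to be compared modulo
  coboundaries, through \<open>lam\<close>; the others can be read off from \<open>prd_cells\<close>
  or vanish by degree.\<close>

lemma iso_rank1_pos:
  fixes l :: "'r::field"
  assumes two: "(2 :: 'r) \<noteq> 0"
    and M: "(of_int ((1 + m1) * (1 + n2) - n1 * m2) :: 'r) = 0"
    and D: "m1 * n2 - m2 * n1 = 1"
    and u: "(of_int n1 :: 'r) \<noteq> 0 \<or> (of_int (1 + m1) :: 'r) \<noteq> 0"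
    and span: "\<And>r s :: 'r. \<exists>k. (\<lambda>c. r * delta Z1 c + s * delta Z2 c) \<approx>\<^sub>c (\<lambda>c. k * xF c)"
    and lam: "(\<lambda>c. l * xF c) \<approx>\<^sub>c (\<lambda>c. of_int (- n1) * delta Z1 c + of_int (1 + m1) * delta Z2 c)"
    and c: "cc = of_int (1 + n2 - m2 + n2 * m2) / 2 * of_int (- n1)
      + of_int (1 - n1 + m1 - n1 * m1) / 2 * (of_int (1 + m1) :: 'r)"
    and R: "R = {gen 0 \<star> gen 0, gen 1 \<star> gen 1, gen 0 \<star> gen 1 - l \<odot> gen 2, gen 1 \<star> gen 2,
      gen 0 \<star> gen 2 - of_int (- (n1^2) - (1 + m1) * m1) \<odot> (gen 1 \<star> gen 3),
      gen 0 \<star> gen 3 - cc \<odot> (gen 1 \<star> gen 3), gen 2 \<star> gen 2, gen 3 \<star> gen 3, gen 2 \<star> gen 3}"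
  shows "\<exists>\<phi>\<in>graded_ring_isos [1, 1, 2, 2] R \<theta>. \<phi> (quot_elem [1, 1, 2, 2] R (gen 0)) = cl uF \<and>
    \<phi> (quot_elem [1, 1, 2, 2] R (gen 1)) = cl (delta Y3) \<and>
    \<phi> (quot_elem [1, 1, 2, 2] R (gen 2)) = cl xF \<and> \<phi> (quot_elem [1, 1, 2, 2] R (gen 3)) = cl (delta Z3)"
proof -
  let ?ds = "[1, 1, 2, 2] :: nat list"
  define gs :: "nat \<Rightarrow> cell \<Rightarrow> 'r" where "gs i = [uF, delta Y3, xF, delta Z3] ! i" for i
  let ?B = "{[], [0], [1], [2], [3], [1, 3]} :: nat list set"
  have [simp]: "gs 0 = uF" "gs (Suc 0) = delta Y3" "gs 2 = xF" "gs 3 = delta Z3"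
    "gs (Suc (Suc 0)) = xF" "gs (Suc (Suc (Suc 0))) = delta Z3" by (simp_all add: gs_def)
  have D0: "(of_int (m1 * n2 - m2 * n1 - 1) :: 'r) = 0" using D by simp
  have ddu: "dd (uF :: cell \<Rightarrow> 'r) = 0" by (rule dd_uF[OF M])
  have ddZ3: "dd (delta Z3 :: cell \<Rightarrow> 'r) = 0"
    unfolding cocycle_iff D0 by (simp_all add: delta_def)
  note dds = ddu ddZ3 dd_xF dd_Y3
  have EY3: "ev (UF (delta Y3)) (elem_E \<theta>) = (1::'r)" unfolding ev_E_Y3 D by simp
  have Eu: "ev (UF uF) (elem_E \<theta>) = cc" unfolding c by (rule ev_E_uF[OF two M D])
  have R_carrier: "R \<subseteq> carrier (free_alg (length ?ds))"
    unfolding R by (auto intro!: diff_free_alg scale_free_alg mult_free_alg gen_free_alg)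
  interpret P: presentation ?ds R by unfold_locales (rule R_carrier)
  \<comment> \<open>The moment over E of the homomorphism that sends t to 1 and a, b to 0 is m1 n2 -
    m2 n1 = 1, so this product is the generator of degree 3.\<close>
  have YZ: "prd (delta Y3) (delta Z3) = (delta W :: cell \<Rightarrow> 'r)"
  proof
    show "prd (delta Y3) (delta Z3) x = (delta W x :: 'r)" for x
      by (cases x) (simp_all add: prd_cells dds EY3, simp_all add: delta_def)
  qed
  have "\<exists>\<phi>\<in>graded_ring_isos ?ds R \<theta>. \<forall>i<length ?ds. \<phi> (quot_elem ?ds R (gen i)) = cl (gs i)"
  proof (rule coh_presentation[where B = ?B and gs = gs, OF R_carrier])
    show "?ds ! i = 1 \<or> ?ds ! i = 2" if "i < length ?ds" for i using that by (auto simp: less_Suc_eq)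
    show "dd (gs i) = 0" if "i < length ?ds" for i using that by (auto simp: less_Suc_eq dds)
    show hgs: "hg (?ds ! i) (gs i)" if "i < length ?ds" for i
      using that by (auto simp: less_Suc_eq hg_gens hg_uF hg_xF)
    have "prd uF (delta Y3) x = (of_int (- n1) * delta Z1 x + of_int (1 + m1) * delta Z2 x :: 'r)" for x
      by (cases x) (simp_all add: prd_cells dds, simp_all add: delta_def uF_def)
    then have uY: "prd uF (delta Y3) = (\<lambda>x. of_int (- n1) * delta Z1 x + of_int (1 + m1) * delta Z2 x :: 'r)" by blast
    have r1: "prd uF (delta Y3) - (\<lambda>x. l * xF x) \<approx>\<^sub>c 0"
      unfolding uY using coh_diff[OF coh_sym[OF lam] coh_refl[of "\<lambda>x. l * xF x"]] by simp
    have "prd (delta Y3) xF x = (0 :: 'r)" for x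
      by (cases x) (simp_all add: prd_cells dds, simp_all add: delta_def xF_def)
    then have r2: "prd (delta Y3) xF = (0 :: cell \<Rightarrow> 'r)" by (simp add: fun_eq_iff)
    \<comment> \<open>On w the product is u(y1) \<xi>1(z2) - u(y2) \<xi>1(z1), with u = (-n1, 1 +
      m1) and \<xi>1 = (m1, n1).\<close>
    have "prd uF xF x = of_int (- (n1^2) - (1 + m1) * m1) * (delta W x :: 'r)" for x
      by (cases x) (simp_all add: prd_cells dds, simp_all add: delta_def xF_def uF_def power2_eq_square algebra_simps)
    then have r3: "prd uF xF - (\<lambda>x. of_int (- (n1^2) - (1 + m1) * m1) * delta W x) = (0 :: cell \<Rightarrow> 'r)"
      by (simp add: fun_eq_iff)
    have "prd uF (delta Z3) x = cc * delta W x" for x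
      by (cases x) (simp_all add: prd_cells dds Eu, simp_all add: delta_def uF_def)
    then have r4: "prd uF (delta Z3) - (\<lambda>x. cc * delta W x) = 0"
      by (simp add: fun_eq_iff)
    show "evw gs r \<approx>\<^sub>c 0" if "r \<in> R" for r
      using that unfolding R
      by (elim insertE emptyE)
        (simp_all only: evw_diff evw_scale evw_gen2 evw_gen, simp_all add: dds evw_gen2 evw_gen YZ r1 r2 r3 r4
          square_zero[OF two] hg_gens hg_uF hg_xF prd_deg22
          del: of_int_add of_int_diff of_int_minus of_int_mult of_int_power)
    show "gen i \<star> gen i \<in> R" if "i < length ?ds" for i
      using that by (auto simp: R less_Suc_eq numeral_2_eq_2 numeral_3_eq_3)
    have B: "P.reduces ?B (P.wd w)" if "w \<in> ?B" for w by (rule P.reduces_basis) (use that in auto)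
    note [simp] = gen_def fmult_single fscale_single
    have w01: "P.reduces ?B (P.wd [0, 1])"
      using P.reduces_replace[of 0 1 l "[2]" "[]" "[]" ?B] B[of "[2]"] by (simp add: R)
    have w02: "P.reduces ?B (P.wd [0, 2])"
      using P.reduces_replace[of 0 2 "of_int (- (n1^2) - (1 + m1) * m1)" "[1, 3]" "[]" "[]" ?B] B[of "[1, 3]"] by (simp add: R)
    have w03: "P.reduces ?B (P.wd [0, 3])"
      using P.reduces_replace[of 0 3 cc "[1, 3]" "[]" "[]" ?B] B[of "[1, 3]"] by (simp add: R)
    have z12: "P.reduces ?B (P.wd (w @ 1 # 2 # v))" if "set (w @ v) \<subseteq> {..<length ?ds}" for w v
      by (rule P.reduces_zero_pair[OF _ that]) (simp add: R)
    have z23: "P.reduces ?B (P.wd (w @ 2 # 3 # v))" if "set (w @ v) \<subseteq> {..<length ?ds}" for w v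
      by (rule P.reduces_zero_pair[OF _ that]) (simp add: R)
    \<comment> \<open>Replacing \<zeta>1 \<zeta>2 by a multiple of \<xi>1 leaves \<xi>1 \<xi>2,
      which is a relation; so this word of degree 4 becomes 0.\<close>
    have w013: "P.reduces ?B (P.wd [0, 1, 3])"
      using P.reduces_replace[of 0 1 l "[2]" "[]" "[3]" ?B] z23[of "[]" "[]"] by (simp add: R)
    have ws: "P.reduces ?B (P.wd [1, 2])" "P.reduces ?B (P.wd [0, 1, 2])" "P.reduces ?B (P.wd [1, 2, 3])"
      "P.reduces ?B (P.wd [0, 1, 2, 3])" "P.reduces ?B (P.wd [2, 3])" "P.reduces ?B (P.wd [0, 2, 3])"
      using z12[of "[]" "[]"] z12[of "[0]" "[]"] z12[of "[]" "[3]"] z12[of "[0]" "[3]"] z23[of "[]" "[]"] z23[of "[0]" "[]"]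
      by simp_all
    have up: "[0..<length ?ds] = [0, 1, 2, 3]" by (simp add: upt_rec)
    show "P.reduces ?B (P.wd (filter Q [0..<length ?ds]))" for Q
      unfolding up using B[of "[]"] B[of "[0]"] B[of "[1]"] B[of "[2]"] B[of "[3]"] B[of "[1, 3]"] w01 w02 w03 w013 ws
      by (cases "Q 0"; cases "Q 1"; cases "Q 2"; cases "Q 3") simp_all
    show "set b \<subseteq> {..<length ?ds}" if "b \<in> ?B" for b using that by auto
    show "\<exists>c. F \<approx>\<^sub>c (\<lambda>x. \<Sum>b\<in>?B. c b * pw gs b x)" if F: "dd F = 0" for F :: "cell \<Rightarrow> 'r"
    proof -
      obtain k where k: "F Y1 = k * of_int (- n1)" "F Y2 = k * of_int (1 + m1)"
        using cocycle_uF_multiple[OF F u] by blast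
      obtain e where e: "(\<lambda>x. F Z1 * delta Z1 x + F Z2 * delta Z2 x) \<approx>\<^sub>c (\<lambda>x. e * xF x)" using span by blast
      define c where "c b = (if b = [] then F X0 else if b = [0] then k else if b = [1] then F Y3
        else if b = [2] then e else if b = [3] then F Z3 else F W)" for b :: "nat list"
      let ?G = "(\<lambda>x. F X0 * delta X0 x + k * uF x + F Y3 * delta Y3 x + F Z3 * delta Z3 x + F W * delta W x)"
      have "F x = ((\<lambda>x. F Z1 * delta Z1 x + F Z2 * delta Z2 x) + ?G) x" for x
        by (cases x) (simp_all add: delta_def uF_def k)
      then have 1: "F = (\<lambda>x. F Z1 * delta Z1 x + F Z2 * delta Z2 x) + ?G" by blast
      have "((\<lambda>x. e * xF x) + ?G) x = (\<Sum>b\<in>?B. c b * pw gs b x)" for x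
        by (simp add: c_def prd_one_right dds YZ)
      then have 2: "(\<lambda>x. \<Sum>b\<in>?B. c b * pw gs b x) = (\<lambda>x. e * xF x) + ?G" by (simp add: fun_eq_iff)
      have "F \<approx>\<^sub>c (\<lambda>x. \<Sum>b\<in>?B. c b * pw gs b x)"
        unfolding 2 using coh_add[OF e coh_refl[of ?G]] unfolding 1[symmetric] .
      then show ?thesis by blast
    qed
    show "c b = 0" if c: "(\<lambda>x. \<Sum>b\<in>?B. c b * pw gs b x) \<approx>\<^sub>c 0" and b: "b \<in> ?B" for c b
    proof -
      have s: "(\<lambda>x. \<Sum>b\<in>?B. c b * pw gs b x) = (\<lambda>x. c [] * delta X0 x + c [0] * uF x + c [1] * delta Y3 x
        + c [2] * xF x + c [3] * delta Z3 x + c [1, 3] * delta W x)"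
        by (simp add: fun_eq_iff prd_one_right dds YZ)
      obtain K1 K2 where *: "c [] = 0" "c [0] * of_int (- n1) = 0" "c [0] * of_int (1 + m1) = 0" "c [1] = 0"
        "c [2] * of_int m1 = of_int (1 + m1) * K1 + of_int n1 * K2"
        "c [2] * of_int n1 = of_int m2 * K1 + of_int (1 + n2) * K2" "c [3] = 0" "c [1, 3] = 0"
        using c unfolding s coh_iff D0 by (simp add: delta_def uF_def xF_def del: of_int_add) (elim conjE exE, metis)
      have "c [2] = 0" by (rule xF_nonzero[OF M span *(5,6)])
      moreover have "c [0] = 0" using *(2,3) u by (auto simp del: of_int_add)
      ultimately show ?thesis using * b by auto
    qed
  qed
  then obtain \<phi> where \<phi>: "\<phi> \<in> graded_ring_isos ?ds R \<theta>" "\<And>i. i < 4 \<Longrightarrow> \<phi> (quot_elem ?ds R (gen i)) = cl (gs i)"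
    by auto
  then show ?thesis using \<phi>(2)[of 0] \<phi>(2)[of 1] \<phi>(2)[of 2] \<phi>(2)[of 3] by (intro bexI[of _ \<phi>]) simp_all
qed

text \<open>The differential from the dual of z3 to the dual of w is multiplication by a unit here.
  Hence z3 contributes no cocycle, degree 3 vanishes, and with it every product of generators of
  degrees 1 and 2.\<close>

lemma iso_rank1_neg:
  fixes l :: "'r::field"
  assumes two: "(2 :: 'r) \<noteq> 0"
    and M: "(of_int ((1 + m1) * (1 + n2) - n1 * m2) :: 'r) = 0"
    and D: "(of_int (m1 * n2 - m2 * n1 - 1) :: 'r) \<noteq> 0"
    and u: "(of_int n1 :: 'r) \<noteq> 0 \<or> (of_int (1 + m1) :: 'r) \<noteq> 0"
    and span: "\<And>r s :: 'r. \<exists>k. (\<lambda>c. r * delta Z1 c + s * delta Z2 c) \<approx>\<^sub>c (\<lambda>c. k * xF c)"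
    and lam: "(\<lambda>c. l * xF c) \<approx>\<^sub>c (\<lambda>c. of_int (- n1) * delta Z1 c + of_int (1 + m1) * delta Z2 c)"
    and R: "R = {gen 0 \<star> gen 0, gen 1 \<star> gen 1, gen 0 \<star> gen 1 - l \<odot> gen 2, gen 0 \<star> gen 2,
      gen 1 \<star> gen 2, gen 2 \<star> gen 2}"
  shows "\<exists>\<phi>\<in>graded_ring_isos [1, 1, 2] R \<theta>. \<phi> (quot_elem [1, 1, 2] R (gen 0)) = cl uF \<and>
    \<phi> (quot_elem [1, 1, 2] R (gen 1)) = cl (delta Y3) \<and>
    \<phi> (quot_elem [1, 1, 2] R (gen 2)) = cl xF"
proof -
  let ?ds = "[1, 1, 2] :: nat list"
  let ?D = "of_int (m1 * n2 - m2 * n1 - 1) :: 'r"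
  define gs :: "nat \<Rightarrow> cell \<Rightarrow> 'r" where "gs i = [uF, delta Y3, xF] ! i" for i
  let ?B = "{[], [0], [1], [2]} :: nat list set"
  have [simp]: "gs 0 = uF" "gs (Suc 0) = delta Y3" "gs 2 = xF" "gs (Suc (Suc 0)) = xF" by (simp_all add: gs_def)
  have ddu: "dd (uF :: cell \<Rightarrow> 'r) = 0" by (rule dd_uF[OF M])
  note dds = ddu dd_xF dd_Y3
  have W: "(\<lambda>x. k * delta W x) \<approx>\<^sub>c 0" for k :: 'r
    unfolding coh_iff using D by (intro exI[of _ 0] exI[of _ "k / ?D"]) (simp add: delta_def del: of_int_add of_int_diff)
  have R_carrier: "R \<subseteq> carrier (free_alg (length ?ds))"
    unfolding R by (auto intro!: diff_free_alg scale_free_alg mult_free_alg gen_free_alg)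
  interpret P: presentation ?ds R by unfold_locales (rule R_carrier)
  have "\<exists>\<phi>\<in>graded_ring_isos ?ds R \<theta>. \<forall>i<length ?ds. \<phi> (quot_elem ?ds R (gen i)) = cl (gs i)"
  proof (rule coh_presentation[where B = ?B and gs = gs, OF R_carrier])
    show "?ds ! i = 1 \<or> ?ds ! i = 2" if "i < length ?ds" for i using that by (auto simp: less_Suc_eq)
    show "dd (gs i) = 0" if "i < length ?ds" for i using that by (auto simp: less_Suc_eq dds)
    show hgs: "hg (?ds ! i) (gs i)" if "i < length ?ds" for i
      using that by (auto simp: less_Suc_eq hg_gens hg_uF hg_xF)
    have "prd uF (delta Y3) x = (of_int (- n1) * delta Z1 x + of_int (1 + m1) * delta Z2 x :: 'r)" for x
      by (cases x) (simp_all add: prd_cells dds, simp_all add: delta_def uF_def)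
    then have uY: "prd uF (delta Y3) = (\<lambda>x. of_int (- n1) * delta Z1 x + of_int (1 + m1) * delta Z2 x :: 'r)" by blast
    have r1: "prd uF (delta Y3) - (\<lambda>x. l * xF x) \<approx>\<^sub>c 0"
      unfolding uY using coh_diff[OF coh_sym[OF lam] coh_refl[of "\<lambda>x. l * xF x"]] by simp
    have top: "F = (\<lambda>x. F W * delta W x)" if "hg 3 F" for F :: "cell \<Rightarrow> 'r"
    proof
      show "F x = F W * delta W x" for x using that by (cases x) (simp_all add: hg_def delta_def)
    qed
    have top0: "F \<approx>\<^sub>c 0" if "hg 3 F" for F :: "cell \<Rightarrow> 'r"
      using W[of "F W"] unfolding top[OF that, symmetric] .
    have r2: "prd (delta Y3) xF \<approx>\<^sub>c (0 :: cell \<Rightarrow> 'r)"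
      by (rule top0) (use hg_prd[OF hg_gens(3) dd_Y3 hg_xF dd_xF] in \<open>simp add: numeral_3_eq_3\<close>)
    have r3: "prd uF xF \<approx>\<^sub>c (0 :: cell \<Rightarrow> 'r)"
      by (rule top0) (use hg_prd[OF hg_uF ddu hg_xF dd_xF] in \<open>simp add: numeral_3_eq_3\<close>)
    show "evw gs r \<approx>\<^sub>c 0" if "r \<in> R" for r
      using that unfolding R
      by (elim insertE emptyE)
        (simp_all only: evw_diff evw_scale evw_gen2 evw_gen, simp_all add: dds evw_gen2 evw_gen r1 r2 r3
          square_zero[OF two] hg_gens hg_uF hg_xF prd_deg22)
    show "gen i \<star> gen i \<in> R" if "i < length ?ds" for i
      using that by (auto simp: R less_Suc_eq numeral_2_eq_2)
    have B: "P.reduces ?B (P.wd w)" if "w \<in> ?B" for w by (rule P.reduces_basis) (use that in auto)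
    note [simp] = gen_def fmult_single fscale_single
    have w01: "P.reduces ?B (P.wd [0, 1])"
      using P.reduces_replace[of 0 1 l "[2]" "[]" "[]" ?B] B[of "[2]"] by (simp add: R)
    have w02: "P.reduces ?B (P.wd [0, 2])"
      using P.reduces_zero_pair[of 0 2 "[]" "[]" ?B] by (simp add: R)
    have z12: "P.reduces ?B (P.wd (w @ 1 # 2 # v))" if "set (w @ v) \<subseteq> {..<length ?ds}" for w v
      by (rule P.reduces_zero_pair[OF _ that]) (simp add: R)
    have ws: "P.reduces ?B (P.wd [1, 2])" "P.reduces ?B (P.wd [0, 1, 2])"
      using z12[of "[]" "[]"] z12[of "[0]" "[]"] by simp_all
    have up: "[0..<length ?ds] = [0, 1, 2]" by (simp add: upt_rec)
    show "P.reduces ?B (P.wd (filter Q [0..<length ?ds]))" for Q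
      unfolding up using B[of "[]"] B[of "[0]"] B[of "[1]"] B[of "[2]"] w01 w02 ws
      by (cases "Q 0"; cases "Q 1"; cases "Q 2") simp_all
    show "set b \<subseteq> {..<length ?ds}" if "b \<in> ?B" for b using that by auto
    show "\<exists>c. F \<approx>\<^sub>c (\<lambda>x. \<Sum>b\<in>?B. c b * pw gs b x)" if F: "dd F = 0" for F :: "cell \<Rightarrow> 'r"
    proof -
      obtain k where k: "F Y1 = k * of_int (- n1)" "F Y2 = k * of_int (1 + m1)"
        using cocycle_uF_multiple[OF F u] by blast
      obtain e where e: "(\<lambda>x. F Z1 * delta Z1 x + F Z2 * delta Z2 x) \<approx>\<^sub>c (\<lambda>x. e * xF x)" using span by blast
      have "?D * F Z3 = 0" using F unfolding cocycle_iff by blast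
      then have Z3: "F Z3 = 0" using D by (metis mult_eq_0_iff)
      define c where "c b = (if b = [] then F X0 else if b = [0] then k else if b = [1] then F Y3 else e)"
        for b :: "nat list"
      let ?G = "(\<lambda>x. F X0 * delta X0 x + k * uF x + F Y3 * delta Y3 x)"
      have "F x = ((\<lambda>x. F Z1 * delta Z1 x + F Z2 * delta Z2 x) + (\<lambda>x. F W * delta W x) + ?G) x" for x
        by (cases x) (simp_all add: delta_def uF_def k Z3)
      then have 1: "F = (\<lambda>x. F Z1 * delta Z1 x + F Z2 * delta Z2 x) + (\<lambda>x. F W * delta W x) + ?G" by blast
      have "((\<lambda>x. e * xF x) + 0 + ?G) x = (\<Sum>b\<in>?B. c b * pw gs b x)" for x
        by (simp add: c_def prd_one_right dds)
      then have 2: "(\<lambda>x. \<Sum>b\<in>?B. c b * pw gs b x) = (\<lambda>x. e * xF x) + 0 + ?G" by (simp add: fun_eq_iff)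
      have "F \<approx>\<^sub>c (\<lambda>x. \<Sum>b\<in>?B. c b * pw gs b x)"
        unfolding 2 using coh_add[OF coh_add[OF e W[of "F W"]] coh_refl[of ?G]] unfolding 1[symmetric] .
      then show ?thesis by blast
    qed
    show "c b = 0" if c: "(\<lambda>x. \<Sum>b\<in>?B. c b * pw gs b x) \<approx>\<^sub>c 0" and b: "b \<in> ?B" for c b
    proof -
      have s: "(\<lambda>x. \<Sum>b\<in>?B. c b * pw gs b x) = (\<lambda>x. c [] * delta X0 x + c [0] * uF x + c [1] * delta Y3 x + c [2] * xF x)"
        by (simp add: fun_eq_iff prd_one_right dds)
      obtain K1 K2 where *: "c [] = 0" "c [0] * of_int (- n1) = 0" "c [0] * of_int (1 + m1) = 0" "c [1] = 0"
        "c [2] * of_int m1 = of_int (1 + m1) * K1 + of_int n1 * K2"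
        "c [2] * of_int n1 = of_int m2 * K1 + of_int (1 + n2) * K2"
        using c unfolding s coh_iff by (simp add: delta_def uF_def xF_def del: of_int_add) (elim conjE exE, metis)
      have "c [2] = 0" by (rule xF_nonzero[OF M span *(5,6)])
      moreover have "c [0] = 0" using *(2,3) u by (auto simp del: of_int_add)
      ultimately show ?thesis using * b by auto
    qed
  qed
  then obtain \<phi> where \<phi>: "\<phi> \<in> graded_ring_isos ?ds R \<theta>" "\<And>i. i < 3 \<Longrightarrow> \<phi> (quot_elem ?ds R (gen i)) = cl (gs i)"
    by auto
  then show ?thesis using \<phi>(2)[of 0] \<phi>(2)[of 1] \<phi>(2)[of 2] by (intro bexI[of _ \<phi>]) simp_all
qed

end

section \<open>Rank 1: the additive structure\<close>

lemma to_int_mod_ring_less: "0 \<le> to_int_mod_ring (x :: 'p::prime_card mod_ring)" "to_int_mod_ring x < int CARD('p)"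
proof -
  have "to_int_mod_ring x \<in> {0..<int CARD('p)}" using range_to_int_mod_ring[where 'a = 'p] by blast
  then show "0 \<le> to_int_mod_ring x" "to_int_mod_ring x < int CARD('p)" by simp_all
qed

lemma mod_ring_line:
  fixes f :: "'p::prime_card mod_ring \<Rightarrow> 'a"
  assumes inj: "inj f" and add: "\<And>x y. f (x + y) = f x \<oplus>\<^bsub>H\<^esub> f y"
  shows "add_subgroup H (range f) \<cong> integer_mod_group CARD('p)"
proof -
  let ?h = "\<lambda>x. to_int_mod_ring (inv_into UNIV f x)"
  have "?h \<in> hom (add_subgroup H (range f)) (integer_mod_group CARD('p))"
  proof (rule homI)
    show "?h x \<in> carrier (integer_mod_group CARD('p))" if "x \<in> carrier (add_subgroup H (range f))" for x
      unfolding integer_mod_group_def using to_int_mod_ring_less[where 'p = 'p] by simp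
  qed (auto simp: add_subgroup_def integer_mod_group_def inj add[symmetric] to_int_mod_ring_add)
  moreover have "bij_betw ?h (carrier (add_subgroup H (range f))) (carrier (integer_mod_group CARD('p)))"
    unfolding bij_betw_def
  proof
    show "inj_on ?h (carrier (add_subgroup H (range f)))"
      using inj by (auto simp: inj_on_def add_subgroup_def)
    have "?h ` range f = range (to_int_mod_ring :: 'p mod_ring \<Rightarrow> int)" using inj by (simp add: image_image)
    then show "?h ` carrier (add_subgroup H (range f)) = carrier (integer_mod_group CARD('p))"
      by (auto simp: add_subgroup_def integer_mod_group_def range_to_int_mod_ring)
  qed
  ultimately show ?thesis by (auto simp: is_iso_def iso_def)
qed

lemma mod_ring_plane:
  fixes f :: "'p::prime_card mod_ring \<times> 'p mod_ring \<Rightarrow> 'a"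
  assumes inj: "inj f" and add: "\<And>x y. f (x + y) = f x \<oplus>\<^bsub>H\<^esub> f y"
  shows "add_subgroup H (range f) \<cong> integer_mod_group CARD('p) \<times>\<times> integer_mod_group CARD('p)"
proof -
  let ?t = "\<lambda>x :: 'p mod_ring \<times> 'p mod_ring. (to_int_mod_ring (fst x), to_int_mod_ring (snd x))"
  let ?h = "\<lambda>x. ?t (inv_into UNIV f x)"
  have r: "range ?t = range (to_int_mod_ring :: 'p mod_ring \<Rightarrow> int) \<times> range (to_int_mod_ring :: 'p mod_ring \<Rightarrow> int)"
    by (auto simp: image_iff)
  have "?h \<in> hom (add_subgroup H (range f)) (integer_mod_group CARD('p) \<times>\<times> integer_mod_group CARD('p))"
  proof (rule homI)
    show "?h x \<in> carrier (integer_mod_group CARD('p) \<times>\<times> integer_mod_group CARD('p))" if "x \<in> carrier (add_subgroup H (range f))" for x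
      unfolding DirProd_def integer_mod_group_def using to_int_mod_ring_less[where 'p = 'p] by simp
  qed (auto simp: add_subgroup_def integer_mod_group_def inj add[symmetric] to_int_mod_ring_add)
  moreover have "bij_betw ?h (carrier (add_subgroup H (range f))) (carrier (integer_mod_group CARD('p) \<times>\<times> integer_mod_group CARD('p)))"
    unfolding bij_betw_def
  proof
    show "inj_on ?h (carrier (add_subgroup H (range f)))"
      using inj by (auto simp: inj_on_def add_subgroup_def prod_eq_iff)
    have "?h ` range f = range ?t" using inj by (simp add: image_image)
    then show "?h ` carrier (add_subgroup H (range f)) = carrier (integer_mod_group CARD('p) \<times>\<times> integer_mod_group CARD('p))"
      unfolding r by (auto simp: add_subgroup_def integer_mod_group_def range_to_int_mod_ring)
  qed
  ultimately show ?thesis by (auto simp: is_iso_def iso_def)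
qed

text \<open>The image of a 2 x 2 matrix of rank 1 is a line, the kernel of a functional (e, f). The
  vector (r0, s0), on which the functional is 1, spans a complement and will represent a generator
  of the cokernel.\<close>

lemma rank1_image:
  fixes a b c d :: "'r::field"
  assumes det: "a * d - b * c = 0" and nz: "\<not> (a = 0 \<and> b = 0 \<and> c = 0 \<and> d = 0)"
  obtains e f r0 s0 :: 'r where "e * r0 + f * s0 = 1"
    "\<And>r s. (\<exists>x y. r = a * x + b * y \<and> s = c * x + d * y) \<longleftrightarrow> e * r + f * s = 0"
proof -
  \<comment> \<open>A non-zero first column (a', c') spans the image, and (c', -a') is the
    functional that kills it. If the first column is 0, the columns are exchanged, which keeps the
    image; the assumption \<open>im\<close> allows for this.\<close>
  have *: "\<exists>e f r0 s0. e * r0 + f * s0 = 1 \<and> (\<forall>r s. (\<exists>x y. r = a * x + b * y \<and> s = c * x + d * y) \<longleftrightarrow> e * r + f * s = 0)"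
    if nz: "a' \<noteq> 0 \<or> c' \<noteq> 0" and det: "a' * d' - b' * c' = 0"
    and im: "\<And>r s. (\<exists>x y. r = a * x + b * y \<and> s = c * x + d * y) \<longleftrightarrow> (\<exists>x y. r = a' * x + b' * y \<and> s = c' * x + d' * y)"
    for a' b' c' d'
  proof -
    have "\<exists>r0 s0. c' * r0 + - a' * s0 = 1"
    proof (cases "c' = 0")
      case True
      then show ?thesis using nz by (intro exI[of _ 0] exI[of _ "- (1 / a')"]) simp
    next
      case False
      then show ?thesis by (intro exI[of _ "1 / c'"] exI[of _ 0]) simp
    qed
    then obtain r0 s0 where 1: "c' * r0 + - a' * s0 = 1" by blast
    have 2: "(\<exists>x y. r = a' * x + b' * y \<and> s = c' * x + d' * y) \<longleftrightarrow> c' * r + - a' * s = 0" for r s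
    proof
      assume "\<exists>x y. r = a' * x + b' * y \<and> s = c' * x + d' * y"
      then obtain x y where rs: "r = a' * x + b' * y" "s = c' * x + d' * y" by blast
      have "c' * r + - a' * s = - (a' * d' - b' * c') * y" unfolding rs by (simp add: algebra_simps)
      then show "c' * r + - a' * s = 0" using det by simp
    next
      assume "c' * r + - a' * s = 0"
      from orthogonal_multiple[OF this] nz obtain k where "r = k * - (- a')" "s = k * c'" by auto
      then show "\<exists>x y. r = a' * x + b' * y \<and> s = c' * x + d' * y"
        by (intro exI[of _ k] exI[of _ 0]) simp
    qed
    show ?thesis unfolding im 2 using 1 by blast
  qed
  have "\<exists>e f r0 s0. e * r0 + f * s0 = 1 \<and> (\<forall>r s. (\<exists>x y. r = a * x + b * y \<and> s = c * x + d * y) \<longleftrightarrow> e * r + f * s = 0)"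
  proof (cases "a \<noteq> 0 \<or> c \<noteq> 0")
    case True
    then show ?thesis by (rule *[OF _ det]) (rule refl)
  next
    case False
    then have "b \<noteq> 0 \<or> d \<noteq> 0" using nz by blast
    then show ?thesis
    proof (rule *)
      show "b * c - a * d = 0" using det by (simp add: mult.commute)
      show "(\<exists>x y. r = a * x + b * y \<and> s = c * x + d * y) \<longleftrightarrow> (\<exists>x y. r = b * x + a * y \<and> s = d * x + c * y)" for r s
        by (metis add.commute)
    qed
  qed
  then show thesis using that by blast
qed

context gl2
begin

lemma coc_combination: "r \<cdot> dual a + s \<cdot> dual b = coc (\<lambda>c. r * delta a c + s * delta b c)"
proof
  show "(r \<cdot> dual a + s \<cdot> dual b) v = coc (\<lambda>c. r * delta a c + s * delta b c) v" for v
    by (simp add: cscale_def dual_eq_coc coc_def ev_fun_add ev_fun_mult)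
qed

lemma coh_comm_group: "comm_group (add_monoid (cohomology \<theta> :: (chain \<Rightarrow> 'r::comm_ring_1) set ring))"
proof (rule comm_groupI)
  fix x :: "(chain \<Rightarrow> 'r) set"
  assume "x \<in> carrier (add_monoid (cohomology \<theta>))"
  then obtain F :: "cell \<Rightarrow> 'r" where x: "x = cl F" "dd F = 0" by (auto simp: coh_carrier)
  have "dd (- F) = 0" using dd_diff[of 0 F] x(2) by simp
  then show "\<exists>y\<in>carrier (add_monoid (cohomology \<theta>)). y \<otimes>\<^bsub>add_monoid (cohomology \<theta>)\<^esub> x = \<one>\<^bsub>add_monoid (cohomology \<theta>)\<^esub>"
    unfolding x by (intro bexI[of _ "cl (- F)"]) (auto simp: coh_carrier coh_add_cl coh_zero_cl)
qed (auto simp: coh_carrier coh_add_cl coh_zero_cl dd_add add_ac intro: exI[of _ "0 :: cell \<Rightarrow> 'r"] dd_add[THEN trans])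

text \<open>\<open>add_span\<close> generates only a subgroup; over the prime field this is already
  the subspace, because every scalar is the image of a natural number.\<close>

lemma add_span_cl:
  fixes F :: "cell \<Rightarrow> 'p::prime_card mod_ring"
  assumes F: "dd F = 0"
  shows "add_span (cohomology \<theta>) (cl F) = range (\<lambda>k. cl (\<lambda>c. k * F c))"
proof -
  interpret G: comm_group "add_monoid (cohomology \<theta> :: (chain \<Rightarrow> 'p mod_ring) set ring)" by (rule coh_comm_group)
  have ddk: "dd (\<lambda>c. k * F c) = 0" for k by (simp add: dd_mult F fun_eq_iff)
  have "range (\<lambda>k. cl (\<lambda>c. k * F c)) = generate (add_monoid (cohomology \<theta>)) {cl F}"
  proof (rule G.generateI)
    show "subgroup (range (\<lambda>k. cl (\<lambda>c. k * F c))) (add_monoid (cohomology \<theta>))"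
    proof (rule G.subgroupI)
      show "range (\<lambda>k. cl (\<lambda>c. k * F c)) \<subseteq> carrier (add_monoid (cohomology \<theta>))" using ddk by (auto simp: coh_carrier)
      fix x assume "x \<in> range (\<lambda>k. cl (\<lambda>c. k * F c))"
      then obtain k where k: "x = cl (\<lambda>c. k * F c)" by blast
      have "cl (\<lambda>c. (- k) * F c) \<otimes>\<^bsub>add_monoid (cohomology \<theta>)\<^esub> x = \<one>\<^bsub>add_monoid (cohomology \<theta>)\<^esub>"
        unfolding k by (simp add: coh_add_cl coh_zero_cl plus_fun_def zero_fun_def)
      then have "inv\<^bsub>add_monoid (cohomology \<theta>)\<^esub> x = cl (\<lambda>c. (- k) * F c)"
        unfolding k by (intro G.inv_equality) (use ddk[of k] ddk[of "- k"] in \<open>auto simp: coh_carrier simp del: mult_minus_left\<close>)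
      then show "inv\<^bsub>add_monoid (cohomology \<theta>)\<^esub> x \<in> range (\<lambda>k. cl (\<lambda>c. k * F c))" by blast
      fix y assume "y \<in> range (\<lambda>k. cl (\<lambda>c. k * F c))"
      then obtain l where l: "y = cl (\<lambda>c. l * F c)" by blast
      have "x \<otimes>\<^bsub>add_monoid (cohomology \<theta>)\<^esub> y = cl (\<lambda>c. (k + l) * F c)"
        unfolding k l by (simp add: coh_add_cl plus_fun_def distrib_right)
      then show "x \<otimes>\<^bsub>add_monoid (cohomology \<theta>)\<^esub> y \<in> range (\<lambda>k. cl (\<lambda>c. k * F c))" by blast
    qed blast
    have "cl F = cl (\<lambda>c. 1 * F c)" by simp
    then show "{cl F} \<subseteq> range (\<lambda>k. cl (\<lambda>c. k * F c))" by blast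
    fix J assume J: "subgroup J (add_monoid (cohomology \<theta>))" "{cl F} \<subseteq> J"
    have "cl (\<lambda>c. of_nat n * F c) \<in> J" for n
    proof (induction n)
      case 0
      show ?case using subgroup.one_closed[OF J(1)] by (simp add: coh_zero_cl zero_fun_def)
    next
      case (Suc n)
      have "cl F \<oplus>\<^bsub>cohomology \<theta>\<^esub> cl (\<lambda>c. of_nat n * F c) \<in> J"
        using subgroup.m_closed[OF J(1) _ Suc, of "cl F"] J(2) by simp
      then show ?case by (simp add: coh_add_cl plus_fun_def distrib_right)
    qed
    moreover have "\<exists>n. k = of_nat n" for k :: "'p mod_ring" using surj_of_nat_mod_ring by blast
    ultimately have "cl (\<lambda>c. k * F c) \<in> J" for k by metis
    then show "range (\<lambda>k. cl (\<lambda>c. k * F c)) \<subseteq> J" by blast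
  qed
  then show ?thesis by (simp add: add_span_def)
qed

lemma coh_line:
  fixes F :: "cell \<Rightarrow> 'p::prime_card mod_ring"
  assumes "\<And>k. (\<lambda>c. k * F c) \<approx>\<^sub>c 0 \<Longrightarrow> k = 0"
  shows "add_subgroup (cohomology \<theta>) (range (\<lambda>k. cl (\<lambda>c. k * F c))) \<cong> integer_mod_group CARD('p)"
proof (rule mod_ring_line)
  show "inj (\<lambda>k. cl (\<lambda>c. k * F c))"
  proof (rule injI)
    fix k l assume "cl (\<lambda>c. k * F c) = cl (\<lambda>c. l * F c)"
    then have "(\<lambda>c. k * F c) - (\<lambda>c. l * F c) \<approx>\<^sub>c (\<lambda>c. l * F c) - (\<lambda>c. l * F c)"
      unfolding cl_eq_iff by (rule coh_diff) simp
    then show "k = l" using assms[of "k - l"] by (simp add: left_diff_distrib fun_diff_def)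
  qed
qed (simp add: coh_add_cl plus_fun_def distrib_right)

lemma coh_plane:
  fixes F G :: "cell \<Rightarrow> 'p::prime_card mod_ring"
  assumes ind: "\<And>k l. (\<lambda>c. k * F c + l * G c) \<approx>\<^sub>c 0 \<Longrightarrow> k = 0 \<and> l = 0"
    and F: "dd F = 0" and G: "dd G = 0"
    and S: "S = {cl (\<lambda>c. k * F c + l * G c) | k l. True}"
  shows "add_subgroup (cohomology \<theta>) S \<cong> integer_mod_group CARD('p) \<times>\<times> integer_mod_group CARD('p)"
    and "internal_direct_sum (cohomology \<theta>) S (add_span (cohomology \<theta>) (cl F)) (add_span (cohomology \<theta>) (cl G))"
proof -
  let ?f = "\<lambda>k. cl (\<lambda>c. fst k * F c + snd k * G c)"
  have S': "S = range ?f" unfolding S by (auto simp: image_iff) (metis fst_conv snd_conv)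
  have diff: "k = k' \<and> l = l'" if "cl (\<lambda>c. k * F c + l * G c) = cl (\<lambda>c. k' * F c + l' * G c)" for k l k' l'
  proof -
    have "(\<lambda>c. k * F c + l * G c) - (\<lambda>c. k' * F c + l' * G c) \<approx>\<^sub>c (\<lambda>c. k' * F c + l' * G c) - (\<lambda>c. k' * F c + l' * G c)"
      using that unfolding cl_eq_iff by (rule coh_diff) simp
    moreover have "(\<lambda>c. k * F c + l * G c) - (\<lambda>c. k' * F c + l' * G c) = (\<lambda>c. (k - k') * F c + (l - l') * G c)"
      by (simp add: fun_eq_iff algebra_simps)
    ultimately show ?thesis using ind[of "k - k'" "l - l'"] by simp
  qed
  show "add_subgroup (cohomology \<theta>) S \<cong> integer_mod_group CARD('p) \<times>\<times> integer_mod_group CARD('p)"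
    unfolding S'
  proof (rule mod_ring_plane)
    show "inj ?f" by (rule injI) (use diff in \<open>auto simp: prod_eq_iff\<close>)
    show "?f (x + y) = ?f x \<oplus>\<^bsub>cohomology \<theta>\<^esub> ?f y" for x y
      by (simp add: coh_add_cl plus_fun_def algebra_simps)
  qed
  show "internal_direct_sum (cohomology \<theta>) S (add_span (cohomology \<theta>) (cl F)) (add_span (cohomology \<theta>) (cl G))"
    unfolding internal_direct_sum_def add_span_cl[OF F] add_span_cl[OF G]
  proof
    show "S = range (\<lambda>k. cl (\<lambda>c. k * F c)) <+>\<^bsub>cohomology \<theta>\<^esub> range (\<lambda>k. cl (\<lambda>c. k * G c))"
      unfolding S set_add_def set_mult_def by (auto simp: coh_add_cl plus_fun_def)
    show "range (\<lambda>k. cl (\<lambda>c. k * F c)) \<inter> range (\<lambda>k. cl (\<lambda>c. k * G c)) = {\<zero>\<^bsub>cohomology \<theta>\<^esub>}"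
    proof (intro equalityI subsetI)
      fix x assume "x \<in> range (\<lambda>k. cl (\<lambda>c. k * F c)) \<inter> range (\<lambda>k. cl (\<lambda>c. k * G c))"
      then obtain k l where x: "x = cl (\<lambda>c. k * F c)" "x = cl (\<lambda>c. l * G c)" by blast
      then have "k = 0" using diff[of k 0 0 l] by simp
      then show "x \<in> {\<zero>\<^bsub>cohomology \<theta>\<^esub>}" using x by (simp add: coh_zero_cl zero_fun_def)
    next
      have "\<zero>\<^bsub>cohomology \<theta>\<^esub> = cl (\<lambda>c. 0 * F c)" "\<zero>\<^bsub>cohomology \<theta>\<^esub> = cl (\<lambda>c. 0 * G c)"
        by (simp_all add: coh_zero_cl zero_fun_def)
      then show "x \<in> range (\<lambda>k. cl (\<lambda>c. k * F c)) \<inter> range (\<lambda>k. cl (\<lambda>c. k * G c))" if "x \<in> {\<zero>\<^bsub>cohomology \<theta>\<^esub>}" for x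
        using that by blast
    qed
  qed
qed

definition vF :: "cell \<Rightarrow> 'r::comm_ring_1" where
  "vF c = of_int (1 + n2) * delta Y1 c - of_int m2 * delta Y2 c"

text \<open>The class u of the theorem with both of its cases, so that the additive statements in
  rank 1 can be proved for the two together.\<close>

definition wF :: "cell \<Rightarrow> 'r::comm_ring_1" where
  "wF = (if (of_int n1 :: 'r) \<noteq> 0 \<or> (of_int (1 + m1) :: 'r) \<noteq> 0 then uF else vF)"

lemma dd_wF:
  assumes M: "(of_int ((1 + m1) * (1 + n2) - n1 * m2) :: 'r::comm_ring_1) = 0"
  shows "dd (wF :: cell \<Rightarrow> 'r) = 0"
  unfolding cocycle_iff using M by (auto simp: wF_def uF_def vF_def delta_def algebra_simps)

text \<open>A cocycle is orthogonal on (y1, y2) to both rows (1 + m1, n1) and (m2, 1 + n2). The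
  vector \<open>wF\<close> is orthogonal to the first row if that is non-zero and otherwise to the
  second, and the vectors orthogonal to a non-zero row form a line.\<close>

lemma cocycle_wF_multiple:
  fixes F :: "cell \<Rightarrow> 'r::field"
  assumes F: "dd F = 0"
    and nz: "\<not> ((of_int (1 + m1) :: 'r) = 0 \<and> (of_int n1 :: 'r) = 0 \<and> (of_int m2 :: 'r) = 0 \<and> (of_int (1 + n2) :: 'r) = 0)"
  shows "\<exists>k. F Y1 = k * wF Y1 \<and> F Y2 = k * wF Y2"
proof (cases "(of_int n1 :: 'r) \<noteq> 0 \<or> (of_int (1 + m1) :: 'r) \<noteq> 0")
  case True
  then show ?thesis using cocycle_uF_multiple[OF F True] by (simp add: wF_def uF_def delta_def)
next
  case False
  then have z: "(of_int m2 :: 'r) \<noteq> 0 \<or> (of_int (1 + n2) :: 'r) \<noteq> 0" using nz by (simp del: of_int_add)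
  have "of_int m2 * F Y1 + of_int (1 + n2) * F Y2 = 0" using F unfolding cocycle_iff by blast
  from orthogonal_multiple[OF this z] obtain k where "F Y1 = k * - of_int (1 + n2)" "F Y2 = k * of_int m2" by blast
  then show ?thesis using False by (intro exI[of _ "- k"]) (simp add: wF_def vF_def delta_def algebra_simps)
qed

lemma wF_nonzero:
  fixes k :: "'r::field"
  assumes nz: "\<not> ((of_int (1 + m1) :: 'r) = 0 \<and> (of_int n1 :: 'r) = 0 \<and> (of_int m2 :: 'r) = 0 \<and> (of_int (1 + n2) :: 'r) = 0)"
    and k: "k * wF Y1 = (0 :: 'r)" "k * wF Y2 = 0"
  shows "k = 0"
  using assms by (auto simp: wF_def uF_def vF_def delta_def split: if_splits simp del: of_int_add)

lemma wF_off: "c \<noteq> Y1 \<Longrightarrow> c \<noteq> Y2 \<Longrightarrow> wF c = 0"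
  by (simp add: wF_def uF_def vF_def delta_def)

lemma H1_rank1:
  assumes M: "(of_int ((1 + m1) * (1 + n2) - n1 * m2) :: 'p::prime_card mod_ring) = 0"
    and nz: "\<not> ((of_int (1 + m1) :: 'p mod_ring) = 0 \<and> (of_int n1 :: 'p mod_ring) = 0
      \<and> (of_int m2 :: 'p mod_ring) = 0 \<and> (of_int (1 + n2) :: 'p mod_ring) = 0)"
  shows "add_subgroup (cohomology \<theta> :: (chain \<Rightarrow> 'p mod_ring) set ring) (coh_deg \<theta> 1)
      \<cong> integer_mod_group CARD('p) \<times>\<times> integer_mod_group CARD('p)"
    and "internal_direct_sum (cohomology \<theta> :: (chain \<Rightarrow> 'p mod_ring) set ring) (coh_deg \<theta> 1)
      (add_span (cohomology \<theta>) (cl wF)) (add_span (cohomology \<theta>) (cl (delta Y3)))"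
proof -
  have ind: "k = 0 \<and> l = 0" if kl: "(\<lambda>c. k * wF c + l * delta Y3 c) \<approx>\<^sub>c 0" for k l :: "'p mod_ring"
  proof -
    have "k * wF Y1 = 0" "k * wF Y2 = 0" "l = 0"
      using kl unfolding coh_iff by (auto simp: delta_def wF_off simp del: mult_eq_0_iff)
    then show ?thesis using wF_nonzero[OF nz] by blast
  qed
  have S: "coh_deg \<theta> 1 = {cl (\<lambda>c. k * wF c + l * delta Y3 c :: 'p mod_ring) | k l. True}"
  proof (intro equalityI subsetI)
    fix x :: "(chain \<Rightarrow> 'p mod_ring) set"
    assume "x \<in> coh_deg \<theta> 1"
    then obtain F where F: "x = cl F" "dd F = 0" "\<And>c. cdim c \<noteq> 1 \<Longrightarrow> F c = 0" unfolding coh_deg_cl by blast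
    obtain k where k: "F Y1 = k * wF Y1" "F Y2 = k * wF Y2" using cocycle_wF_multiple[OF F(2) nz] by blast
    have "F c = k * wF c + F Y3 * delta Y3 c" for c
      using F(3)[of c] by (cases c) (simp_all add: k wF_off delta_def)
    then have e: "cl F = cl (\<lambda>c. k * wF c + F Y3 * delta Y3 c)" by (intro arg_cong[where f = cl] ext)
    then show "x \<in> {cl (\<lambda>c. k * wF c + l * delta Y3 c) | k l. True}" using e unfolding F(1) by blast
  next
    fix x :: "(chain \<Rightarrow> 'p mod_ring) set"
    assume "x \<in> {cl (\<lambda>c. k * wF c + l * delta Y3 c) | k l. True}"
    then obtain k l where x: "x = cl (\<lambda>c. k * wF c + l * delta Y3 c)" by blast
    have "(\<lambda>c. k * wF c + l * delta Y3 c) = (\<lambda>c. k * wF c) + (\<lambda>c. l * delta Y3 c)" by (simp add: fun_eq_iff)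
    then have "dd (\<lambda>c. k * wF c + l * delta Y3 c) = 0"
      by (simp add: dd_add dd_mult dd_wF[OF M] dd_Y3) (simp add: fun_eq_iff)
    moreover have "k * wF c + l * delta Y3 c = 0" if "cdim c \<noteq> 1" for c
      using that by (cases c) (simp_all add: wF_off delta_def)
    ultimately show "x \<in> coh_deg \<theta> 1" unfolding coh_deg_cl x by blast
  qed
  show "add_subgroup (cohomology \<theta> :: (chain \<Rightarrow> 'p mod_ring) set ring) (coh_deg \<theta> 1)
      \<cong> integer_mod_group CARD('p) \<times>\<times> integer_mod_group CARD('p)"
    by (rule coh_plane(1)[OF ind dd_wF[OF M] dd_Y3 S])
  show "internal_direct_sum (cohomology \<theta> :: (chain \<Rightarrow> 'p mod_ring) set ring) (coh_deg \<theta> 1)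
      (add_span (cohomology \<theta>) (cl wF)) (add_span (cohomology \<theta>) (cl (delta Y3)))"
    by (rule coh_plane(2)[OF ind dd_wF[OF M] dd_Y3 S])
qed

lemma z12_cl: "z12_classes \<theta> = {cl (\<lambda>c. r * delta Z1 c + s * delta Z2 c) | r s :: 'r::comm_ring_1. True}"
proof -
  have "r \<cdot> dual Z1 + s \<cdot> dual Z2 = coc (\<lambda>c. r * delta Z1 c + s * delta Z2 c)" for r s :: 'r
    by (simp add: coc_combination)
  then show ?thesis by (simp add: z12_classes_def cl_def)
qed

text \<open>The functional of \<open>rank1_image\<close> identifies the classes of z1 and z2 with
  the field, and the complement vector is a generator. It is used instead of \<open>xF\<close>,
  which is a generator only under the additional assumption made for the ring structure.\<close>

lemma z12_rank1:
  assumes M: "(of_int ((1 + m1) * (1 + n2) - n1 * m2) :: 'r::field) = 0"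
    and nz: "\<not> ((of_int (1 + m1) :: 'r) = 0 \<and> (of_int n1 :: 'r) = 0 \<and> (of_int m2 :: 'r) = 0 \<and> (of_int (1 + n2) :: 'r) = 0)"
  obtains x :: "cell \<Rightarrow> 'r::field" where "z12_classes \<theta> = range (\<lambda>k. cl (\<lambda>c. k * x c))"
    "\<And>k. (\<lambda>c. k * x c) \<approx>\<^sub>c 0 \<Longrightarrow> k = 0" "\<And>c. c \<noteq> Z1 \<Longrightarrow> c \<noteq> Z2 \<Longrightarrow> x c = 0"
proof -
  have "(of_int (1 + m1) :: 'r) * of_int (1 + n2) - of_int n1 * of_int m2 = 0" using M by simp
  from rank1_image[OF this] nz obtain e f r0 s0 :: 'r where 1: "e * r0 + f * s0 = 1"
    and im: "\<And>r s. (\<exists>x y. r = of_int (1 + m1) * x + of_int n1 * y \<and> s = of_int m2 * x + of_int (1 + n2) * y) \<longleftrightarrow> e * r + f * s = 0"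
    by metis
  let ?x = "\<lambda>c. r0 * delta Z1 c + s0 * delta Z2 c"
  have im': "(\<lambda>c. r * delta Z1 c + s * delta Z2 c) \<approx>\<^sub>c (\<lambda>c. r' * delta Z1 c + s' * delta Z2 c) \<longleftrightarrow> e * (r - r') + f * (s - s') = 0"
    for r s r' s'
    unfolding im[symmetric] coh_iff by (simp add: delta_def diff_eq_eq add.commute del: of_int_add)
  have kx: "(\<lambda>c. k * ?x c) = (\<lambda>c. (k * r0) * delta Z1 c + (k * s0) * delta Z2 c)" for k
    by (simp add: fun_eq_iff algebra_simps)
  have *: "cl (\<lambda>c. r * delta Z1 c + s * delta Z2 c) = cl (\<lambda>c. (e * r + f * s) * ?x c)" for r s
  proof -
    have "e * (r - (e * r + f * s) * r0) + f * (s - (e * r + f * s) * s0) = (e * r + f * s) - (e * r + f * s) * (e * r0 + f * s0)"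
      by (simp add: algebra_simps)
    then show ?thesis unfolding kx cl_eq_iff im' 1 by simp
  qed
  show thesis
  proof (rule that[of ?x])
    show "z12_classes \<theta> = range (\<lambda>k. cl (\<lambda>c. k * ?x c))"
    proof (intro equalityI subsetI)
      fix x assume "x \<in> range (\<lambda>k. cl (\<lambda>c. k * ?x c))"
      then show "x \<in> z12_classes \<theta>" unfolding z12_cl kx by blast
    qed (use * in \<open>auto simp: z12_cl\<close>)
    show "k = 0" if "(\<lambda>c. k * ?x c) \<approx>\<^sub>c 0" for k
    proof -
      have "(\<lambda>c. k * ?x c) \<approx>\<^sub>c (\<lambda>c. 0 * delta Z1 c + 0 * delta Z2 c)" using that by (simp add: zero_fun_def)
      then have "k * (e * r0 + f * s0) = 0" unfolding kx im' by (simp add: algebra_simps)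
      then show ?thesis unfolding 1 by simp
    qed
  qed (simp add: delta_def)
qed

lemma H2_rank1_pos:
  assumes M: "(of_int ((1 + m1) * (1 + n2) - n1 * m2) :: 'p::prime_card mod_ring) = 0"
    and nz: "\<not> ((of_int (1 + m1) :: 'p mod_ring) = 0 \<and> (of_int n1 :: 'p mod_ring) = 0
      \<and> (of_int m2 :: 'p mod_ring) = 0 \<and> (of_int (1 + n2) :: 'p mod_ring) = 0)"
    and D: "(of_int (m1 * n2 - m2 * n1 - 1) :: 'p mod_ring) = 0"
  shows "add_subgroup (cohomology \<theta> :: (chain \<Rightarrow> 'p mod_ring) set ring) (coh_deg \<theta> 2)
      \<cong> integer_mod_group CARD('p) \<times>\<times> integer_mod_group CARD('p)"
    and "internal_direct_sum (cohomology \<theta> :: (chain \<Rightarrow> 'p mod_ring) set ring) (coh_deg \<theta> 2)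
      (z12_classes \<theta>) (add_span (cohomology \<theta>) (cl (delta Z3)))"
proof -
  obtain x :: "cell \<Rightarrow> 'p mod_ring" where x: "z12_classes \<theta> = range (\<lambda>k. cl (\<lambda>c. k * x c))"
    "\<And>k. (\<lambda>c. k * x c) \<approx>\<^sub>c 0 \<Longrightarrow> k = 0" "\<And>c. c \<noteq> Z1 \<Longrightarrow> c \<noteq> Z2 \<Longrightarrow> x c = 0"
    using z12_rank1[OF M nz] by blast
  have ddx: "dd x = 0" and ddZ3: "dd (delta Z3 :: cell \<Rightarrow> 'p mod_ring) = 0"
    unfolding cocycle_iff D by (simp_all add: x(3) delta_def)
  have ind: "k = 0 \<and> l = 0" if kl: "(\<lambda>c. k * x c + l * delta Z3 c) \<approx>\<^sub>c 0" for k l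
  proof -
    have l: "l = 0" using kl unfolding coh_iff by (auto simp: delta_def x(3))
    have "(\<lambda>c. k * x c) \<approx>\<^sub>c 0" using kl unfolding l by simp
    then show ?thesis using x(2) l by blast
  qed
  have S: "coh_deg \<theta> 2 = {cl (\<lambda>c. k * x c + l * delta Z3 c) | k l. True}"
  proof (intro equalityI subsetI)
    fix y :: "(chain \<Rightarrow> 'p mod_ring) set"
    assume "y \<in> coh_deg \<theta> 2"
    then obtain F where F: "y = cl F" "dd F = 0" "\<And>c. cdim c \<noteq> 2 \<Longrightarrow> F c = 0" unfolding coh_deg_cl by blast
    have "cl (\<lambda>c. F Z1 * delta Z1 c + F Z2 * delta Z2 c) \<in> z12_classes \<theta>" unfolding z12_cl by blast
    then obtain k where k: "(\<lambda>c. F Z1 * delta Z1 c + F Z2 * delta Z2 c) \<approx>\<^sub>c (\<lambda>c. k * x c)"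
      unfolding x(1) using cl_eq_iff by blast
    have "F c = ((\<lambda>c. F Z1 * delta Z1 c + F Z2 * delta Z2 c) + (\<lambda>c. F Z3 * delta Z3 c)) c" for c
      using F(3)[of c] by (cases c) (simp_all add: delta_def)
    then have 1: "F = (\<lambda>c. F Z1 * delta Z1 c + F Z2 * delta Z2 c) + (\<lambda>c. F Z3 * delta Z3 c)" by blast
    have 2: "(\<lambda>c. k * x c + F Z3 * delta Z3 c) = (\<lambda>c. k * x c) + (\<lambda>c. F Z3 * delta Z3 c)" by (simp add: fun_eq_iff)
    have "F \<approx>\<^sub>c (\<lambda>c. k * x c + F Z3 * delta Z3 c)"
      unfolding 2 using coh_add[OF k coh_refl[of "\<lambda>c. F Z3 * delta Z3 c"]] unfolding 1[symmetric] .
    then have "y = cl (\<lambda>c. k * x c + F Z3 * delta Z3 c)" unfolding F(1) cl_eq_iff .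
    then show "y \<in> {cl (\<lambda>c. k * x c + l * delta Z3 c) | k l. True}" by blast
  next
    fix y :: "(chain \<Rightarrow> 'p mod_ring) set"
    assume "y \<in> {cl (\<lambda>c. k * x c + l * delta Z3 c) | k l. True}"
    then obtain k l where y: "y = cl (\<lambda>c. k * x c + l * delta Z3 c)" by blast
    have "dd (\<lambda>c. k * x c + l * delta Z3 c) = 0" unfolding cocycle_iff D by (simp add: delta_def x(3))
    moreover have "k * x c + l * delta Z3 c = 0" if "cdim c \<noteq> 2" for c
      using that by (cases c) (simp_all add: x(3) delta_def)
    ultimately show "y \<in> coh_deg \<theta> 2" unfolding coh_deg_cl y by blast
  qed
  show "add_subgroup (cohomology \<theta> :: (chain \<Rightarrow> 'p mod_ring) set ring) (coh_deg \<theta> 2)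
      \<cong> integer_mod_group CARD('p) \<times>\<times> integer_mod_group CARD('p)"
    by (rule coh_plane(1)[OF ind ddx ddZ3 S])
  show "internal_direct_sum (cohomology \<theta> :: (chain \<Rightarrow> 'p mod_ring) set ring) (coh_deg \<theta> 2)
      (z12_classes \<theta>) (add_span (cohomology \<theta>) (cl (delta Z3)))"
    using coh_plane(2)[OF ind ddx ddZ3 S] unfolding x(1) add_span_cl[OF ddx] .
qed

lemma z12_iso:
  assumes M: "(of_int ((1 + m1) * (1 + n2) - n1 * m2) :: 'p::prime_card mod_ring) = 0"
    and nz: "\<not> ((of_int (1 + m1) :: 'p mod_ring) = 0 \<and> (of_int n1 :: 'p mod_ring) = 0
      \<and> (of_int m2 :: 'p mod_ring) = 0 \<and> (of_int (1 + n2) :: 'p mod_ring) = 0)"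
  shows "add_subgroup (cohomology \<theta> :: (chain \<Rightarrow> 'p mod_ring) set ring) (z12_classes \<theta>) \<cong> integer_mod_group CARD('p)"
proof -
  obtain x :: "cell \<Rightarrow> 'p mod_ring" where x: "z12_classes \<theta> = range (\<lambda>k. cl (\<lambda>c. k * x c))"
    "\<And>k. (\<lambda>c. k * x c) \<approx>\<^sub>c 0 \<Longrightarrow> k = 0"
    using z12_rank1[OF M nz, of thesis] by metis
  show ?thesis unfolding x(1) by (rule coh_line[OF x(2)])
qed

text \<open>The dual of z3 is no cocycle: its coboundary is m1 n2 - m2 n1 - 1 times the dual of w, a
  non-zero multiple.\<close>

lemma H2_neg:
  assumes D: "(of_int (m1 * n2 - m2 * n1 - 1) :: 'r::field) \<noteq> 0"
  shows "coh_deg \<theta> 2 = (z12_classes \<theta> :: (chain \<Rightarrow> 'r) set set)"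
proof (intro equalityI subsetI)
  fix y :: "(chain \<Rightarrow> 'r) set"
  assume "y \<in> coh_deg \<theta> 2"
  then obtain F where F: "y = cl F" "dd F = 0" "\<And>c. cdim c \<noteq> 2 \<Longrightarrow> F c = 0" unfolding coh_deg_cl by blast
  have "of_int (m1 * n2 - m2 * n1 - 1) * F Z3 = 0" using F(2) unfolding cocycle_iff by blast
  then have "F Z3 = 0" using D by (metis mult_eq_0_iff)
  then have "F c = F Z1 * delta Z1 c + F Z2 * delta Z2 c" for c
    using F(3)[of c] by (cases c) (simp_all add: delta_def)
  then have e: "cl F = cl (\<lambda>c. F Z1 * delta Z1 c + F Z2 * delta Z2 c)" by (intro arg_cong[where f = cl] ext)
  then show "y \<in> z12_classes \<theta>" using e unfolding F(1) z12_cl by blast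
next
  fix y :: "(chain \<Rightarrow> 'r) set"
  assume "y \<in> z12_classes \<theta>"
  then obtain r s where y: "y = cl (\<lambda>c. r * delta Z1 c + s * delta Z2 c)" unfolding z12_cl by blast
  have "dd (\<lambda>c. r * delta Z1 c + s * delta Z2 c) = 0" by (simp add: cocycle_iff delta_def)
  moreover have "r * delta Z1 c + s * delta Z2 c = 0" if "cdim c \<noteq> 2" for c
    using that by (auto simp: delta_def)
  ultimately show "y \<in> coh_deg \<theta> 2" unfolding coh_deg_cl y by blast
qed

lemma coh_deg_3: "coh_deg \<theta> 3 = range (\<lambda>k. cl (\<lambda>c. k * delta W c :: 'r::comm_ring_1))"
proof (intro equalityI subsetI)
  fix y :: "(chain \<Rightarrow> 'r) set"
  assume "y \<in> coh_deg \<theta> 3"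
  then obtain F where F: "y = cl F" "\<And>c. cdim c \<noteq> 3 \<Longrightarrow> F c = 0" unfolding coh_deg_cl by blast
  have "F c = F W * delta W c" for c using F(2)[of c] by (cases c) (simp_all add: delta_def)
  then have e: "cl F = cl (\<lambda>c. F W * delta W c)" by (intro arg_cong[where f = cl] ext)
  then show "y \<in> range (\<lambda>k. cl (\<lambda>c. k * delta W c))" using e unfolding F(1) by blast
next
  fix y :: "(chain \<Rightarrow> 'r) set"
  assume "y \<in> range (\<lambda>k. cl (\<lambda>c. k * delta W c))"
  then obtain k where y: "y = cl (\<lambda>c. k * delta W c)" by blast
  have "dd (\<lambda>c. k * delta W c) = 0" by (simp add: cocycle_iff delta_def)
  moreover have "k * delta W c = 0" if "cdim c \<noteq> 3" for c
    using that by (auto simp: delta_def)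
  ultimately show "y \<in> coh_deg \<theta> 3" unfolding coh_deg_cl y by blast
qed

lemma H3_pos:
  assumes D: "(of_int (m1 * n2 - m2 * n1 - 1) :: 'p::prime_card mod_ring) = 0"
  shows "coh_deg \<theta> 3 = add_span (cohomology \<theta>) (cl (delta W :: cell \<Rightarrow> 'p mod_ring))"
    and "add_subgroup (cohomology \<theta> :: (chain \<Rightarrow> 'p mod_ring) set ring) (coh_deg \<theta> 3) \<cong> integer_mod_group CARD('p)"
proof -
  have "dd (delta W :: cell \<Rightarrow> 'p mod_ring) = 0" by (simp add: cocycle_iff delta_def)
  then show "coh_deg \<theta> 3 = add_span (cohomology \<theta>) (cl (delta W :: cell \<Rightarrow> 'p mod_ring))"
    by (simp add: coh_deg_3 add_span_cl)
  show "add_subgroup (cohomology \<theta> :: (chain \<Rightarrow> 'p mod_ring) set ring) (coh_deg \<theta> 3) \<cong> integer_mod_group CARD('p)"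
    unfolding coh_deg_3 by (rule coh_line) (auto simp: coh_iff D delta_def simp del: of_int_diff)
qed

lemma H3_neg:
  assumes D: "(of_int (m1 * n2 - m2 * n1 - 1) :: 'r::field) \<noteq> 0"
  shows "coh_deg \<theta> 3 = {\<zero>\<^bsub>cohomology \<theta> :: (chain \<Rightarrow> 'r) set ring\<^esub>}"
proof -
  have "(\<lambda>c. k * delta W c) \<approx>\<^sub>c 0" for k :: 'r
    unfolding coh_iff using D
    by (intro exI[of _ 0] exI[of _ "k / of_int (m1 * n2 - m2 * n1 - 1)"]) (simp add: delta_def del: of_int_add of_int_diff)
  then have "cl (\<lambda>c. k * delta W c) = cl 0" for k :: 'r unfolding cl_eq_iff .
  then show ?thesis unfolding coh_deg_3 coh_zero_cl by auto
qed

end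

section \<open>Rank and determinant modulo p\<close>

lemma rank_zero_imp: "rank A = 0 \<Longrightarrow> A = 0" for A :: "'r::field^'n^'m"
proof -
  assume "rank A = 0"
  then have "rows A \<subseteq> {0}" unfolding row_rank_def_gen by (rule vec.dim_eq_0[THEN iffD1])
  then have "row i A = 0" for i unfolding rows_def by blast
  then show "A = 0" by (simp add: row_def vec_eq_iff)
qed

lemma rank_full_iff: "rank A = CARD('n) \<longleftrightarrow> det A \<noteq> 0" for A :: "'r::field^'n^'n"
proof -
  have "rank A = CARD('n) \<longleftrightarrow> vec.span (rows A) = UNIV"
    by (simp add: row_rank_def_gen vec.dim_eq_full[symmetric] vec.dimension_def card_cart_basis)
  also have "\<dots> \<longleftrightarrow> invertible A"
    unfolding matrix_left_invertible_span_rows_gen[symmetric] invertible_def by (metis matrix_left_right_inverse)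
  finally show ?thesis by (simp add: invertible_det_nz)
qed

lemma rank_zero: "rank (0 :: 'r::field^'n^'m) = 0"
proof -
  have "rows (0 :: 'r^'n^'m) \<subseteq> {0}" by (auto simp: rows_def row_def vec_eq_iff)
  then show ?thesis unfolding row_rank_def_gen by (rule vec.dim_eq_0[THEN iffD2])
qed

context gl2
begin

text \<open>The adjugate formula for -\<theta>^-1, obtained without division by combining the
  equations of \<open>theta_entries\<close>.\<close>

lemma mn_entries:
  "det \<theta> * m1 = - \<theta>$2$2" "det \<theta> * m2 = \<theta>$1$2" "det \<theta> * n1 = \<theta>$2$1" "det \<theta> * n2 = - \<theta>$1$1"
proof -
  have "det \<theta> * m1 = \<theta>$2$2 * (m1 * \<theta>$1$1 + m2 * \<theta>$2$1) - \<theta>$2$1 * (m1 * \<theta>$1$2 + m2 * \<theta>$2$2)"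
    by (simp add: det_2 algebra_simps)
  then show "det \<theta> * m1 = - \<theta>$2$2" unfolding theta_entries by simp
  have "det \<theta> * m2 = \<theta>$1$1 * (m1 * \<theta>$1$2 + m2 * \<theta>$2$2) - \<theta>$1$2 * (m1 * \<theta>$1$1 + m2 * \<theta>$2$1)"
    by (simp add: det_2 algebra_simps)
  then show "det \<theta> * m2 = \<theta>$1$2" unfolding theta_entries by simp
  have "det \<theta> * n1 = \<theta>$2$2 * (n1 * \<theta>$1$1 + n2 * \<theta>$2$1) - \<theta>$2$1 * (n1 * \<theta>$1$2 + n2 * \<theta>$2$2)"
    by (simp add: det_2 algebra_simps)
  then show "det \<theta> * n1 = \<theta>$2$1" unfolding theta_entries by simp
  have "det \<theta> * n2 = \<theta>$1$1 * (n1 * \<theta>$1$2 + n2 * \<theta>$2$2) - \<theta>$1$2 * (n1 * \<theta>$1$1 + n2 * \<theta>$2$1)"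
    by (simp add: det_2 algebra_simps)
  then show "det \<theta> * n2 = - \<theta>$1$1" unfolding theta_entries by simp
qed

text \<open>The last equation relates the matrix of the differential to the rank condition: 1 -
  \<theta>^-1 = \<theta>^-1 (\<theta> - 1), so the two determinants differ by the factor det
  \<theta>. In \<open>mn_det_neg\<close> this factor is -1.\<close>

lemma mn_det_pos:
  assumes d: "det \<theta> = 1"
  shows "m1 = - \<theta>$2$2" "m2 = \<theta>$1$2" "n1 = \<theta>$2$1" "n2 = - \<theta>$1$1" "m1 * n2 - m2 * n1 = 1"
    "(1 + m1) * (1 + n2) - n1 * m2 = det (\<theta> - mat 1)"
proof -
  show e: "m1 = - \<theta>$2$2" "m2 = \<theta>$1$2" "n1 = \<theta>$2$1" "n2 = - \<theta>$1$1" using mn_entries unfolding d by simp_all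
  show "m1 * n2 - m2 * n1 = 1" using d unfolding e by (simp add: det_2 mult.commute)
  show "(1 + m1) * (1 + n2) - n1 * m2 = det (\<theta> - mat 1)" unfolding e by (simp add: det_2 mat_def algebra_simps)
qed

lemma mn_det_neg:
  assumes d: "det \<theta> = - 1"
  shows "m1 = \<theta>$2$2" "m2 = - \<theta>$1$2" "n1 = - \<theta>$2$1" "n2 = \<theta>$1$1" "m1 * n2 - m2 * n1 = - 1"
    "(1 + m1) * (1 + n2) - n1 * m2 = - det (\<theta> - mat 1)"
proof -
  show e: "m1 = \<theta>$2$2" "m2 = - \<theta>$1$2" "n1 = - \<theta>$2$1" "n2 = \<theta>$1$1" using mn_entries unfolding d by simp_all
  show m: "m1 * n2 - m2 * n1 = - 1" using d unfolding e by (simp add: det_2 mult.commute)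
  have "(1 + m1) * (1 + n2) - n1 * m2 = 1 + m1 + n2 + (m1 * n2 - m2 * n1)" by (simp add: algebra_simps)
  moreover have "det (\<theta> - mat 1) = 1 - m1 - n2 + (m1 * n2 - m2 * n1)" unfolding e by (simp add: det_2 mat_def algebra_simps)
  ultimately show "(1 + m1) * (1 + n2) - n1 * m2 = - det (\<theta> - mat 1)" unfolding m by simp
qed

lemma cls_dual: "cls \<theta> (dual c) = cl (delta c)"
  by (simp add: cl_def dual_eq_coc)

end

lemma det_map_of_int: "det (map_matrix of_int A :: 'r::comm_ring_1^2^2) = of_int (det A)"
  by (simp add: det_2 map_matrix_def)

theorem theorem8:
  fixes \<theta> :: "int^2^2" and \<alpha> \<beta> \<gamma> \<delta> m1 m2 n1 n2 :: int
    and u :: "chain \<Rightarrow> 'p::prime_card mod_ring"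
    and H :: "(chain \<Rightarrow> 'p mod_ring) set ring"
    and \<rho> :: nat
  assumes theta: "\<theta> = vector [vector [\<alpha>, \<gamma>], vector [\<beta>, \<delta>]]"
    and GL2: "invertible \<theta>"
    and odd_p: "odd CARD('p)"
    and mn: "- matrix_inv \<theta> = vector [vector [m1, m2], vector [n1, n2]]"
    and rho: "\<rho> = rank (map_matrix of_int (\<theta> - mat 1) :: 'p mod_ring^2^2)"
    and H: "H = cohomology \<theta>"
    and u: "u = (if \<not> [1 + m1 = 0] (mod int CARD('p)) \<or> \<not> [n1 = 0] (mod int CARD('p))
                 then of_int (- n1) \<cdot> dual Y1 + of_int (1 + m1) \<cdot> dual Y2
                 else of_int (1 + n2) \<cdot> dual Y1 - of_int m2 \<cdot> dual Y2)"
  shows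
    "(\<rho> = 0 \<and> det \<theta> = 1 \<longrightarrow>
        (let \<zeta>1 = gen 0; \<zeta>2 = gen 1; \<zeta>3 = gen 2 in
         graded_ring_isos [1, 1, 1]
           {\<zeta>1 \<star> \<zeta>1, \<zeta>2 \<star> \<zeta>2, \<zeta>3 \<star> (\<zeta>3 :: 'p mod_ring falg)} \<theta> \<noteq> {}))

   \<and> (\<rho> = 0 \<and> det \<theta> = - 1 \<longrightarrow>
        (let \<zeta>1 = gen 0; \<zeta>2 = gen 1; \<zeta>3 = gen 2 in
         graded_ring_isos [1, 1, 1]
           {\<zeta>1 \<star> \<zeta>1, \<zeta>2 \<star> \<zeta>2, \<zeta>3 \<star> \<zeta>3, \<zeta>1 \<star> (\<zeta>2 :: 'p mod_ring falg)} \<theta> \<noteq> {}))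

   \<and> (\<rho> = 1 \<and> det \<theta> = 1 \<longrightarrow>
        - matrix_inv \<theta> = vector [vector [- \<delta>, \<gamma>], vector [\<beta>, - \<alpha>]] \<and>
        internal_direct_sum H (coh_deg \<theta> 1) (add_span H (cls \<theta> u)) (add_span H (cls \<theta> (dual Y3))) \<and>
        add_subgroup H (coh_deg \<theta> 1) \<cong> integer_mod_group CARD('p) \<times>\<times> integer_mod_group CARD('p) \<and>
        internal_direct_sum H (coh_deg \<theta> 2) (z12_classes \<theta>) (add_span H (cls \<theta> (dual Z3))) \<and>
        add_subgroup H (z12_classes \<theta>) \<cong> integer_mod_group CARD('p) \<and>
        add_subgroup H (coh_deg \<theta> 2) \<cong> integer_mod_group CARD('p) \<times>\<times> integer_mod_group CARD('p) \<and>
        coh_deg \<theta> 3 = add_span H (cls \<theta> (dual W)) \<and>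
        add_subgroup H (coh_deg \<theta> 3) \<cong> integer_mod_group CARD('p) \<and>
        (u = of_int (- n1) \<cdot> dual Y1 + of_int (1 + m1) \<cdot> dual Y2 \<and>
         add_span H (cls \<theta> (of_int m1 \<cdot> dual Z1 + of_int n1 \<cdot> dual Z2)) = z12_classes \<theta> \<longrightarrow>
         (\<forall>l :: 'p mod_ring.
            cls \<theta> (l \<cdot> (of_int m1 \<cdot> dual Z1 + of_int n1 \<cdot> dual Z2)) =
              cls \<theta> (of_int (- n1) \<cdot> dual Z1 + of_int (1 + m1) \<cdot> dual Z2) \<longrightarrow>
            (let \<zeta>1 = gen 0; \<zeta>2 = gen 1; \<xi>1 = gen 2; \<xi>2 = gen 3;
                 ds = [1, 1, 2, 2];
                 c = of_int (1 - \<alpha> - \<gamma> - \<alpha> * \<gamma>) / 2 * of_int (- n1)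
                     + of_int (1 - \<beta> - \<delta> + \<beta> * \<delta>) / 2 * of_int (1 + m1);
                 R = {\<zeta>1 \<star> \<zeta>1,
                      \<zeta>2 \<star> \<zeta>2,
                      \<zeta>1 \<star> \<zeta>2 - l \<odot> \<xi>1,
                      \<zeta>2 \<star> \<xi>1,
                      \<zeta>1 \<star> \<xi>1 - of_int (- (n1^2) - (1 + m1) * m1) \<odot> (\<zeta>2 \<star> \<xi>2),
                      \<zeta>1 \<star> \<xi>2 - c \<odot> (\<zeta>2 \<star> \<xi>2),
                      \<xi>1 \<star> \<xi>1,
                      \<xi>2 \<star> \<xi>2,
                      \<xi>1 \<star> \<xi>2}
             in \<exists>\<phi> \<in> graded_ring_isos ds R \<theta>.
                  \<phi> (quot_elem ds R \<zeta>1) = cls \<theta> u \<and>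
                  \<phi> (quot_elem ds R \<zeta>2) = cls \<theta> (dual Y3) \<and>
                  \<phi> (quot_elem ds R \<xi>1) =
                    cls \<theta> (of_int m1 \<cdot> dual Z1 + of_int n1 \<cdot> dual Z2) \<and>
                  \<phi> (quot_elem ds R \<xi>2) = cls \<theta> (dual Z3)))))

   \<and> (\<rho> = 1 \<and> det \<theta> = - 1 \<longrightarrow>
        internal_direct_sum H (coh_deg \<theta> 1) (add_span H (cls \<theta> u)) (add_span H (cls \<theta> (dual Y3))) \<and>
        add_subgroup H (coh_deg \<theta> 1) \<cong> integer_mod_group CARD('p) \<times>\<times> integer_mod_group CARD('p) \<and>
        coh_deg \<theta> 2 = (z12_classes \<theta> :: (chain \<Rightarrow> 'p mod_ring) set set) \<and>
        add_subgroup H (coh_deg \<theta> 2) \<cong> integer_mod_group CARD('p) \<and>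
        coh_deg \<theta> 3 = {\<zero>\<^bsub>H\<^esub>} \<and>
        (u = of_int (- n1) \<cdot> dual Y1 + of_int (1 + m1) \<cdot> dual Y2 \<and>
         add_span H (cls \<theta> (of_int m1 \<cdot> dual Z1 + of_int n1 \<cdot> dual Z2)) = z12_classes \<theta> \<longrightarrow>
         (\<forall>l :: 'p mod_ring.
            cls \<theta> (l \<cdot> (of_int m1 \<cdot> dual Z1 + of_int n1 \<cdot> dual Z2)) =
              cls \<theta> (of_int (- n1) \<cdot> dual Z1 + of_int (1 + m1) \<cdot> dual Z2) \<longrightarrow>
            (let \<zeta>1 = gen 0; \<zeta>2 = gen 1; \<xi> = gen 2;
                 ds = [1, 1, 2];
                 R = {\<zeta>1 \<star> \<zeta>1,
                      \<zeta>2 \<star> \<zeta>2,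
                      \<zeta>1 \<star> \<zeta>2 - l \<odot> \<xi>,
                      \<zeta>1 \<star> \<xi>,
                      \<zeta>2 \<star> \<xi>,
                      \<xi> \<star> \<xi>}
             in \<exists>\<phi> \<in> graded_ring_isos ds R \<theta>.
                  \<phi> (quot_elem ds R \<zeta>1) = cls \<theta> u \<and>
                  \<phi> (quot_elem ds R \<zeta>2) = cls \<theta> (dual Y3) \<and>
                  \<phi> (quot_elem ds R \<xi>) =
                    cls \<theta> (of_int m1 \<cdot> dual Z1 + of_int n1 \<cdot> dual Z2)))))

   \<and> (\<rho> = 2 \<and> det \<theta> = 1 \<longrightarrow>
        (let \<zeta> = gen 0; \<xi> = gen 1 in
         graded_ring_isos [1, 2] {\<zeta> \<star> \<zeta>, \<xi> \<star> (\<xi> :: 'p mod_ring falg)} \<theta> \<noteq> {}))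

   \<and> (\<rho> = 2 \<and> det \<theta> = - 1 \<longrightarrow>
        (let \<zeta> = gen 0 in
         graded_ring_isos [1] {\<zeta> \<star> (\<zeta> :: 'p mod_ring falg)} \<theta> \<noteq> {}))"
proof -
  interpret G: gl2 \<theta> by unfold_locales (rule GL2)
  let ?A = "map_matrix of_int (\<theta> - mat 1) :: 'p mod_ring^2^2"
  have e: "mn \<theta>$1$1 = m1" "mn \<theta>$1$2 = m2" "mn \<theta>$2$1 = n1" "mn \<theta>$2$2 = n2"
    by (simp_all add: mn_def mn)
  have t: "\<theta>$1$1 = \<alpha>" "\<theta>$1$2 = \<gamma>" "\<theta>$2$1 = \<beta>" "\<theta>$2$2 = \<delta>" by (simp_all add: theta)
  have A: "?A$1$1 = of_int (\<alpha> - 1)" "?A$1$2 = of_int \<gamma>" "?A$2$1 = of_int \<beta>" "?A$2$2 = of_int (\<delta> - 1)"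
    by (simp_all add: map_matrix_def mat_def t)
  have cong0: "[k = 0] (mod int CARD('p)) \<longleftrightarrow> (of_int k :: 'p mod_ring) = 0" for k
    by (simp add: cong_0_iff of_int_eq_0_iff_char_dvd)
  have two: "(2 :: 'p mod_ring) \<noteq> 0"
  proof
    assume "(2 :: 'p mod_ring) = 0"
    then have "[2 = 0] (mod int CARD('p))" unfolding cong0 by simp
    then have "int CARD('p) dvd 2" by (simp add: cong_0_iff)
    then have "CARD('p) dvd 2" by presburger
    then show False using odd_p prime_card[where 'a = 'p] by (metis dvd_refl prime_nat_iff primes_dvd_imp_eq two_is_prime_nat)
  qed
  have r0: "?A = 0" if "\<rho> = 0" using that unfolding rho by (rule rank_zero_imp)
  have r1: "?A \<noteq> 0 \<and> (of_int (det (\<theta> - mat 1)) :: 'p mod_ring) = 0" if "\<rho> = 1"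
    using that rank_full_iff[of ?A] rank_zero[where 'r = "'p mod_ring" and 'n = 2 and 'm = 2] unfolding rho det_map_of_int
    by auto
  have r2: "(of_int (det (\<theta> - mat 1)) :: 'p mod_ring) \<noteq> 0" if "\<rho> = 2"
    using that rank_full_iff[of ?A] unfolding rho det_map_of_int by simp
  let ?o = "of_int :: int \<Rightarrow> 'p mod_ring"
  let ?nz = "\<not> (?o (1 + m1) = 0 \<and> ?o n1 = 0 \<and> ?o m2 = 0 \<and> ?o (1 + n2) = 0)"
  let ?H = "cohomology \<theta> :: (chain \<Rightarrow> 'p mod_ring) set ring"
  note pos = G.mn_det_pos[unfolded e t] and neg = G.mn_det_neg[unfolded e t]
  have M: "?o ((1 + m1) * (1 + n2) - n1 * m2) = ?o (det (\<theta> - mat 1)) \<or> ?o ((1 + m1) * (1 + n2) - n1 * m2) = - ?o (det (\<theta> - mat 1))"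
    if "det \<theta> = 1 \<or> det \<theta> = - 1"
    using that pos(6) neg(6) by (metis of_int_minus)
  have M0: "?o ((1 + m1) * (1 + n2) - n1 * m2) = 0" if "\<rho> = 1" "det \<theta> = 1 \<or> det \<theta> = - 1"
    using M[OF that(2)] r1[OF that(1)] by (metis neg_equal_0_iff_equal)
  have M2: "?o ((1 + m1) * (1 + n2) - n1 * m2) \<noteq> 0" if "\<rho> = 2" "det \<theta> = 1 \<or> det \<theta> = - 1"
    using M[OF that(2)] r2[OF that(1)] by (metis neg_equal_0_iff_equal)
  have Dpos: "?o (m1 * n2 - m2 * n1 - 1) = 0" if "det \<theta> = 1"
    using pos(5)[OF that] by simp
  have Dneg: "?o (m1 * n2 - m2 * n1 - 1) \<noteq> 0" if "det \<theta> = - 1"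
    unfolding neg(5)[OF that] using two by simp
  have nz: ?nz if r: "\<rho> = 1" and d: "det \<theta> = 1 \<or> det \<theta> = - 1"
    using d
  proof
    assume d: "det \<theta> = 1"
    show ?nz
    proof
      assume "?o (1 + m1) = 0 \<and> ?o n1 = 0 \<and> ?o m2 = 0 \<and> ?o (1 + n2) = 0"
      then have "?A = 0" unfolding pos(1-4)[OF d] by (simp add: vec_eq_iff forall_2 t mat_def)
      then show False using r1[OF r] by blast
    qed
  next
    assume d: "det \<theta> = - 1"
    show ?nz
    proof
      assume "?o (1 + m1) = 0 \<and> ?o n1 = 0 \<and> ?o m2 = 0 \<and> ?o (1 + n2) = 0"
      \<comment> \<open>If the differential vanished, -\<theta>^-1 would be -1 mod p and would have
        determinant 1 there, whereas its determinant is -1; these differ as p is odd.\<close>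
      then have "?o m1 = - 1" "?o n2 = - 1" "?o n1 = 0" by (simp_all add: eq_neg_iff_add_eq_0 add.commute)
      then have "?o (m1 * n2 - m2 * n1) = 1" by simp
      then show False unfolding neg(5)[OF d] using two by (simp add: eq_neg_iff_add_eq_0)
    qed
  qed
  have combination: "cls \<theta> (r \<cdot> dual a + s \<cdot> dual b) = G.cl (\<lambda>c. r * delta a c + s * delta b c)" for r s :: "'p mod_ring" and a b
    by (simp add: G.cl_def G.coc_combination)
  have u_wF: "u = coc G.wF"
  proof (cases "?o n1 \<noteq> 0 \<or> ?o (1 + m1) \<noteq> 0")
    case True
    then have "u = of_int (- n1) \<cdot> dual Y1 + of_int (1 + m1) \<cdot> dual Y2" unfolding u cong0 by auto
    then show ?thesis using True by (simp add: G.coc_combination G.wF_def G.uF_def[abs_def] e del: of_int_add of_int_minus)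
  next
    case False
    have "u = of_int (1 + n2) \<cdot> dual Y1 + of_int (- m2) \<cdot> dual Y2"
      using False unfolding u cong0 by (auto simp: cscale_def fun_eq_iff)
    then show ?thesis using False by (simp add: G.coc_combination G.wF_def G.vF_def[abs_def] e del: of_int_add)
  qed
  then have cls_u: "cls \<theta> u = G.cl G.wF" by (simp add: G.cl_def)
  have wF_uF: "(G.wF :: cell \<Rightarrow> 'p mod_ring) = G.uF \<and> (?o n1 \<noteq> 0 \<or> ?o (1 + m1) \<noteq> 0)"
    if r: "\<rho> = 1" "det \<theta> = 1 \<or> det \<theta> = - 1" and u': "u = of_int (- n1) \<cdot> dual Y1 + of_int (1 + m1) \<cdot> dual Y2"
  proof -
    have "u = coc G.uF" unfolding u' by (simp add: G.coc_combination G.uF_def[abs_def] e del: of_int_add of_int_minus)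
    then have w: "(G.wF :: cell \<Rightarrow> 'p mod_ring) = G.uF" unfolding u_wF coc_inject .
    \<comment> \<open>If both coefficients were 0 mod p, the assumed form of u would make it 0, but
      the class prescribed by the case distinction is a non-zero cochain in rank 1.\<close>
    have "?o n1 \<noteq> 0 \<or> ?o (1 + m1) \<noteq> 0"
    proof (rule ccontr)
      assume *: "\<not> (?o n1 \<noteq> 0 \<or> ?o (1 + m1) \<noteq> 0)"
      then have "(G.wF Y1 :: 'p mod_ring) = 0" "(G.wF Y2 :: 'p mod_ring) = 0"
        unfolding w G.uF_def e by (simp_all add: delta_def del: of_int_add)
      then show False using G.wF_nonzero[of "1 :: 'p mod_ring", unfolded e, OF nz[OF r]] by simp
    qed
    with w show ?thesis by blast
  qed
  have xF: "cls \<theta> (of_int m1 \<cdot> dual Z1 + of_int n1 \<cdot> dual Z2) = G.cl (G.xF :: cell \<Rightarrow> 'p mod_ring)"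
    unfolding combination by (simp add: G.xF_def[abs_def] e)
  have scale_xF: "cls \<theta> (l \<cdot> (of_int m1 \<cdot> dual Z1 + of_int n1 \<cdot> dual Z2)) = G.cl (\<lambda>c. l * G.xF c)" for l :: "'p mod_ring"
  proof -
    have "l \<cdot> (of_int m1 \<cdot> dual Z1 + of_int n1 \<cdot> dual Z2) = (l * of_int m1) \<cdot> dual Z1 + (l * of_int n1) \<cdot> dual Z2"
      by (simp add: cscale_def fun_eq_iff algebra_simps)
    then show ?thesis unfolding G.xF_def e by (simp add: combination algebra_simps)
  qed
  have span: "\<exists>k. G.coh (\<lambda>c. r * delta Z1 c + s * delta Z2 c) (\<lambda>c. k * G.xF c)"
    if "add_span H (cls \<theta> (of_int m1 \<cdot> dual Z1 + of_int n1 \<cdot> dual Z2)) = (z12_classes \<theta> :: (chain \<Rightarrow> 'p mod_ring) set set)"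
    for r s :: "'p mod_ring"
  proof -
    have "range (\<lambda>k. G.cl (\<lambda>c. k * G.xF c :: 'p mod_ring)) = z12_classes \<theta>"
      using that unfolding H xF G.add_span_cl[OF G.dd_xF] .
    moreover have "G.cl (\<lambda>c. r * delta Z1 c + s * delta Z2 c) \<in> z12_classes \<theta>" unfolding G.z12_cl by blast
    ultimately obtain k where "G.cl (\<lambda>c. r * delta Z1 c + s * delta Z2 c) = G.cl (\<lambda>c. k * G.xF c)" by blast
    then show ?thesis unfolding G.cl_eq_iff by blast
  qed
  have lam: "G.coh (\<lambda>c. l * G.xF c) (\<lambda>c. of_int (- n1) * delta Z1 c + of_int (1 + m1) * delta Z2 c)"
    if "cls \<theta> (l \<cdot> (of_int m1 \<cdot> dual Z1 + of_int n1 \<cdot> dual Z2)) = cls \<theta> (of_int (- n1) \<cdot> dual Z1 + of_int (1 + m1) \<cdot> dual Z2)"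
    for l :: "'p mod_ring"
    using that unfolding scale_xF combination G.cl_eq_iff .
  show ?thesis
  proof (intro conjI impI, goal_cases)
    case 1
    then have A0: "?A = 0" and d: "det \<theta> = 1" using r0 by auto
    then have "?o (1 + m1) = 0" "?o m2 = 0" "?o n1 = 0" "?o (1 + n2) = 0"
      using A unfolding pos(1-4)[OF d] A0 by simp_all
    then show ?case using G.iso_rank0[OF two, unfolded e] Dpos[OF d] by (simp add: Let_def del: of_int_add of_int_diff)
  next
    case 2
    then have A0: "?A = 0" and d: "det \<theta> = - 1" using r0 by auto
    have "?o \<alpha> = 1" "?o \<beta> = 0" "?o \<gamma> = 0" "?o \<delta> = 1" using A unfolding A0 by simp_all
    then have "?o (det \<theta>) = 1" by (simp add: det_2 t)
    then show ?case unfolding d using two by (simp add: eq_neg_iff_add_eq_0)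
  next
    case 3
    then show ?case using pos(1-4) by (simp add: mn)
  next
    case 4
    then show ?case unfolding H cls_u G.cls_dual using G.H1_rank1(2)[unfolded e, OF M0 nz] by blast
  next
    case 5
    then show ?case unfolding H using G.H1_rank1(1)[unfolded e, OF M0 nz] by blast
  next
    case 6
    then show ?case unfolding H G.cls_dual using G.H2_rank1_pos(2)[unfolded e, OF M0 nz Dpos] by blast
  next
    case 7
    then show ?case unfolding H using G.z12_iso[unfolded e, OF M0 nz] by blast
  next
    case 8
    then show ?case unfolding H using G.H2_rank1_pos(1)[unfolded e, OF M0 nz Dpos] by blast
  next
    case 9
    then show ?case unfolding H G.cls_dual using G.H3_pos(1)[unfolded e, OF Dpos] by blast
  next
    case 10
    then show ?case unfolding H using G.H3_pos(2)[unfolded e, OF Dpos] by blast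
  next
    case 11
    then have r: "\<rho> = 1" "det \<theta> = 1 \<or> det \<theta> = - 1" and d: "det \<theta> = 1"
      and sp: "add_span H (cls \<theta> (of_int m1 \<cdot> dual Z1 + of_int n1 \<cdot> dual Z2)) = (z12_classes \<theta> :: (chain \<Rightarrow> 'p mod_ring) set set)"
      and w: "(G.wF :: cell \<Rightarrow> 'p mod_ring) = G.uF" "?o n1 \<noteq> 0 \<or> ?o (1 + m1) \<noteq> 0"
      using wF_uF by auto
    \<comment> \<open>Written in m1, m2, n1, n2, the coefficient of the statement takes the form in
      which \<open>ev_E_uF\<close> computes it.\<close>
    have abcd: "\<alpha> = - n2" "\<beta> = n1" "\<gamma> = m2" "\<delta> = - m1" using pos(1-4)[OF d] by simp_all
    show ?case
      unfolding Let_def cls_u w(1) xF G.cls_dual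
      by (intro allI impI G.iso_rank1_pos[unfolded e, OF two M0[OF r] pos(5)[OF d] w(2) span[OF sp] lam _ refl])
        (simp_all add: abcd xF)
  next
    case 12
    then show ?case unfolding H cls_u G.cls_dual using G.H1_rank1(2)[unfolded e, OF M0 nz] by blast
  next
    case 13
    then show ?case unfolding H using G.H1_rank1(1)[unfolded e, OF M0 nz] by blast
  next
    case 14
    then show ?case using G.H2_neg[unfolded e, OF Dneg] by blast
  next
    case 15
    then show ?case unfolding H using G.z12_iso[unfolded e, OF M0 nz] G.H2_neg[unfolded e, OF Dneg] by simp
  next
    case 16
    then show ?case unfolding H using G.H3_neg[unfolded e, OF Dneg] by blast
  next
    case 17
    then have r: "\<rho> = 1" "det \<theta> = 1 \<or> det \<theta> = - 1" and d: "det \<theta> = - 1"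
      and sp: "add_span H (cls \<theta> (of_int m1 \<cdot> dual Z1 + of_int n1 \<cdot> dual Z2)) = (z12_classes \<theta> :: (chain \<Rightarrow> 'p mod_ring) set set)"
      and w: "(G.wF :: cell \<Rightarrow> 'p mod_ring) = G.uF" "?o n1 \<noteq> 0 \<or> ?o (1 + m1) \<noteq> 0"
      using wF_uF by auto
    show ?case
      unfolding Let_def cls_u w(1) xF G.cls_dual
      by (intro allI impI G.iso_rank1_neg[unfolded e, OF two M0[OF r] Dneg[OF d] w(2) span[OF sp] lam refl])
        (simp_all add: xF)
  next
    case 18
    then show ?case using G.iso_rank2_pos[OF two, unfolded e] M2 pos(5) by (simp add: Let_def)
  next
    case 19
    then show ?case using G.iso_rank2_neg[OF two, unfolded e, OF M2 Dneg] by (simp add: Let_def)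
  qed
qed

end
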